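(* Let $K\subset\mathbb{R}^n$ be a convex body in $C^2_+$ with centroid at the origin. For $p\in\mathbb{R}$, $p\neq -n$, let $f_p:\partial K\to\mathbb{R}$ be defined by $$f_p(y)=\kappa_K(y)^{\frac{n^2+p}{2(n+p)}}\ \langle y,N_K(y)\rangle^{-\frac{(n-1)(n^2+2n+p)}{2(n+p)}},$$ and let $\beta_n=2\left(|B_2^{n-1}|\right)^{\frac{2}{n-1}}$. Then (i) $$\lim_{s\to 0}\beta_n\,\frac{|(K_{f_p,s})^\circ|-|K^\circ|}{s^{\frac{2}{n-1}}}=as_{\frac{n^2}{p}}(K^\circ).$$ (ii) $$\lim_{s\to 0}\beta_n\,\frac{|(K_{f_p,s})^\circ|-|K^\circ|}{s^{\frac{2}{n-1}}}=as_{p}(K).$$ (iii) $$as_p(K)=as_{\frac{n^2}{p}}(K^\circ).$$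
   Context: Here $n\ge 2$. A convex body is a compact convex subset of $\mathbb{R}^n$ with nonempty interior. $|\cdot|$ denotes volume (Hausdorff measure of the appropriate dimension), $\langle\cdot,\cdot\rangle$ the standard inner product, and $B_2^m$ the Euclidean unit ball of $\mathbb{R}^m$. $K\in C^2_+$ means that $\partial K$ is $C^2$ with everywhere strictly positive Gaussian curvature. $N_K(x)$ is the outer unit normal to $\partial K$ at $x$, $\kappa_K(x)$ the Gaussian curvature of $\partial K$ at $x$, and $\mu_K$ the usual surface area measure on $\partial K$. The polar body is $K^\circ=\{y\in\mathbb{R}^n:\langle x,y\rangle\le 1\ \text{for all } x\in K\}$. $L_p$ affine surface area: for a convex body $L$ containing the origin in its interior and real $p\ne -n$, $$as_p(L)=\int_{\partial L}\frac{\kappa_L(x)^{\frac{p}{n+p}}}{\langle x,N_L(x)\rangle^{\frac{n(p-1)}{n+p}}}\,d\mu_L(x),\qquad as_{\pm\infty}(L)=\int_{\partial L}\frac{\kappa_L(x)}{\langle x,N_L(x)\rangle^{n}}\,d\mu_L(x),$$ provided the integrals exist. For $p=0$, $as_{n^2/p}$ is understood as $as_{\pm\infty}$. Surface body: for $s\ge0$ and a nonnegative integrable function $f:\partial K\to\mathbb{R}$, $K_{f,s}$ is the intersection of all closed half-spaces $H^+$ whose bounding hyperplanes $H$ cut off a set of $f\mu_K$-measure at most $s$ from $\partial K$, i.e. $$K_{f,s}=\bigcap_{\int_{\partial K\cap H^-}f\,d\mu_K\le s}H^+,$$ where $H^+$ and $H^-$ are the two closed half-spaces bounded by $H$. The limit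 is as $s\to0$, $s>0$. *)

theory Defs
  imports "HOL-Analysis.Analysis"
begin

(* Normalised as usual by the volume of the unit ball, so that on an m-dimensional affine subspace
   it is m-dimensional Lebesgue measure.  Meant for m \<ge> 1: for m = 0 the empty covering sets
   would contribute 0 ^ 0 = 1.  Boundedness of the covering sets is required because diameter
   is a junk value on unbounded sets. *)
definition hausdorff_outer :: "nat \<Rightarrow> 'a::metric_space set \<Rightarrow> ennreal" where
  "hausdorff_outer m A =
     (SUP \<delta>\<in>{0<..}. INF C\<in>{C :: nat \<Rightarrow> 'a set. A \<subseteq> (\<Union>i. C i) \<and>
            (\<forall>i. bounded (C i) \<and> diameter (C i) \<le> \<delta>)}.
        \<Sum>i. ennreal (unit_ball_vol (real m) * (diameter (C i) / 2) ^ m))"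

(* hausdorff_outer m is a metric outer measure, hence countably additive on the Borel sets
   (Caratheodory), so that measure_of does not fall back to the zero measure here. *)
definition hausdorff_measure :: "nat \<Rightarrow> 'a::metric_space measure" where
  "hausdorff_measure m = measure_of UNIV (sets borel) (hausdorff_outer m)"

definition surface_measure :: "(real ^ 'n) set \<Rightarrow> (real ^ 'n) measure" where
  "surface_measure K = restrict_space (hausdorff_measure (CARD('n) - 1)) (frontier K)"

definition convex_body :: "'a::euclidean_space set \<Rightarrow> bool" where
  "convex_body K \<longleftrightarrow> compact K \<and> convex K \<and> interior K \<noteq> {}"

definition centroid :: "'a::euclidean_space set \<Rightarrow> 'a" where
  "centroid K = (1 / measure lebesgue K) *\<^sub>R (LINT x:K|lebesgue. x)"

definition polar_body :: "'a::real_inner set \<Rightarrow> 'a set" where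
  "polar_body K = {y. \<forall>x\<in>K. x \<bullet> y \<le> 1}"

definition outer_normal :: "'a::euclidean_space set \<Rightarrow> 'a \<Rightarrow> 'a" where
  "outer_normal K x = (THE u. norm u = 1 \<and> (\<forall>y\<in>K. u \<bullet> (y - x) \<le> 0))"

(* The derivative along the frontier of the Gauss map at x is determined exactly on the tangent
   hyperplane at x, where it is the Weingarten map, whose determinant is the Gaussian curvature.
   Extending it by the identity in the normal direction makes it unique on the whole space and
   does not change the determinant. *)
definition gauss_curvature :: "(real ^ 'n) set \<Rightarrow> real ^ 'n \<Rightarrow> real" where
  "gauss_curvature K x =
     det (matrix (THE W. (outer_normal K has_derivative W) (at x within frontier K) \<and>
                         W (outer_normal K x) = outer_normal K x))"

(* g and H are the gradient and the Hessian of the local defining function \<phi>. *)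
definition C2_hypersurface :: "'a::euclidean_space set \<Rightarrow> bool" where
  "C2_hypersurface S \<longleftrightarrow>
     (\<forall>x\<in>S. \<exists>U \<phi> g (H :: 'a \<Rightarrow> 'a \<Rightarrow>\<^sub>L 'a).
        open U \<and> x \<in> U \<and>
        (\<forall>y\<in>U. ((\<phi> :: 'a \<Rightarrow> real) has_derivative (\<lambda>h. g y \<bullet> h)) (at y)) \<and>
        (\<forall>y\<in>U. (g has_derivative blinfun_apply (H y)) (at y)) \<and>
        continuous_on U H \<and>
        (\<forall>y\<in>U. g y \<noteq> 0) \<and>
        S \<inter> U = {y \<in> U. \<phi> y = 0})"

definition C2_plus :: "(real ^ 'n) set \<Rightarrow> bool" where
  "C2_plus K \<longleftrightarrow> C2_hypersurface (frontier K) \<and> (\<forall>x\<in>frontier K. gauss_curvature K x > 0)"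

(* The index is extended real to include the common value at \<plusminus>\<infinity>.  Division in ereal gives
   n\<^sup>2 / 0 = \<infinity>, which is the convention for the index n\<^sup>2 / p at p = 0. *)
definition affine_surface_area :: "ereal \<Rightarrow> (real ^ 'n) set \<Rightarrow> real" where
  "affine_surface_area q L =
     (let n = real CARD('n) in
      case q of
        ereal p \<Rightarrow>
          (LINT x|surface_measure L.
             gauss_curvature L x powr (p / (n + p)) /
             (x \<bullet> outer_normal L x) powr (n * (p - 1) / (n + p)))
      | _ \<Rightarrow>
          (LINT x|surface_measure L.
             gauss_curvature L x / (x \<bullet> outer_normal L x) ^ CARD('n)))"

(* The hyperplane {x. u \<bullet> x = t} occurs also as {x. - u \<bullet> x = - t}, so either of its two closed
   sides may play the role of the half-space that is cut off. *)
definition surface_body :: "(real ^ 'n) set \<Rightarrow> (real ^ 'n \<Rightarrow> real) \<Rightarrow> real \<Rightarrow> (real ^ 'n) set" where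
  "surface_body K f s =
     \<Inter> {{x. u \<bullet> x \<le> t} | u t.
           u \<noteq> 0 \<and> (LINT x:frontier K \<inter> {x. u \<bullet> x \<ge> t}|surface_measure K. f x) \<le> s}"

definition weight :: "real \<Rightarrow> (real ^ 'n) set \<Rightarrow> real ^ 'n \<Rightarrow> real" where
  "weight p K y =
     (let n = real CARD('n) in
      gauss_curvature K y powr ((n\<^sup>2 + p) / (2 * (n + p))) *
      (y \<bullet> outer_normal K y) powr (- ((n - 1) * (n\<^sup>2 + 2 * n + p) / (2 * (n + p)))))"

definition ball_const :: "real \<Rightarrow> real" where
  "ball_const n = 2 * unit_ball_vol (n - 1) powr (2 / (n - 1))"

end

theory Submission
  imports Defs
begin

text \<open>Let \<open>g\<close> be the gauge of \<open>K\<close> and \<open>S = grad (g\<^sup>2 / 2)\<close>, a bijection that maps the boundary of \<open>K\<close>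
  to that of the polar body, with \<open>S x = N(x) / (x \<bullet> N(x))\<close> on the boundary.  In the coordinates \<open>x \<mapsto> (x / g x, g x)\<close>
  the surface measure becomes \<open>n \<cdot> \<bar>S\<bar>\<close> times Lebesgue measure on \<open>K\<close>, and with \<open>\<Phi> = det (DS)\<close> one has
  \<open>\<kappa> = \<Phi> (x \<bullet> N)^(n + 1)\<close>.  Hence \<open>as_p(K)\<close> is \<open>n\<close> times the integral of \<open>\<Phi> powr (p / (n + p))\<close> over \<open>K\<close>, the
  corresponding quantity of the polar body is \<open>n\<close> times the integral of \<open>\<Phi> powr (- n / (n + p))\<close> taken at the
  \<open>S\<close>-preimage, and the substitution \<open>y = S x\<close> identifies the two.

  For the limit, the second order Taylor expansion of \<open>g\<^sup>2\<close> shows, uniformly in the boundary point \<open>z\<close>, that the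
  hyperplane \<open>S z \<bullet> x = 1 - e\<close> cuts off a cap whose weighted measure is asymptotic to
  \<open>\<omega> (2 e \<Phi>(z) powr (n / (n + p))) powr ((n - 1) / 2)\<close>, where \<open>\<omega>\<close> is the volume of the unit ball of dimension \<open>n - 1\<close>.
  So the caps of measure \<open>s\<close> have height about \<open>q(z) \<delta>\<close> with \<open>\<delta> = s powr (2 / (n - 1))\<close> and
  \<open>q = \<Phi> powr (- n / (n + p)) / \<beta>\<close>, and the polar of the surface body lies between two star-shaped sets
  \<open>h (1 - c q \<delta>) \<le> 1\<close> with \<open>h\<close> the support function of \<open>K\<close> and \<open>c\<close> close to 1.  Their volume is the integral of
  \<open>(1 - c q \<delta>) powr (- n)\<close> over the polar body.\<close>

section \<open>Hausdorff measure as a Borel measure\<close>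

text \<open>The obstacle is the surface measure: it is given by coverings, and the boundary comes
  without a parametrization. Comparing it with volumes of cones requires Hausdorff and Lebesgue
  measure to agree on hyperplanes with constant exactly 1; the isodiametric inequality gives one
  direction, a packing by balls the other. The exponents of \<open>weight\<close> come from a
  cancellation. With h = x \<bullet> N the curvature is \<Phi> h^(n+1) and the surface density is n
  / h, so a weight \<kappa>^a h^c leaves exactly \<Phi>^a when (n+1) a + c = 1. A thin cap has
  volume proportional to \<Phi>^(-1/2), and a = (n^2+p) / (2 (n+p)) turns this into \<Phi>^(n (n-1)
  / (2 (n+p))). Solving for the height yields the power -n / (n+p) that the affine surface area of
  the polar body contains; \<open>ball_const\<close> collects the constants of this solution.
  Positive curvature makes DS positive definite, and compactness of the boundary then makes every
  estimate uniform. The second limit is the first one rewritten by the duality formula.\<close>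

lemma metric_outer_measure_closed:
  fixes f :: "'a::metric_space set \<Rightarrow> ennreal"
  assumes mono: "\<And>A B. A \<subseteq> B \<Longrightarrow> f A \<le> f B"
    and sub: "\<And>A :: nat \<Rightarrow> 'a set. f (\<Union>i. A i) \<le> (\<Sum>i. f (A i))"
    and empty: "f {} = 0"
    and sep: "\<And>A B d. d > 0 \<Longrightarrow> (\<And>x y. x \<in> A \<Longrightarrow> y \<in> B \<Longrightarrow> d \<le> dist x y) \<Longrightarrow> f A + f B \<le> f (A \<union> B)"
    and F: "closed F"
  shows "f (X \<inter> F) + f (X - F) \<le> f X"
proof (cases "f X = \<infinity> \<or> F = {}")
  case True
  then show ?thesis using empty by auto
next
  case False
  then have fin: "f X < \<infinity>" and ne: "F \<noteq> {}" by (auto simp: less_top)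
  have sub2: "f (A \<union> B) \<le> f A + f B" for A B
  proof -
    have "f (A \<union> B) = f (\<Union>i. binaryset A B i)"
      by (simp add: UN_binaryset_eq)
    also have "\<dots> \<le> (\<Sum>i. f (binaryset A B i))" by (rule sub)
    also have "\<dots> = f A + f B"
      by (rule suminf_binaryset_eq) (simp add: empty)
    finally show ?thesis .
  qed
  \<comment> \<open>The part of \<open>X\<close> outside \<open>F\<close> is cut into shells
    \<open>R k\<close> by distance from \<open>F\<close>. Shells whose indices differ by at least 2
    are a positive distance apart, so \<open>sep\<close> makes \<open>f\<close> superadditive on the
    even and on the odd shells, and their total mass is at most twice \<open>f X\<close>. The tail
    of the series then bounds what is lost on replacing \<open>X - F\<close> by \<open>E k\<close>,
    which is separated from \<open>F\<close>.\<close>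
  define R where "R k = {x\<in>X. 1 / real (k+2) \<le> infdist x F \<and> infdist x F < 1 / real (k+1)}" for k :: nat
  define E where "E k = {x\<in>X. 1 / real (k+1) \<le> infdist x F}" for k :: nat
  have R_sub: "R k \<subseteq> X" and E_sub: "E k \<subseteq> X" for k by (auto simp: R_def E_def)
  have infdist_sep: "a - b \<le> dist x y" if "a \<le> infdist x F" "infdist y F \<le> b" for a b x y
    using infdist_triangle[of x F y] that by simp
  have part: "(\<Sum>j<N. f (R (2*j+c))) \<le> f (\<Union>j<N. R (2*j+c))" for N c
  proof (induction N)
    case (Suc N)
    have "f (\<Union>j<N. R (2*j+c)) + f (R (2*N+c)) \<le> f ((\<Union>j<N. R (2*j+c)) \<union> R (2*N+c))"
    proof (cases "N = 0")
      case False
      show ?thesis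
      proof (rule sep)
        show "0 < 1 / real (2*N+c) - 1 / real (2*N+c+1)"
          using False by (intro diff_gt_0_iff_gt[THEN iffD2] divide_strict_left_mono) auto
        show "1 / real (2*N+c) - 1 / real (2*N+c+1) \<le> dist x y"
          if x: "x \<in> (\<Union>j<N. R (2*j+c))" and y: "y \<in> R (2*N+c)" for x y
        proof (rule infdist_sep)
          obtain j where j: "j < N" "x \<in> R (2*j+c)" using x by blast
          have "1 / real (2*N+c) \<le> 1 / real (2*j+c+2)"
            using j(1) by (intro divide_left_mono) auto
          also have "\<dots> \<le> infdist x F" using j(2) by (auto simp: R_def)
          finally show "1 / real (2*N+c) \<le> infdist x F" .
          show "infdist y F \<le> 1 / real (2*N+c+1)" using y by (auto simp: R_def)
        qed
      qed
    qed (simp add: empty)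
    also have "\<dots> = f (\<Union>j<Suc N. R (2*j+c))" by (simp add: lessThan_Suc Un_commute)
    finally show ?case using Suc by (simp add: order_trans[OF add_right_mono])
  qed (simp add: empty)
  have "(\<Sum>j<2*N. f (R j)) \<le> f X + f X" for N
  proof -
    have "(\<Sum>j<2*N. f (R j)) = (\<Sum>j<N. f (R (2*j+0))) + (\<Sum>j<N. f (R (2*j+1)))"
      by (induction N) (auto simp: algebra_simps)
    also have "\<dots> \<le> f X + f X"
      by (intro add_mono order_trans[OF part] mono) (use R_sub in blast)+
    finally show ?thesis .
  qed
  moreover have "(\<Sum>j<N. f (R j)) \<le> (\<Sum>j<2*N. f (R j))" for N
    by (rule sum_mono2) auto
  ultimately have "(\<Sum>j<N. f (R j)) \<le> f X + f X" for N
    using order_trans by blast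
  then have "(\<Sum>j. f (R j)) \<le> f X + f X"
    by (intro suminf_le_const summableI)
  then have "(\<Sum>j. f (R j)) < \<infinity>" using fin
    by (auto intro: order.strict_trans1 simp: ennreal_add_less_top)
  then have ntop: "(\<Sum>j. f (R j)) \<noteq> top" by simp
  then have "f (R j) \<noteq> top" for j
    using ennreal_suminf_lessD[of "\<lambda>j. f (R j)" top j] by (simp add: less_top)
  then have fR: "f (R j) = ennreal (enn2real (f (R j)))" for j
    by (simp add: less_top)
  have smR: "summable (\<lambda>j. enn2real (f (R j)))"
    by (rule summable_suminf_not_top) (use ntop fR in simp_all)
  have "(\<lambda>k. ennreal (\<Sum>j. enn2real (f (R (j + k))))) \<longlonglongrightarrow> 0"
    using tendsto_ennrealI[OF suminf_exist_split2[OF smR]] by simp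
  moreover have "(\<Sum>j. f (R (j + k))) = ennreal (\<Sum>j. enn2real (f (R (j + k))))" for k
    by (subst fR, rule suminf_ennreal2) (simp_all add: summable_ignore_initial_segment[OF smR])
  ultimately have tail: "(\<lambda>k. \<Sum>j. f (R (j + k))) \<longlonglongrightarrow> 0"
    by simp
  have step: "f (X \<inter> F) + f (X - F) \<le> f X + (\<Sum>j. f (R (j + k)))" for k
  proof -
    have "X - F \<subseteq> E k \<union> (\<Union>j. R (j + k))"
    proof
      fix x assume x: "x \<in> X - F"
      then have pos: "0 < infdist x F" 
        using F ne using in_closed_iff_infdist_zero[OF F ne, of x] infdist_nonneg[of x F] by auto
      show "x \<in> E k \<union> (\<Union>j. R (j + k))"
      proof (cases "x \<in> E k")
        case False
        obtain l where "inverse (real (Suc l)) < infdist x F" using reals_Archimedean[OF pos] by blast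
        then have ex: "\<exists>l. 1 / real (l+2) \<le> infdist x F"
          by (intro exI[of _ l]) (use pos in \<open>auto simp: field_simps inverse_eq_divide\<close>)
        define l where "l = (LEAST l. 1 / real (l+2) \<le> infdist x F)"
        have l1: "1 / real (l+2) \<le> infdist x F" unfolding l_def using ex by (rule LeastI_ex)
        have lk: "k \<le> l"
        proof (rule ccontr)
          assume "\<not> k \<le> l"
          then have "1 / real (k+1) \<le> 1 / real (l+2)" by (intro divide_left_mono) auto
          with l1 False x show False by (auto simp: E_def)
        qed
        have "infdist x F < 1 / real (l+1)"
        proof (cases "l = 0 \<or> l = k")
          case True
          then show ?thesis using False x lk by (auto simp: E_def)
        next
          case nz: False
          then have "\<not> 1 / real ((l-1)+2) \<le> infdist x F"
            using not_less_Least[of "l-1" "\<lambda>l. 1 / real (l+2) \<le> infdist x F"] unfolding l_def by linarith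
          then show ?thesis using nz by (auto simp: of_nat_diff not_le)
        qed
        then have "x \<in> R (l - k + k)" using l1 x lk by (auto simp: R_def)
        then show ?thesis by blast
      qed simp
    qed
    then have "f (X - F) \<le> f (E k \<union> (\<Union>j. R (j + k)))" by (rule mono)
    also have "\<dots> \<le> f (E k) + f (\<Union>j. R (j + k))" by (rule sub2)
    also have "\<dots> \<le> f (E k) + (\<Sum>j. f (R (j + k)))" by (intro add_left_mono sub)
    finally have "f (X \<inter> F) + f (X - F) \<le> (f (X \<inter> F) + f (E k)) + (\<Sum>j. f (R (j + k)))"
      by (simp add: add.assoc add_left_mono)
    also have "f (X \<inter> F) + f (E k) \<le> f (X \<inter> F \<union> E k)"
    proof (rule sep[of "1 / real (k+1)"])
      show "1 / real (k+1) \<le> dist x y" if "x \<in> X \<inter> F" "y \<in> E k" for x y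
        using infdist_sep[of "1 / real (k+1)" y x 0] that by (auto simp: E_def dist_commute)
    qed simp
    also have "f (X \<inter> F \<union> E k) \<le> f X" by (rule mono) (use E_sub in auto)
    finally show ?thesis by (simp add: add_right_mono)
  qed
  have "(\<lambda>k. f X + (\<Sum>j. f (R (j + k)))) \<longlonglongrightarrow> f X + 0"
    by (intro tendsto_intros tail) 
  then show ?thesis using step by (intro LIMSEQ_le_const[where x="f X"]) auto
qed

text \<open>The outer measure is split into its fixed-scale contents, so that estimates can be made
  at one scale before the supremum over scales is taken.\<close>

definition hausdorff_cover :: "real \<Rightarrow> 'a::metric_space set \<Rightarrow> (nat \<Rightarrow> 'a set) set" where
  "hausdorff_cover d A = {C. A \<subseteq> (\<Union>i. C i) \<and> (\<forall>i. bounded (C i) \<and> diameter (C i) \<le> d)}"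

definition hausdorff_weight :: "nat \<Rightarrow> 'a::metric_space set \<Rightarrow> ennreal" where
  "hausdorff_weight m C = ennreal (unit_ball_vol (real m) * (diameter C / 2) ^ m)"

definition hausdorff_pre :: "nat \<Rightarrow> real \<Rightarrow> 'a::metric_space set \<Rightarrow> ennreal" where
  "hausdorff_pre m d A = (INF C\<in>hausdorff_cover d A. \<Sum>i. hausdorff_weight m (C i))"

lemma hausdorff_outer_eq: "hausdorff_outer m A = (SUP d\<in>{0<..}. hausdorff_pre m d A)"
  by (simp add: hausdorff_outer_def hausdorff_pre_def hausdorff_weight_def hausdorff_cover_def)

lemma hausdorff_pre_le_outer: "d > 0 \<Longrightarrow> hausdorff_pre m d A \<le> hausdorff_outer m A"
  unfolding hausdorff_outer_eq by (rule SUP_upper) auto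

lemma hausdorff_outer_leI: "(\<And>d. d > 0 \<Longrightarrow> hausdorff_pre m d A \<le> c) \<Longrightarrow> hausdorff_outer m A \<le> c"
  unfolding hausdorff_outer_eq by (rule SUP_least) auto

lemma hausdorff_pre_le:
  "A \<subseteq> (\<Union>i. C i) \<Longrightarrow> (\<And>i. bounded (C i)) \<Longrightarrow> (\<And>i. diameter (C i) \<le> d) \<Longrightarrow>
    hausdorff_pre m d A \<le> (\<Sum>i. hausdorff_weight m (C i))"
  unfolding hausdorff_pre_def by (rule INF_lower) (simp add: hausdorff_cover_def)

lemma hausdorff_pre_mono: "A \<subseteq> B \<Longrightarrow> hausdorff_pre m d A \<le> hausdorff_pre m d B"
  unfolding hausdorff_pre_def by (rule INF_superset_mono) (auto simp: hausdorff_cover_def)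

lemma hausdorff_pre_antimono: "d \<le> d' \<Longrightarrow> hausdorff_pre m d' A \<le> hausdorff_pre m d A"
  unfolding hausdorff_pre_def
  by (rule INF_superset_mono) (auto simp: hausdorff_cover_def intro: order_trans)

lemma hausdorff_outer_mono: "A \<subseteq> B \<Longrightarrow> hausdorff_outer m A \<le> hausdorff_outer m B"
  by (meson hausdorff_outer_leI hausdorff_pre_le_outer hausdorff_pre_mono order_trans)

lemma hausdorff_weight_empty: "m \<ge> 1 \<Longrightarrow> hausdorff_weight m {} = 0"
  by (simp add: hausdorff_weight_def)

lemma hausdorff_pre_empty: "m \<ge> 1 \<Longrightarrow> d > 0 \<Longrightarrow> hausdorff_pre m d {} = 0"
  using hausdorff_pre_le[of "{}" "\<lambda>_. {}" d m] by (simp add: hausdorff_weight_empty)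

lemma hausdorff_outer_empty: "m \<ge> 1 \<Longrightarrow> hausdorff_outer m {} = 0"
  by (metis hausdorff_outer_leI hausdorff_pre_empty le_zero_eq order_refl)

lemma hausdorff_pre_countable_subadditive:
  "hausdorff_pre m d (\<Union>i::nat. A i) \<le> (\<Sum>i. hausdorff_pre m d (A i))"
proof (rule ennreal_le_epsilon)
  fix e :: real
  assume e: "0 < e" and fin: "(\<Sum>i. hausdorff_pre m d (A i)) < top"
  have "\<exists>C\<in>hausdorff_cover d (A n). (\<Sum>i. hausdorff_weight m (C i)) < hausdorff_pre m d (A n) + e * (1/2)^Suc n" for n
  proof -
    have "hausdorff_pre m d (A n) < top" using fin by (rule ennreal_suminf_lessD)
    then have "hausdorff_pre m d (A n) < hausdorff_pre m d (A n) + e * (1/2)^Suc n"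
      using e by (auto simp: less_top)
    then show ?thesis unfolding hausdorff_pre_def[of m d "A n"] INF_less_iff by auto
  qed
  then obtain B where B: "\<And>n. B n \<in> hausdorff_cover d (A n)"
    and Ble: "\<And>n. (\<Sum>i. hausdorff_weight m (B n i)) < hausdorff_pre m d (A n) + e * (1/2)^Suc n"
    by metis
  define C where "C = case_prod B o prod_decode"
  have A_C: "(\<Union>i. A i) \<subseteq> (\<Union>i. C i)"
    using B by (auto simp: C_def subset_eq hausdorff_cover_def) (metis prod.case prod_encode_inverse)
  have "hausdorff_pre m d (\<Union>i. A i) \<le> (\<Sum>i. hausdorff_weight m (C i))"
    using A_C by (rule hausdorff_pre_le) (use B in \<open>auto simp: C_def hausdorff_cover_def split: prod.split\<close>)
  also have "\<dots> = (\<Sum>n. \<Sum>i. hausdorff_weight m (B n i))"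
    unfolding C_def comp_def by (intro suminf_ennreal_2dimen) (auto simp: split_def)
  also have "\<dots> \<le> (\<Sum>n. hausdorff_pre m d (A n) + e * (1/2) ^ Suc n)"
    by (intro suminf_le allI less_imp_le[OF Ble]) auto
  also have "\<dots> = (\<Sum>n. hausdorff_pre m d (A n)) + (\<Sum>n. ennreal e * ennreal ((1/2) ^ Suc n))"
    using e by (subst suminf_add[symmetric])
      (auto simp del: ennreal_suminf_cmult simp add: ennreal_mult[symmetric])
  also have "\<dots> = (\<Sum>n. hausdorff_pre m d (A n)) + e"
    unfolding ennreal_suminf_cmult
    by (subst suminf_ennreal_eq[OF zero_le_power power_half_series]) auto
  finally show "hausdorff_pre m d (\<Union>i. A i) \<le> (\<Sum>n. hausdorff_pre m d (A n)) + e" .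
qed

lemma hausdorff_outer_countable_subadditive:
  "hausdorff_outer m (\<Union>i::nat. A i) \<le> (\<Sum>i. hausdorff_outer m (A i))"
proof (rule hausdorff_outer_leI)
  fix d :: real assume "d > 0"
  then show "hausdorff_pre m d (\<Union>i::nat. A i) \<le> (\<Sum>i. hausdorff_outer m (A i))"
    by (intro order_trans[OF hausdorff_pre_countable_subadditive] suminf_le hausdorff_pre_le_outer) auto
qed

text \<open>A covering set of diameter below \<open>r\<close> cannot meet both \<open>A\<close> and
  \<open>B\<close>, so a fine cover of the union splits into a cover of each. Discarded members are
  replaced by the empty set, which has weight 0 since m is at least 1.\<close>

lemma hausdorff_outer_separated:
  fixes A B :: "'a::metric_space set"
  assumes "m \<ge> 1" "r > 0" "\<And>x y. x \<in> A \<Longrightarrow> y \<in> B \<Longrightarrow> r \<le> dist x y"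
  shows "hausdorff_outer m A + hausdorff_outer m B \<le> hausdorff_outer m (A \<union> B)"
proof -
  have pre: "hausdorff_pre m d A + hausdorff_pre m d B \<le> hausdorff_pre m d (A \<union> B)" if d: "0 < d" "d < r" for d
    unfolding hausdorff_pre_def[of m d "A \<union> B"]
  proof (rule INF_greatest)
    fix C assume C: "C \<in> hausdorff_cover d (A \<union> B)"
    define D where "D X i = (if C i \<inter> X \<noteq> {} then C i else {})" for X i
    have D_cov: "hausdorff_pre m d X \<le> (\<Sum>i. hausdorff_weight m (D X i))" if X: "X \<subseteq> A \<union> B" for X
    proof (rule hausdorff_pre_le)
      show "X \<subseteq> \<Union> (range (D X))"
      proof
        fix x assume x: "x \<in> X"
        then have "x \<in> (\<Union>i. C i)" using C X unfolding hausdorff_cover_def by blast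
        then obtain i where "x \<in> C i" by blast
        then have "x \<in> D X i" using x by (auto simp: D_def)
        then show "x \<in> \<Union> (range (D X))" by blast
      qed
      show "bounded (D X i)" for i using C by (auto simp: hausdorff_cover_def D_def)
      show "diameter (D X i) \<le> d" for i using C d by (auto simp: hausdorff_cover_def D_def)
    qed
    have single: "C i \<inter> A = {} \<or> C i \<inter> B = {}" for i
    proof (rule ccontr)
      assume "\<not> ?thesis"
      then obtain x y where "x \<in> C i" "x \<in> A" "y \<in> C i" "y \<in> B" by auto
      then have "r \<le> dist x y" "dist x y \<le> diameter (C i)"
        using assms(3) C by (auto simp: hausdorff_cover_def intro!: diameter_bounded_bound)
      moreover have "diameter (C i) \<le> d" using C by (auto simp: hausdorff_cover_def)
      ultimately show False using d by linarith
    qed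
    have "hausdorff_pre m d A + hausdorff_pre m d B \<le>
        (\<Sum>i. hausdorff_weight m (D A i)) + (\<Sum>i. hausdorff_weight m (D B i))"
      by (intro add_mono D_cov) auto
    also have "\<dots> = (\<Sum>i. hausdorff_weight m (D A i) + hausdorff_weight m (D B i))"
      by (intro suminf_add) auto
    also have "\<dots> \<le> (\<Sum>i. hausdorff_weight m (C i))"
      using single by (intro suminf_le) (auto simp: D_def hausdorff_weight_empty[OF assms(1)])
    finally show "hausdorff_pre m d A + hausdorff_pre m d B \<le> (\<Sum>i. hausdorff_weight m (C i))" .
  qed
  \<comment> \<open>Two independent scales are required because the suprema of the two summands are
    taken one after the other; both contents are passed to a common scale below r.\<close>
  have "hausdorff_pre m d A + hausdorff_pre m e B \<le> hausdorff_outer m (A \<union> B)" if "d > 0" "e > 0" for d e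
  proof -
    define c where "c = min (min d e) (r/2)"
    have "c > 0" "c < r" "c \<le> d" "c \<le> e" using that assms(2) by (auto simp: c_def)
    then show ?thesis
      by (intro order_trans[OF add_mono order_trans[OF pre hausdorff_pre_le_outer]] hausdorff_pre_antimono)
  qed
  note * = this
  have "hausdorff_pre m d A + hausdorff_outer m B \<le> hausdorff_outer m (A \<union> B)" if d: "d > 0" for d
  proof -
    have "hausdorff_pre m d A + hausdorff_outer m B = (SUP e\<in>{0<..}. hausdorff_pre m d A + hausdorff_pre m e B)"
      unfolding hausdorff_outer_eq[of m B] by (intro ennreal_SUP_add_right) auto
    also have "\<dots> \<le> hausdorff_outer m (A \<union> B)" using *[OF d] by (intro SUP_least) auto
    finally show ?thesis .
  qed
  moreover have "hausdorff_outer m A + hausdorff_outer m B = (SUP d\<in>{0<..}. hausdorff_pre m d A + hausdorff_outer m B)"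
    unfolding hausdorff_outer_eq[of m A] by (intro ennreal_SUP_add_left[symmetric]) auto
  ultimately show ?thesis by (auto intro!: SUP_least)
qed

lemma hausdorff_outer_Un_le:
  "m \<ge> 1 \<Longrightarrow> hausdorff_outer m (A \<union> B) \<le> hausdorff_outer m A + hausdorff_outer m B"
  using hausdorff_outer_countable_subadditive[of m "binaryset A B"]
    suminf_binaryset_eq[of "hausdorff_outer m" A B]
  by (simp add: UN_binaryset_eq hausdorff_outer_empty)

lemma sets_hausdorff_measure [simp, measurable_cong]: "sets (hausdorff_measure m :: 'a::metric_space measure) = sets borel"
  using sets.sigma_sets_eq[of "borel :: 'a measure"] by (simp add: hausdorff_measure_def)

lemma space_hausdorff_measure [simp]: "space (hausdorff_measure m :: 'a::metric_space measure) = UNIV"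
  by (simp add: hausdorff_measure_def)

text \<open>The Caratheodory-measurable sets form a sigma-algebra that contains the closed sets by
  the metric criterion, hence all Borel sets; this gives the countable additivity that
  \<open>measure_of\<close> asks for.\<close>

lemma emeasure_hausdorff_measure:
  fixes A :: "'a::metric_space set"
  assumes "m \<ge> 1" "A \<in> sets borel"
  shows "emeasure (hausdorff_measure m) A = hausdorff_outer m A"
proof -
  let ?L = "lambda_system UNIV UNIV (hausdorff_outer m :: 'a set \<Rightarrow> ennreal)"
  have oms: "outer_measure_space UNIV (hausdorff_outer m :: 'a set \<Rightarrow> ennreal)"
    using hausdorff_outer_empty[OF assms(1)] hausdorff_outer_mono hausdorff_outer_countable_subadditive
    by (auto simp: outer_measure_space_def positive_def increasing_def countably_subadditive_def)
  interpret sigma_algebra "UNIV :: 'a set" UNIV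
    using sigma_algebra_Pow[of "UNIV :: 'a set"] by simp
  have ms: "measure_space UNIV ?L (hausdorff_outer m :: 'a set \<Rightarrow> ennreal)"
    using caratheodory_lemma[OF oms] .
  then interpret L: sigma_algebra "UNIV :: 'a set" ?L by (simp add: measure_space_def)
  have "F \<in> ?L" if "closed F" for F :: "'a set"
  proof -
    have le: "hausdorff_outer m (X \<inter> F) + hausdorff_outer m (X - F) \<le> hausdorff_outer m X" for X
      using hausdorff_outer_mono hausdorff_outer_countable_subadditive hausdorff_outer_empty[OF assms(1)]
        hausdorff_outer_separated[OF assms(1)] that
      by (rule metric_outer_measure_closed)
    have "hausdorff_outer m X \<le> hausdorff_outer m (X \<inter> F) + hausdorff_outer m (X - F)" for X
      using hausdorff_outer_Un_le[OF assms(1), of "X \<inter> F" "X - F"] by (simp add: Int_Diff_Un)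
    then show ?thesis using le by (simp add: lambda_system_eq antisym)
  qed
  then have "sets (borel :: 'a measure) \<subseteq> ?L"
    unfolding borel_eq_closed using L.sigma_sets_subset[of "Collect closed"] by auto
  then have "measure_space UNIV (sets (borel :: 'a measure)) (hausdorff_outer m)"
    using measure_down[OF ms] sets.sigma_algebra_axioms[of "borel :: 'a measure"] by simp
  then show ?thesis unfolding hausdorff_measure_def
    by (intro emeasure_measure_of_sigma) (use assms in \<open>auto simp: measure_space_def\<close>)
qed

text \<open>Images of the members of a cover at scale d / L form a cover at scale d, and each weight
  grows by at most L^m.\<close>

lemma hausdorff_outer_lipschitz_image:
  fixes f :: "'a::metric_space \<Rightarrow> 'b::metric_space"
  assumes m: "m \<ge> 1" and L: "L > 0" and lip: "\<And>x y. x \<in> A \<Longrightarrow> y \<in> A \<Longrightarrow> dist (f x) (f y) \<le> L * dist x y"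
  shows "hausdorff_outer m (f ` A) \<le> ennreal (L ^ m) * hausdorff_outer m A"
proof (rule hausdorff_outer_leI)
  fix d :: real assume d: "d > 0"
  have "hausdorff_pre m d (f ` A) \<le> ennreal (L ^ m) * hausdorff_pre m (d/L) A"
  proof -
    have "hausdorff_pre m d (f ` A) \<le> ennreal (L ^ m) * (\<Sum>i. hausdorff_weight m (C i))"
      if C: "C \<in> hausdorff_cover (d/L) A" for C
    proof -
      have fin: "bounded (f ` (C i \<inter> A)) \<and> diameter (f ` (C i \<inter> A)) \<le> L * diameter (C i)" for i
      proof -
        have b: "dist x y \<le> L * diameter (C i)" if xy: "x \<in> f ` (C i \<inter> A)" "y \<in> f ` (C i \<inter> A)" for x y
        proof -
          obtain x' y' where *: "x' \<in> C i \<inter> A" "y' \<in> C i \<inter> A" "x = f x'" "y = f y'" using xy by auto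
          have "dist x y \<le> L * dist x' y'" using lip * by auto
          also have "\<dots> \<le> L * diameter (C i)"
            using L C * by (intro mult_left_mono diameter_bounded_bound) (auto simp: hausdorff_cover_def)
          finally show ?thesis .
        qed
        have "0 \<le> diameter (C i)" using C diameter_ge_0 by (auto simp: hausdorff_cover_def)
        then have "diameter (f ` (C i \<inter> A)) \<le> L * diameter (C i)"
          using b L unfolding diameter_def[of "f ` (C i \<inter> A)"] by (auto intro!: cSUP_least)
        moreover have "bounded (f ` (C i \<inter> A))"
          unfolding bounded_two_points using b by blast
        ultimately show ?thesis by simp
      qed
      have Ld: "L * diameter (C i) \<le> d" for i
        using C L by (auto simp: hausdorff_cover_def field_simps)
      have "hausdorff_pre m d (f ` A) \<le> (\<Sum>i. hausdorff_weight m (f ` (C i \<inter> A)))"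
        using fin Ld C by (intro hausdorff_pre_le) (auto simp: hausdorff_cover_def intro: order_trans, blast)
      also have "\<dots> \<le> (\<Sum>i. ennreal (L ^ m) * hausdorff_weight m (C i))"
      proof (intro suminf_le summableI)
        fix i
        have "diameter (f ` (C i \<inter> A)) ^ m \<le> (L * diameter (C i)) ^ m"
          using fin[of i] by (intro power_mono diameter_ge_0) auto
        then show "hausdorff_weight m (f ` (C i \<inter> A)) \<le> ennreal (L ^ m) * hausdorff_weight m (C i)"
          using L by (auto simp: hausdorff_weight_def ennreal_mult'[symmetric] power_mult_distrib power_divide
              field_simps intro!: ennreal_leI)
      qed
      finally show ?thesis by simp
    qed
    \<comment> \<open>The factor is moved to the left so that the infimum over covers stands alone
      on the right and \<open>INF_greatest\<close> applies.\<close>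
    then have "ennreal (1 / L^m) * hausdorff_pre m d (f ` A) \<le> hausdorff_pre m (d/L) A"
      unfolding hausdorff_pre_def[of m "d/L" A]
    proof (intro INF_greatest)
      fix C assume "C \<in> hausdorff_cover (d/L) A"
      and *: "\<And>C. C \<in> hausdorff_cover (d/L) A \<Longrightarrow> hausdorff_pre m d (f ` A) \<le> ennreal (L ^ m) * (\<Sum>i. hausdorff_weight m (C i))"
      then have "ennreal (1 / L^m) * hausdorff_pre m d (f ` A) \<le> ennreal (1 / L^m) * (ennreal (L ^ m) * (\<Sum>i. hausdorff_weight m (C i)))"
        by (intro mult_left_mono) auto
      also have "\<dots> = (\<Sum>i. hausdorff_weight m (C i))"
        using L by (simp add: mult.assoc[symmetric] ennreal_mult'[symmetric])
      finally show "ennreal (1 / L^m) * hausdorff_pre m d (f ` A) \<le> (\<Sum>i. hausdorff_weight m (C i))" .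
    qed
    then have "ennreal (L^m) * (ennreal (1 / L^m) * hausdorff_pre m d (f ` A)) \<le> ennreal (L^m) * hausdorff_pre m (d/L) A"
      by (rule mult_left_mono) simp
    then show ?thesis using L by (simp add: mult.assoc[symmetric] ennreal_mult'[symmetric])
  qed
  also have "\<dots> \<le> ennreal (L ^ m) * hausdorff_outer m A"
    using d L by (intro mult_left_mono hausdorff_pre_le_outer) auto
  finally show "hausdorff_pre m d (f ` A) \<le> ennreal (L ^ m) * hausdorff_outer m A" .
qed

section \<open>Lebesgue measure and coordinates\<close>

text \<open>Lower-dimensional space is modelled by a coordinate hyperplane of the same type, and
  slicing by overwriting a single coordinate.\<close>

definition vupd :: "real^'n \<Rightarrow> 'n \<Rightarrow> real \<Rightarrow> real^'n" where
  "vupd x j t = (\<chi> i. if i = j then t else x $ i)"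

lemma vupd_nth [simp]: "vupd x j t $ i = (if i = j then t else x $ i)"
  by (simp add: vupd_def)

lemma measurable_vec_lambda_PiM [measurable]: "(\<lambda>f. \<chi> i::'n::finite. f i) \<in> Pi\<^sub>M UNIV (\<lambda>_. lborel :: real measure) \<rightarrow>\<^sub>M borel"
proof (rule borel_measurable_euclidean_space[THEN iffD2], intro ballI)
  fix b :: "real^'n" assume "b \<in> Basis"
  then obtain i where b: "b = axis i 1" by (auto simp: Basis_vec_def)
  have "(\<lambda>f. (\<chi> i. f i) \<bullet> b) = (\<lambda>f. f i)"
    by (auto simp: b inner_axis)
  then show "(\<lambda>f. (\<chi> i. f i) \<bullet> b) \<in> borel_measurable (Pi\<^sub>M UNIV (\<lambda>_. lborel))" by simp
qed

lemma lborel_vec_eq: "(lborel :: (real^'n) measure) = distr (Pi\<^sub>M UNIV (\<lambda>_. lborel)) borel (\<lambda>f. \<chi> i. f i)"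
proof (rule lborel_eqI)
  interpret product_sigma_finite "\<lambda>_::'n. lborel :: real measure" by standard
  fix l u :: "real^'n" assume le: "\<And>b. b \<in> Basis \<Longrightarrow> l \<bullet> b \<le> u \<bullet> b"
  have le': "l $ i \<le> u $ i" for i using le[of "axis i 1"] by (auto simp: Basis_vec_def inner_axis)
  have "emeasure (distr (Pi\<^sub>M UNIV (\<lambda>_. lborel)) borel (\<lambda>f. \<chi> i. f i)) (box l u) =
     emeasure (Pi\<^sub>M UNIV (\<lambda>_. lborel)) (\<Pi>\<^sub>E i\<in>UNIV. {l $ i<..<u $ i})"
    by (subst emeasure_distr) (auto simp: space_PiM mem_box_cart PiE_iff intro!: arg_cong2[where f=emeasure])
  also have "\<dots> = (\<Prod>i\<in>UNIV. emeasure lborel {l $ i<..<u $ i})"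
    by (subst emeasure_PiM) auto
  also have "\<dots> = ennreal (\<Prod>i\<in>UNIV. u $ i - l $ i)"
    using le' by (simp add: prod_ennreal)
  also have "(\<Prod>i\<in>UNIV. u $ i - l $ i) = (\<Prod>b\<in>Basis. (u - l) \<bullet> b)"
    by (simp add: Basis_vec_def cart_eq_inner_axis UNION_singleton_eq_range prod.reindex inj_on_def axis_eq_axis inner_diff_left)
  finally show "emeasure (distr (Pi\<^sub>M UNIV (\<lambda>_. lborel)) borel (\<lambda>f. \<chi> i. f i)) (box l u) = ennreal (\<Prod>b\<in>Basis. (u - l) \<bullet> b)" .
qed simp

lemma measurable_vupd [measurable]: "(\<lambda>(x, t). vupd x j t) \<in> borel \<Otimes>\<^sub>M borel \<rightarrow>\<^sub>M (borel :: (real^'n) measure)"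
proof -
  have "continuous_on UNIV (\<lambda>z::(real^'n)\<times>real. vupd (fst z) j (snd z))"
    unfolding vupd_def
  proof (intro continuous_on_vec_lambda)
    show "continuous_on UNIV (\<lambda>x::(real^'n)\<times>real. if i = j then snd x else fst x $ i)" for i
      by (cases "i = j") (auto intro!: continuous_intros)
  qed
  then show ?thesis
    by (simp add: borel_prod split_beta borel_measurable_continuous_onI)
qed

lemma vupd_slice_measurable [measurable]:
  assumes [measurable]: "X \<in> sets borel"
  shows "(\<lambda>x. emeasure lborel {t. vupd x j t \<in> X}) \<in> borel_measurable (borel :: (real^'n) measure)"
proof -
  have "(\<lambda>(x,t). vupd x j t) -` X \<inter> space (borel \<Otimes>\<^sub>M lborel) \<in> sets (borel \<Otimes>\<^sub>M lborel)"
    using measurable_sets[OF measurable_vupd assms] by (simp cong: sets_pair_measure_cong add: space_pair_measure)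
  from lborel.measurable_emeasure_Pair[OF this]
  show ?thesis by (simp add: space_pair_measure vimage_def)
qed

text \<open>Cavalieri's principle in both orders, from the product description of
  \<open>lborel\<close> with the factor \<open>j\<close> split off: first by lines in direction
  \<open>j\<close>, then by sections at height \<open>t\<close>. The component \<open>j\<close> of
  the product point is overwritten and hence arbitrary.\<close>

lemma emeasure_lborel_slices:
  fixes X :: "(real^'n) set"
  assumes [measurable]: "X \<in> sets borel"
  shows "emeasure lborel X = (\<integral>\<^sup>+x. emeasure lborel {t. vupd (\<chi> i. x i) j t \<in> X} \<partial>Pi\<^sub>M (UNIV - {j}) (\<lambda>_. lborel))"
    and "emeasure lborel X = (\<integral>\<^sup>+t. emeasure (Pi\<^sub>M (UNIV - {j}) (\<lambda>_. lborel))
       {x\<in>space (Pi\<^sub>M (UNIV - {j}) (\<lambda>_. lborel)). vupd (\<chi> i. x i) j t \<in> X} \<partial>lborel)"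
proof -
  interpret product_sigma_finite "\<lambda>_::'n. lborel :: real measure" by standard
  let ?P = "Pi\<^sub>M (UNIV - {j}) (\<lambda>_. lborel :: real measure)"
  let ?v = "\<lambda>f. (\<chi> i. f i) :: real^'n"
  have ins: "insert j (UNIV - {j}) = UNIV" by auto
  have vj: "?v (x(j := t)) = vupd (?v x) j t" for x t
    by (simp add: vec_eq_iff)
  have [measurable]: "(\<lambda>x. ?v (x(j := t))) \<in> ?P \<rightarrow>\<^sub>M borel" for t
  proof -
    have "(\<lambda>x. x(j := t)) \<in> ?P \<rightarrow>\<^sub>M Pi\<^sub>M (insert j (UNIV - {j})) (\<lambda>_. lborel)"
      by (rule measurable_fun_upd[where J="UNIV - {j}"]) auto
    then show ?thesis unfolding ins using measurable_compose[OF _ measurable_vec_lambda_PiM] by blast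
  qed
  have X: "(\<lambda>f. indicator X (?v f)) \<in> borel_measurable (Pi\<^sub>M (insert j (UNIV - {j})) (\<lambda>_. lborel :: real measure))"
    unfolding ins by measurable
  have eq: "emeasure lborel X = (\<integral>\<^sup>+f. indicator X (?v f) \<partial>Pi\<^sub>M (insert j (UNIV - {j})) (\<lambda>_. lborel))"
    unfolding ins by (simp add: lborel_vec_eq nn_integral_distr nn_integral_indicator[symmetric] del: nn_integral_indicator)
  have "emeasure lborel X = (\<integral>\<^sup>+x. \<integral>\<^sup>+t. indicator X (vupd (?v x) j t) \<partial>lborel \<partial>?P)"
    unfolding eq by (subst product_nn_integral_insert[OF _ _ X]) (auto simp: vj)
  also have "\<dots> = (\<integral>\<^sup>+x. emeasure lborel {t. vupd (?v x) j t \<in> X} \<partial>?P)"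
  proof (rule nn_integral_cong)
    fix x
    have "{t. vupd (?v x) j t \<in> X} \<in> sets lborel" by measurable
    then have "emeasure lborel {t. vupd (?v x) j t \<in> X} = (\<integral>\<^sup>+t. indicator {t. vupd (?v x) j t \<in> X} t \<partial>lborel)"
      by (rule nn_integral_indicator[symmetric])
    then show "(\<integral>\<^sup>+t. indicator X (vupd (?v x) j t) \<partial>lborel) = emeasure lborel {t. vupd (?v x) j t \<in> X}"
      by (simp add: indicator_def)
  qed
  finally show "emeasure lborel X = \<dots>" .
  have "emeasure lborel X = (\<integral>\<^sup>+t. \<integral>\<^sup>+x. indicator X (vupd (?v x) j t) \<partial>?P \<partial>lborel)"
    unfolding eq by (subst product_nn_integral_insert_rev[OF _ _ X]) (auto simp: vj)
  also have "\<dots> = (\<integral>\<^sup>+t. emeasure ?P {x\<in>space ?P. vupd (?v x) j t \<in> X} \<partial>lborel)"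
  proof (rule nn_integral_cong)
    fix t
    have "{x\<in>space ?P. vupd (?v x) j t \<in> X} \<in> sets ?P" unfolding vj[symmetric] by measurable
    then have "emeasure ?P {x\<in>space ?P. vupd (?v x) j t \<in> X} = (\<integral>\<^sup>+x. indicator {x\<in>space ?P. vupd (?v x) j t \<in> X} x \<partial>?P)"
      by (rule nn_integral_indicator[symmetric])
    also have "\<dots> = (\<integral>\<^sup>+x. indicator X (vupd (?v x) j t) \<partial>?P)"
      by (rule nn_integral_cong) (simp add: indicator_def)
    finally show "(\<integral>\<^sup>+x. indicator X (vupd (?v x) j t) \<partial>?P) = emeasure ?P {x\<in>space ?P. vupd (?v x) j t \<in> X}" ..
  qed
  finally show "emeasure lborel X = \<dots>" .
qed

lemma matrix_component: "matrix f $ i $ j = f (axis j 1) $ i"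
  by (simp add: matrix_def)

lemma emeasure_lborel_scaled:
  fixes g :: "real^'n \<Rightarrow> real^'n"
  assumes "lborel = density (distr lborel borel g) (\<lambda>_. ennreal c)" and X: "X \<in> sets borel"
    and [measurable]: "g \<in> borel \<rightarrow>\<^sub>M borel"
  shows "emeasure lborel X = ennreal c * emeasure lborel (g -` X)"
  using X by (subst assms(1)) (simp add: emeasure_density nn_integral_cmult_indicator emeasure_distr)

lemma measurable_linear_cart: "linear (g :: real^'n \<Rightarrow> real^'n) \<Longrightarrow> g \<in> borel \<rightarrow>\<^sub>M borel"
  by (intro borel_measurable_continuous_onI linear_continuous_on) (simp add: linear_conv_bounded_linear)

text \<open>Both sides are multiplicative under composition, which reduces the claim to elementary
  maps: diagonal maps, transpositions and shears. A shear translates every line parallel to axis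
  \<open>m\<close>, so slicing along \<open>m\<close> shows that it preserves volume.\<close>

lemma emeasure_lborel_linear_vimage:
  fixes g :: "real^'n \<Rightarrow> real^'n"
  assumes g: "linear g" and det: "det (matrix g) \<noteq> 0" and X: "X \<in> sets borel"
  shows "emeasure lborel X = ennreal \<bar>det (matrix g)\<bar> * emeasure lborel (g -` X)"
proof -
  define P where "P g \<longleftrightarrow> (det (matrix g) \<noteq> 0 \<longrightarrow>
    (\<forall>X\<in>sets borel. emeasure lborel X = ennreal \<bar>det (matrix g)\<bar> * emeasure lborel (g -` X)))"
    for g :: "real^'n \<Rightarrow> real^'n"
  have "P g"
  proof (rule induct_linear_elementary[where P=P, OF g])
    fix f g :: "real^'n \<Rightarrow> real^'n" assume comp: "linear f" "linear g" "P f" "P g"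
    have fX: "f -` X \<in> sets borel" if "X \<in> sets borel" for X
      using measurable_sets[OF measurable_linear_cart[OF comp(1)] that] by simp
    have "emeasure lborel X = ennreal \<bar>det (matrix f)\<bar> * (ennreal \<bar>det (matrix g)\<bar> * emeasure lborel (g -` (f -` X)))"
      if "det (matrix f) \<noteq> 0" "det (matrix g) \<noteq> 0" "X \<in> sets borel" for X
      using comp(3,4) that fX unfolding P_def by metis
    then show "P (f \<circ> g)"
      by (simp add: P_def matrix_compose comp det_mul vimage_comp abs_mult ennreal_mult mult.assoc)
  next
    fix f :: "real^'n \<Rightarrow> real^'n" and i :: 'n assume "\<And>x. f x $ i = 0"
    then have "row i (matrix f) = 0" by (simp add: row_def matrix_component vec_eq_iff)
    then have "det (matrix f) = 0" by (rule det_zero_row(1))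
    then show "P f" by (simp add: P_def)
  next
    fix c :: "'n \<Rightarrow> real"
    let ?g = "\<lambda>x::real^'n. \<chi> i. c i * x $ i"
    have lin: "linear ?g" by (auto simp: linear_iff vec_eq_iff algebra_simps)
    have d: "det (matrix ?g) = (\<Prod>i\<in>UNIV. c i)"
      by (subst det_diagonal) (auto simp: matrix_component axis_def)
    show "P ?g" unfolding P_def
    proof (intro impI ballI)
      fix X :: "(real^'n) set" assume nz: "det (matrix ?g) \<noteq> 0" and X: "X \<in> sets borel"
      \<comment> \<open>The affine formula for \<open>lborel\<close> indexes its factors by basis
        vectors, so the factors are transferred from coordinates to the vectors
        \<open>axis i 1\<close>.\<close>
      define c' where "c' b = c (THE i. b = axis i 1)" for b :: "real^'n"
      have c': "c' (axis i 1) = c i" for i by (simp add: c'_def axis_eq_axis)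
      have B: "(Basis :: (real^'n) set) = range (\<lambda>i. axis i 1)" by (auto simp: Basis_vec_def)
      have inj: "inj (\<lambda>i. axis i 1 :: real^'n)" by (simp add: inj_on_def axis_eq_axis)
      have "c' b \<noteq> 0" if "b \<in> Basis" for b
        using that nz d by (auto simp: B c')
      from lborel_affine_euclidean[of c' 0, OF this]
      have "lborel = density (distr lborel borel (\<lambda>x. \<Sum>j\<in>Basis. (c' j * (x \<bullet> j)) *\<^sub>R j)) (\<lambda>_. ennreal (\<Prod>j\<in>Basis. \<bar>c' j\<bar>))"
        by simp
      also have "(\<lambda>x. \<Sum>j\<in>Basis. (c' j * (x \<bullet> j)) *\<^sub>R j) = ?g"
        by (simp add: fun_eq_iff B sum.reindex[OF inj] c' inner_axis vec_eq_iff)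
          (simp add: axis_def mult_delta_right)
      also have "(\<Prod>j\<in>Basis. \<bar>c' j\<bar>) = \<bar>det (matrix ?g)\<bar>"
        by (simp add: d B prod.reindex[OF inj] c' abs_prod)
      finally show "emeasure lborel X = ennreal \<bar>det (matrix ?g)\<bar> * emeasure lborel (?g -` X)"
        using X measurable_linear_cart[OF lin] by (rule emeasure_lborel_scaled)
    qed
  next
    fix m n :: 'n assume swap: "m \<noteq> n"
    let ?t = "Transposition.transpose m n"
    let ?g = "\<lambda>x::real^'n. \<chi> i. x $ ?t i"
    have lin: "linear ?g" by (auto simp: linear_iff vec_eq_iff)
    have "matrix ?g = (\<chi> i. (mat 1 :: real^'n^'n) $ ?t i)"
      by (auto simp: vec_eq_iff matrix_component axis_def mat_def)
    then have d: "\<bar>det (matrix ?g)\<bar> = 1"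
      using swap by (simp add: det_permute_rows permutes_swap_id sign_swap_id abs_mult)
    have [measurable]: "?g \<in> borel \<rightarrow>\<^sub>M borel" by (rule measurable_linear_cart[OF lin])
    have tt: "?t (?t i) = i" for i by simp
    have "lborel = distr lborel borel ?g"
    proof (rule lborel_eqI)
      fix l u :: "real^'n" assume le: "\<And>b. b \<in> Basis \<Longrightarrow> l \<bullet> b \<le> u \<bullet> b"
      have le': "l $ i \<le> u $ i" for i using le[of "axis i 1"] by (auto simp: Basis_vec_def inner_axis)
      have vim: "?g -` box l u = box (?g l) (?g u)"
        by (auto simp: mem_box_cart) (metis tt)+
      have B: "(\<Prod>b\<in>Basis. v \<bullet> b) = (\<Prod>i\<in>UNIV. v $ i)" for v :: "real^'n"
        by (simp add: Basis_vec_def cart_eq_inner_axis UNION_singleton_eq_range prod.reindex inj_on_def axis_eq_axis)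
      have "emeasure lborel (box (?g l) (?g u)) = ennreal (\<Prod>b\<in>Basis. (?g u - ?g l) \<bullet> b)"
        using le' by (intro emeasure_lborel_box) (auto simp: Basis_vec_def inner_axis)
      also have "(\<Prod>b\<in>Basis. (?g u - ?g l) \<bullet> b) = (\<Prod>i\<in>UNIV. (u - l) $ ?t i)"
        unfolding B by simp
      also have "\<dots> = (\<Prod>i\<in>UNIV. (u - l) $ i)"
        using prod.permute[OF permutes_swap_id[of m UNIV n], of "\<lambda>i. (u - l) $ i"] by (simp add: o_def)
      finally show "emeasure (distr lborel borel ?g) (box l u) = ennreal (\<Prod>b\<in>Basis. (u - l) \<bullet> b)"
        by (simp add: emeasure_distr vim B)
    qed simp
    then have "lborel = density (distr lborel borel ?g) (\<lambda>_. ennreal \<bar>det (matrix ?g)\<bar>)"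
      by (simp add: d density_1)
    then show "P ?g" unfolding P_def using measurable_linear_cart[OF lin] emeasure_lborel_scaled by blast
  next
    fix m n :: 'n assume idplus: "m \<noteq> n"
    let ?g = "\<lambda>x::real^'n. \<chi> i. if i = m then x $ m + x $ n else x $ i"
    have lin: "linear ?g" by (auto simp: linear_iff vec_eq_iff algebra_simps)
    have [measurable]: "?g \<in> borel \<rightarrow>\<^sub>M borel" by (rule measurable_linear_cart[OF lin])
    have "matrix ?g = (\<chi> k. if k = m then row m (mat 1) + 1 *s row n (mat 1) else row k (mat 1))"
      using idplus by (auto simp: vec_eq_iff matrix_component axis_def mat_def row_def)
    then have "det (matrix ?g) = det (mat 1 :: real^'n^'n)"
      using det_row_operation[OF idplus, of "mat 1 :: real^'n^'n" 1] by (simp only:)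
    then have d: "det (matrix ?g) = 1" by (simp only: det_I)
    have "emeasure lborel X = emeasure lborel (?g -` X)" if [measurable]: "X \<in> sets borel" for X
    proof -
      have gX [measurable]: "?g -` X \<in> sets borel"
        using measurable_sets[of ?g borel borel X] that by simp
      have "emeasure lborel {t. vupd x m t \<in> ?g -` X} = emeasure lborel {t. vupd x m t \<in> X}" for x
      proof -
        have "?g (vupd x m t) = vupd x m (x $ n + t)" for t
          using idplus by (auto simp: vec_eq_iff)
        then have "{t. vupd x m t \<in> ?g -` X} = (\<lambda>t. x $ n + t) -` {t. vupd x m t \<in> X}" by auto
        then have "emeasure lborel {t. vupd x m t \<in> ?g -` X} = emeasure (distr lborel borel (\<lambda>t. x $ n + t)) {t. vupd x m t \<in> X}"
          by (subst emeasure_distr) auto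
        then show ?thesis by (simp add: lborel_distr_plus)
      qed
      then show ?thesis by (simp add: emeasure_lborel_slices(1)[of _ m])
    qed
    then show "P ?g" by (simp add: P_def d)
  qed
  then show ?thesis using det X by (simp add: P_def)
qed

abbreviation flat :: "'n \<Rightarrow> real^'n \<Rightarrow> real^'n" where "flat k x \<equiv> vupd x k 0"

lemma vupd_vupd [simp]: "vupd (vupd x j s) j t = vupd x j t"
  by (simp add: vec_eq_iff)

lemma continuous_vupd [continuous_intros]:
  "continuous_on S f \<Longrightarrow> continuous_on S g \<Longrightarrow> continuous_on S (\<lambda>x. vupd (f x) j (g x) :: real^'n)"
  unfolding vupd_def
  by (intro continuous_on_vec_lambda) (case_tac "i = j"; auto intro!: continuous_intros)

text \<open>Since the height is 1, the volume of this cylinder is the (n-1)-dimensional volume of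
  the part of \<open>A\<close> in the hyperplane.\<close>

definition cyl :: "'n \<Rightarrow> (real^'n) set \<Rightarrow> (real^'n) set" where
  "cyl k A = {x. flat k x \<in> A \<and> 0 \<le> x $ k \<and> x $ k \<le> 1}"

lemma measurable_flat [measurable]: "flat k \<in> borel \<rightarrow>\<^sub>M borel"
  by (intro borel_measurable_continuous_onI continuous_intros)

lemma measurable_vec_nth [measurable]: "(\<lambda>x::real^'n. x $ i) \<in> borel_measurable borel"
  by (intro borel_measurable_continuous_onI continuous_intros)

lemma cyl_measurable [measurable]:
  assumes [measurable]: "A \<in> sets borel"
  shows "cyl k A \<in> sets borel"
  unfolding cyl_def by measurable

lemma norm_flat_vec: "norm (flat k (\<chi> i. f i)) = sqrt (\<Sum>i\<in>UNIV-{k}. (f i)\<^sup>2)"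
proof -
  have "(\<Sum>i\<in>UNIV. (flat k (\<chi> i. f i) $ i)\<^sup>2) = (\<Sum>i\<in>UNIV-{k}. (f i)\<^sup>2)"
    by (rule sum.mono_neutral_cong_right) auto
  then show ?thesis by (simp add: norm_vec_def L2_set_def)
qed

lemma flat_ball_measurable: "{x. norm (flat k x) \<le> r} \<in> sets borel"
  by (intro borel_closed closed_Collect_le continuous_intros)

lemma emeasure_cyl_ball:
  fixes k :: "'n::finite"
  assumes r: "r > 0"
  shows "emeasure lborel (cyl k {x. norm (flat k x) \<le> r}) = ennreal (unit_ball_vol (real (CARD('n) - 1)) * r ^ (CARD('n) - 1))"
proof -
  let ?P = "Pi\<^sub>M (UNIV-{k}) (\<lambda>_. lborel :: real measure)"
  have B [measurable]: "{x. norm (flat k x) \<le> r} \<in> sets borel" by measurable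
  have sl: "{t. vupd v k t \<in> cyl k {x. norm (flat k x) \<le> r}} = (if norm (flat k v) \<le> r then {0..1} else {})" for v
    by (auto simp: cyl_def)
  let ?E = "{f. sqrt (\<Sum>i\<in>UNIV-{k}. (f i)\<^sup>2) \<le> r} \<inter> space ?P"
  have "emeasure lborel (cyl k {x. norm (flat k x) \<le> r}) =
      (\<integral>\<^sup>+x. emeasure lborel {t. vupd (\<chi> i. x i) k t \<in> cyl k {x. norm (flat k x) \<le> r}} \<partial>?P)"
    by (rule emeasure_lborel_slices(1)) measurable
  also have "\<dots> = (\<integral>\<^sup>+f. indicator ?E f \<partial>?P)"
    unfolding sl by (rule nn_integral_cong) (auto simp: norm_flat_vec)
  also have "\<dots> = emeasure ?P ?E"
    by (rule nn_integral_indicator) measurable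
  also have "\<dots> = ennreal (unit_ball_vol (real (card (UNIV-{k}))) * r ^ card (UNIV-{k}))"
    using r by (intro emeasure_cball_aux) auto
  finally show ?thesis by (simp add: card_Diff_singleton)
qed

section \<open>Steiner symmetrization and the isodiametric inequality\<close>

text \<open>The isodiametric inequality for sets in the hyperplane \<open>x $ k = 0\<close> is derived from that for full-dimensional
  cylinders of height 1 over them, so that only Lebesgue measure on the whole space is ever used.\<close>

definition slab_body :: "'n \<Rightarrow> real \<Rightarrow> (real^'n) set \<Rightarrow> bool" where
  "slab_body k d X \<longleftrightarrow> compact X \<and> (\<forall>x\<in>X. 0 \<le> x $ k \<and> x $ k \<le> 1) \<and> (\<forall>x\<in>X. \<forall>y\<in>X. norm (flat k (x - y)) \<le> d)"

definition mirror :: "'n \<Rightarrow> real^'n \<Rightarrow> real^'n" where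
  "mirror j x = vupd x j (- (x $ j))"

text \<open>Each section of \<open>X\<close> by a line in direction \<open>j\<close> is replaced by
  the centred segment of the same length. Cavalieri keeps the volume, the projected diameter does
  not grow, and mirror symmetries in other coordinates survive because mirrored lines have sections
  of equal length. The closure restores compactness and can only add volume, hence an
  inequality.\<close>

lemma steiner_symmetrization:
  fixes X :: "(real^'n) set"
  assumes X: "slab_body k d X" and jk: "j \<noteq> k"
  obtains Y where "slab_body k d Y" "emeasure lborel X \<le> emeasure lborel Y" "\<forall>x\<in>Y. mirror j x \<in> Y"
    "\<And>i. (\<forall>x\<in>X. mirror i x \<in> X) \<Longrightarrow> (\<forall>x\<in>Y. mirror i x \<in> Y)"
proof -
  have cX: "compact X" and slab: "\<And>x. x \<in> X \<Longrightarrow> 0 \<le> x $ k \<and> x $ k \<le> 1"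
    and diam: "\<And>x y. x \<in> X \<Longrightarrow> y \<in> X \<Longrightarrow> norm (flat k (x - y)) \<le> d"
    using X by (auto simp: slab_body_def)
  have [measurable]: "X \<in> sets borel" using cX by (simp add: borel_compact)
  obtain B where B: "\<And>x. x \<in> X \<Longrightarrow> norm x \<le> B" using compact_imp_bounded[OF cX] unfolding bounded_iff by blast
  have Bc: "\<bar>x $ i\<bar> \<le> B" if "x \<in> X" for x i using B[OF that] component_le_norm_cart[of x i] by linarith
  define S where "S x = {t. vupd x j t \<in> X}" for x
  define w where "w x = measure lborel (S x)" for x
  define Y0 where "Y0 = {x. S x \<noteq> {} \<and> \<bar>x $ j\<bar> \<le> w x / 2}"
  define Y where "Y = closure Y0"
  have S_sub: "S x \<subseteq> {-B..B}" for x
  proof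
    fix t assume "t \<in> S x"
    then show "t \<in> {-B..B}" using Bc[of "vupd x j t" j] by (auto simp: S_def)
  qed
  have "closed (S x)" for x
    unfolding S_def using closed_vimage[OF compact_imp_closed[OF cX], of "\<lambda>t. vupd x j t"]
    by (simp add: vimage_def continuous_intros)
  then have cS: "compact (S x)" for x
    using bounded_subset[OF bounded_closed_interval S_sub] by (simp add: compact_eq_bounded_closed)
  have eS: "emeasure lborel (S x) = ennreal (w x)" for x
    unfolding w_def using emeasure_compact_finite[OF cS[of x]] by (simp add: emeasure_eq_ennreal_measure)
  have w0: "0 \<le> w x" for x by (simp add: w_def)
  have w_le: "w x \<le> b - a" if "S x \<subseteq> {a..b}" "a \<le> b" for x a b
    unfolding w_def using measure_mono_fmeasurable[OF that(1), of lborel] cS[of x] that(2)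
    by (simp add: borel_compact fmeasurable_def)
  have [measurable]: "w \<in> borel_measurable borel"
    unfolding w_def measure_def S_def by measurable
  have "{x. S x \<noteq> {}} = flat j -` (flat j ` X)"
  proof -
    have "(S x \<noteq> {}) = (flat j x \<in> flat j ` X)" for x
    proof
      assume "flat j x \<in> flat j ` X"
      then obtain z where z: "z \<in> X" "flat j x = flat j z" by auto
      have "vupd x j (z $ j) = vupd (flat j x) j (z $ j)" by simp
      also have "\<dots> = z" unfolding z(2) by (simp add: vec_eq_iff)
      finally show "S x \<noteq> {}" using z(1) unfolding S_def by (metis empty_iff mem_Collect_eq)
    next
      assume "S x \<noteq> {}"
      then obtain t where "vupd x j t \<in> X" by (auto simp: S_def)
      then show "flat j x \<in> flat j ` X" by (intro image_eqI[of _ _ "vupd x j t"]) auto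
    qed
    then show ?thesis by auto
  qed
  moreover have "flat j ` X \<in> sets borel"
    by (intro borel_compact compact_continuous_image cX continuous_intros)
  ultimately have [measurable]: "{x. S x \<noteq> {}} \<in> sets borel"
    using measurable_sets[OF measurable_flat] by auto
  have Y0m [measurable]: "Y0 \<in> sets borel"
  proof -
    have "Y0 = {x. S x \<noteq> {}} \<inter> {x. \<bar>x $ j\<bar> \<le> w x / 2}" by (auto simp: Y0_def)
    also have "\<dots> \<in> sets borel" by measurable
    finally show ?thesis .
  qed
  have Su: "S (vupd x j t) = S x" "w (vupd x j t) = w x" for x t by (auto simp: S_def w_def)
  have "emeasure lborel {t. vupd v j t \<in> Y0} = emeasure lborel {t. vupd v j t \<in> X}" for v
  proof (cases "S v = {}")
    case True
    then show ?thesis by (simp add: Y0_def Su S_def[symmetric])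
  next
    case False
    then have "{t. vupd v j t \<in> Y0} = {- (w v / 2)..w v / 2}"
      by (auto simp: Y0_def Su abs_le_iff)
    then show ?thesis using w0 by (simp add: S_def[symmetric] eS)
  qed
  then have "emeasure lborel X = emeasure lborel Y0"
    by (simp add: emeasure_lborel_slices(1)[of _ j])
  also have "\<dots> \<le> emeasure lborel Y"
    unfolding Y_def by (intro emeasure_mono closure_subset) auto
  finally have le: "emeasure lborel X \<le> emeasure lborel Y" .
  have cont_m: "continuous_on UNIV (mirror i)" for i :: 'n
    unfolding mirror_def by (intro continuous_intros)
  have closure_prop: "x \<in> C" if "x \<in> Y" "closed C" "\<And>x. x \<in> Y0 \<Longrightarrow> x \<in> C" for x C
    using that closure_minimal[of Y0 C] unfolding Y_def by blast
  have mirror_Y: "\<forall>x\<in>Y. mirror i x \<in> Y" if "\<And>x. x \<in> Y0 \<Longrightarrow> mirror i x \<in> Y0" for i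
  proof
    fix x assume "x \<in> Y"
    then have "x \<in> mirror i -` Y"
    proof (rule closure_prop)
      show "closed (mirror i -` Y)"
        unfolding Y_def using cont_m by (intro continuous_closed_vimage) (auto simp: continuous_on_eq_continuous_at)
      show "x \<in> mirror i -` Y" if "x \<in> Y0" for x
        using \<open>\<And>x. x \<in> Y0 \<Longrightarrow> mirror i x \<in> Y0\<close>[OF that] closure_subset by (auto simp: Y_def)
    qed
    then show "mirror i x \<in> Y" by simp
  qed
  have 1: "\<forall>x\<in>Y. mirror j x \<in> Y"
    by (rule mirror_Y) (auto simp: Y0_def mirror_def Su)
  have 2: "\<forall>x\<in>Y. mirror i x \<in> Y" if m: "\<forall>x\<in>X. mirror i x \<in> X" for i
  proof (cases "i = j")
    case False
    have comm: "mirror i (vupd x j t) = vupd (mirror i x) j t" for x t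
      using False by (auto simp: mirror_def vec_eq_iff)
    have inv: "mirror i (mirror i x) = x" for x by (simp add: mirror_def vec_eq_iff)
    have "S x \<subseteq> S (mirror i x)" for x unfolding S_def using m by (auto simp: comm[symmetric])
    from this this[of "mirror i x" for x] have "S (mirror i x) = S x" for x unfolding inv by blast
    moreover from this have "w (mirror i x) = w x" for x by (simp add: w_def)
    moreover have "mirror i x $ j = x $ j" for x using False by (simp add: mirror_def)
    ultimately show ?thesis by (intro mirror_Y) (simp add: Y0_def)
  qed (use 1 in simp)
  have "slab_body k d Y" unfolding slab_body_def
  proof (intro conjI ballI)
    have "norm x \<le> real CARD('n) * B" if x: "x \<in> Y0" for x
    proof -
      from x obtain t where t: "vupd x j t \<in> X" by (auto simp: Y0_def S_def)
      have "\<bar>x $ i\<bar> \<le> B" for i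
      proof (cases "i = j")
        case True
        have "w x \<le> B - (-B)" using Bc[OF t, of i] by (intro w_le S_sub) auto
        then show ?thesis using x True by (auto simp: Y0_def)
      qed (use Bc[OF t, of i] in auto)
      then have "(\<Sum>i\<in>UNIV. \<bar>x $ i\<bar>) \<le> (\<Sum>i\<in>(UNIV::'n set). B)" by (intro sum_mono) auto
      then show ?thesis using norm_le_l1_cart[of x] by simp
    qed
    then have "bounded Y0" by (auto simp: bounded_iff)
    then show "compact Y" unfolding Y_def by (simp add: compact_closure)
  next
    fix x assume "x \<in> Y"
    moreover have "closed {x::real^'n. 0 \<le> x $ k}" "closed {x::real^'n. x $ k \<le> 1}"
      by (auto intro!: closed_Collect_le continuous_intros)
    moreover have "0 \<le> x $ k \<and> x $ k \<le> 1" if x: "x \<in> Y0" for x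
    proof -
      from x obtain t where t: "vupd x j t \<in> X" by (auto simp: Y0_def S_def)
      then show ?thesis using slab[OF t] jk by auto
    qed
    ultimately show "0 \<le> x $ k" "x $ k \<le> 1"
      using closure_prop[of x "{x. 0 \<le> x $ k}"] closure_prop[of x "{x. x $ k \<le> 1}"] by auto
  next
    \<comment> \<open>Let [a, b] and [c, e] be the hulls of the two sections. Centring bounds the
      distance of the new points in direction \<open>j\<close> by the mean of b - c and e - a, hence
      by one of them in absolute value; that one is realised by two end points of the sections,
      which belong to \<open>X\<close>.\<close>
    have base: "norm (flat k (x - y)) \<le> d" if x: "x \<in> Y0" and y: "y \<in> Y0" for x y
    proof -
      obtain a where a: "a \<in> S x" "\<And>t. t \<in> S x \<Longrightarrow> a \<le> t" using compact_attains_inf[OF cS[of x]] x by (auto simp: Y0_def)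
      obtain b where b: "b \<in> S x" "\<And>t. t \<in> S x \<Longrightarrow> t \<le> b" using compact_attains_sup[OF cS[of x]] x by (auto simp: Y0_def)
      obtain c where c: "c \<in> S y" "\<And>t. t \<in> S y \<Longrightarrow> c \<le> t" using compact_attains_inf[OF cS[of y]] y by (auto simp: Y0_def)
      obtain e where e: "e \<in> S y" "\<And>t. t \<in> S y \<Longrightarrow> t \<le> e" using compact_attains_sup[OF cS[of y]] y by (auto simp: Y0_def)
      have "w x \<le> b - a" by (rule w_le) (use a b in auto)
      moreover have "w y \<le> e - c" by (rule w_le) (use c e in auto)
      moreover have "\<bar>x $ j\<bar> \<le> w x / 2" "\<bar>y $ j\<bar> \<le> w y / 2" using x y by (auto simp: Y0_def)
      ultimately have D: "\<bar>x $ j - y $ j\<bar> \<le> ((b - c) + (e - a)) / 2"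
        using abs_triangle_ineq4[of "x $ j" "y $ j"] by argo
      have "\<bar>x $ j - y $ j\<bar> \<le> \<bar>a - e\<bar> \<or> \<bar>x $ j - y $ j\<bar> \<le> \<bar>b - c\<bar>"
      proof (cases "b - c \<le> e - a")
        case True
        then have "\<bar>x $ j - y $ j\<bar> \<le> e - a" using D by argo
        then show ?thesis by linarith
      next
        case False
        then have "\<bar>x $ j - y $ j\<bar> \<le> b - c" using D by argo
        then show ?thesis by linarith
      qed
      then obtain s t where st: "s \<in> S x" "t \<in> S y" "\<bar>x $ j - y $ j\<bar> \<le> \<bar>s - t\<bar>"
        using a(1) b(1) c(1) e(1) by blast
      have "norm (flat k (x - y)) \<le> norm (flat k (vupd x j s - vupd y j t))"
        using st(3) jk by (intro norm_le_componentwise_cart) auto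
      also have "\<dots> \<le> d" using st by (intro diam) (auto simp: S_def)
      finally show ?thesis .
    qed
    fix x y assume x: "x \<in> Y" and y: "y \<in> Y"
    have cl: "closed {x::real^'n. norm (flat k (x - y)) \<le> d}" "closed {y::real^'n. norm (flat k (x - y)) \<le> d}" for x y
      by (auto intro!: closed_Collect_le continuous_intros)
    have "norm (flat k (x - y)) \<le> d" if y: "y \<in> Y0" for y
      using closure_prop[OF x cl(1)] base y by auto
    then show "norm (flat k (x - y)) \<le> d"
      using closure_prop[OF y cl(2)] by auto
  qed
  then show ?thesis using that le 1 2 by blast
qed

text \<open>After symmetrization in all directions other than \<open>k\<close>, the set contains
  with x also the point with all these coordinates negated. Their projections differ by twice
  \<open>flat k x\<close>, so the set lies in the cylinder over the ball of radius d / 2.\<close>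

lemma emeasure_slab_body_le:
  fixes X :: "(real^'n) set"
  assumes X: "slab_body k d X" and d: "d > 0"
  shows "emeasure lborel X \<le> ennreal (unit_ball_vol (real (CARD('n) - 1)) * (d / 2) ^ (CARD('n) - 1))"
proof -
  have "\<exists>Y. slab_body k d Y \<and> emeasure lborel X \<le> emeasure lborel Y \<and> (\<forall>i\<in>J. \<forall>x\<in>Y. mirror i x \<in> Y)"
    if "k \<notin> J" for J :: "'n set"
    using finite[of J] that
  proof (induction J)
    case empty
    then show ?case using X by auto
  next
    case (insert j J)
    then obtain Y where Y: "slab_body k d Y" "emeasure lborel X \<le> emeasure lborel Y" "\<forall>i\<in>J. \<forall>x\<in>Y. mirror i x \<in> Y" by auto
    from insert.prems have "j \<noteq> k" by auto
    from steiner_symmetrization[OF Y(1) this]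
    obtain Z where Z: "slab_body k d Z" "emeasure lborel Y \<le> emeasure lborel Z" "\<forall>x\<in>Z. mirror j x \<in> Z"
      "\<And>i. (\<forall>x\<in>Y. mirror i x \<in> Y) \<Longrightarrow> (\<forall>x\<in>Z. mirror i x \<in> Z)"
      by blast
    have "emeasure lborel X \<le> emeasure lborel Z" using Y(2) Z(2) by (rule order_trans)
    moreover have "\<forall>i\<in>insert j J. \<forall>x\<in>Z. mirror i x \<in> Z" using Z(3,4) Y(3) by blast
    ultimately show ?case using Z(1) by blast
  qed
  from this[of "UNIV - {k}"] obtain Y where Y: "slab_body k d Y" "emeasure lborel X \<le> emeasure lborel Y"
    and sym: "\<And>i x. i \<noteq> k \<Longrightarrow> x \<in> Y \<Longrightarrow> mirror i x \<in> Y" by auto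
  have "Y \<subseteq> cyl k {x. norm (flat k x) \<le> d / 2}"
  proof
    fix x assume x: "x \<in> Y"
    have "(\<chi> i. if i \<in> J then - x $ i else x $ i) \<in> Y" if "k \<notin> J" for J
      using finite[of J] that
    proof (induction J)
      case (insert j J)
      then have "mirror j (\<chi> i. if i \<in> J then - x $ i else x $ i) \<in> Y" by (intro sym) auto
      also have "mirror j (\<chi> i. if i \<in> J then - x $ i else x $ i) = (\<chi> i. if i \<in> insert j J then - x $ i else x $ i)"
        using insert by (auto simp: mirror_def vec_eq_iff)
      finally show ?case .
    qed (use x in simp)
    from this[of "UNIV - {k}"] have "(\<chi> i. if i \<noteq> k then - x $ i else x $ i) \<in> Y"
      by (simp only: Diff_iff UNIV_I singleton_iff simp_thms)
    then have "norm (flat k (x - (\<chi> i. if i \<noteq> k then - x $ i else x $ i))) \<le> d"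
      using Y(1) x unfolding slab_body_def by blast
    also have "flat k (x - (\<chi> i. if i \<noteq> k then - x $ i else x $ i)) = 2 *\<^sub>R flat k x"
      by (auto simp: vec_eq_iff)
    finally have "norm (flat k x) \<le> d / 2" by simp
    moreover have "0 \<le> x $ k \<and> x $ k \<le> 1" using Y(1) x unfolding slab_body_def by blast
    ultimately show "x \<in> cyl k {x. norm (flat k x) \<le> d / 2}"
      unfolding cyl_def by simp
  qed
  then have 1: "emeasure lborel Y \<le> emeasure lborel (cyl k {x. norm (flat k x) \<le> d / 2})"
    using flat_ball_measurable cyl_measurable by (intro emeasure_mono) auto
  have "d / 2 > 0" using d by simp
  note 2 = emeasure_cyl_ball[OF this, of k]
  show ?thesis using order_trans[OF Y(2) 1] unfolding 2 .
qed

section \<open>Determinants of rank-one updates and uniqueness of invariant measures\<close>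

lemma det_matrix_compose:
  fixes f g :: "real^'n \<Rightarrow> real^'n"
  assumes "linear f" "linear g"
  shows "det (matrix (f \<circ> g)) = det (matrix f) * det (matrix g)"
  using matrix_compose[OF assms(2,1)] by (simp add: det_mul)

lemma det_matrix_id: "det (matrix (id :: real^'n \<Rightarrow> real^'n)) = 1"
  by (simp add: matrix_id_mat_1)

text \<open>If \<open>a\<close> is a multiple of an axis vector, one column of the identity matrix
  is changed and Cramer's rule gives the determinant; an orthogonal map turns the general
  \<open>a\<close> into this case.\<close>

lemma det_rank_one_update:
  fixes a u :: "real^'n"
  shows "det (matrix (\<lambda>x. x + (a \<bullet> x) *\<^sub>R u)) = 1 + a \<bullet> u"
proof -
  define g where "g a u x = x + (a \<bullet> x) *\<^sub>R u" for a u x :: "real^'n"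
  have lin: "linear (g a u)" for a u
    by (auto simp: g_def linear_iff algebra_simps inner_add_right)
  have ax: "det (matrix (g (axis k c) v)) = 1 + axis k c \<bullet> v" for k :: 'n and c v
  proof -
    let ?x = "axis k 1 + c *\<^sub>R v"
    have "matrix (g (axis k c) v) = (\<chi> i j. if j = k then (mat 1 *v ?x) $ i else mat 1 $ i $ j)"
      by (simp add: vec_eq_iff matrix_component g_def inner_axis' matrix_vector_mul_lid)
        (simp add: axis_def mat_def)
    then have "det (matrix (g (axis k c) v)) = ?x $ k * det (mat 1 :: real^'n^'n)"
      using cramer_lemma[of k "mat 1" ?x] by simp
    then show ?thesis by (simp add: inner_axis' det_I)
  qed
  obtain k :: 'n where True by simp
  have "norm (axis k (norm a)) = norm a" by (simp add: norm_eq_sqrt_inner inner_axis')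
  then obtain f where f: "orthogonal_transformation f" "f (axis k (norm a)) = a"
    using orthogonal_transformation_exists by blast
  define f' where "f' = inv f"
  have of': "orthogonal_transformation f'" unfolding f'_def using f(1) by (rule orthogonal_transformation_inv)
  have ff': "f (f' x) = x" for x
    unfolding f'_def using orthogonal_transformation_bij[OF f(1)] by (simp add: bij_is_surj surj_f_inv_f)
  have lf: "linear f" "linear f'" using f(1) of' by (auto simp: orthogonal_transformation_linear)
  have inner: "axis k (norm a) \<bullet> f' x = a \<bullet> x" for x
    using f orthogonal_transformation_def ff' by metis
  have "g a u = f \<circ> (g (axis k (norm a)) (f' u) \<circ> f')"
    using lf by (auto simp: fun_eq_iff g_def inner ff' linear_add linear_scale)
  then have "det (matrix (g a u)) = det (matrix f) * (det (matrix (g (axis k (norm a)) (f' u))) * det (matrix f'))"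
    using lf lin by (simp add: det_matrix_compose linear_compose)
  also have "\<dots> = (det (matrix f) * det (matrix f')) * (1 + a \<bullet> u)"
    by (simp add: ax inner)
  also have "det (matrix f) * det (matrix f') = det (matrix (f \<circ> f'))"
    using lf by (simp add: det_matrix_compose)
  also have "f \<circ> f' = id" using ff' by auto
  finally show ?thesis unfolding det_matrix_id g_def by simp
qed

text \<open>Uniqueness of Haar measure by Fubini: the integral of 1_A(x) 1_B(x + y) over the product
  is evaluated in two ways. Invariance is asked only for translations from \<open>V\<close>, on
  which both measures are concentrated, so that measures on a hyperplane inside the whole space are
  covered. The reflection turns the set of y with x - y in \<open>A\<close> into a translate of
  \<open>A\<close>.\<close>

lemma translation_invariant_measures_proportional:
  fixes M N :: "'a::euclidean_space measure"
  assumes sets: "sets M = sets borel" "sets N = sets borel"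
    and sf: "sigma_finite_measure M" "sigma_finite_measure N"
    and V: "AE x in M. x \<in> V" "AE x in N. x \<in> V" and neg: "\<And>v. v \<in> V \<Longrightarrow> - v \<in> V"
    and invM: "\<And>v A. v \<in> V \<Longrightarrow> A \<in> sets borel \<Longrightarrow> emeasure M ((\<lambda>x. x + v) -` A) = emeasure M A"
    and invN: "\<And>v A. v \<in> V \<Longrightarrow> A \<in> sets borel \<Longrightarrow> emeasure N ((\<lambda>x. x + v) -` A) = emeasure N A"
    and refl: "\<And>A. A \<in> sets borel \<Longrightarrow> emeasure N (uminus -` A) = emeasure N A"
    and A [measurable]: "A \<in> sets borel" and B [measurable]: "B \<in> sets borel"
  shows "emeasure M A * emeasure N B = emeasure M B * emeasure N A"
proof -
  interpret M: sigma_finite_measure M by fact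
  interpret N: sigma_finite_measure N by fact
  interpret pair_sigma_finite M N ..
  note [measurable_cong] = sets
  have pre [measurable]: "(\<lambda>x. x + v) -` C \<in> sets borel" "uminus -` C \<in> sets borel" "{y. v + y \<in> C} \<in> sets borel" "{y. v - y \<in> C} \<in> sets borel"
    if [measurable]: "C \<in> sets borel" for C :: "'a set" and v
    using that measurable_sets[of "\<lambda>x. x + v" borel borel C] measurable_sets[of "uminus" borel borel C]
      measurable_sets[of "\<lambda>x. v + x" borel borel C] measurable_sets[of "\<lambda>x. v - x" borel borel C]
    by (simp_all add: vimage_def)
  have "emeasure M A * emeasure N B = (\<integral>\<^sup>+x. indicator A x * emeasure N B \<partial>M)"
    by (simp add: nn_integral_multc sets)
  also have "\<dots> = (\<integral>\<^sup>+x. (\<integral>\<^sup>+y. indicator A x * indicator B (x + y) \<partial>N) \<partial>M)"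
  proof (rule nn_integral_cong_AE, use V(1) in eventually_elim)
    case (elim x)
    have "emeasure N B = emeasure N {y. x + y \<in> B}"
      using invN[OF elim B] by (simp add: vimage_def add.commute)
    also have "\<dots> = (\<integral>\<^sup>+y. indicator {y. x + y \<in> B} y \<partial>N)"
      using pre(3)[OF B] sets by simp
    finally show ?case by (simp add: nn_integral_cmult indicator_def)
  qed
  also have "\<dots> = (\<integral>\<^sup>+y. (\<integral>\<^sup>+x. indicator A x * indicator B (x + y) \<partial>M) \<partial>N)"
    by (rule Fubini'[symmetric]) measurable
  also have "\<dots> = (\<integral>\<^sup>+y. (\<integral>\<^sup>+x. indicator B x * indicator A (x - y) \<partial>M) \<partial>N)"
  proof (rule nn_integral_cong_AE, use V(2) in eventually_elim)
    case (elim y)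
    have m1: "A \<inter> ((\<lambda>x. x + y) -` B) \<in> sets borel" and m2: "B \<inter> ((\<lambda>x. x + (-y)) -` A) \<in> sets borel"
      using A B pre(1) by blast+
    have "(\<integral>\<^sup>+x. indicator A x * indicator B (x + y) \<partial>M) = (\<integral>\<^sup>+x. indicator (A \<inter> ((\<lambda>x. x + y) -` B)) x \<partial>M)"
      by (rule nn_integral_cong) (auto simp: indicator_def)
    also have "\<dots> = emeasure M (A \<inter> ((\<lambda>x. x + y) -` B))" using m1 sets by simp
    also have "\<dots> = emeasure M ((\<lambda>x. x + (-y)) -` (A \<inter> ((\<lambda>x. x + y) -` B)))"
      using invM[OF neg[OF elim] m1] by simp
    also have "(\<lambda>x. x + (-y)) -` (A \<inter> ((\<lambda>x. x + y) -` B)) = B \<inter> ((\<lambda>x. x + (-y)) -` A)" by auto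
    also have "emeasure M \<dots> = (\<integral>\<^sup>+x. indicator (B \<inter> ((\<lambda>x. x + (-y)) -` A)) x \<partial>M)" using m2 sets by simp
    also have "\<dots> = (\<integral>\<^sup>+x. indicator B x * indicator A (x - y) \<partial>M)"
      by (rule nn_integral_cong) (auto simp: indicator_def)
    finally show ?case .
  qed
  also have "\<dots> = (\<integral>\<^sup>+x. (\<integral>\<^sup>+y. indicator B x * indicator A (x - y) \<partial>N) \<partial>M)"
    by (rule Fubini') measurable
  also have "\<dots> = (\<integral>\<^sup>+x. indicator B x * emeasure N A \<partial>M)"
  proof (rule nn_integral_cong_AE, use V(1) in eventually_elim)
    case (elim x)
    have "emeasure N A = emeasure N (uminus -` ((\<lambda>z. z + x) -` A))"
      using invN[OF elim A] refl[OF pre(1)[OF A]] by simp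
    also have "uminus -` ((\<lambda>z. z + x) -` A) = {y. x - y \<in> A}" by auto
    also have "emeasure N {y. x - y \<in> A} = (\<integral>\<^sup>+y. indicator {y. x - y \<in> A} y \<partial>N)"
      using pre(4)[OF A] sets by simp
    finally show ?case by (simp add: nn_integral_cmult indicator_def)
  qed
  also have "\<dots> = emeasure M B * emeasure N A"
    by (simp add: nn_integral_multc sets)
  finally show ?thesis .
qed

section \<open>Lebesgue and Hausdorff measure on a hyperplane\<close>

text \<open>Both measures live on the hyperplane \<open>x $ k = 0\<close> and are translation invariant there, hence proportional; the
  unit ball gives the factor \<open>n\<close> between a cylinder and a cone over the same base.\<close>

definition plane_measure :: "'n \<Rightarrow> (real^'n) measure" where
  "plane_measure k = distr (density lborel (indicator {x. 0 \<le> x $ k \<and> x $ k \<le> 1})) borel (flat k)"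

text \<open>The mass of a base \<open>A\<close> is the volume of the cone with apex 0 over the copy
  of \<open>A\<close> in the plane \<open>x $ k = 1\<close>: dividing by \<open>x $ k\<close>
  projects radially to that plane, and \<open>flat k\<close> brings it down to height 0.\<close>

definition cone_measure :: "'n \<Rightarrow> (real^'n) measure" where
  "cone_measure k = distr (density lborel (indicator {x. 0 < x $ k \<and> x $ k \<le> 1})) borel (\<lambda>x. flat k (x /\<^sub>R x $ k))"

lemma sets_plane_measure [simp, measurable_cong]: "sets (plane_measure k) = sets borel"
  by (simp add: plane_measure_def)

lemma sets_cone_measure [simp, measurable_cong]: "sets (cone_measure k) = sets borel"
  by (simp add: cone_measure_def)

lemma emeasure_plane_measure:
  assumes [measurable]: "A \<in> sets borel"
  shows "emeasure (plane_measure k) A = emeasure lborel (cyl k A)"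
proof -
  have "emeasure (plane_measure k) A = emeasure lborel ({x. 0 \<le> x $ k \<and> x $ k \<le> 1} \<inter> (flat k -` A))"
  proof -
    have "{x::real^'a. 0 \<le> x $ k \<and> x $ k \<le> 1} \<in> sets borel" by measurable
    then show ?thesis using measurable_sets[OF measurable_flat assms]
      by (simp add: plane_measure_def emeasure_distr emeasure_restricted)
  qed
  also have "{x. 0 \<le> x $ k \<and> x $ k \<le> 1} \<inter> (flat k -` A) = cyl k A"
    by (auto simp: cyl_def)
  finally show ?thesis .
qed

lemma emeasure_cone_measure:
  assumes [measurable]: "A \<in> sets borel"
  shows "emeasure (cone_measure k) A = emeasure lborel {x. 0 < x $ k \<and> x $ k \<le> 1 \<and> flat k (x /\<^sub>R x $ k) \<in> A}"
proof -
  have vA: "(\<lambda>x. flat k (x /\<^sub>R x $ k)) -` A \<in> sets borel"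
    using measurable_sets[of "\<lambda>x. flat k (x /\<^sub>R x $ k)" borel borel A] by simp
  have "emeasure (cone_measure k) A = emeasure lborel ({x. 0 < x $ k \<and> x $ k \<le> 1} \<inter> ((\<lambda>x. flat k (x /\<^sub>R x $ k)) -` A))"
  proof -
    have "{x::real^'a. 0 < x $ k \<and> x $ k \<le> 1} \<in> sets borel" by measurable
    then show ?thesis using vA
      by (simp add: cone_measure_def emeasure_distr emeasure_restricted)
  qed
  also have "{x. 0 < x $ k \<and> x $ k \<le> 1} \<inter> ((\<lambda>x. flat k (x /\<^sub>R x $ k)) -` A) = {x. 0 < x $ k \<and> x $ k \<le> 1 \<and> flat k (x /\<^sub>R x $ k) \<in> A}"
    by auto
  finally show ?thesis .
qed

lemma sigma_finite_cballI:
  fixes M :: "'a::euclidean_space measure"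
  assumes "sets M = sets borel" "\<And>i::nat. emeasure M (cball 0 (real i)) < \<infinity>"
  shows "sigma_finite_measure M"
proof
  have "space M = UNIV" using sets_eq_imp_space_eq[OF assms(1)] by simp
  moreover have "(\<Union>i::nat. cball 0 (real i)) = (UNIV :: 'a set)"
    using real_arch_simple by (auto simp: UNION_eq)
  ultimately show "\<exists>A. countable A \<and> A \<subseteq> sets M \<and> \<Union>A = space M \<and> (\<forall>a\<in>A. emeasure M a \<noteq> \<infinity>)"
    using assms by (intro exI[of _ "range (\<lambda>i::nat. cball 0 (real i))"]) (auto simp: less_top)
qed

lemma norm_le_flat: "norm (x::real^'n) \<le> norm (flat k x) + \<bar>x $ k\<bar>"
proof -
  have "x = flat k x + axis k (x $ k)" by (simp add: vec_eq_iff axis_def)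
  then have "norm x \<le> norm (flat k x) + norm (axis k (x $ k) :: real^'n)" using norm_triangle_ineq by metis
  also have "norm (axis k (x $ k) :: real^'n) = \<bar>x $ k\<bar>" by (simp add: norm_eq_sqrt_inner inner_axis')
  finally show ?thesis .
qed

lemma sigma_finite_plane: "sigma_finite_measure (plane_measure k)"
proof (rule sigma_finite_cballI)
  fix i :: nat
  have "norm x \<le> real i + 1" if "x \<in> cyl k (cball 0 (real i))" for x
    using norm_le_flat[of x k] that by (simp add: cyl_def)
  then have "bounded (cyl k (cball 0 (real i)))"
    by (rule boundedI)
  then show "emeasure (plane_measure k) (cball 0 (real i)) < \<infinity>"
    using emeasure_bounded_finite by (subst emeasure_plane_measure) auto
qed simp

lemma sigma_finite_cone: "sigma_finite_measure (cone_measure k)"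
proof (rule sigma_finite_cballI)
  fix i :: nat
  have "norm x \<le> real i + 1" if "0 < x $ k" "x $ k \<le> 1" "norm (flat k (x /\<^sub>R x $ k)) \<le> real i" for x
  proof -
    have "flat k (x /\<^sub>R x $ k) = (flat k x) /\<^sub>R x $ k" by (simp add: vec_eq_iff)
    then have "norm (flat k x) \<le> real i * x $ k" using that by (simp add: field_simps)
    also have "\<dots> \<le> real i" using that by (simp add: mult_left_le)
    finally show ?thesis using norm_le_flat[of x k] that by linarith
  qed
  then have "bounded {x. 0 < x $ k \<and> x $ k \<le> 1 \<and> flat k (x /\<^sub>R x $ k) \<in> cball 0 (real i)}"
    by (intro boundedI[of _ "real i + 1"]) simp
  then show "emeasure (cone_measure k) (cball 0 (real i)) < \<infinity>"
    using emeasure_bounded_finite by (subst emeasure_cone_measure) auto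
qed simp

lemma AE_plane_measure: "AE x in plane_measure k. x $ k = 0"
  unfolding plane_measure_def by (subst AE_distr_iff) auto

lemma AE_cone_measure: "AE x in cone_measure k. x $ k = 0"
  unfolding cone_measure_def by (subst AE_distr_iff) auto

lemma emeasure_lborel_translation:
  assumes [measurable]: "A \<in> sets borel"
  shows "emeasure lborel ((\<lambda>x. x + v) -` A) = emeasure lborel (A :: 'a::euclidean_space set)"
proof -
  have "emeasure lborel A = emeasure (distr lborel borel (\<lambda>x. v + x)) A" by (simp add: lborel_distr_plus)
  also have "\<dots> = emeasure lborel ((\<lambda>x. x + v) -` A)" unfolding add.commute[of v] by (subst emeasure_distr) auto
  finally show ?thesis ..
qed

lemma plane_measure_translation:
  assumes v: "v $ k = 0" and [measurable]: "A \<in> sets borel"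
  shows "emeasure (plane_measure k) ((\<lambda>x. x + v) -` A) = emeasure (plane_measure k) A"
proof -
  have 1: "(\<lambda>x. x + v) -` A \<in> sets borel" using measurable_sets[of "\<lambda>x. x + v" borel borel A] by simp
  have "flat k x + v = flat k (x + v)" for x using v by (simp add: vec_eq_iff)
  then have "cyl k ((\<lambda>x. x + v) -` A) = (\<lambda>x. x + v) -` (cyl k A)"
    using v by (auto simp: cyl_def)
  then show ?thesis using 1 by (simp add: emeasure_plane_measure emeasure_lborel_translation)
qed

lemma plane_measure_reflection:
  assumes [measurable]: "A \<in> sets borel"
  shows "emeasure (plane_measure k) (uminus -` A) = emeasure (plane_measure k) A"
proof -
  have 1: "uminus -` A \<in> sets borel" using measurable_sets[of "uminus" borel borel A] by simp
  have lin: "linear (uminus :: real^'a \<Rightarrow> real^'a)" by (simp add: linear_iff)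
  have "det (matrix (uminus \<circ> uminus :: real^'a \<Rightarrow> real^'a)) = (det (matrix (uminus :: real^'a \<Rightarrow> real^'a)))\<^sup>2"
    unfolding power2_eq_square by (rule det_matrix_compose[OF lin lin])
  moreover have "uminus \<circ> uminus = (id :: real^'a \<Rightarrow> real^'a)" by auto
  ultimately have "(det (matrix (uminus :: real^'a \<Rightarrow> real^'a)))\<^sup>2 = 1"
    using det_matrix_id by metis
  then have d: "\<bar>det (matrix (uminus :: real^'a \<Rightarrow> real^'a))\<bar> = 1"
    using abs_square_eq_1 by blast
  \<comment> \<open>Negation carries the slab between heights 0 and 1 to the one between -1 and 0;
    adding \<open>axis k 1\<close> brings it back.\<close>
  have fl: "- flat k x = flat k (- x + axis k 1)" for x by (simp add: vec_eq_iff axis_def)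
  let ?T = "(\<lambda>x. x + axis k 1) -` (cyl k A)"
  have eq: "cyl k (uminus -` A) = uminus -` ?T"
    by (auto simp: cyl_def fl)
  have T: "?T \<in> sets borel"
    using measurable_sets[of "\<lambda>x. x + axis k 1" borel borel "cyl k A"] by simp
  have "emeasure lborel (cyl k A) = emeasure lborel ?T"
    by (simp add: emeasure_lborel_translation)
  moreover have "det (matrix (uminus :: real^'a \<Rightarrow> real^'a)) \<noteq> 0" using d by auto
  from emeasure_lborel_linear_vimage[OF lin this T] d
  have "emeasure lborel ?T = emeasure lborel (uminus -` ?T)" by simp
  ultimately have "emeasure lborel (cyl k A) = emeasure lborel (cyl k (uminus -` A))"
    unfolding eq by simp
  then show ?thesis using 1 by (simp add: emeasure_plane_measure)
qed

text \<open>Translating the base by \<open>v\<close> is the action on the cone of the shear that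
  adds \<open>x $ k\<close> times \<open>v\<close>; its determinant is 1 because \<open>v\<close>
  has no component along \<open>k\<close>.\<close>

lemma cone_measure_translation:
  assumes v: "v $ k = 0" and A [measurable]: "A \<in> sets borel"
  shows "emeasure (cone_measure k) ((\<lambda>x. x + v) -` A) = emeasure (cone_measure k) A"
proof -
  have 1: "(\<lambda>x. x + v) -` A \<in> sets borel" using measurable_sets[of "\<lambda>x. x + v" borel borel A] by simp
  let ?g = "\<lambda>x. x + (axis k 1 \<bullet> x) *\<^sub>R v"
  let ?C = "\<lambda>A. {x. 0 < x $ k \<and> x $ k \<le> 1 \<and> flat k (x /\<^sub>R x $ k) \<in> A}"
  have lin: "linear ?g" by (auto simp: linear_iff algebra_simps inner_add_right)
  have d: "det (matrix ?g) = 1" using v by (subst det_rank_one_update) (simp add: inner_axis')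
  have "flat k (x /\<^sub>R x $ k) + v = flat k (?g x /\<^sub>R ?g x $ k)" if "x $ k > 0" for x
    using v that by (simp add: vec_eq_iff inner_axis' field_simps)
  then have "?C ((\<lambda>x. x + v) -` A) = ?g -` (?C A)"
    using v by (auto simp: inner_axis')
  moreover have "?C A \<in> sets borel" by measurable
  ultimately show ?thesis
    using 1 emeasure_lborel_linear_vimage[OF lin, of "?C A"] d by (simp add: emeasure_cone_measure)
qed

lemma emeasure_plane_ball:
  "r > 0 \<Longrightarrow> emeasure (plane_measure (k::'n)) {x. norm (flat k x) \<le> r} = ennreal (unit_ball_vol (real (CARD('n::finite) - 1)) * r ^ (CARD('n) - 1))"
  by (simp add: emeasure_plane_measure flat_ball_measurable emeasure_cyl_ball)

lemma norm_flat_cone_slice: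
  assumes "t > 0"
  shows "norm (flat k (flat k (vupd v k t /\<^sub>R t))) \<le> 1 \<longleftrightarrow> norm (flat k v) \<le> t"
proof -
  have "flat k (flat k (vupd v k t /\<^sub>R t)) = (1 / t) *\<^sub>R flat k v"
    by (simp add: vec_eq_iff divide_inverse)
  then have "norm (flat k (flat k (vupd v k t /\<^sub>R t))) = norm ((1 / t) *\<^sub>R flat k v)" by (simp only:)
  also have "\<dots> = norm (flat k v) / t" using assms by simp
  finally have "norm (flat k (flat k (vupd v k t /\<^sub>R t))) = norm (flat k v) / t" .
  then show ?thesis using assms by (simp only: divide_le_eq_1_pos)
qed

text \<open>The section of this cone at height t is a ball of radius t, and the integral of t^(n-1)
  over the unit interval contributes the factor 1 / n.\<close>

lemma emeasure_cone_ball: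
  "emeasure (cone_measure (k::'n)) {x. norm (flat k x) \<le> 1} = ennreal (unit_ball_vol (real (CARD('n::finite) - 1)) / real CARD('n))"
proof -
  let ?C = "{x. 0 < x $ k \<and> x $ k \<le> 1 \<and> flat k (x /\<^sub>R x $ k) \<in> {x. norm (flat k x) \<le> 1}}"
  let ?P = "Pi\<^sub>M (UNIV-{k}) (\<lambda>_. lborel :: real measure)"
  let ?m = "CARD('n) - 1"
  have B [measurable]: "{x. norm (flat k x) \<le> 1} \<in> sets borel" by (rule flat_ball_measurable)
  have Cm: "?C \<in> sets borel" by measurable
  have slice: "emeasure ?P {x\<in>space ?P. vupd (\<chi> i. x i) k t \<in> ?C} = ennreal (unit_ball_vol (real ?m) * t ^ ?m) * indicator {0..1} t"
    if "t \<noteq> 0" for t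
  proof (cases "0 < t \<and> t \<le> 1")
        case True
        have eq: "{x\<in>space ?P. vupd (\<chi> i. x i) k t \<in> ?C} = {f. sqrt (\<Sum>i\<in>UNIV-{k}. (f i)\<^sup>2) \<le> t} \<inter> space ?P"
          using norm_flat_cone_slice[where k=k] True norm_flat_vec[where k=k] by (intro set_eqI) auto
        have "emeasure ?P ({f. sqrt (\<Sum>i\<in>UNIV-{k}. (f i)\<^sup>2) \<le> t} \<inter> space ?P) = ennreal (unit_ball_vol (real (card (UNIV-{k}))) * t ^ card (UNIV-{k}))"
          using True by (intro emeasure_cball_aux) auto
        then show ?thesis unfolding eq using True by (simp add: card_Diff_singleton)
      next
        case False
        then have eq: "{x\<in>space ?P. vupd (\<chi> i. x i) k t \<in> ?C} = {}" by auto
        show ?thesis unfolding eq using False that by simp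
  qed
  have "emeasure (cone_measure k) {x. norm (flat k x) \<le> 1} = emeasure lborel ?C"
    by (rule emeasure_cone_measure) measurable
  also have "\<dots> = (\<integral>\<^sup>+t. emeasure ?P {x\<in>space ?P. vupd (\<chi> i. x i) k t \<in> ?C} \<partial>lborel)"
    by (rule emeasure_lborel_slices(2)[OF Cm])
  also have "\<dots> = (\<integral>\<^sup>+t. ennreal (unit_ball_vol (real ?m) * t ^ ?m) * indicator {0..1} t \<partial>lborel)"
    by (rule nn_integral_cong_AE, rule AE_mp[OF AE_lborel_singleton[of 0]], rule AE_I2, rule impI, rule slice)
  also have "\<dots> = ennreal (unit_ball_vol (real ?m) / real (Suc ?m) * 1 ^ Suc ?m - unit_ball_vol (real ?m) / real (Suc ?m) * 0 ^ Suc ?m)"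
    by (rule nn_integral_FTC_Icc) (auto intro!: derivative_eq_intros simp: field_simps simp del: of_nat_Suc)
  finally show ?thesis by (simp add: zero_power)
qed

lemma cone_measure_eq:
  assumes A: "A \<in> sets borel"
  shows "ennreal (real CARD('n)) * emeasure (cone_measure (k::'n::finite)) A = emeasure (plane_measure k) A"
proof -
  let ?B = "{x::real^'n. norm (flat k x) \<le> 1}"
  let ?o = "unit_ball_vol (real (CARD('n) - 1))"
  have o: "?o > 0" by simp
  have "emeasure (cone_measure k) A * emeasure (plane_measure k) ?B = emeasure (cone_measure k) ?B * emeasure (plane_measure k) A"
  proof (rule translation_invariant_measures_proportional[where V="{x. x $ k = 0}"])
    show "AE x in cone_measure k. x \<in> {x. x $ k = 0}" "AE x in plane_measure k. x \<in> {x. x $ k = 0}"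
      using AE_cone_measure[of k] AE_plane_measure[of k] by simp_all
  qed (simp_all add: sigma_finite_cone sigma_finite_plane cone_measure_translation
         plane_measure_translation plane_measure_reflection A flat_ball_measurable)
  then have "emeasure (cone_measure k) A * ennreal ?o = ennreal (?o / real CARD('n)) * emeasure (plane_measure k) A"
    by (simp add: emeasure_plane_ball emeasure_cone_ball)
  note * = this
  have c: "ennreal (real CARD('n) / r) * (x * ennreal r) = ennreal (real CARD('n)) * x"
      "ennreal (real CARD('n) / r) * (ennreal (r / real CARD('n)) * x) = x" if "r > 0" for x r
    using that by (simp_all add: mult.assoc[symmetric] mult.commute[of x] ennreal_mult'[symmetric])
  show ?thesis using arg_cong[OF *, of "\<lambda>x. ennreal (real CARD('n) / ?o) * x"] unfolding c[OF o] .
qed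

section \<open>Normalization of Hausdorff measure on a hyperplane\<close>

lemma hausdorff_pre_Un_le:
  assumes "m \<ge> 1" "d > 0"
  shows "hausdorff_pre m d (A \<union> B) \<le> hausdorff_pre m d A + hausdorff_pre m d B"
proof -
  have "hausdorff_pre m d (\<Union>i. binaryset A B i) \<le> (\<Sum>i. hausdorff_pre m d (binaryset A B i))"
    by (rule hausdorff_pre_countable_subadditive)
  then show ?thesis
    using suminf_binaryset_eq[of "hausdorff_pre m d" A B] assms
    by (simp add: UN_binaryset_eq hausdorff_pre_empty)
qed

lemma hausdorff_pre_le_weight:
  assumes "m \<ge> 1" "bounded C" "diameter C \<le> d" "d > 0"
  shows "hausdorff_pre m d C \<le> hausdorff_weight m C"
proof -
  have "hausdorff_pre m d C \<le> (\<Sum>i. hausdorff_weight m (binaryset C {} i))"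
    by (rule hausdorff_pre_le) (use assms in \<open>auto simp: UN_binaryset_eq binaryset_def\<close>)
  then show ?thesis
    using suminf_binaryset_eq[of "hausdorff_weight m" C "{}"] assms(1) by (simp add: hausdorff_weight_empty)
qed

lemma hausdorff_pre_finite_cover:
  assumes "m \<ge> 1" "d > 0" and I: "finite I" and C: "\<And>i. i \<in> I \<Longrightarrow> bounded (C i) \<and> diameter (C i) \<le> d"
  shows "hausdorff_pre m d (\<Union>i\<in>I. C i) \<le> (\<Sum>i\<in>I. hausdorff_weight m (C i))"
  using I C
proof (induction I)
  case (insert i I)
  have "hausdorff_pre m d (\<Union>i\<in>insert i I. C i) \<le> hausdorff_pre m d (C i) + hausdorff_pre m d (\<Union>i\<in>I. C i)"
    using hausdorff_pre_Un_le[OF assms(1,2)] by simp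
  also have "\<dots> \<le> hausdorff_weight m (C i) + (\<Sum>i\<in>I. hausdorff_weight m (C i))"
    using insert assms(1,2) by (intro add_mono hausdorff_pre_le_weight) auto
  finally show ?case using insert by simp
qed (simp add: hausdorff_pre_empty[OF assms(1,2)])

definition unit_cube :: "'n \<Rightarrow> (real^'n) set" where
  "unit_cube k = {x. x $ k = 0 \<and> (\<forall>i. 0 \<le> x $ i \<and> x $ i \<le> 1)}"

definition grid_index :: "'n \<Rightarrow> nat \<Rightarrow> ('n \<Rightarrow> nat) set" where
  "grid_index k N = PiE (UNIV - {k}) (\<lambda>_. {..<N})"

definition grid_cell :: "'n \<Rightarrow> nat \<Rightarrow> ('n \<Rightarrow> nat) \<Rightarrow> (real^'n) set" where
  "grid_cell k N f = {x. x $ k = 0 \<and> (\<forall>i. i \<noteq> k \<longrightarrow> real (f i) / real N \<le> x $ i \<and> x $ i \<le> (real (f i) + 1) / real N)}"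

text \<open>A ball at the centre of a grid cell. Its radius is a quarter of the side, less than the
  inradius, so balls of distinct cells are disjoint, and together they fill a fraction of the cube
  that is independent of \<open>N\<close>.\<close>

definition grid_ball :: "'n \<Rightarrow> nat \<Rightarrow> ('n \<Rightarrow> nat) \<Rightarrow> (real^'n) set" where
  "grid_ball k N f = {x. x $ k = 0 \<and> norm (x - (\<chi> i. if i = k then 0 else (real (f i) + 1/2) / real N)) \<le> 1 / (4 * real N)}"

lemma finite_grid_index: "finite (grid_index (k::'n::finite) N)"
  by (simp add: grid_index_def finite_PiE)

lemma card_grid_index: "card (grid_index (k::'n::finite) N) = N ^ (CARD('n) - 1)"
  by (simp add: grid_index_def card_PiE card_Diff_singleton)

lemma unit_cube_subset_grid:
  assumes "N \<ge> 1"
  shows "unit_cube k \<subseteq> (\<Union>f\<in>grid_index k N. grid_cell k N f)"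
proof
  fix x assume x: "x \<in> unit_cube k"
  define f where "f = restrict (\<lambda>i. min (N - 1) (nat \<lfloor>x $ i * N\<rfloor>)) (UNIV - {k})"
  have "f \<in> grid_index k N" using assms by (auto simp: f_def grid_index_def)
  moreover have "x \<in> grid_cell k N f"
    unfolding grid_cell_def
  proof (intro CollectI conjI allI impI)
    fix i assume i: "i \<noteq> k"
    have x01: "0 \<le> x $ i" "x $ i \<le> 1" using x by (auto simp: unit_cube_def)
    have fi: "f i = min (N - 1) (nat \<lfloor>x $ i * N\<rfloor>)" using i by (simp add: f_def)
    have fl: "real (nat \<lfloor>x $ i * N\<rfloor>) \<le> x $ i * N" "x $ i * N < real (nat \<lfloor>x $ i * N\<rfloor>) + 1"
      using x01 by (auto simp: of_nat_nat)
    have "real (f i) \<le> x $ i * N" using fl(1) unfolding fi by linarith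
    then show "real (f i) / real N \<le> x $ i" using assms by (simp add: field_simps)
    have "x $ i * N \<le> real (f i) + 1"
    proof (cases "N - 1 \<le> nat \<lfloor>x $ i * N\<rfloor>")
      case True
      then have "real (f i) + 1 = real N" unfolding fi using assms by (simp add: of_nat_diff)
      then show ?thesis using x01 by (simp add: mult_left_le_one_le)
    qed (use fl(2) in \<open>simp add: fi min_def\<close>)
    then show "x $ i \<le> (real (f i) + 1) / real N" using assms by (simp add: field_simps)
  qed (use x in \<open>simp add: unit_cube_def\<close>)
  ultimately show "x \<in> (\<Union>f\<in>grid_index k N. grid_cell k N f)" by blast
qed

lemma grid_cell_small:
  fixes k :: "'n::finite"
  assumes "N \<ge> 1"
  shows "bounded (grid_cell k N f)" "diameter (grid_cell k N f) \<le> real CARD('n) / real N"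
proof -
  have d: "norm (x - y) \<le> real CARD('n) / real N" if x: "x \<in> grid_cell k N f" and y: "y \<in> grid_cell k N f" for x y
  proof -
    have "\<bar>(x - y) $ i\<bar> \<le> 1 / real N" for i
    proof (cases "i = k")
      case False
      then have "real (f i) / real N \<le> x $ i" "x $ i \<le> (real (f i) + 1) / real N"
        "real (f i) / real N \<le> y $ i" "y $ i \<le> (real (f i) + 1) / real N"
        using x y by (auto simp: grid_cell_def)
      then show ?thesis by (simp add: add_divide_distrib abs_le_iff)
    qed (use x y in \<open>simp add: grid_cell_def\<close>)
    then have "(\<Sum>i\<in>UNIV. \<bar>(x - y) $ i\<bar>) \<le> (\<Sum>i\<in>(UNIV::'n set). 1 / real N)" by (intro sum_mono)
    then show ?thesis using norm_le_l1_cart[of "x - y"] by simp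
  qed
  then show "diameter (grid_cell k N f) \<le> real CARD('n) / real N"
    by (intro diameter_le) auto
  show "bounded (grid_cell k N f)"
    unfolding bounded_two_points dist_norm using d by blast
qed

text \<open>The N^(n-1) grid cells have diameter at most n / N, so the sum of their weights does not
  depend on N. The bound is far from sharp; finiteness is what sigma-finiteness and the later
  cancellation rest on.\<close>

lemma hausdorff_unit_cube_finite:
  fixes k :: "'n::finite"
  assumes n: "CARD('n) \<ge> 2"
  shows "hausdorff_outer (CARD('n) - 1) (unit_cube k) < \<infinity>"
proof -
  let ?m = "CARD('n) - 1"
  let ?c = "unit_ball_vol (real ?m) * (real CARD('n) / 2) ^ ?m"
  have m: "?m \<ge> 1" using n by simp
  have "hausdorff_outer ?m (unit_cube k) \<le> ennreal ?c"
  proof (rule hausdorff_outer_leI)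
    fix d :: real assume d: "d > 0"
    obtain N :: nat where N: "real CARD('n) / d < real N" using reals_Archimedean2 by blast
    have "0 < real CARD('n) / d" using d by simp
    then have N0: "N \<ge> 1" "real N > 0" using N by (cases N; simp)+
    have Nd: "real CARD('n) / real N \<le> d" using N d N0 by (simp add: field_simps)
    have "hausdorff_pre ?m d (unit_cube k) \<le> hausdorff_pre ?m d (\<Union>f\<in>grid_index k N. grid_cell k N f)"
      by (rule hausdorff_pre_mono[OF unit_cube_subset_grid[OF N0(1)]])
    also have "\<dots> \<le> (\<Sum>f\<in>grid_index k N. hausdorff_weight ?m (grid_cell k N f))"
      by (rule hausdorff_pre_finite_cover[OF m d finite_grid_index])
        (use grid_cell_small[OF N0(1), of k] Nd in \<open>blast intro: order_trans\<close>)
    also have "\<dots> \<le> (\<Sum>f\<in>grid_index k N. ennreal (unit_ball_vol (real ?m) * (real CARD('n) / real N / 2) ^ ?m))"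
    proof (rule sum_mono)
      fix f
      have "(diameter (grid_cell k N f) / 2) ^ ?m \<le> (real CARD('n) / real N / 2) ^ ?m"
        using grid_cell_small[OF N0(1), of k f] diameter_ge_0 by (intro power_mono divide_right_mono) auto
      then show "hausdorff_weight ?m (grid_cell k N f) \<le> ennreal (unit_ball_vol (real ?m) * (real CARD('n) / real N / 2) ^ ?m)"
        unfolding hausdorff_weight_def by (intro ennreal_leI mult_left_mono) auto
    qed
    also have "\<dots> = ennreal (real N ^ ?m * (unit_ball_vol (real ?m) * (real CARD('n) / real N / 2) ^ ?m))"
      by (simp only: sum_constant card_grid_index ennreal_mult' ennreal_of_nat_eq_real_of_nat of_nat_power zero_le_power of_nat_0_le_iff)
    also have "real N ^ ?m * (unit_ball_vol (real ?m) * (real CARD('n) / real N / 2) ^ ?m) = ?c"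
      using N0 by (simp add: power_divide)
    finally show "hausdorff_pre ?m d (unit_cube k) \<le> ennreal ?c" .
  qed
  then show ?thesis by (rule order.strict_trans1) simp
qed

text \<open>Members of a cover may have diameter 0; this case is reached by letting d + e decrease
  to d.\<close>

lemma emeasure_slab_body_le':
  fixes X :: "(real^'n) set"
  assumes X: "slab_body k d X" and d: "d \<ge> 0"
  shows "emeasure lborel X \<le> ennreal (unit_ball_vol (real (CARD('n) - 1)) * (d / 2) ^ (CARD('n) - 1))"
proof (rule tendsto_lowerbound)
  have "((\<lambda>e. ennreal (unit_ball_vol (real (CARD('n) - 1)) * ((d + e) / 2) ^ (CARD('n) - 1))) \<longlongrightarrow>
      ennreal (unit_ball_vol (real (CARD('n) - 1)) * ((d + 0) / 2) ^ (CARD('n) - 1))) (at_right 0)"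
    by (intro tendsto_intros) auto
  then show "((\<lambda>e. ennreal (unit_ball_vol (real (CARD('n) - 1)) * ((d + e) / 2) ^ (CARD('n) - 1))) \<longlongrightarrow>
      ennreal (unit_ball_vol (real (CARD('n) - 1)) * (d / 2) ^ (CARD('n) - 1))) (at_right 0)"
    by (simp only: add_0_right)
  show "\<forall>\<^sub>F e in at_right 0. emeasure lborel X \<le> ennreal (unit_ball_vol (real (CARD('n) - 1)) * ((d + e) / 2) ^ (CARD('n) - 1))"
    unfolding eventually_at_right_field
  proof (intro exI[of _ 1] conjI allI impI)
    fix e :: real assume e: "e > 0"
    have "slab_body k (d + e) X" using X e unfolding slab_body_def by (smt (verit))
    then show "emeasure lborel X \<le> ennreal (unit_ball_vol (real (CARD('n) - 1)) * ((d + e) / 2) ^ (CARD('n) - 1))"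
      using d e by (intro emeasure_slab_body_le) auto
  qed simp
qed simp_all

text \<open>Every covering set, cut with the hyperplane and closed, is the base of a cylinder whose
  volume the isodiametric inequality bounds by exactly the Hausdorff weight. The bound holds for
  covers at any scale, so scale 1 suffices.\<close>

lemma plane_measure_le_hausdorff:
  fixes A :: "(real^'n) set"
  assumes A: "A \<in> sets borel" "A \<subseteq> {x. x $ k = 0}"
  shows "emeasure (plane_measure k) A \<le> hausdorff_outer (CARD('n) - 1) A"
proof -
  let ?m = "CARD('n) - 1"
  have "emeasure (plane_measure k) A \<le> hausdorff_pre ?m 1 A"
    unfolding hausdorff_pre_def
  proof (rule INF_greatest)
    fix C assume C: "C \<in> hausdorff_cover 1 A"
    define D where "D i = closure (C i \<inter> {x. x $ k = 0})" for i
    have bd: "bounded (C i)" for i using C by (auto simp: hausdorff_cover_def)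
    have cD: "compact (D i)" for i
      unfolding D_def using bounded_subset[OF bd[of i], of "C i \<inter> {x. x $ k = 0}"] by (simp add: compact_closure)
    have Dk: "x $ k = 0" if "x \<in> D i" for x i
    proof -
      have "closed {x::real^'n. x $ k = 0}" by (intro closed_Collect_eq continuous_intros)
      then have "D i \<subseteq> {x. x $ k = 0}" unfolding D_def by (intro closure_minimal) auto
      then show ?thesis using that by auto
    qed
    have diamD: "dist x y \<le> diameter (C i)" if "x \<in> D i" "y \<in> D i" for x y i
    proof -
      have "dist x y \<le> diameter (D i)" using that cD by (intro diameter_bounded_bound compact_imp_bounded)
      also have "\<dots> = diameter (C i \<inter> {x. x $ k = 0})"
        unfolding D_def using bounded_subset[OF bd, of "C i \<inter> {x. x $ k = 0}"] by (intro diameter_closure) auto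
      also have "\<dots> \<le> diameter (C i)" by (intro diameter_subset bd) auto
      finally show ?thesis .
    qed
    have flatD: "flat k x = x" if "x \<in> D i" for x i using Dk[OF that] by (simp add: vec_eq_iff)
    have slab: "slab_body k (diameter (C i)) (cyl k (D i))" for i
      unfolding slab_body_def
    proof (intro conjI ballI)
      have "cyl k (D i) = {x. flat k x \<in> D i} \<inter> {x. 0 \<le> x $ k} \<inter> {x. x $ k \<le> 1}" by (auto simp: cyl_def)
      also have "closed \<dots>"
        using closed_vimage[OF compact_imp_closed[OF cD[of i]], of "flat k"]
        by (intro closed_Int closed_Collect_le continuous_intros) (simp_all add: vimage_def continuous_intros)
      finally have 1: "closed (cyl k (D i))" .
      obtain B where B: "\<And>x. x \<in> D i \<Longrightarrow> norm x \<le> B"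
        using compact_imp_bounded[OF cD[of i]] unfolding bounded_iff by blast
      have "norm x \<le> B + 1" if "x \<in> cyl k (D i)" for x
        using norm_le_flat[of x k] B[of "flat k x"] that by (simp add: cyl_def)
      then have "bounded (cyl k (D i))" by (rule boundedI)
      with 1 show "compact (cyl k (D i))" by (simp add: compact_eq_bounded_closed)
      fix x assume x: "x \<in> cyl k (D i)"
      then show "0 \<le> x $ k" "x $ k \<le> 1" by (auto simp: cyl_def)
      fix y assume y: "y \<in> cyl k (D i)"
      have "flat k (x - y) = flat k x - flat k y" by (simp add: vec_eq_iff)
      then show "norm (flat k (x - y)) \<le> diameter (C i)"
        using diamD[of "flat k x" i "flat k y"] x y by (simp add: cyl_def dist_norm)
    qed
    have cov: "cyl k A \<subseteq> (\<Union>i. cyl k (D i))"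
    proof
      fix x assume x: "x \<in> cyl k A"
      then obtain i where "flat k x \<in> C i" using C by (auto simp: cyl_def hausdorff_cover_def)
      then have "flat k x \<in> D i" unfolding D_def using closure_subset by fastforce
      then show "x \<in> (\<Union>i. cyl k (D i))" using x by (auto simp: cyl_def)
    qed
    have Dm: "D i \<in> sets borel" for i using cD by (simp add: borel_compact)
    have "emeasure (plane_measure k) A = emeasure lborel (cyl k A)" by (rule emeasure_plane_measure[OF A(1)])
    also have "\<dots> \<le> emeasure lborel (\<Union>i. cyl k (D i))"
      using Dm by (intro emeasure_mono[OF cov]) auto
    also have "\<dots> \<le> (\<Sum>i. emeasure lborel (cyl k (D i)))"
      using Dm by (intro emeasure_subadditive_countably) auto
    also have "\<dots> \<le> (\<Sum>i. hausdorff_weight ?m (C i))"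
      unfolding hausdorff_weight_def
      by (intro suminf_le summableI emeasure_slab_body_le'[OF slab] diameter_ge_0 bd)
    finally show "emeasure (plane_measure k) A \<le> (\<Sum>i. hausdorff_weight ?m (C i))" .
  qed
  also have "\<dots> \<le> hausdorff_outer ?m A" by (rule hausdorff_pre_le_outer) simp
  finally show ?thesis .
qed

lemma hausdorff_outer_similarity:
  fixes f :: "'a::metric_space \<Rightarrow> 'b::metric_space"
  assumes m: "m \<ge> 1" and L: "L > 0" and sim: "\<And>x y. x \<in> A \<Longrightarrow> y \<in> A \<Longrightarrow> dist (f x) (f y) = L * dist x y"
  shows "hausdorff_outer m (f ` A) = ennreal (L ^ m) * hausdorff_outer m A"
proof (rule antisym)
  show "hausdorff_outer m (f ` A) \<le> ennreal (L ^ m) * hausdorff_outer m A"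
    using sim by (intro hausdorff_outer_lipschitz_image m L) simp
  have inj: "inj_on f A"
  proof (rule inj_onI)
    fix x y assume "x \<in> A" "y \<in> A" "f x = f y"
    then have "L * dist x y = 0" using sim[of x y] by simp
    then show "x = y" using L by simp
  qed
  define g where "g = inv_into A f"
  have g: "g (f x) = x" if "x \<in> A" for x using inj that by (simp add: g_def)
  have "hausdorff_outer m (g ` (f ` A)) \<le> ennreal ((1 / L) ^ m) * hausdorff_outer m (f ` A)"
  proof (rule hausdorff_outer_lipschitz_image[OF m])
    show "0 < 1 / L" using L by simp
    show "dist (g x) (g y) \<le> 1 / L * dist x y" if "x \<in> f ` A" "y \<in> f ` A" for x y
      using that g sim L by auto
  qed
  also have "g ` (f ` A) = A" using g by force
  finally have "ennreal (L ^ m) * hausdorff_outer m A \<le> ennreal (L ^ m) * (ennreal ((1 / L) ^ m) * hausdorff_outer m (f ` A))"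
    by (rule mult_left_mono) simp
  also have "\<dots> = hausdorff_outer m (f ` A)"
    using L by (simp add: mult.assoc[symmetric] ennreal_mult'[symmetric] power_divide)
  finally show "ennreal (L ^ m) * hausdorff_outer m A \<le> hausdorff_outer m (f ` A)" .
qed

definition plane_hausdorff :: "'n::finite \<Rightarrow> (real^'n) measure" where
  "plane_hausdorff k = density (hausdorff_measure (CARD('n) - 1)) (indicator {x. x $ k = 0})"

lemma sets_plane_hausdorff [simp, measurable_cong]: "sets (plane_hausdorff k) = sets borel"
  by (simp add: plane_hausdorff_def)

lemma coordinate_plane_measurable [measurable]: "{x::real^'n. x $ k = 0} \<in> sets borel"
  by (intro borel_closed closed_Collect_eq continuous_intros)

lemma emeasure_plane_hausdorff:
  fixes k :: "'n::finite"
  assumes n: "CARD('n) \<ge> 2" and A: "A \<in> sets borel"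
  shows "emeasure (plane_hausdorff k) A = hausdorff_outer (CARD('n) - 1) (A \<inter> {x. x $ k = 0})"
proof -
  have "emeasure (plane_hausdorff k) A = emeasure (hausdorff_measure (CARD('n) - 1)) ({x. x $ k = 0} \<inter> A)"
    unfolding plane_hausdorff_def using A coordinate_plane_measurable by (intro emeasure_restricted) auto
  also have "\<dots> = hausdorff_outer (CARD('n) - 1) ({x. x $ k = 0} \<inter> A)"
    using n A coordinate_plane_measurable by (intro emeasure_hausdorff_measure) auto
  finally show ?thesis by (simp add: Int_commute)
qed

lemma sigma_finite_plane_hausdorff:
  fixes k :: "'n::finite"
  assumes n: "CARD('n) \<ge> 2"
  shows "sigma_finite_measure (plane_hausdorff k)"
proof (rule sigma_finite_cballI)
  fix i :: nat
  let ?m = "CARD('n) - 1"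
  define R where "R = real i + 1"
  have R: "R > 0" by (simp add: R_def)
  define f where "f x = flat k ((2 * R) *\<^sub>R x - (\<chi> j. R))" for x
  have "cball 0 (real i) \<inter> {x::real^'n. x $ k = 0} \<subseteq> f ` unit_cube k"
  proof
    fix y :: "real^'n" assume y: "y \<in> cball 0 (real i) \<inter> {x. x $ k = 0}"
    define x where "x = flat k (\<chi> j. (y $ j + R) / (2 * R))"
    have "\<bar>y $ j\<bar> \<le> R" for j
      using component_le_norm_cart[of y j] y by (simp add: R_def)
    then have "0 \<le> y $ j + R \<and> y $ j + R \<le> 2 * R" for j by (simp add: abs_le_iff) (smt (verit))
    then have "0 \<le> (y $ j + R) / (2 * R) \<and> (y $ j + R) / (2 * R) \<le> 1" for j using R by simp
    then have "x \<in> unit_cube k" by (simp add: x_def unit_cube_def)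
    moreover have "f x = y"
      using y R by (simp add: f_def x_def vec_eq_iff)
    ultimately show "y \<in> f ` unit_cube k" by blast
  qed
  then have "hausdorff_outer ?m (cball 0 (real i) \<inter> {x::real^'n. x $ k = 0}) \<le> hausdorff_outer ?m (f ` unit_cube k)"
    by (rule hausdorff_outer_mono)
  also have "\<dots> \<le> ennreal ((2 * R) ^ ?m) * hausdorff_outer ?m (unit_cube k)"
  proof (rule hausdorff_outer_lipschitz_image)
    fix x y :: "real^'n"
    have "f x - f y = (2 * R) *\<^sub>R flat k (x - y)" by (simp add: f_def vec_eq_iff algebra_simps)
    then have "dist (f x) (f y) = 2 * R * norm (flat k (x - y))" using R by (simp add: dist_norm)
    also have "\<dots> \<le> 2 * R * norm (x - y)"
      using R by (intro mult_left_mono norm_le_componentwise_cart) auto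
    finally show "dist (f x) (f y) \<le> 2 * R * dist x y" by (simp add: dist_norm)
  qed (use n R in auto)
  also have "\<dots> < \<infinity>"
    using hausdorff_unit_cube_finite[OF n, of k] by (simp add: ennreal_mult_less_top)
  finally show "emeasure (plane_hausdorff k) (cball 0 (real i)) < \<infinity>"
    by (simp add: emeasure_plane_hausdorff[OF n])
qed simp

lemma plane_hausdorff_translation:
  fixes k :: "'n::finite"
  assumes n: "CARD('n) \<ge> 2" and v: "v $ k = 0" and A: "A \<in> sets borel"
  shows "emeasure (plane_hausdorff k) ((\<lambda>x. x + v) -` A) = emeasure (plane_hausdorff k) A"
proof -
  have 1: "(\<lambda>x. x + v) -` A \<in> sets borel" using measurable_sets[of "\<lambda>x. x + v" borel borel A] A by simp
  let ?X = "(\<lambda>x. x + v) -` A \<inter> {x. x $ k = 0}"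
  have "x \<in> (\<lambda>x. x + v) ` ?X" if "x \<in> A" "x $ k = 0" for x
    using that v by (intro image_eqI[of _ _ "x - v"]) auto
  then have "(\<lambda>x. x + v) ` ?X = A \<inter> {x. x $ k = 0}" using v by auto
  moreover have "hausdorff_outer (CARD('n) - 1) ((\<lambda>x. x + v) ` ?X) = ennreal (1 ^ (CARD('n) - 1)) * hausdorff_outer (CARD('n) - 1) ?X"
    using n by (intro hausdorff_outer_similarity) auto
  ultimately show ?thesis using 1 A n by (simp add: emeasure_plane_hausdorff)
qed

lemma emeasure_plane_unit_cube: "emeasure (plane_measure k) (unit_cube k) = 1"
proof -
  have cl: "closed (unit_cube k)"
    unfolding unit_cube_def
    by (intro closed_Collect_conj closed_Collect_eq closed_Collect_all closed_Collect_le continuous_intros)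
  have "cyl k (unit_cube k) = cbox 0 (\<chi> i. 1)"
    by (auto simp: cyl_def unit_cube_def mem_box_cart)
  moreover have "emeasure lborel (cbox 0 (\<chi> i. 1) :: (real^'a) set) = 1"
    by (subst emeasure_lborel_cbox) (auto simp: Basis_vec_def inner_axis intro!: prod.neutral)
  ultimately show ?thesis using cl by (simp add: emeasure_plane_measure borel_closed)
qed

lemma unit_cube_measurable [measurable]: "unit_cube k \<in> sets borel"
  unfolding unit_cube_def
  by (intro borel_closed closed_Collect_conj closed_Collect_eq closed_Collect_all closed_Collect_le continuous_intros)

lemma plane_hausdorff_proportional:
  fixes k :: "'n::finite"
  assumes n: "CARD('n) \<ge> 2" and A: "A \<in> sets borel"
  shows "emeasure (plane_hausdorff k) A = emeasure (plane_hausdorff k) (unit_cube k) * emeasure (plane_measure k) A"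
proof -
  have "emeasure (plane_hausdorff k) A * emeasure (plane_measure k) (unit_cube k) =
    emeasure (plane_hausdorff k) (unit_cube k) * emeasure (plane_measure k) A"
  proof (rule translation_invariant_measures_proportional[where V="{x. x $ k = 0}"])
    have "AE x in plane_hausdorff k. x $ k = 0"
      unfolding plane_hausdorff_def using coordinate_plane_measurable[of k]
      by (subst AE_density) (auto simp: indicator_def)
    then show "AE x in plane_hausdorff k. x \<in> {x. x $ k = 0}" "AE x in plane_measure k. x \<in> {x. x $ k = 0}"
      using AE_plane_measure[of k] by simp_all
  qed (simp_all add: sigma_finite_plane sigma_finite_plane_hausdorff plane_hausdorff_translation n
         plane_measure_translation plane_measure_reflection A unit_cube_measurable)
  then show ?thesis by (simp add: emeasure_plane_unit_cube)
qed

lemma grid_ball_props: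
  fixes k :: "'n::finite"
  assumes N: "N \<ge> 1" and n: "CARD('n) \<ge> 2"
  shows "f \<in> grid_index k N \<Longrightarrow> grid_ball k N f \<subseteq> unit_cube k"
    and "disjoint_family_on (grid_ball k N) (grid_index k N)"
    and "grid_ball k N f \<in> sets borel"
    and "bounded (grid_ball k N f)"
    and "diameter (grid_ball k N f) \<le> 1 / (2 * real N)"
    and "emeasure (plane_measure k) (grid_ball k N f) = ennreal (unit_ball_vol (real (CARD('n) - 1)) * (1 / (4 * real N)) ^ (CARD('n) - 1))"
proof -
  define c where "c f = (\<chi> i. if i = k then 0 else (real (f i) + 1/2) / real N)" for f
  have gb: "grid_ball k N f = {x. x $ k = 0 \<and> norm (x - c f) \<le> 1 / (4 * real N)}" for f
    by (simp add: grid_ball_def c_def)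
  have N0: "real N > 0" using N by simp
  have comp: "\<bar>x $ i - (real (f i) + 1/2) / real N\<bar> \<le> 1 / (4 * real N)" if "x \<in> grid_ball k N f" "i \<noteq> k" for x i f
    using component_le_norm_cart[of "x - c f" i] that by (simp add: gb c_def)
  show "grid_ball k N f \<subseteq> unit_cube k" if f: "f \<in> grid_index k N"
  proof
    fix x assume x: "x \<in> grid_ball k N f"
    have "0 \<le> x $ i \<and> x $ i \<le> 1" for i
    proof (cases "i = k")
      case False
      then have "f i < N" using f by (auto simp: grid_index_def)
      then have "real (f i) + 1 \<le> real N" by linarith
      moreover have "\<bar>x $ i * real N - (real (f i) + 1/2)\<bar> \<le> 1 / 4"
      proof -
        have "\<bar>x $ i * real N - (real (f i) + 1/2)\<bar> = \<bar>x $ i - (real (f i) + 1/2) / real N\<bar> * real N"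
          using N0 by (simp add: abs_mult_pos[symmetric] field_simps)
        also have "\<dots> \<le> 1 / (4 * real N) * real N" using comp[OF x False] N0 by (intro mult_right_mono) auto
        finally show ?thesis using N0 by simp
      qed
      ultimately have "0 \<le> x $ i * real N" "x $ i * real N \<le> 1 * real N"
        using of_nat_0_le_iff[of "f i", where 'a=real] unfolding abs_le_iff by linarith+
      then show ?thesis using N0 by (auto simp: zero_le_mult_iff)
    qed (use x in \<open>simp add: gb\<close>)
    then show "x \<in> unit_cube k" using x by (simp add: unit_cube_def gb)
  qed
  show "disjoint_family_on (grid_ball k N) (grid_index k N)"
    unfolding disjoint_family_on_def
  proof (intro ballI impI)
    fix f g assume fg: "f \<in> grid_index k N" "g \<in> grid_index k N" "f \<noteq> g"
    then obtain i where i: "i \<noteq> k" "f i \<noteq> g i" by (auto simp: grid_index_def dest: PiE_ext)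
    have False if x: "x \<in> grid_ball k N f" "x \<in> grid_ball k N g" for x
    proof -
      have "\<bar>(real (f i) + 1/2) / real N - (real (g i) + 1/2) / real N\<bar> \<le> 1 / (2 * real N)"
        using comp[OF x(1) i(1)] comp[OF x(2) i(1)] by (simp add: field_simps) 
      then have "\<bar>real (f i) - real (g i)\<bar> / real N \<le> (1/2) / real N"
        using N0 by (simp add: diff_divide_distrib[symmetric])
      then have "\<bar>real (f i) - real (g i)\<bar> \<le> 1/2" using mult_right_mono[of _ _ "real N"] N0 by fastforce
      then show False using i(2) by linarith
    qed
    then show "grid_ball k N f \<inter> grid_ball k N g = {}" by blast
  qed
  show m: "grid_ball k N f \<in> sets borel"
    unfolding gb by (intro borel_closed closed_Collect_conj closed_Collect_eq closed_Collect_le continuous_intros)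
  have d: "norm (x - y) \<le> 1 / (2 * real N)" if "x \<in> grid_ball k N f" "y \<in> grid_ball k N f" for x y
  proof -
    have "norm (x - y) \<le> norm (x - c f) + norm (y - c f)" using norm_triangle_ineq4[of "x - c f" "y - c f"] by simp
    then show ?thesis using that by (simp add: gb field_simps)
  qed
  then show "diameter (grid_ball k N f) \<le> 1 / (2 * real N)" using N0 by (intro diameter_le) auto
  show "bounded (grid_ball k N f)" unfolding bounded_two_points dist_norm using d by blast
  have ck: "(- c f) $ k = 0" by (simp add: c_def)
  have fl: "flat k x + c f = flat k (x + c f)" for x by (simp add: vec_eq_iff c_def)
  have B: "{x. norm (flat k x) \<le> 1 / (4 * real N)} \<in> sets borel" by (rule flat_ball_measurable)
  let ?T = "(\<lambda>x. x + (- c f)) -` {x. norm (flat k x) \<le> 1 / (4 * real N)}"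
  have T: "?T \<in> sets borel" using measurable_sets[of "\<lambda>x. x + (- c f)" borel borel, OF _ B] by simp
  have "cyl k (grid_ball k N f) = cyl k ?T"
  proof -
    have "flat k (flat k x + - c f) = flat k x - c f" for x by (simp add: vec_eq_iff c_def)
    then show ?thesis by (auto simp: cyl_def gb)
  qed
  then have "emeasure (plane_measure k) (grid_ball k N f) = emeasure (plane_measure k) ?T"
    using m T by (simp add: emeasure_plane_measure)
  also have "\<dots> = emeasure (plane_measure k) {x. norm (flat k x) \<le> 1 / (4 * real N)}"
    by (rule plane_measure_translation[OF ck B])
  also have "\<dots> = ennreal (unit_ball_vol (real (CARD('n) - 1)) * (1 / (4 * real N)) ^ (CARD('n) - 1))"
    using N0 by (intro emeasure_plane_ball) auto
  finally show "emeasure (plane_measure k) (grid_ball k N f) = \<dots>" .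
qed

text \<open>Let c be the proportionality constant. Small balls fill a fixed fraction t of the cube,
  and the sum of their Hausdorff weights is t as well; the remainder has Hausdorff measure c (1 -
  t). Covering both parts gives c \<le> t + c (1 - t), hence c \<le> 1. One packing at each scale
  takes the place of a Vitali covering.\<close>

lemma plane_hausdorff_unit_cube_le:
  fixes k :: "'n::finite"
  assumes n: "CARD('n) \<ge> 2"
  shows "emeasure (plane_hausdorff k) (unit_cube k) \<le> 1"
proof -
  let ?m = "CARD('n) - 1"
  let ?H = "emeasure (plane_hausdorff k)" and ?P = "emeasure (plane_measure k)"
  have m: "?m \<ge> 1" using n by simp
  define t where "t = unit_ball_vol (real ?m) * (1 / 4) ^ ?m"
  have t: "t > 0" by (simp add: t_def)
  have Hc: "?H (unit_cube k) = hausdorff_outer ?m (unit_cube k)"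
  proof -
    have "unit_cube k \<inter> {x. x $ k = 0} = unit_cube k" by (auto simp: unit_cube_def)
    then show ?thesis by (simp add: emeasure_plane_hausdorff[OF n])
  qed
  have fin: "?H (unit_cube k) < \<infinity>" unfolding Hc by (rule hausdorff_unit_cube_finite[OF n])
  then obtain c where c: "?H (unit_cube k) = ennreal c" "c \<ge> 0"
    by (cases "?H (unit_cube k)") auto
  have main: "hausdorff_pre ?m d (unit_cube k) \<le> ennreal (t + c * (1 - t)) \<and> t \<le> 1" if d: "d > 0" for d
  proof -
    obtain N :: nat where N: "1 / d < real N" using reals_Archimedean2 by blast
    have "0 < 1 / d" using d by simp
    then have "real N > 0" using N by linarith
    then have N0: "N \<ge> 1" "real N > 0" by auto
    have Nd: "1 / (2 * real N) \<le> d"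
    proof -
      have "1 \<le> d * real N" using N d by (simp add: field_simps)
      also have "\<dots> \<le> d * (2 * real N)" using d N0 by (intro mult_left_mono) auto
      finally have "1 \<le> d * (2 * real N)" .
      then show ?thesis using N0 by (simp add: divide_le_eq)
    qed
    note gp = grid_ball_props[where k=k, OF N0(1) n]
    let ?U = "\<Union>f\<in>grid_index k N. grid_ball k N f"
    have U: "?U \<in> sets borel" using gp(3) finite_grid_index by blast
    have Usub: "?U \<subseteq> unit_cube k" using gp(1) by blast
    let ?r = "unit_ball_vol (real ?m) * (1 / (4 * real N)) ^ ?m"
    have r: "real N ^ ?m * ?r = t" using N0 by (simp add: t_def power_divide power_mult_distrib)
    have sumr: "(\<Sum>f\<in>grid_index k N. ennreal ?r) = ennreal t"
    proof -
      have "(\<Sum>f\<in>grid_index k N. ennreal ?r) = ennreal (\<Sum>f\<in>grid_index k N. ?r)"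
        by (rule sum_ennreal) simp
      also have "(\<Sum>f\<in>grid_index k N. ?r) = t" using r by (simp add: card_grid_index)
      finally show ?thesis .
    qed
    have PU: "?P ?U = ennreal t"
    proof -
      have "?P ?U = (\<Sum>f\<in>grid_index k N. ?P (grid_ball k N f))"
        using gp(2,3) finite_grid_index by (intro sum_emeasure[symmetric]) auto
      also have "\<dots> = (\<Sum>f\<in>grid_index k N. ennreal ?r)" by (rule sum.cong[OF refl gp(6)])
      finally show ?thesis using sumr by simp
    qed
    have t1: "t \<le> 1"
    proof -
      have "?P ?U \<le> ?P (unit_cube k)" by (intro emeasure_mono Usub) simp
      then show ?thesis by (simp add: PU emeasure_plane_unit_cube)
    qed
    have PD: "?P (unit_cube k - ?U) = ennreal (1 - t)"
    proof -
      have "?P (unit_cube k - ?U) = ?P (unit_cube k) - ?P ?U"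
        using U Usub PU by (intro emeasure_Diff) auto
      then show ?thesis using t by (simp add: PU emeasure_plane_unit_cube ennreal_minus ennreal_1[symmetric] del: ennreal_1)
    qed
    have HD: "hausdorff_outer ?m (unit_cube k - ?U) = ennreal (c * (1 - t))"
    proof -
      have eq: "(unit_cube k - ?U) \<inter> {x. x $ k = 0} = unit_cube k - ?U" by (auto simp: unit_cube_def)
      have D: "unit_cube k - ?U \<in> sets borel" using U by simp
      have "hausdorff_outer ?m (unit_cube k - ?U) = ?H (unit_cube k - ?U)"
        using emeasure_plane_hausdorff[OF n D, of k] unfolding eq by simp
      also have "\<dots> = ?H (unit_cube k) * ?P (unit_cube k - ?U)"
        by (rule plane_hausdorff_proportional[OF n D])
      also have "\<dots> = ennreal (c * (1 - t))" using c t1 by (simp add: PD ennreal_mult)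
      finally show ?thesis .
    qed
    have "hausdorff_pre ?m d (unit_cube k) \<le> hausdorff_pre ?m d (?U \<union> (unit_cube k - ?U))"
      by (rule hausdorff_pre_mono) auto
    also have "\<dots> \<le> hausdorff_pre ?m d ?U + hausdorff_pre ?m d (unit_cube k - ?U)"
      by (rule hausdorff_pre_Un_le[OF m d])
    also have "\<dots> \<le> (\<Sum>f\<in>grid_index k N. hausdorff_weight ?m (grid_ball k N f)) + hausdorff_outer ?m (unit_cube k - ?U)"
    proof (intro add_mono hausdorff_pre_le_outer[OF d] hausdorff_pre_finite_cover[OF m d finite_grid_index] conjI gp(4))
      show "diameter (grid_ball k N f) \<le> d" for f using gp(5) Nd by (rule order_trans)
    qed
    also have "\<dots> \<le> (\<Sum>f\<in>grid_index k N. ennreal ?r) + hausdorff_outer ?m (unit_cube k - ?U)"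
    proof (intro add_right_mono sum_mono)
      fix f
      have "diameter (grid_ball k N f) / 2 \<le> 1 / (4 * real N)"
        using gp(5)[of f] by simp
      moreover have "0 \<le> diameter (grid_ball k N f)" by (rule diameter_ge_0[OF gp(4)])
      ultimately show "hausdorff_weight ?m (grid_ball k N f) \<le> ennreal ?r"
        unfolding hausdorff_weight_def by (intro ennreal_leI mult_left_mono power_mono) auto
    qed
    also have "\<dots> = ennreal (t + c * (1 - t))"
      unfolding sumr HD using t t1 c by (simp add: ennreal_plus)
    finally show ?thesis using t1 by simp
  qed
  then have t1: "t \<le> 1" using zero_less_one by blast
  have "ennreal c \<le> ennreal (t + c * (1 - t))"
    unfolding c(1)[symmetric] Hc using main by (intro hausdorff_outer_leI) blast
  then have "c \<le> t + c * (1 - t)"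
    using t t1 c by (subst (asm) ennreal_le_iff) auto
  then have "c * t \<le> 1 * t" by (simp only: right_diff_distrib mult_1_right mult_1_left)
  then have "c \<le> 1" using t by simp
  then show ?thesis unfolding c(1) by simp
qed

lemma plane_hausdorff_eq:
  fixes k :: "'n::finite"
  assumes n: "CARD('n) \<ge> 2" and A: "A \<in> sets borel"
  shows "emeasure (plane_hausdorff k) A = emeasure (plane_measure k) A"
proof -
  have "unit_cube k \<inter> {x. x $ k = 0} = unit_cube k" by (auto simp: unit_cube_def)
  then have "1 \<le> emeasure (plane_hausdorff k) (unit_cube k)"
    using plane_measure_le_hausdorff[of "unit_cube k" k] emeasure_plane_unit_cube[of k]
    by (simp add: emeasure_plane_hausdorff[OF n] Int_absorb2[symmetric]) (auto simp: unit_cube_def)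
  then have "emeasure (plane_hausdorff k) (unit_cube k) = 1"
    using plane_hausdorff_unit_cube_le[OF n, of k] by (rule antisym[rotated])
  then show ?thesis using plane_hausdorff_proportional[OF n A, of k] by simp
qed

text \<open>The rule that n times the volume of a cone is its height times its base. The map
  \<open>g\<close>, h times an orthogonal map, carries the plane \<open>x $ k = 1\<close> to the
  given hyperplane; it scales volume by h^n and Hausdorff measure by h^(n-1), which leaves one
  factor h.\<close>

theorem hausdorff_hyperplane:
  fixes B :: "(real^'n) set"
  assumes n: "CARD('n) \<ge> 2" and u: "norm u = 1" and h: "h > 0" and B: "B \<in> sets borel" "B \<subseteq> {x. u \<bullet> x = h}"
  shows "ennreal (real CARD('n)) * emeasure lborel {x. 0 < u \<bullet> x \<and> u \<bullet> x \<le> h \<and> (h / (u \<bullet> x)) *\<^sub>R x \<in> B} =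
    ennreal h * hausdorff_outer (CARD('n) - 1) B"
proof -
  obtain k :: 'n where True by simp
  let ?m = "CARD('n) - 1"
  have "norm (axis k 1 :: real^'n) = norm u" using u by simp
  then obtain f :: "real^'n \<Rightarrow> real^'n" where f: "orthogonal_transformation f" "f (axis k 1) = u"
    using orthogonal_transformation_exists by blast
  have lf: "linear f" using f(1) by (simp add: orthogonal_transformation_linear)
  have inner: "u \<bullet> f x = x $ k" for x :: "real^'n"
    using f inner_axis'[of k 1 x] unfolding orthogonal_transformation_def by (metis real_inner_1_left)
  have nf: "norm (f x) = norm x" for x using f(1) by (simp add: orthogonal_transformation)
  define g where "g w = h *\<^sub>R f w" for w :: "real^'n"
  have lg: "linear g" unfolding g_def by (rule linear_compose_scale_right[OF lf])
  have [measurable]: "g \<in> borel \<rightarrow>\<^sub>M borel" by (rule measurable_linear_cart[OF lg])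
  define A where "A = {w. w $ k = 0 \<and> g (axis k 1 + w) \<in> B}"
  have A: "A \<in> sets borel"
  proof -
    have "(\<lambda>w. g (axis k 1 + w)) -` B \<inter> space borel \<in> sets borel"
      by (rule measurable_sets[OF _ B(1)]) measurable
    then show ?thesis unfolding A_def
      using sets.Int[OF coordinate_plane_measurable[of k]] by (simp add: Collect_conj_eq vimage_def)
  qed
  have surj: "surj f" using f(1) by (simp add: orthogonal_transformation_surj)
  have im: "(\<lambda>w. g (axis k 1 + w)) ` A = B"
  proof (intro set_eqI iffI)
    fix b assume b: "b \<in> B"
    obtain z where z: "f z = (1 / h) *\<^sub>R b" using surj by (metis surjD)
    then have gz: "g z = b" using h by (simp add: g_def)
    have "z $ k = u \<bullet> ((1 / h) *\<^sub>R b)" using inner[of z] z by simp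
    also have "\<dots> = 1" using b B h by auto
    finally have "z - axis k 1 \<in> A" using gz b by (simp add: A_def)
    then show "b \<in> (\<lambda>w. g (axis k 1 + w)) ` A" using gz by (intro image_eqI[of _ _ "z - axis k 1"]) auto
  qed (auto simp: A_def)
  have Hh: "hausdorff_outer ?m B = ennreal (h ^ ?m) * hausdorff_outer ?m A"
    unfolding im[symmetric]
  proof (rule hausdorff_outer_similarity)
    fix x y :: "real^'n"
    have "g (axis k 1 + x) - g (axis k 1 + y) = h *\<^sub>R f (x - y)"
      using lf by (simp add: g_def linear_add linear_diff algebra_simps)
    then show "dist (g (axis k 1 + x)) (g (axis k 1 + y)) = h * dist x y"
      using h by (simp add: dist_norm nf)
  qed (use n h in auto)
  let ?C = "{x. 0 < u \<bullet> x \<and> u \<bullet> x \<le> h \<and> (h / (u \<bullet> x)) *\<^sub>R x \<in> B}"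
  have C: "?C \<in> sets borel" using B(1) by measurable
  have "matrix g = (\<chi> i. h *s (matrix f $ i))"
    by (simp add: vec_eq_iff matrix_component g_def)
  then have "det (matrix g) = h ^ CARD('n) * det (matrix f)"
    by (simp add: det_rows_mul)
  moreover have "\<bar>det (matrix f)\<bar> = 1" using f(1) by simp
  ultimately have dg: "\<bar>det (matrix g)\<bar> = h ^ CARD('n)" using h by (simp add: abs_mult)
  have vim: "g -` ?C = {x. 0 < x $ k \<and> x $ k \<le> 1 \<and> flat k (x /\<^sub>R x $ k) \<in> A}"
  proof -
    have "(h / (u \<bullet> g x)) *\<^sub>R g x \<in> B \<longleftrightarrow> flat k (x /\<^sub>R x $ k) \<in> A" if "x $ k > 0" for x
    proof -
      have "axis k 1 + flat k (x /\<^sub>R x $ k) = (1 / x $ k) *\<^sub>R x"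
        using that by (simp add: vec_eq_iff axis_def divide_inverse)
      then have "g (axis k 1 + flat k (x /\<^sub>R x $ k)) = (h / (u \<bullet> g x)) *\<^sub>R g x"
        using h that lf by (simp add: g_def inner linear_scale)
      then show ?thesis by (simp add: A_def)
    qed
    then show ?thesis using h by (auto simp: g_def inner zero_less_mult_iff)
  qed
  have d0: "det (matrix g) \<noteq> 0" using dg h by auto
  have E: "emeasure lborel ?C = ennreal (h ^ CARD('n)) * emeasure (cone_measure k) A"
    using emeasure_lborel_linear_vimage[OF lg d0 C] unfolding dg vim emeasure_cone_measure[OF A] .
  have "ennreal (real CARD('n)) * emeasure lborel ?C = ennreal (h ^ CARD('n)) * (ennreal (real CARD('n)) * emeasure (cone_measure k) A)"
    unfolding E by (rule mult.left_commute)
  also have "ennreal (real CARD('n)) * emeasure (cone_measure k) A = hausdorff_outer ?m A"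
  proof -
    have "A \<inter> {x. x $ k = 0} = A" by (auto simp: A_def)
    then show ?thesis
      using emeasure_plane_hausdorff[OF n A, of k] unfolding cone_measure_eq[OF A] plane_hausdorff_eq[OF n A, symmetric] by (simp only:)
  qed
  also have "ennreal (h ^ CARD('n)) = ennreal h * ennreal (h ^ ?m)"
  proof -
    have "h ^ CARD('n) = h * h ^ ?m" using n by (cases "CARD('n)") auto
    then show ?thesis using h by (simp add: ennreal_mult)
  qed
  finally show ?thesis unfolding Hh by (simp only: mult.assoc)
qed

section \<open>Support function, gauge and duality map\<close>

definition supp :: "'a::euclidean_space set \<Rightarrow> 'a \<Rightarrow> real" where
  "supp A x = Sup ((\<lambda>a. x \<bullet> a) ` A)"

lemma polar_body_closed: "closed (polar_body K)"
proof -
  have "polar_body K = (\<Inter>x\<in>K. {y. x \<bullet> y \<le> 1})" by (auto simp: polar_body_def)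
  then show ?thesis by (auto intro!: closed_INT closed_Collect_le continuous_intros)
qed

lemma polar_body_convex: "convex (polar_body K)"
  unfolding polar_body_def convex_def
proof (intro ballI allI impI, clarsimp simp: inner_add_right)
  fix x y z and u v :: real
  assume a: "\<forall>w\<in>K. w \<bullet> x \<le> 1" "\<forall>w\<in>K. w \<bullet> y \<le> 1" "0 \<le> u" "0 \<le> v" "u + v = 1" "z \<in> K"
  have "u * (z \<bullet> x) \<le> u" "v * (z \<bullet> y) \<le> v" using a by (auto simp: mult_left_le)
  then show "u * (z \<bullet> x) + v * (z \<bullet> y) \<le> 1" using a(5) by linarith
qed

locale conv_body =
  fixes K :: "'a::euclidean_space set"
  assumes compact_K: "compact K" and convex_K: "convex K" and int0: "0 \<in> interior K"
begin

lemma zero_in: "0 \<in> K" using int0 interior_subset by blast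

lemma inner_ball: obtains r where "r > 0" "cball 0 r \<subseteq> K"
  using int0 by (auto simp: mem_interior_cball)

lemma outer_ball: obtains R where "R > 0" "K \<subseteq> cball 0 R"
  using compact_imp_bounded[OF compact_K] unfolding bounded_pos by (auto simp: subset_iff)

lemma inner_image_compact: "compact ((\<lambda>a. x \<bullet> a) ` K)"
  by (intro compact_continuous_image continuous_intros compact_K)

lemma supp_attained: obtains a where "a \<in> K" "x \<bullet> a = supp K x"
proof -
  have "Sup ((\<lambda>a. x \<bullet> a) ` K) \<in> (\<lambda>a. x \<bullet> a) ` K"
    using inner_image_compact[of x] zero_in
    by (intro closed_contains_Sup bounded_imp_bdd_above compact_imp_bounded compact_imp_closed) auto
  then show ?thesis using that unfolding supp_def by auto
qed

lemma supp_upper: "a \<in> K \<Longrightarrow> x \<bullet> a \<le> supp K x"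
  unfolding supp_def
  by (rule cSup_upper) (auto intro!: bounded_imp_bdd_above compact_imp_bounded inner_image_compact)

lemma supp_le: "(\<And>a. a \<in> K \<Longrightarrow> x \<bullet> a \<le> c) \<Longrightarrow> supp K x \<le> c"
  using supp_attained[of x] by metis

lemma supp_scale: "c \<ge> 0 \<Longrightarrow> supp K (c *\<^sub>R x) = c * supp K x"
proof (rule antisym)
  assume c: "c \<ge> 0"
  show "supp K (c *\<^sub>R x) \<le> c * supp K x"
    using c by (intro supp_le) (simp add: mult_left_mono supp_upper)
  obtain a where "a \<in> K" "x \<bullet> a = supp K x" by (rule supp_attained)
  then show "c * supp K x \<le> supp K (c *\<^sub>R x)" using supp_upper[of a "c *\<^sub>R x"] by simp
qed

lemma supp_triangle: "supp K (x + y) \<le> supp K x + supp K y"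
  by (intro supp_le) (simp add: inner_add_left add_mono supp_upper)

lemma supp_zero [simp]: "supp K 0 = 0"
  using supp_scale[of 0 0] by simp

lemma supp_pos: "x \<noteq> 0 \<Longrightarrow> supp K x > 0"
proof -
  assume x: "x \<noteq> 0"
  obtain r where r: "r > 0" "cball 0 r \<subseteq> K" by (rule inner_ball)
  have "(r / norm x) *\<^sub>R x \<in> K" using r x by (intro subsetD[OF r(2)]) simp
  from supp_upper[OF this, of x] have "r * norm x \<le> supp K x"
    using x by (simp add: power2_norm_eq_inner[symmetric] power2_eq_square)
  moreover have "r * norm x > 0" using r x by simp
  ultimately show ?thesis by linarith
qed

lemma supp_nonneg: "supp K x \<ge> 0"
  using supp_upper[OF zero_in, of x] by simp

lemma supp_lipschitz: obtains R where "R > 0" "\<And>x y. \<bar>supp K x - supp K y\<bar> \<le> R * norm (x - y)"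
proof -
  obtain R where R: "R > 0" "K \<subseteq> cball 0 R" by (rule outer_ball)
  have *: "supp K x - supp K y \<le> R * norm (x - y)" for x y
  proof -
    obtain a where a: "a \<in> K" "x \<bullet> a = supp K x" by (rule supp_attained)
    have "supp K x - supp K y \<le> (x - y) \<bullet> a" using a supp_upper[of a y] by (simp add: inner_diff_left)
    also have "\<dots> \<le> norm (x - y) * norm a" by (rule norm_cauchy_schwarz)
    also have "\<dots> \<le> norm (x - y) * R" using a R by (intro mult_left_mono) auto
    finally show ?thesis by (simp add: mult.commute)
  qed
  show ?thesis
  proof (rule that[OF R(1)])
    fix x y show "\<bar>supp K x - supp K y\<bar> \<le> R * norm (x - y)"
      using *[of x y] *[of y x] by (simp add: abs_le_iff norm_minus_commute)
  qed
qed

lemma supp_continuous: "continuous_on UNIV (supp K)"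
proof -
  obtain R where R: "R > 0" "\<And>x y. \<bar>supp K x - supp K y\<bar> \<le> R * norm (x - y)" by (rule supp_lipschitz) blast
  have "R-lipschitz_on UNIV (supp K)"
    using R by (intro lipschitz_onI) (auto simp: dist_norm)
  then show ?thesis by (rule lipschitz_on_continuous_on)
qed

lemma continuous_on_supp [continuous_intros]: "continuous_on S f \<Longrightarrow> continuous_on S (\<lambda>x. supp K (f x))"
  using continuous_on_compose2[OF supp_continuous] by blast

lemma polar_iff_supp: "y \<in> polar_body K \<longleftrightarrow> supp K y \<le> 1"
proof
  assume "y \<in> polar_body K"
  then show "supp K y \<le> 1" by (intro supp_le) (auto simp: polar_body_def inner_commute)
next
  assume "supp K y \<le> 1"
  then show "y \<in> polar_body K" using supp_upper[of _ y] by (force simp: polar_body_def inner_commute)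
qed

lemma conv_body_polar: "conv_body (polar_body K)"
proof
  obtain r where r: "r > 0" "cball 0 r \<subseteq> K" by (rule inner_ball)
  have "norm y \<le> 1 / r" if y: "y \<in> polar_body K" for y
  proof (cases "y = 0")
    case False
    have "(r / norm y) *\<^sub>R y \<in> K" using r False by (intro subsetD[OF r(2)]) simp
    then have "(r / norm y) *\<^sub>R y \<bullet> y \<le> 1" using y by (auto simp: polar_body_def)
    then show ?thesis using False r by (simp add: power2_norm_eq_inner[symmetric] power2_eq_square field_simps)
  qed (use r in simp)
  then have "bounded (polar_body K)" by (rule boundedI)
  then show "compact (polar_body K)" using polar_body_closed compact_eq_bounded_closed by blast
  show "convex (polar_body K)" by (rule polar_body_convex)
  obtain R where R: "R > 0" "K \<subseteq> cball 0 R" by (rule outer_ball)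
  have "cball 0 (1 / R) \<subseteq> polar_body K"
  proof
    fix y :: 'a assume y: "y \<in> cball 0 (1 / R)"
    have "x \<bullet> y \<le> 1" if "x \<in> K" for x
    proof -
      have "x \<bullet> y \<le> norm x * norm y" by (rule norm_cauchy_schwarz)
      also have "\<dots> \<le> R * (1 / R)" using that R y by (intro mult_mono) auto
      finally show ?thesis using R by simp
    qed
    then show "y \<in> polar_body K" by (simp add: polar_body_def)
  qed
  then show "0 \<in> interior (polar_body K)" using R by (auto simp: mem_interior_cball intro!: exI[of _ "1 / R"])
qed

lemma bipolar: "polar_body (polar_body K) = K"
proof
  show "K \<subseteq> polar_body (polar_body K)" by (auto simp: polar_body_def inner_commute)
  show "polar_body (polar_body K) \<subseteq> K"
  proof (rule ccontr)
    assume "\<not> ?thesis"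
    then obtain z where z: "z \<in> polar_body (polar_body K)" "z \<notin> K" by blast
    obtain a b where ab: "a \<bullet> z < b" "\<And>x. x \<in> K \<Longrightarrow> a \<bullet> x > b"
      using separating_hyperplane_closed_point[OF convex_K compact_imp_closed[OF compact_K] z(2)] by blast
    have b: "b < 0" using ab(2)[OF zero_in] by simp
    have "(1 / b) *\<^sub>R a \<in> polar_body K"
      using ab(2) b by (force simp: polar_body_def inner_commute divide_simps)
    then have "((1 / b) *\<^sub>R a) \<bullet> z \<le> 1" using z(1) unfolding polar_body_def by blast
    moreover have "a \<bullet> z / b > 1" using ab(1) b by (simp add: less_divide_eq)
    ultimately show False by simp
  qed
qed

text \<open>The gauge is written as the support function of the polar body, so that everything
  proved for support functions applies to it by interpreting the locale at the polar.\<close>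

abbreviation gauge_fn :: "'a \<Rightarrow> real" where "gauge_fn \<equiv> supp (polar_body K)"

interpretation P: conv_body "polar_body K" by (rule conv_body_polar)

lemma mem_iff_gauge: "x \<in> K \<longleftrightarrow> gauge_fn x \<le> 1"
  using P.polar_iff_supp[of x] bipolar by simp

lemma gauge_scale: "c \<ge> 0 \<Longrightarrow> gauge_fn (c *\<^sub>R x) = c * gauge_fn x"
  by (rule P.supp_scale)

lemma gauge_pos: "x \<noteq> 0 \<Longrightarrow> gauge_fn x > 0"
  by (rule P.supp_pos)

lemma gauge_zero [simp]: "gauge_fn 0 = 0"
  by (rule P.supp_zero)

lemma gauge_nonneg: "gauge_fn x \<ge> 0"
  by (rule P.supp_nonneg)

lemma gauge_triangle: "gauge_fn (x + y) \<le> gauge_fn x + gauge_fn y"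
  by (rule P.supp_triangle)

lemma gauge_continuous: "continuous_on UNIV gauge_fn"
  by (rule P.supp_continuous)

lemma continuous_on_gauge [continuous_intros]: "continuous_on S f \<Longrightarrow> continuous_on S (\<lambda>x. gauge_fn (f x))"
  by (rule P.continuous_on_supp)

lemma inner_le_gauge: "y \<in> polar_body K \<Longrightarrow> x \<bullet> y \<le> gauge_fn x"
  by (rule P.supp_upper)

lemma gauge_attained: obtains y where "y \<in> polar_body K" "x \<bullet> y = gauge_fn x"
  by (rule P.supp_attained)

lemma interior_iff_gauge: "x \<in> interior K \<longleftrightarrow> gauge_fn x < 1"
proof
  assume x: "x \<in> interior K"
  show "gauge_fn x < 1"
  proof (cases "x = 0")
    case False
    obtain e where e: "e > 0" "cball x e \<subseteq> K" using x by (auto simp: mem_interior_cball)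
    have "x + (e / norm x) *\<^sub>R x \<in> K" using e False by (intro subsetD[OF e(2)]) (simp add: dist_norm)
    also have "x + (e / norm x) *\<^sub>R x = (1 + e / norm x) *\<^sub>R x" by (simp add: algebra_simps)
    finally have "(1 + e / norm x) * gauge_fn x \<le> 1"
      unfolding mem_iff_gauge using e by (subst (asm) gauge_scale) auto
    moreover have "e / norm x * gauge_fn x > 0" using e False gauge_pos by simp
    ultimately show ?thesis by (simp add: algebra_simps)
  qed simp
next
  assume "gauge_fn x < 1"
  moreover have "open {x. gauge_fn x < 1}" by (intro open_Collect_less continuous_intros)
  ultimately show "x \<in> interior K"
    by (intro interiorI[of "{x. gauge_fn x < 1}"]) (auto simp: mem_iff_gauge)
qed

lemma frontier_iff_gauge: "x \<in> frontier K \<longleftrightarrow> gauge_fn x = 1"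
  using compact_imp_closed[OF compact_K]
  by (auto simp: frontier_def interior_iff_gauge mem_iff_gauge)

lemma compact_frontier_K: "compact (frontier K)"
  using compact_K by (rule compact_frontier)

lemma frontier_nonzero: "x \<in> frontier K \<Longrightarrow> x \<noteq> 0"
  by (auto simp: frontier_iff_gauge)

lemma normalized_in_frontier: "x \<noteq> 0 \<Longrightarrow> x /\<^sub>R gauge_fn x \<in> frontier K"
  using gauge_pos[of x] by (simp add: frontier_iff_gauge gauge_scale)

end

text \<open>Smoothness of the boundary in a form without derivatives: the supporting hyperplane at
  each boundary point is unique. The same form can later be checked directly for the polar
  body.\<close>

locale smooth_body = conv_body K for K :: "'a::euclidean_space set" +
  assumes dual_unique: "\<lbrakk>x \<in> frontier K; y \<in> polar_body K; y' \<in> polar_body K; x \<bullet> y = 1; x \<bullet> y' = 1\<rbrakk> \<Longrightarrow> y = y'"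
begin

interpretation P: conv_body "polar_body K" by (rule conv_body_polar)

text \<open>The gradient of half the squared gauge; on the boundary it is the outer normal divided by the support distance.\<close>

definition dual_pt :: "'a \<Rightarrow> 'a" where
  "dual_pt x = (if x = 0 then 0 else gauge_fn x *\<^sub>R (THE y. y \<in> polar_body K \<and> x \<bullet> y = gauge_fn x))"

lemma dual_pt_zero [simp]: "dual_pt 0 = 0" by (simp add: dual_pt_def)

lemma dual_ex1:
  assumes "x \<noteq> 0" shows "\<exists>!y. y \<in> polar_body K \<and> x \<bullet> y = gauge_fn x"
proof (rule ex_ex1I)
  show "\<exists>y. y \<in> polar_body K \<and> x \<bullet> y = gauge_fn x" using gauge_attained by metis
  fix y y' assume *: "y \<in> polar_body K \<and> x \<bullet> y = gauge_fn x" "y' \<in> polar_body K \<and> x \<bullet> y' = gauge_fn x"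
  show "y = y'"
  proof (rule dual_unique[OF normalized_in_frontier[OF assms]])
    show "(x /\<^sub>R gauge_fn x) \<bullet> y = 1" "(x /\<^sub>R gauge_fn x) \<bullet> y' = 1" using * gauge_pos[OF assms] by simp_all
  qed (use * in simp_all)
qed

lemma dual_pt:
  assumes "x \<noteq> 0"
  shows "dual_pt x /\<^sub>R gauge_fn x \<in> polar_body K" "x \<bullet> dual_pt x = (gauge_fn x)\<^sup>2"
    "\<And>z. z \<bullet> dual_pt x \<le> gauge_fn z * gauge_fn x"
    and dual_pt_eqI: "\<And>y. y \<in> polar_body K \<Longrightarrow> x \<bullet> y = gauge_fn x \<Longrightarrow> dual_pt x = gauge_fn x *\<^sub>R y"
proof -
  define y where "y = (THE y. y \<in> polar_body K \<and> x \<bullet> y = gauge_fn x)"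
  have y: "y \<in> polar_body K" "x \<bullet> y = gauge_fn x" using theI'[OF dual_ex1[OF assms]] by (auto simp: y_def)
  have d: "dual_pt x = gauge_fn x *\<^sub>R y" using assms by (simp add: dual_pt_def y_def)
  have gp: "gauge_fn x > 0" by (rule gauge_pos[OF assms])
  show "dual_pt x /\<^sub>R gauge_fn x \<in> polar_body K" using gp y by (simp add: d)
  show "x \<bullet> dual_pt x = (gauge_fn x)\<^sup>2" using y by (simp add: d power2_eq_square)
  show "z \<bullet> dual_pt x \<le> gauge_fn z * gauge_fn x" for z
    using gp mult_left_mono[OF inner_le_gauge[OF y(1), of z], of "gauge_fn x"] by (simp add: d mult.commute)
  show "dual_pt x = gauge_fn x *\<^sub>R y'" if "y' \<in> polar_body K" "x \<bullet> y' = gauge_fn x" for y'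
  proof -
    have "y' = y" by (rule ex1E[OF dual_ex1[OF assms]]) (use y that in metis)
    then show ?thesis by (simp add: d)
  qed
qed

lemma dual_pt_scale: "c > 0 \<Longrightarrow> dual_pt (c *\<^sub>R x) = c *\<^sub>R dual_pt x"
proof (cases "x = 0")
  case False
  assume c: "c > 0"
  have gp: "gauge_fn x > 0" by (rule gauge_pos[OF False])
  have "(c *\<^sub>R x) \<bullet> (dual_pt x /\<^sub>R gauge_fn x) = gauge_fn (c *\<^sub>R x)"
    using gp c by (simp add: gauge_scale dual_pt(2)[OF False] power2_eq_square)
  then have "dual_pt (c *\<^sub>R x) = gauge_fn (c *\<^sub>R x) *\<^sub>R (dual_pt x /\<^sub>R gauge_fn x)"
    using False c dual_pt(1)[OF False] by (intro dual_pt_eqI) auto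
  then show ?thesis using c gauge_pos[OF False] by (simp add: gauge_scale)
qed simp

lemma supp_dual_pt: "supp K (dual_pt x) = gauge_fn x"
proof (cases "x = 0")
  case False
  have gp: "gauge_fn x > 0" by (rule gauge_pos[OF False])
  show ?thesis
  proof (rule antisym)
    show "supp K (dual_pt x) \<le> gauge_fn x"
    proof (rule supp_le)
      fix a assume "a \<in> K"
      then have "gauge_fn a \<le> 1" by (simp add: mem_iff_gauge)
      then have "gauge_fn a * gauge_fn x \<le> gauge_fn x" using gp by simp
      then show "dual_pt x \<bullet> a \<le> gauge_fn x" using dual_pt(3)[OF False, of a] by (simp add: inner_commute)
    qed
    have "x /\<^sub>R gauge_fn x \<in> K" using normalized_in_frontier[OF False] frontier_iff_gauge mem_iff_gauge by force
    from supp_upper[OF this, of "dual_pt x"] show "gauge_fn x \<le> supp K (dual_pt x)"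
      using gp dual_pt(2)[OF False] by (simp add: inner_commute power2_eq_square mult.assoc[symmetric])
  qed
qed (simp add: conv_body.supp_zero[OF conv_body_axioms])

lemma dual_pt_frontier:
  assumes "x \<in> frontier K"
  shows "dual_pt x \<in> polar_body K" "x \<bullet> dual_pt x = 1" "\<And>z. z \<bullet> dual_pt x \<le> gauge_fn z"
  using dual_pt(1)[OF frontier_nonzero[OF assms]] dual_pt(2)[OF frontier_nonzero[OF assms]]
    dual_pt(3)[OF frontier_nonzero[OF assms]] assms by (simp_all add: frontier_iff_gauge)

lemma dual_pt_nonzero: "x \<noteq> 0 \<Longrightarrow> dual_pt x \<noteq> 0"
  using dual_pt(2)[of x] gauge_pos[of x] by auto

lemma outer_normal_eq:
  assumes x: "x \<in> frontier K"
  shows "outer_normal K x = dual_pt x /\<^sub>R norm (dual_pt x)"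
  unfolding outer_normal_def
proof (rule the_equality)
  have nz: "dual_pt x \<noteq> 0" by (rule dual_pt_nonzero[OF frontier_nonzero[OF x]])
  show "norm (dual_pt x /\<^sub>R norm (dual_pt x)) = 1 \<and> (\<forall>y\<in>K. (dual_pt x /\<^sub>R norm (dual_pt x)) \<bullet> (y - x) \<le> 0)"
  proof (intro conjI ballI)
    fix y assume "y \<in> K"
    then have "y \<bullet> dual_pt x \<le> 1" using dual_pt_frontier(3)[OF x, of y] by (simp add: mem_iff_gauge)
    then have "dual_pt x \<bullet> (y - x) \<le> 0" using dual_pt_frontier(2)[OF x] by (simp add: inner_diff_right inner_commute[of "dual_pt x"])
    then show "(dual_pt x /\<^sub>R norm (dual_pt x)) \<bullet> (y - x) \<le> 0" using nz by (simp add: divide_nonpos_pos mult_nonneg_nonpos)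
  qed (use nz in simp)
  fix u assume u: "norm u = 1 \<and> (\<forall>y\<in>K. u \<bullet> (y - x) \<le> 0)"
  \<comment> \<open>Since r u lies in \<open>K\<close>, the supporting inequality gives u \<bullet>
    x \<ge> r > 0, so \<open>u\<close> can be scaled to a point of the polar body that supports
    \<open>K\<close> at \<open>x\<close>.\<close>
  obtain r where r: "r > 0" "cball 0 r \<subseteq> K" by (rule inner_ball)
  have "r *\<^sub>R u \<in> K" using r u by (intro subsetD[OF r(2)]) simp
  then have "u \<bullet> (r *\<^sub>R u - x) \<le> 0" using u by blast
  moreover have "u \<bullet> u = 1" using u by (simp add: power2_norm_eq_inner[symmetric])
  ultimately have ux: "u \<bullet> x > 0" using r by (simp add: inner_diff_right)
  have "u /\<^sub>R (u \<bullet> x) \<in> polar_body K"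
    using u ux by (auto simp: polar_body_def inner_diff_right inner_commute divide_simps)
  then have "dual_pt x = gauge_fn x *\<^sub>R (u /\<^sub>R (u \<bullet> x))"
    using ux x by (intro dual_pt_eqI frontier_nonzero) (auto simp: frontier_iff_gauge inner_commute)
  then have "dual_pt x = u /\<^sub>R (u \<bullet> x)" using x by (simp add: frontier_iff_gauge)
  then show "u = dual_pt x /\<^sub>R norm (dual_pt x)" using ux u by simp
qed

lemma inner_outer_normal:
  assumes x: "x \<in> frontier K" shows "x \<bullet> outer_normal K x = 1 / norm (dual_pt x)"
  using dual_pt_frontier(2)[OF x] by (simp add: outer_normal_eq[OF x] divide_inverse)

text \<open>The graph is the set of incident pairs x \<bullet> y = 1 in the product of the boundary
  with the polar body, because supporting functionals are unique. It is closed, and the range is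
  compact.\<close>

lemma dual_pt_continuous_frontier: "continuous_on (frontier K) dual_pt"
proof (rule continuous_from_closed_graph[of "polar_body K"])
  show "compact (polar_body K)" by (rule P.compact_K)
  show "dual_pt \<in> frontier K \<rightarrow> polar_body K" using dual_pt_frontier(1) by blast
  have "((\<lambda>x. (x, dual_pt x)) ` frontier K) = (frontier K \<times> polar_body K) \<inter> {z. fst z \<bullet> snd z = 1}"
  proof (intro set_eqI iffI)
    fix z assume "z \<in> (\<lambda>x. (x, dual_pt x)) ` frontier K"
    then show "z \<in> (frontier K \<times> polar_body K) \<inter> {z. fst z \<bullet> snd z = 1}" using dual_pt_frontier by auto
  next
    fix z assume z: "z \<in> (frontier K \<times> polar_body K) \<inter> {z. fst z \<bullet> snd z = 1}"
    then have "snd z = dual_pt (fst z)"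
      using dual_pt_frontier(1,2) dual_unique[of "fst z" "snd z" "dual_pt (fst z)"] by auto
    then show "z \<in> (\<lambda>x. (x, dual_pt x)) ` frontier K" using z by (intro image_eqI[of _ _ "fst z"]) (auto simp: prod_eq_iff)
  qed
  moreover have "closed ((frontier K \<times> polar_body K) \<inter> {z. fst z \<bullet> snd z = 1})"
    by (intro closed_Int closed_Times frontier_closed polar_body_closed closed_Collect_eq continuous_intros)
  ultimately show "closed ((\<lambda>x. (x, dual_pt x)) ` frontier K)" by simp
qed

lemma dual_pt_continuous: "continuous_on (- {0}) dual_pt"
proof -
  have "continuous_on (- {0}) (\<lambda>x. gauge_fn x *\<^sub>R dual_pt (x /\<^sub>R gauge_fn x))"
    using gauge_pos normalized_in_frontier
    by (intro continuous_intros continuous_on_compose2[OF dual_pt_continuous_frontier]) (auto simp: less_imp_neq[symmetric])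
  then show ?thesis
  proof (rule continuous_on_cong[THEN iffD1, rotated -1])
    fix x assume "x \<in> - {0::'a}"
    then show "gauge_fn x *\<^sub>R dual_pt (x /\<^sub>R gauge_fn x) = dual_pt x"
      using gauge_pos[of x] by (simp add: dual_pt_scale)
  qed simp
qed

text \<open>With s z the subgradient at z, the subgradient inequalities at x and at z trap the
  first-order error between 0 and (z - x) \<bullet> (s z - s x); continuity of s makes this o(norm
  (z - x)).\<close>

lemma gauge_has_derivative:
  assumes x: "x \<noteq> 0"
  shows "(gauge_fn has_derivative (\<lambda>v. v \<bullet> (dual_pt x /\<^sub>R gauge_fn x))) (at x)"
proof -
  define s where "s z = dual_pt z /\<^sub>R gauge_fn z" for z
  have s: "z \<bullet> s z = gauge_fn z" "w \<bullet> s z \<le> gauge_fn w" if "z \<noteq> 0" for z w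
    using dual_pt(1,2)[OF that] gauge_pos[OF that] inner_le_gauge[of "s z" w] by (simp_all add: s_def power2_eq_square)
  have "continuous_on (- {0}) s"
    unfolding s_def by (intro continuous_intros dual_pt_continuous) (use gauge_pos in \<open>auto simp: less_imp_neq[symmetric]\<close>)
  then have cs: "isCont s x" using x by (simp add: continuous_on_eq_continuous_at open_Compl)
  have bound: "\<bar>gauge_fn z - gauge_fn x - (z - x) \<bullet> s x\<bar> \<le> norm (s z - s x) * norm (z - x)" if z: "z \<noteq> 0" for z
  proof -
    have "0 \<le> gauge_fn z - gauge_fn x - (z - x) \<bullet> s x"
      using s(2)[OF x, of z] s(1)[OF x] by (simp add: inner_diff_left)
    moreover have "gauge_fn z - gauge_fn x - (z - x) \<bullet> s x \<le> (z - x) \<bullet> (s z - s x)"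
      using s(2)[OF z, of x] s(1)[OF z] by (simp add: inner_diff_left inner_diff_right)
    moreover have "(z - x) \<bullet> (s z - s x) \<le> norm (z - x) * norm (s z - s x)" by (rule norm_cauchy_schwarz)
    ultimately show ?thesis by (simp add: mult.commute)
  qed
  have "(gauge_fn has_derivative (\<lambda>v. v \<bullet> s x)) (at x)"
    unfolding has_derivative_at_within
  proof (intro conjI)
    show "bounded_linear (\<lambda>v. v \<bullet> s x)" by (rule bounded_linear_inner_left)
    show "((\<lambda>y. (gauge_fn y - gauge_fn x - (y - x) \<bullet> s x) /\<^sub>R norm (y - x)) \<longlongrightarrow> 0) (at x)"
    proof (rule Lim_null_comparison)
      have "((\<lambda>z. norm (s z - s x)) \<longlongrightarrow> norm (s x - s x)) (at x)"
        using cs unfolding isCont_def by (intro tendsto_intros)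
      then show "((\<lambda>z. norm (s z - s x)) \<longlongrightarrow> 0) (at x)" by simp
      have "\<forall>\<^sub>F z in at x. z \<noteq> 0" using tendsto_imp_eventually_ne[OF tendsto_ident_at x] .
      then show "\<forall>\<^sub>F y in at x. norm ((gauge_fn y - gauge_fn x - (y - x) \<bullet> s x) /\<^sub>R norm (y - x)) \<le> norm (s y - s x)"
      proof eventually_elim
        case (elim y)
        show ?case
        proof (cases "y = x")
          case False
          have "norm ((gauge_fn y - gauge_fn x - (y - x) \<bullet> s x) /\<^sub>R norm (y - x)) =
              \<bar>gauge_fn y - gauge_fn x - (y - x) \<bullet> s x\<bar> / norm (y - x)"
            by (simp add: abs_mult divide_inverse mult.commute)
          also have "\<dots> \<le> norm (s y - s x)" using bound[OF elim] False by (simp add: divide_le_eq)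
          finally show ?thesis .
        qed simp
      qed
    qed
  qed
  then show ?thesis by (simp add: s_def)
qed

end

section \<open>Surface measure in polar coordinates\<close>

text \<open>Compactness leaves finitely many neighbourhoods, and a set is cut along them one at a
  time.\<close>

lemma measure_le_of_locally_le:
  fixes M N :: "'a::metric_space measure"
  assumes sets: "sets M = sets borel" "sets N = sets borel" and X: "compact X" "A \<in> sets borel" "A \<subseteq> X"
    and loc: "\<And>x. x \<in> X \<Longrightarrow> \<exists>U. open U \<and> x \<in> U \<and> (\<forall>A\<in>sets borel. A \<subseteq> X \<inter> U \<longrightarrow> emeasure M A \<le> emeasure N A)"
  shows "emeasure M A \<le> emeasure N A"
proof -
  define Q where "Q U \<longleftrightarrow> open U \<and> (\<forall>A\<in>sets borel. A \<subseteq> X \<inter> U \<longrightarrow> emeasure M A \<le> emeasure N A)" for U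
  have "X \<subseteq> \<Union>(Collect Q)" using loc unfolding Q_def by blast
  then obtain D where D: "D \<subseteq> Collect Q" "finite D" "X \<subseteq> \<Union>D"
    using compactE[OF X(1), of "Collect Q"] unfolding Q_def by blast
  have "emeasure M B \<le> emeasure N B" if "B \<in> sets borel" "B \<subseteq> X \<inter> \<Union>D" for B
    using D(2,1) that
  proof (induction D arbitrary: B)
    case empty
    then show ?case by simp
  next
    case (insert U D)
    have U: "U \<in> sets borel" "Q U" using insert.prems by (auto simp: Q_def)
    have split: "emeasure L (B \<inter> U) + emeasure L (B - U) = emeasure L B" if "sets L = sets borel" for L
    proof -
      have "emeasure L (B \<inter> U) + emeasure L (B - U) = emeasure L ((B \<inter> U) \<union> (B - U))"
        using insert.prems U that by (intro plus_emeasure) auto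
      then show ?thesis by (simp only: Int_Diff_Un)
    qed
    have "emeasure M (B \<inter> U) \<le> emeasure N (B \<inter> U)"
    proof -
      have "\<forall>A\<in>sets borel. A \<subseteq> X \<inter> U \<longrightarrow> emeasure M A \<le> emeasure N A" using U(2) by (simp add: Q_def)
      then show ?thesis using insert.prems U(1) by (elim ballE[of _ _ "B \<inter> U"]) auto
    qed
    moreover have "emeasure M (B - U) \<le> emeasure N (B - U)"
      using insert.prems U by (intro insert.IH) auto
    ultimately show ?case
      unfolding split[OF sets(1), symmetric] split[OF sets(2), symmetric] by (rule add_mono)
  qed
  then show ?thesis using X D(3) by blast
qed

lemma ennreal_le_of_le_mult:
  fixes x y :: ennreal
  assumes "\<And>c. c > 1 \<Longrightarrow> x \<le> ennreal c * y"
  shows "x \<le> y"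
proof (cases y)
  case (real r)
  show ?thesis
  proof (rule tendsto_lowerbound)
    have "((\<lambda>c. ennreal (c * r)) \<longlongrightarrow> ennreal (1 * r)) (at_right 1)" by (intro tendsto_intros)
    then show "((\<lambda>c. ennreal (c * r)) \<longlongrightarrow> y) (at_right 1)" using real by simp
    show "\<forall>\<^sub>F c in at_right 1. x \<le> ennreal (c * r)"
      unfolding eventually_at_right_field
    proof (intro exI[of _ 2] conjI allI impI)
      fix c :: real assume c: "c > 1"
      have "x \<le> ennreal c * ennreal r" using assms[OF c] real by simp
      then show "x \<le> ennreal (c * r)" using c real(1) by (simp add: ennreal_mult)
    qed simp
  qed simp
qed simp

lemma det_matrix_scale: "det (matrix (\<lambda>x::real^'n. c *\<^sub>R x)) = c ^ CARD('n)"
proof -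
  have "matrix (\<lambda>x::real^'n. c *\<^sub>R x) = (\<chi> i. c *s (mat 1 $ i))"
    by (simp add: vec_eq_iff matrix_component axis_def mat_def)
  then have "det (matrix (\<lambda>x::real^'n. c *\<^sub>R x)) = c ^ CARD('n) * det (mat 1 :: real^'n^'n)"
    by (simp only: det_rows_mul[of "\<lambda>_. c"]) simp
  then show ?thesis by simp
qed

lemma emeasure_lborel_scaling:
  fixes X :: "(real^'n) set"
  assumes c: "c > 0" and X: "X \<in> sets borel"
  shows "emeasure lborel ((\<lambda>x. c *\<^sub>R x) -` X) = ennreal ((1 / c) ^ CARD('n)) * emeasure lborel X"
proof -
  have lin: "linear (\<lambda>x::real^'n. c *\<^sub>R x)" by (simp add: linear_iff algebra_simps)
  note d = det_matrix_scale[of c, where 'n='n]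
  have "emeasure lborel X = ennreal (c ^ CARD('n)) * emeasure lborel ((\<lambda>x. c *\<^sub>R x) -` X)"
    using emeasure_lborel_linear_vimage[OF lin _ X] c unfolding d by simp
  then have "ennreal ((1 / c) ^ CARD('n)) * emeasure lborel X = ennreal ((1 / c) ^ CARD('n)) * (ennreal (c ^ CARD('n)) * emeasure lborel ((\<lambda>x. c *\<^sub>R x) -` X))"
    by (rule arg_cong)
  also have "\<dots> = emeasure lborel ((\<lambda>x. c *\<^sub>R x) -` X)"
    using c by (simp add: mult.assoc[symmetric] ennreal_mult'[symmetric] power_divide)
  finally show ?thesis ..
qed

locale smooth_body_cart = smooth_body K for K :: "(real^'n) set" +
  assumes dim2: "CARD('n) \<ge> 2"
begin

definition proj :: "real^'n \<Rightarrow> real^'n" where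
  "proj x = x /\<^sub>R gauge_fn x"

text \<open>This is n times the cone volume measure of convex geometry. A cone over a boundary
  element has volume h / n times its area, with h the distance of the tangent plane from 0, so
  surface measure should have density 1 / h, that is \<open>norm (dual_pt x)\<close>, with respect
  to it.\<close>

definition cone_meas :: "(real^'n) measure" where
  "cone_meas = distr (density lborel (\<lambda>x. ennreal (real CARD('n)) * indicator (K - {0}) x)) borel proj"

lemma measurable_gauge [measurable]: "gauge_fn \<in> borel_measurable borel"
  by (intro borel_measurable_continuous_onI gauge_continuous)

lemma measurable_proj [measurable]: "proj \<in> borel \<rightarrow>\<^sub>M borel"
  unfolding proj_def by measurable

lemma measurable_dual_pt [measurable]: "dual_pt \<in> borel \<rightarrow>\<^sub>M borel"
proof -
  have "(\<lambda>x. if x \<in> {0} then 0 else dual_pt x) \<in> borel \<rightarrow>\<^sub>M borel"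
    using dual_pt_continuous by (intro borel_measurable_continuous_on_if) auto
  moreover have "(\<lambda>x. if x \<in> {0} then 0 else dual_pt x) = dual_pt" by auto
  ultimately show ?thesis by simp
qed

lemma K_measurable [measurable]: "K \<in> sets borel" "frontier K \<in> sets borel"
  using compact_K compact_frontier_K by (auto simp: borel_compact)

lemma sets_cone_meas [simp, measurable_cong]: "sets cone_meas = sets borel"
  by (simp add: cone_meas_def)

lemma emeasure_cone_meas:
  assumes [measurable]: "A \<in> sets borel"
  shows "emeasure cone_meas A = ennreal (real CARD('n)) * emeasure lborel {x \<in> K - {0}. proj x \<in> A}"
proof -
  have pA: "proj -` A \<in> sets borel" using measurable_sets[OF measurable_proj assms] by simp
  have m: "{x \<in> K - {0}. proj x \<in> A} \<in> sets borel" by measurable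
  have "emeasure cone_meas A = (\<integral>\<^sup>+x. ennreal (real CARD('n)) * indicator (K - {0}) x * indicator (proj -` A) x \<partial>lborel)"
    using pA by (simp add: cone_meas_def emeasure_distr emeasure_density)
  also have "\<dots> = (\<integral>\<^sup>+x. ennreal (real CARD('n)) * indicator {x \<in> K - {0}. proj x \<in> A} x \<partial>lborel)"
    by (rule nn_integral_cong) (simp add: indicator_def)
  finally show ?thesis using m by (simp add: nn_integral_cmult_indicator)
qed

lemma proj_scale: "c > 0 \<Longrightarrow> proj (c *\<^sub>R x) = proj x"
  by (cases "x = 0") (simp_all add: proj_def gauge_scale)

lemma proj_frontier: "x \<in> frontier K \<Longrightarrow> proj x = x"
  by (simp add: proj_def frontier_iff_gauge)

text \<open>The map in question projects radially to the tangent hyperplane at \<open>x0\<close>. It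
  differs from the identity on x - y by two small terms: the factor h / (u \<bullet> x) is close to
  1, and its variation between x and y is small compared with norm (x - y), since nearby boundary
  points have nearly the same supporting hyperplane.\<close>

lemma radial_projection_bilipschitz:
  assumes x0: "x0 \<in> frontier K" and c: "c > 1"
  defines "u \<equiv> dual_pt x0 /\<^sub>R norm (dual_pt x0)" and "h \<equiv> 1 / norm (dual_pt x0)"
  obtains d where "d > 0"
    "\<And>x. x \<in> frontier K \<Longrightarrow> dist x x0 < d \<Longrightarrow> u \<bullet> x > 0 \<and> 1 / c \<le> h / (u \<bullet> x) \<and> h / (u \<bullet> x) \<le> c"
    "\<And>x. x \<in> frontier K \<Longrightarrow> dist x x0 < d \<Longrightarrow> 1 / (c * h) \<le> norm (dual_pt x) \<and> norm (dual_pt x) \<le> c / h"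
    "\<And>x y. x \<in> frontier K \<Longrightarrow> dist x x0 < d \<Longrightarrow> y \<in> frontier K \<Longrightarrow> dist y x0 < d \<Longrightarrow>
       dist ((h / (u \<bullet> x)) *\<^sub>R x) ((h / (u \<bullet> y)) *\<^sub>R y) \<le> c * dist x y \<and>
       dist x y \<le> c * dist ((h / (u \<bullet> x)) *\<^sub>R x) ((h / (u \<bullet> y)) *\<^sub>R y)"
proof -
  define s where "s = norm (dual_pt x0)"
  have s: "s > 0" using dual_pt_nonzero[OF frontier_nonzero[OF x0]] by (simp add: s_def)
  have h: "h > 0" "h = 1 / s" using s by (simp_all add: h_def s_def)
  have u1: "norm u = 1" using s by (simp add: u_def s_def)
  have S0: "dual_pt x0 = s *\<^sub>R u" using s by (simp add: u_def s_def)
  have "s * (u \<bullet> x0) = 1" using dual_pt_frontier(2)[OF x0] by (simp add: S0 inner_commute)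
  then have "u \<bullet> x0 = 1 / s" using s by (simp add: eq_divide_eq mult.commute)
  then have ux0: "u \<bullet> x0 = h" using h(2) by simp
  have hs: "h * s = 1" using h(2) s by simp
  \<comment> \<open>With this choice 1 - \<eta> is exactly 1 / c while 1 + \<eta> \<le> c, so one
    tolerance serves both Lipschitz constants.\<close>
  define \<eta> where "\<eta> = 1 - 1 / c"
  have \<eta>: "0 < \<eta>" "\<eta> < 1" "1 / c = 1 - \<eta>" using c by (auto simp: \<eta>_def)
  have c\<eta>: "1 + \<eta> \<le> c"
  proof -
    have "0 \<le> (c - 1)\<^sup>2 / c" using c by simp
    also have "(c - 1)\<^sup>2 / c = c - 1 - \<eta>" using c by (simp add: \<eta>_def power2_eq_square field_simps)
    finally show ?thesis by simp
  qed
  obtain R where R: "R > 0" "K \<subseteq> cball 0 R" by (rule outer_ball)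
  have fK: "frontier K \<subseteq> K" using compact_K by (simp add: frontier_subset_compact)
  \<comment> \<open>The first bound keeps \<open>norm (dual_pt x)\<close> within a factor 1
    \<plusminus> \<eta> of s; the second makes the term 4 e R from the variation of the projection
    factor at most \<eta> / 2.\<close>
  define e where "e = min (\<eta> * s) (\<eta> / (8 * R))"
  have e: "e > 0" "e \<le> \<eta> * s" "e * (8 * R) \<le> \<eta>" using \<eta> s R by (auto simp: e_def min_def field_simps)
  obtain d1 where d1: "d1 > 0" "\<And>x. x \<in> frontier K \<Longrightarrow> dist x x0 < d1 \<Longrightarrow> dist (dual_pt x) (dual_pt x0) < e"
    using dual_pt_continuous_frontier x0 e(1) unfolding continuous_on_iff by metis
  define d where "d = min d1 (h * \<eta> / 4)"
  have d: "d > 0" "d \<le> d1" "d \<le> h * \<eta> / 4" using d1 h \<eta> by (auto simp: d_def)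
  have near: "u \<bullet> x > 0 \<and> \<bar>h / (u \<bullet> x) - 1\<bar> \<le> \<eta> / 2 \<and> norm (dual_pt x - dual_pt x0) \<le> e \<and> h / (u \<bullet> x) \<le> 2"
    if x: "x \<in> frontier K" "dist x x0 < d" for x
  proof -
    have "\<bar>u \<bullet> x - h\<bar> = \<bar>u \<bullet> (x - x0)\<bar>" by (simp add: inner_diff_right ux0)
    also have "\<dots> \<le> norm u * norm (x - x0)" by (rule Cauchy_Schwarz_ineq2)
    also have "\<dots> \<le> h * \<eta> / 4" using x(2) d(3) u1 by (simp add: dist_norm)
    finally have a: "\<bar>u \<bullet> x - h\<bar> \<le> h * \<eta> / 4" .
    have "h * \<eta> < h" using mult_strict_left_mono[OF \<eta>(2) h(1)] by simp
    then have a2: "u \<bullet> x \<ge> h / 2" using a h(1) by linarith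
    then have pos: "u \<bullet> x > 0" using h(1) by linarith
    have "\<bar>h / (u \<bullet> x) - 1\<bar> = \<bar>u \<bullet> x - h\<bar> / (u \<bullet> x)"
    proof -
      have "h / (u \<bullet> x) - 1 = (h - u \<bullet> x) / (u \<bullet> x)" using pos by (simp add: diff_divide_distrib)
      then show ?thesis using pos by (simp add: abs_minus_commute)
    qed
    also have "\<dots> \<le> (h * \<eta> / 4) / (h / 2)" using a a2 h(1) \<eta>(1) by (intro frac_le) auto
    also have "\<dots> = \<eta> / 2" using h(1) by simp
    finally have b: "\<bar>h / (u \<bullet> x) - 1\<bar> \<le> \<eta> / 2" .
    have "norm (dual_pt x - dual_pt x0) \<le> e" using d1(2)[OF x(1)] x(2) d(2) by (simp add: dist_norm)
    moreover have "h / (u \<bullet> x) \<le> 2" using b \<eta>(1,2) unfolding abs_le_iff by linarith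
    ultimately show ?thesis using pos b by simp
  qed
  show ?thesis
  proof (rule that[OF d(1)])
    fix x assume x: "x \<in> frontier K" "dist x x0 < d"
    note nx = near[OF x]
    show "u \<bullet> x > 0 \<and> 1 / c \<le> h / (u \<bullet> x) \<and> h / (u \<bullet> x) \<le> c"
      using nx \<eta> c\<eta> unfolding abs_le_iff by linarith
    have "\<bar>norm (dual_pt x) - s\<bar> \<le> \<eta> * s"
      using norm_triangle_ineq3[of "dual_pt x" "dual_pt x0"] nx e(2) unfolding s_def by linarith
    then have "s * (1 - \<eta>) \<le> norm (dual_pt x)" "norm (dual_pt x) \<le> s * (1 + \<eta>)"
      unfolding abs_le_iff by (auto simp: algebra_simps)
    moreover have "s * (1 + \<eta>) \<le> s * c" using s c\<eta> by simp
    moreover have "1 / (c * h) = s * (1 - \<eta>)" unfolding \<eta>(3)[symmetric] using h(2) by simp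
    moreover have "c / h = s * c" using h(2) by simp
    ultimately show "1 / (c * h) \<le> norm (dual_pt x) \<and> norm (dual_pt x) \<le> c / h" by linarith
    fix y assume y: "y \<in> frontier K" "dist y x0 < d"
    note ny = near[OF y]
    let ?a = "u \<bullet> x" and ?b = "u \<bullet> y"
    let ?D = "(h / ?a) *\<^sub>R x - (h / ?b) *\<^sub>R y"
    have gx: "gauge_fn x = 1" "gauge_fn y = 1" using x y by (auto simp: frontier_iff_gauge)
    \<comment> \<open>The supporting hyperplane at w is tested with v, and replacing its normal by
      \<open>dual_pt x0\<close> costs at most e norm (v - w). Exchanging the two points then bounds
      the absolute value.\<close>
    have tang: "dual_pt x0 \<bullet> (v - w) \<le> e * norm (v - w)"
      if w: "w \<in> frontier K" "norm (dual_pt w - dual_pt x0) \<le> e" and v: "v \<in> frontier K" for v w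
    proof -
      have "v \<bullet> dual_pt w \<le> 1" using dual_pt_frontier(3)[OF w(1), of v] v by (simp add: frontier_iff_gauge)
      then have "(v - w) \<bullet> dual_pt w \<le> 0" using dual_pt_frontier(2)[OF w(1)] by (simp add: inner_diff_left)
      moreover have "(v - w) \<bullet> (dual_pt x0 - dual_pt w) \<le> norm (v - w) * norm (dual_pt x0 - dual_pt w)"
        by (rule norm_cauchy_schwarz)
      moreover have "norm (v - w) * norm (dual_pt x0 - dual_pt w) \<le> norm (v - w) * e"
        using w(2) by (intro mult_left_mono) (auto simp: norm_minus_commute)
      ultimately show ?thesis by (simp add: inner_diff_right inner_commute mult.commute)
    qed
    have "\<bar>s * (?a - ?b)\<bar> \<le> e * norm (x - y)"
      using tang[OF x(1) _ y(1)] tang[OF y(1) _ x(1)] nx ny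
      by (simp add: S0 inner_diff_right abs_le_iff norm_minus_commute algebra_simps)
    then have "h * \<bar>s * (?a - ?b)\<bar> \<le> h * (e * norm (x - y))"
      using h(1) by (intro mult_left_mono) auto
    moreover have "h * \<bar>s * (?a - ?b)\<bar> = \<bar>?a - ?b\<bar>"
      using s hs by (simp add: abs_mult mult.assoc[symmetric])
    ultimately have ab: "\<bar>?a - ?b\<bar> \<le> h * e * norm (x - y)" by (simp add: mult.assoc)
    have "?D - (x - y) = (h / ?a - 1) *\<^sub>R (x - y) + (h * (?b - ?a) / (?a * ?b)) *\<^sub>R y"
    proof -
      have "h * (?b - ?a) / (?a * ?b) = h / ?a - h / ?b" using nx ny by (simp add: field_simps)
      then show ?thesis by (simp only:) (simp add: algebra_simps)
    qed
    also have "norm \<dots> \<le> \<bar>h / ?a - 1\<bar> * norm (x - y) + \<bar>h * (?b - ?a) / (?a * ?b)\<bar> * norm y"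
      by (rule order_trans[OF norm_triangle_ineq]) simp
    also have "\<dots> \<le> \<eta> / 2 * norm (x - y) + 4 * e * norm (x - y) * R"
    proof (intro add_mono mult_right_mono mult_mono)
      show "\<bar>h / ?a - 1\<bar> \<le> \<eta> / 2" using nx by simp
      show "norm y \<le> R" using R fK y by auto
      have "\<bar>h * (?b - ?a) / (?a * ?b)\<bar> = (h / ?a) * ((h / ?b) * (\<bar>?a - ?b\<bar> / h))"
        using nx ny h(1) by (simp add: abs_mult abs_minus_commute)
      also have "\<dots> \<le> 2 * (2 * (h * e * norm (x - y) / h))"
        using nx ny h(1) ab e(1) by (intro mult_mono divide_right_mono) auto
      also have "\<dots> = 4 * e * norm (x - y)" using h(1) by simp
      finally show "\<bar>h * (?b - ?a) / (?a * ?b)\<bar> \<le> 4 * e * norm (x - y)" .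
    qed (use e R in auto)
    also have "\<dots> \<le> \<eta> * norm (x - y)"
    proof -
      have "(e * (8 * R)) * norm (x - y) \<le> \<eta> * norm (x - y)" using e(3) by (rule mult_right_mono) simp
      then show ?thesis by (simp add: algebra_simps)
    qed
    finally have D: "norm (?D - (x - y)) \<le> \<eta> * norm (x - y)" .
    have "norm ?D \<le> (1 + \<eta>) * norm (x - y)"
      using norm_triangle_ineq[of "?D - (x - y)" "x - y"] D by (simp add: algebra_simps)
    also have "\<dots> \<le> c * norm (x - y)" using c\<eta> by (rule mult_right_mono) simp
    finally have 1: "norm ?D \<le> c * norm (x - y)" .
    have "norm (x - y) - norm ?D \<le> \<eta> * norm (x - y)"
      using norm_triangle_ineq2[of "x - y" ?D] D by (simp add: norm_minus_commute)
    then have "(1 / c) * norm (x - y) \<le> norm ?D" unfolding \<eta>(3) by (simp add: algebra_simps)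
    then have "norm (x - y) \<le> c * norm ?D" using c by (simp add: field_simps)
    with 1 show "dist ((h / (u \<bullet> x)) *\<^sub>R x) ((h / (u \<bullet> y)) *\<^sub>R y) \<le> c * dist x y \<and>
       dist x y \<le> c * dist ((h / (u \<bullet> x)) *\<^sub>R x) ((h / (u \<bullet> y)) *\<^sub>R y)"
      by (simp add: dist_norm)
  qed
qed

end

lemma ennreal_mult_mult_left: "a \<ge> 0 \<Longrightarrow> b \<ge> 0 \<Longrightarrow> ennreal a * (ennreal b * x) = ennreal (a * b) * x"
  by (simp add: ennreal_mult mult.assoc)

lemma ennreal_mult_mult_left3:
  "a \<ge> 0 \<Longrightarrow> b \<ge> 0 \<Longrightarrow> c \<ge> 0 \<Longrightarrow> ennreal a * (ennreal b * (ennreal c * x)) = ennreal (a * b * c) * x"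
  by (simp add: ennreal_mult mult.assoc)

context smooth_body_cart
begin

text \<open>A boundary piece \<open>A\<close> is compared with its radial image \<open>B\<close> in
  the tangent hyperplane. The Hausdorff measures agree up to c^(n-1), the cone over either set
  shrunk by c lies in the other cone, which costs c^n, and the density is constant up to c. The
  product of the factors is c^(2n).\<close>

lemma hausdorff_surface_locally:
  assumes x0: "x0 \<in> frontier K" and c: "c > 1"
  obtains U where "open U" "x0 \<in> U"
    "\<And>A. A \<in> sets borel \<Longrightarrow> A \<subseteq> frontier K \<inter> U \<Longrightarrow>
      hausdorff_outer (CARD('n) - 1) A \<le> ennreal (c ^ (2 * CARD('n))) * emeasure (density cone_meas (\<lambda>x. ennreal (norm (dual_pt x)))) A \<and>
      emeasure (density cone_meas (\<lambda>x. ennreal (norm (dual_pt x)))) A \<le> ennreal (c ^ (2 * CARD('n))) * hausdorff_outer (CARD('n) - 1) A"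
proof -
  let ?m = "CARD('n) - 1"
  define u where "u = dual_pt x0 /\<^sub>R norm (dual_pt x0)"
  define h where "h = 1 / norm (dual_pt x0)"
  have nz: "norm (dual_pt x0) > 0" using dual_pt_nonzero[OF frontier_nonzero[OF x0]] by simp
  have h: "h > 0" using nz by (simp add: h_def)
  have u1: "norm u = 1" using nz by (simp add: u_def)
  define P where "P x = (h / (u \<bullet> x)) *\<^sub>R x" for x
  obtain d where d: "d > 0"
    and ratio: "\<And>x. x \<in> frontier K \<Longrightarrow> dist x x0 < d \<Longrightarrow> u \<bullet> x > 0 \<and> 1 / c \<le> h / (u \<bullet> x) \<and> h / (u \<bullet> x) \<le> c"
    and nrm: "\<And>x. x \<in> frontier K \<Longrightarrow> dist x x0 < d \<Longrightarrow> 1 / (c * h) \<le> norm (dual_pt x) \<and> norm (dual_pt x) \<le> c / h"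
    and bilip: "\<And>x y. x \<in> frontier K \<Longrightarrow> dist x x0 < d \<Longrightarrow> y \<in> frontier K \<Longrightarrow> dist y x0 < d \<Longrightarrow>
       dist (P x) (P y) \<le> c * dist x y \<and> dist x y \<le> c * dist (P x) (P y)"
    using radial_projection_bilipschitz[OF x0 c] unfolding u_def h_def P_def by blast
  show ?thesis
  proof (rule that[of "ball x0 d"])
    fix A assume A: "A \<in> sets borel" "A \<subseteq> frontier K \<inter> ball x0 d"
    have Af: "a \<in> frontier K" "dist a x0 < d" if "a \<in> A" for a using A(2) that by (auto simp: dist_commute)
    let ?\<nu> = "emeasure cone_meas A" and ?M = "emeasure (density cone_meas (\<lambda>x. ennreal (norm (dual_pt x)))) A"
    let ?H = "hausdorff_outer ?m A"
    define B where "B = {z. u \<bullet> z = h \<and> proj z \<in> A}"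
    have Bm: "B \<in> sets borel" using A(1) unfolding B_def by measurable
    have uP: "u \<bullet> P x = h" if "u \<bullet> x > 0" for x using that by (simp add: P_def)
    have PB: "P ` A = B"
    proof (intro set_eqI iffI)
      fix z assume "z \<in> P ` A"
      then obtain a where a: "a \<in> A" "z = P a" by auto
      then have "u \<bullet> a > 0" using ratio[OF Af[OF a(1)]] by simp
      then show "z \<in> B" using a h Af(1)[OF a(1)] uP
        by (simp add: B_def P_def proj_scale proj_frontier)
    next
      fix z assume z: "z \<in> B"
      then have zn: "z \<noteq> 0" using h by (auto simp: B_def)
      have "P (proj z) = z" using z h gauge_pos[OF zn] by (simp add: P_def proj_def B_def)
      then show "z \<in> P ` A" using z by (intro image_eqI[of _ _ "proj z"]) (auto simp: B_def)
    qed
    have H1: "hausdorff_outer ?m B \<le> ennreal (c ^ ?m) * ?H"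
      unfolding PB[symmetric] using bilip Af dim2 c by (intro hausdorff_outer_lipschitz_image) auto
    have H2: "?H \<le> ennreal (c ^ ?m) * hausdorff_outer ?m B"
    proof -
      define Q where "Q = inv_into A P"
      have inj: "inj_on P A"
      proof (rule inj_onI)
        fix a b assume ab: "a \<in> A" "b \<in> A" "P a = P b"
        then have "dist a b \<le> c * dist (P a) (P b)" using bilip Af by blast
        then show "a = b" using ab(3) by simp
      qed
      have QP: "Q (P a) = a" if "a \<in> A" for a using inj that by (simp add: Q_def)
      have "hausdorff_outer ?m (Q ` B) \<le> ennreal (c ^ ?m) * hausdorff_outer ?m B"
        unfolding PB[symmetric]
      proof (rule hausdorff_outer_lipschitz_image)
        fix x y assume "x \<in> P ` A" "y \<in> P ` A"
        then obtain a b where ab: "a \<in> A" "b \<in> A" "x = P a" "y = P b" by blast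
        then show "dist (Q x) (Q y) \<le> c * dist x y" using bilip Af QP by simp
      qed (use dim2 c in auto)
      moreover have "Q ` B = A" unfolding PB[symmetric] using QP by force
      ultimately show ?thesis by simp
    qed
    have flat: "ennreal (real CARD('n)) * emeasure lborel {x. 0 < u \<bullet> x \<and> u \<bullet> x \<le> h \<and> P x \<in> B} = ennreal h * hausdorff_outer ?m B"
      unfolding P_def by (rule hausdorff_hyperplane[OF dim2 u1 h Bm]) (auto simp: B_def)
    let ?E = "{x. 0 < u \<bullet> x \<and> u \<bullet> x \<le> h \<and> P x \<in> B}" and ?F = "{x \<in> K - {0}. proj x \<in> A}"
    have Em: "?E \<in> sets borel" using Bm unfolding P_def by measurable
    have Fm: "?F \<in> sets borel" using A(1) by measurable
    have E_F: "?E \<subseteq> (\<lambda>x. (1 / c) *\<^sub>R x) -` ?F"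
    proof
      fix x assume x: "x \<in> ?E"
      then have xn: "x \<noteq> 0" by auto
      have "proj ((h / (u \<bullet> x)) *\<^sub>R x) = proj x" using x h by (intro proj_scale) simp
      then have px: "proj x \<in> A" using x by (simp add: B_def P_def)
      have up: "u \<bullet> x = gauge_fn x * (u \<bullet> proj x)" using gauge_pos[OF xn] by (simp add: proj_def)
      have "gauge_fn x \<le> h / (u \<bullet> proj x)"
        using x ratio[OF Af[OF px]] up by (simp add: pos_le_divide_eq)
      also have "\<dots> \<le> c" using ratio[OF Af[OF px]] by simp
      finally have "gauge_fn ((1 / c) *\<^sub>R x) \<le> 1" using c by (simp add: gauge_scale divide_le_eq)
      then show "x \<in> (\<lambda>x. (1 / c) *\<^sub>R x) -` ?F" using c xn px by (simp add: mem_iff_gauge proj_scale)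
    qed
    have F_E: "?F \<subseteq> (\<lambda>x. (1 / c) *\<^sub>R x) -` ?E"
    proof
      fix x assume x: "x \<in> ?F"
      then have xn: "x \<noteq> 0" and px: "proj x \<in> A" and g1: "gauge_fn x \<le> 1" by (auto simp: mem_iff_gauge)
      note r = ratio[OF Af[OF px]]
      have up: "u \<bullet> x = gauge_fn x * (u \<bullet> proj x)" using gauge_pos[OF xn] by (simp add: proj_def)
      then have pos: "u \<bullet> x > 0" using r gauge_pos[OF xn] by simp
      have "u \<bullet> x \<le> u \<bullet> proj x" using up g1 r by (simp add: mult_left_le_one_le gauge_nonneg)
      also have "\<dots> \<le> c * h"
      proof -
        have "(u \<bullet> proj x) * (1 / c) \<le> (u \<bullet> proj x) * (h / (u \<bullet> proj x))"
          using r by (intro mult_left_mono) auto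
        then show ?thesis using r c by (simp add: pos_divide_le_eq mult.commute)
      qed
      finally have "u \<bullet> ((1 / c) *\<^sub>R x) \<le> h" using c by (simp add: divide_le_eq mult.commute)
      moreover have "P ((1 / c) *\<^sub>R x) \<in> B"
        using pos c h px by (simp add: B_def P_def proj_scale)
      ultimately show "x \<in> (\<lambda>x. (1 / c) *\<^sub>R x) -` ?E" using pos c by simp
    qed
    have sc: "emeasure lborel ((\<lambda>x::real^'n. (1 / c) *\<^sub>R x) -` X) = ennreal (c ^ CARD('n)) * emeasure lborel X"
      if "X \<in> sets borel" for X
      using emeasure_lborel_scaling[of "1 / c" X] that c by simp
    have vm: "(\<lambda>x::real^'n. (1 / c) *\<^sub>R x) -` X \<in> sets borel" if "X \<in> sets borel" for X
      using measurable_sets[of "\<lambda>x. (1 / c) *\<^sub>R x" borel borel X] that by simp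
    have E_le: "emeasure lborel ?E \<le> ennreal (c ^ CARD('n)) * emeasure lborel ?F"
    proof -
      have "emeasure lborel ?E \<le> emeasure lborel ((\<lambda>x. (1 / c) *\<^sub>R x) -` ?F)"
        by (rule emeasure_mono[OF E_F]) (simp only: sets_lborel vm[OF Fm])
      then show ?thesis unfolding sc[OF Fm] .
    qed
    have F_le: "emeasure lborel ?F \<le> ennreal (c ^ CARD('n)) * emeasure lborel ?E"
    proof -
      have "emeasure lborel ?F \<le> emeasure lborel ((\<lambda>x. (1 / c) *\<^sub>R x) -` ?E)"
        by (rule emeasure_mono[OF F_E]) (simp only: sets_lborel vm[OF Em])
      then show ?thesis unfolding sc[OF Em] .
    qed
    have nu: "?\<nu> = ennreal (real CARD('n)) * emeasure lborel ?F" by (rule emeasure_cone_meas[OF A(1)])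
    have n1: "ennreal h * hausdorff_outer ?m B \<le> ennreal (c ^ CARD('n)) * ?\<nu>"
      unfolding flat[symmetric] nu using mult_left_mono[OF E_le, of "ennreal (real CARD('n))"] by (simp only: mult.left_commute zero_le)
    have n2: "?\<nu> \<le> ennreal (c ^ CARD('n)) * (ennreal h * hausdorff_outer ?m B)"
      unfolding flat[symmetric] nu using mult_left_mono[OF F_le, of "ennreal (real CARD('n))"] by (simp only: mult.left_commute zero_le)
    have Meq: "?M = (\<integral>\<^sup>+x. ennreal (norm (dual_pt x)) * indicator A x \<partial>cone_meas)"
      using A(1) by (subst emeasure_density) simp_all
    have "?M \<le> (\<integral>\<^sup>+x. ennreal (c / h) * indicator A x \<partial>cone_meas)"
      unfolding Meq using nrm Af by (intro nn_integral_mono) (auto simp: indicator_def intro!: ennreal_leI)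
    then have M1: "?M \<le> ennreal (c / h) * ?\<nu>" using A(1) by (simp add: nn_integral_cmult_indicator)
    have "(\<integral>\<^sup>+x. ennreal (1 / (c * h)) * indicator A x \<partial>cone_meas) \<le> ?M"
      unfolding Meq using nrm Af by (intro nn_integral_mono) (auto simp: indicator_def intro!: ennreal_leI)
    then have M2: "ennreal (1 / (c * h)) * ?\<nu> \<le> ?M" using A(1) by (simp add: nn_integral_cmult_indicator)
    have pw: "c * (c ^ CARD('n) * c ^ ?m) = c ^ (2 * CARD('n))"
      using dim2 by (cases "CARD('n)") (simp_all add: power_add[symmetric] mult_2)
    have "ennreal h * ?H \<le> ennreal h * (ennreal (c ^ ?m) * hausdorff_outer ?m B)" by (intro mult_left_mono H2) simp
    also have "\<dots> = ennreal (c ^ ?m) * (ennreal h * hausdorff_outer ?m B)" by (rule mult.left_commute)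
    also have "\<dots> \<le> ennreal (c ^ ?m) * (ennreal (c ^ CARD('n)) * ?\<nu>)" by (intro mult_left_mono n1) simp
    finally have "ennreal (1 / h) * (ennreal h * ?H) \<le> ennreal (1 / h) * (ennreal (c ^ ?m) * (ennreal (c ^ CARD('n)) * ?\<nu>))"
      by (rule mult_left_mono) simp
    also have "ennreal (1 / h) * (ennreal h * ?H) = ?H" using h by (simp add: mult.assoc[symmetric] ennreal_mult'[symmetric])
    also have "ennreal (1 / h) * (ennreal (c ^ ?m) * (ennreal (c ^ CARD('n)) * ?\<nu>)) =
        ennreal (c * (c ^ CARD('n) * c ^ ?m)) * (ennreal (1 / (c * h)) * ?\<nu>)"
    proof -
      have e: "1 / h * c ^ ?m * c ^ CARD('n) = c * (c ^ CARD('n) * c ^ ?m) * (1 / (c * h))" using h c by simp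
      have "ennreal (1 / h) * (ennreal (c ^ ?m) * (ennreal (c ^ CARD('n)) * ?\<nu>)) = ennreal (1 / h * c ^ ?m * c ^ CARD('n)) * ?\<nu>"
        using h c by (intro ennreal_mult_mult_left3) auto
      also have "\<dots> = ennreal (c * (c ^ CARD('n) * c ^ ?m)) * (ennreal (1 / (c * h)) * ?\<nu>)"
        unfolding e using h c by (intro ennreal_mult_mult_left[symmetric]) auto
      finally show ?thesis .
    qed
    also have "\<dots> \<le> ennreal (c * (c ^ CARD('n) * c ^ ?m)) * ?M" by (intro mult_left_mono M2) simp
    finally have R1: "?H \<le> ennreal (c ^ (2 * CARD('n))) * ?M" unfolding pw .
    have "?M \<le> ennreal (c / h) * (ennreal (c ^ CARD('n)) * (ennreal h * hausdorff_outer ?m B))"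
      by (rule order_trans[OF M1]) (intro mult_left_mono n2, simp)
    also have "\<dots> \<le> ennreal (c / h) * (ennreal (c ^ CARD('n)) * (ennreal h * (ennreal (c ^ ?m) * ?H)))"
      by (intro mult_left_mono H1) simp_all
    also have "\<dots> = ennreal (c * (c ^ CARD('n) * c ^ ?m)) * ?H"
    proof -
      have e: "c / h * c ^ CARD('n) * (h * c ^ ?m) = c * (c ^ CARD('n) * c ^ ?m)" using h c by simp
      have "ennreal h * (ennreal (c ^ ?m) * ?H) = ennreal (h * c ^ ?m) * ?H"
        using h c by (intro ennreal_mult_mult_left) auto
      moreover have "ennreal (c / h) * (ennreal (c ^ CARD('n)) * (ennreal (h * c ^ ?m) * ?H)) = ennreal (c / h * c ^ CARD('n) * (h * c ^ ?m)) * ?H"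
        using h c by (intro ennreal_mult_mult_left3) auto
      ultimately show ?thesis unfolding e by (simp only:)
    qed
    finally have R2: "?M \<le> ennreal (c ^ (2 * CARD('n))) * ?H" unfolding pw .
    show "?H \<le> ennreal (c ^ (2 * CARD('n))) * ?M \<and> ?M \<le> ennreal (c ^ (2 * CARD('n))) * ?H"
      using R1 R2 by simp
  qed (use d in auto)
qed

text \<open>Near a boundary point the radial projection to the tangent hyperplane is Lipschitz in both directions with constants
  close to 1, which reduces the comparison to the hyperplane case.\<close>

theorem surface_measure_eq:
  "surface_measure K = restrict_space (density cone_meas (\<lambda>x. ennreal (norm (dual_pt x)))) (frontier K)"
proof -
  let ?M = "density cone_meas (\<lambda>x. ennreal (norm (dual_pt x)))"
  let ?H = "hausdorff_measure (CARD('n) - 1) :: (real^'n) measure"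
  have m: "CARD('n) - 1 \<ge> 1" using dim2 by simp
  have sH: "sets ?H = sets borel" by simp
  have scale: "emeasure (scale_measure (ennreal r) N) A = ennreal r * emeasure N A" for r and N :: "(real^'n) measure" and A
    by simp
  have "emeasure ?H A = emeasure ?M A" if A: "A \<in> sets borel" "A \<subseteq> frontier K" for A
  proof (rule antisym)
    have rt: "\<exists>b>1. b ^ (2 * CARD('n)) = c" if "c > 1" for c :: real
      using that dim2 by (intro exI[of _ "root (2 * CARD('n)) c"]) (simp add: real_root_gt_1_iff)
    have ex: "\<exists>U. open U \<and> x \<in> U \<and> (\<forall>A\<in>sets borel. A \<subseteq> frontier K \<inter> U \<longrightarrow> emeasure ?H A \<le> ennreal c * emeasure ?M A)"
      "\<exists>U. open U \<and> x \<in> U \<and> (\<forall>A\<in>sets borel. A \<subseteq> frontier K \<inter> U \<longrightarrow> emeasure ?M A \<le> ennreal c * emeasure ?H A)"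
      if c: "c > 1" and x: "x \<in> frontier K" for c x
    proof -
      obtain b where b: "b > 1" "b ^ (2 * CARD('n)) = c" using rt[OF c] by blast
      obtain U where U: "open U" "x \<in> U" "\<forall>A\<in>sets borel. A \<subseteq> frontier K \<inter> U \<longrightarrow>
          hausdorff_outer (CARD('n) - 1) A \<le> ennreal (b ^ (2 * CARD('n))) * emeasure ?M A \<and>
          emeasure ?M A \<le> ennreal (b ^ (2 * CARD('n))) * hausdorff_outer (CARD('n) - 1) A"
      proof (rule hausdorff_surface_locally[OF x b(1)])
        fix U assume *: "open U" "x \<in> U" "\<And>A. A \<in> sets borel \<Longrightarrow> A \<subseteq> frontier K \<inter> U \<Longrightarrow>
          hausdorff_outer (CARD('n) - 1) A \<le> ennreal (b ^ (2 * CARD('n))) * emeasure ?M A \<and>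
          emeasure ?M A \<le> ennreal (b ^ (2 * CARD('n))) * hausdorff_outer (CARD('n) - 1) A"
        show thesis by (rule that[OF *(1,2)]) (intro ballI impI *(3))
      qed
      have "emeasure ?H A \<le> ennreal c * emeasure ?M A" "emeasure ?M A \<le> ennreal c * emeasure ?H A"
        if "A \<in> sets borel" "A \<subseteq> frontier K \<inter> U" for A
        using U(3)[rule_format, OF that] unfolding b(2) emeasure_hausdorff_measure[OF m that(1)] by simp_all
      then show "\<exists>U. open U \<and> x \<in> U \<and> (\<forall>A\<in>sets borel. A \<subseteq> frontier K \<inter> U \<longrightarrow> emeasure ?H A \<le> ennreal c * emeasure ?M A)"
        "\<exists>U. open U \<and> x \<in> U \<and> (\<forall>A\<in>sets borel. A \<subseteq> frontier K \<inter> U \<longrightarrow> emeasure ?M A \<le> ennreal c * emeasure ?H A)"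
        using U(1,2) by (intro exI[of _ U] conjI ballI impI; simp)+
    qed
    show "emeasure ?H A \<le> emeasure ?M A"
    proof (rule ennreal_le_of_le_mult)
      fix c :: real assume c: "c > 1"
      have "emeasure ?H A \<le> emeasure (scale_measure (ennreal c) ?M) A"
        by (rule measure_le_of_locally_le[OF sH _ compact_frontier_K A], simp, unfold scale, rule ex(1)[OF c])
      then show "emeasure ?H A \<le> ennreal c * emeasure ?M A" unfolding scale .
    qed
    show "emeasure ?M A \<le> emeasure ?H A"
    proof (rule ennreal_le_of_le_mult)
      fix c :: real assume c: "c > 1"
      have "emeasure ?M A \<le> emeasure (scale_measure (ennreal c) ?H) A"
        by (rule measure_le_of_locally_le[OF _ _ compact_frontier_K A], simp, simp, unfold scale, rule ex(2)[OF c])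
      then show "emeasure ?M A \<le> ennreal c * emeasure ?H A" unfolding scale .
    qed
  qed
  then show ?thesis
    unfolding surface_measure_def
  proof (intro measure_eqI)
    assume eq: "\<And>A. A \<in> sets borel \<Longrightarrow> A \<subseteq> frontier K \<Longrightarrow> emeasure ?H A = emeasure ?M A"
    show "sets (restrict_space ?H (frontier K)) = sets (restrict_space ?M (frontier K))"
      by (simp add: sets_restrict_space)
    fix A assume "A \<in> sets (restrict_space ?H (frontier K))"
    then have A: "A \<in> sets borel" "A \<subseteq> frontier K" by (auto simp: sets_restrict_space)
    show "emeasure (restrict_space ?H (frontier K)) A = emeasure (restrict_space ?M (frontier K)) A"
      using A eq[OF A] by (subst (1 2) emeasure_restrict_space) simp_all
  qed
qed

lemma integral_surface_measure:
  assumes F: "F \<in> borel_measurable (restrict_space borel (frontier K))"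
  shows "(LINT x|surface_measure K. F x) =
    real CARD('n) * (LINT x|lborel. indicator (K - {0}) x * (F (proj x) * norm (dual_pt (proj x))))"
proof -
  let ?G = "\<lambda>x. indicator (frontier K) x * F x"
  have G [measurable]: "?G \<in> borel_measurable borel"
    using F borel_measurable_restrict_space_iff[of "frontier K" borel F] K_measurable(2) by simp
  have "(LINT x|surface_measure K. F x) = (LINT x|density cone_meas (\<lambda>x. ennreal (norm (dual_pt x))). ?G x)"
    unfolding surface_measure_eq by (subst integral_restrict_space) auto
  also have "\<dots> = (LINT x|cone_meas. norm (dual_pt x) *\<^sub>R ?G x)"
    by (subst integral_density) (auto simp: measurable_cong_sets[OF sets_cone_meas refl])
  also have "\<dots> = (LINT x|density lborel (\<lambda>x. ennreal (real CARD('n)) * indicator (K - {0}) x). norm (dual_pt (proj x)) *\<^sub>R ?G (proj x))"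
    unfolding cone_meas_def by (subst integral_distr) auto
  also have "(\<lambda>x. ennreal (real CARD('n)) * indicator (K - {0}) x) = (\<lambda>x::real^'n. ennreal (real CARD('n) * indicator (K - {0}) x))"
    by (auto simp: indicator_def)
  also have "(LINT x|density lborel \<dots>. norm (dual_pt (proj x)) *\<^sub>R ?G (proj x)) =
      (LINT x|lborel. (real CARD('n) * indicator (K - {0}) x) *\<^sub>R (norm (dual_pt (proj x)) *\<^sub>R ?G (proj x)))"
    by (subst integral_density) auto
  also have "\<dots> = (LINT x|lborel. real CARD('n) * (indicator (K - {0}) x * (F (proj x) * norm (dual_pt (proj x)))))"
    using normalized_in_frontier by (intro Bochner_Integration.integral_cong) (auto simp: indicator_def proj_def)
  finally show ?thesis by simp
qed

section \<open>Gauss curvature as a determinant of the derivative of the duality map\<close>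

text \<open>Each of the two supporting hyperplanes is tested with the other point. It expresses that
  chords of the boundary are tangent to first order.\<close>

lemma supporting_normal_small:
  assumes x: "x \<in> frontier K" and z: "z \<in> frontier K"
  shows "\<bar>dual_pt x \<bullet> (z - x)\<bar> \<le> norm (dual_pt z - dual_pt x) * norm (z - x)"
proof -
  have "z \<bullet> dual_pt x \<le> 1" using dual_pt_frontier(3)[OF x, of z] z by (simp add: frontier_iff_gauge)
  then have 1: "dual_pt x \<bullet> (z - x) \<le> 0"
    using dual_pt_frontier(2)[OF x] by (simp add: inner_diff_right inner_commute[of "dual_pt x"])
  have "x \<bullet> dual_pt z \<le> 1" using dual_pt_frontier(3)[OF z, of x] x by (simp add: frontier_iff_gauge)
  then have 2: "dual_pt z \<bullet> (z - x) \<ge> 0"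
    using dual_pt_frontier(2)[OF z] by (simp add: inner_diff_right inner_commute[of "dual_pt z"])
  have "(dual_pt z - dual_pt x) \<bullet> (z - x) \<le> norm (dual_pt z - dual_pt x) * norm (z - x)"
    by (rule norm_cauchy_schwarz)
  then have "- (dual_pt x \<bullet> (z - x)) \<le> norm (dual_pt z - dual_pt x) * norm (z - x)"
    using 2 by (simp add: inner_diff_left)
  with 1 show ?thesis by linarith
qed

text \<open>For a tangent vector w the radial projection of x + t w is a curve in the boundary with
  velocity w at 0, so a derivative along the boundary is determined on tangent directions; the value
  at the normal fixes the rest. This makes the definite description in
  \<open>gauss_curvature\<close> meaningful.\<close>

lemma weingarten_unique:
  assumes x: "x \<in> frontier K" and u: "u = outer_normal K x"
    and W: "(f has_derivative W) (at x within frontier K)" "W u = c"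
    and W': "(f has_derivative W') (at x within frontier K)" "W' u = c"
  shows "W = W'"
proof
  fix v
  define s where "s = norm (dual_pt x)"
  have s: "s > 0" using dual_pt_nonzero[OF frontier_nonzero[OF x]] by (simp add: s_def)
  have uS: "u = dual_pt x /\<^sub>R s" by (simp add: u outer_normal_eq[OF x] s_def)
  have S: "dual_pt x = s *\<^sub>R u" using s by (simp add: uS)
  have "s * (u \<bullet> x) = 1" using dual_pt_frontier(2)[OF x] by (simp add: S inner_commute)
  then have ux: "u \<bullet> x > 0" using s by (metis zero_less_mult_pos zero_less_one)
  have u1: "u \<bullet> u = 1" using s by (simp add: uS power2_norm_eq_inner[symmetric] s_def)
  define w where "w = v - (u \<bullet> v) *\<^sub>R u"
  have uw: "u \<bullet> w = 0" by (simp add: w_def inner_diff_right u1)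
  define \<phi> where "\<phi> t = (x + t *\<^sub>R w) /\<^sub>R gauge_fn (x + t *\<^sub>R w)" for t
  have nz: "x + t *\<^sub>R w \<noteq> 0" for t
  proof
    assume "x + t *\<^sub>R w = 0"
    then have "u \<bullet> (x + t *\<^sub>R w) = 0" by simp
    then show False using ux by (simp add: inner_add_right uw)
  qed
  have \<phi>f: "\<phi> t \<in> frontier K" for t unfolding \<phi>_def by (rule normalized_in_frontier[OF nz])
  have gx: "gauge_fn x = 1" using x by (simp add: frontier_iff_gauge)
  have \<phi>0: "\<phi> 0 = x" by (simp add: \<phi>_def gx)
  have Sw: "w \<bullet> dual_pt x = 0" by (simp add: S inner_commute uw)
  have lin: "((\<lambda>t. x + t *\<^sub>R w) has_derivative (\<lambda>t. t *\<^sub>R w)) (at 0)"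
    by (auto intro!: derivative_eq_intros)
  have "(gauge_fn has_derivative (\<lambda>v. v \<bullet> dual_pt x)) (at (x + 0 *\<^sub>R w))"
    using gauge_has_derivative[OF frontier_nonzero[OF x]] gx by simp
  from has_derivative_compose[OF lin this]
  have g': "((\<lambda>t. gauge_fn (x + t *\<^sub>R w)) has_derivative (\<lambda>t. 0)) (at 0)"
    by (simp add: Sw)
  have "(\<phi> has_derivative (\<lambda>t. t *\<^sub>R w)) (at 0)"
    unfolding \<phi>_def by (rule derivative_eq_intros lin g' | simp add: gx)+
  then have \<phi>': "(\<phi> has_derivative (\<lambda>t. t *\<^sub>R w)) (at 0 within UNIV)" by simp
  have sub: "range \<phi> \<subseteq> frontier K" using \<phi>f by auto
  have d: "((\<lambda>t. f (\<phi> t)) has_derivative (\<lambda>t. V (t *\<^sub>R w))) (at 0)"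
    if V: "(f has_derivative V) (at x within frontier K)" for V
  proof -
    have "(f has_derivative V) (at (\<phi> 0) within \<phi> ` UNIV)"
      unfolding \<phi>0 by (rule has_derivative_subset[OF V sub])
    from diff_chain_within[OF \<phi>' this] show ?thesis by (simp add: o_def)
  qed
  have "(\<lambda>t. W (t *\<^sub>R w)) = (\<lambda>t. W' (t *\<^sub>R w))"
    by (rule has_derivative_unique[OF d[OF W(1)] d[OF W'(1)]])
  from fun_cong[OF this, of 1] have Ww: "W w = W' w" by simp
  have lW: "linear W" "linear W'" using W(1) W'(1) has_derivative_linear by auto
  have v: "v = w + (u \<bullet> v) *\<^sub>R u" by (simp add: w_def)
  have "V v = V w + (u \<bullet> v) *\<^sub>R c" if "linear V" "V u = c" for V
    by (subst v) (simp only: linear_add[OF that(1)] linear_scale[OF that(1)] that(2))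
  then have "W v = W w + (u \<bullet> v) *\<^sub>R c" "W' v = W' w + (u \<bullet> v) *\<^sub>R c"
    using lW W(2) W'(2) by auto
  then show "W v = W' v" using Ww by simp
qed

text \<open>In directions tangent to the boundary the derivative of \<open>dual_pt\<close> is the Weingarten map up to scaling and a change of the
  normal component by maps of rank one, whose determinants are explicit.\<close>

theorem gauss_curvature_eq:
  assumes x: "x \<in> frontier K" and D: "(dual_pt has_derivative D) (at x)"
  shows "gauss_curvature K x = det (matrix D) * (x \<bullet> outer_normal K x) ^ (CARD('n) + 1)"
proof -
  define s where "s = norm (dual_pt x)"
  have s: "s > 0" using dual_pt_nonzero[OF frontier_nonzero[OF x]] by (simp add: s_def)
  define u where "u = outer_normal K x"
  have uS: "u = dual_pt x /\<^sub>R s" by (simp add: u_def outer_normal_eq[OF x] s_def)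
  have S: "dual_pt x = s *\<^sub>R u" using s by (simp add: uS)
  have u1: "u \<bullet> u = 1" using s by (simp add: uS power2_norm_eq_inner[symmetric] s_def)
  define h where "h = x \<bullet> u"
  have hs: "h = 1 / s" unfolding h_def u_def s_def by (rule inner_outer_normal[OF x])
  have lD: "linear D" using D has_derivative_linear by blast
  \<comment> \<open>Euler's relation: \<open>dual_pt\<close> is positively homogeneous of degree
    1.\<close>
  have Dx: "D x = s *\<^sub>R u"
  proof -
    have d1: "((\<lambda>t. (1 + t) *\<^sub>R x) has_derivative (\<lambda>t. t *\<^sub>R x)) (at 0)"
      by (auto intro!: derivative_eq_intros)
    have "(dual_pt has_derivative D) (at ((1 + 0) *\<^sub>R x))" using D by simp
    from has_derivative_compose[OF d1 this]
    have a: "((\<lambda>t. dual_pt ((1 + t) *\<^sub>R x)) has_derivative (\<lambda>t. D (t *\<^sub>R x))) (at 0)" .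
    have "((\<lambda>t. (1 + t) *\<^sub>R dual_pt x) has_derivative (\<lambda>t. t *\<^sub>R dual_pt x)) (at 0)"
      by (auto intro!: derivative_eq_intros)
    then have b: "((\<lambda>t. dual_pt ((1 + t) *\<^sub>R x)) has_derivative (\<lambda>t. t *\<^sub>R dual_pt x)) (at 0)"
    proof (rule has_derivative_transform_within[where d = 1])
      fix t :: real assume "dist t 0 < 1"
      then have "1 + t > 0" by (auto simp: dist_real_def)
      then show "(1 + t) *\<^sub>R dual_pt x = dual_pt ((1 + t) *\<^sub>R x)" by (simp add: dual_pt_scale)
    qed auto
    from fun_cong[OF has_derivative_unique[OF a b], of 1] show ?thesis by (simp add: S)
  qed
  \<comment> \<open>Obtained by differentiating the identity z \<bullet> \<open>dual_pt z\<close> =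
    (\<open>gauge_fn z\<close>)^2 in two ways.\<close>
  have xD: "x \<bullet> D v = v \<bullet> dual_pt x" for v
  proof -
    have gx: "gauge_fn x = 1" using x by (simp add: frontier_iff_gauge)
    have g': "(gauge_fn has_derivative (\<lambda>v. v \<bullet> dual_pt x)) (at x)"
      using gauge_has_derivative[OF frontier_nonzero[OF x]] gx by simp
    have "((\<lambda>z. z \<bullet> dual_pt z) has_derivative (\<lambda>v. x \<bullet> D v + v \<bullet> dual_pt x)) (at x)"
      by (rule has_derivative_inner[OF has_derivative_ident D])
    moreover have "((\<lambda>z. (gauge_fn z)\<^sup>2) has_derivative (\<lambda>v. 2 * (v \<bullet> dual_pt x))) (at x)"
      using has_derivative_power[OF g', of 2] by (simp add: gx)
    moreover have "(\<lambda>z. z \<bullet> dual_pt z) = (\<lambda>z. (gauge_fn z)\<^sup>2)"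
    proof
      fix z show "z \<bullet> dual_pt z = (gauge_fn z)\<^sup>2" by (cases "z = 0") (simp_all add: dual_pt)
    qed
    ultimately have "(\<lambda>v. x \<bullet> D v + v \<bullet> dual_pt x) = (\<lambda>v. 2 * (v \<bullet> dual_pt x))"
      using has_derivative_unique by metis
    from fun_cong[OF this, of v] show ?thesis by simp
  qed
  \<comment> \<open>\<open>W0\<close> is the derivative of the normalised \<open>dual_pt\<close>,
    which extends the normal off the boundary; \<open>W\<close> agrees with it on tangent vectors
    and fixes the normal, as the definition of curvature demands.\<close>
  define W0 where "W0 v = (1 / s) *\<^sub>R (D v - (u \<bullet> D v) *\<^sub>R u)" for v
  define W where "W v = W0 (v - (u \<bullet> v) *\<^sub>R u) + (u \<bullet> v) *\<^sub>R u" for v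
  have lW0: "linear W0" unfolding W0_def
    by (rule linearI) (simp_all add: linear_add[OF lD] linear_scale[OF lD] inner_add_right algebra_simps)
  have lW: "linear W" unfolding W_def
    by (rule linearI) (simp_all add: linear_add[OF lW0] linear_diff[OF lW0] linear_scale[OF lW0] inner_add_right algebra_simps)
  have uW0: "u \<bullet> W0 v = 0" for v by (simp add: W0_def inner_diff_right u1)
  have Wu: "W u = u" using linear_0[OF lW0] by (simp add: W_def u1)
  have nrm: "((\<lambda>z. norm (dual_pt z)) has_derivative (\<lambda>v. u \<bullet> D v)) (at x)"
  proof -
    have "dual_pt x \<noteq> 0" using s by (auto simp: s_def)
    from has_derivative_compose[OF D has_derivative_norm[OF this]]
    show ?thesis by (simp add: sgn_div_norm uS s_def inner_commute divide_inverse mult.commute)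
  qed
  have f': "((\<lambda>z. dual_pt z /\<^sub>R norm (dual_pt z)) has_derivative W0) (at x)"
  proof -
    have "((\<lambda>z. inverse (norm (dual_pt z))) has_derivative (\<lambda>v. - (inverse s * (u \<bullet> D v) * inverse s))) (at x)"
      using Deriv.has_derivative_inverse[OF _ nrm] s by (simp add: s_def)
    from has_derivative_scaleR[OF this D]
    show ?thesis
    proof (rule has_derivative_eq_rhs)
      show "(\<lambda>h. inverse (norm (dual_pt x)) *\<^sub>R D h + (- (inverse s * (u \<bullet> D h) * inverse s)) *\<^sub>R dual_pt x) = W0"
      proof
        fix v
        have "- (inverse s * (u \<bullet> D v) * inverse s) * s = - ((1 / s) * (u \<bullet> D v))" using s by (simp add: field_simps)
        then have eq: "(- (inverse s * (u \<bullet> D v) * inverse s)) *\<^sub>R (s *\<^sub>R u) = - ((1 / s) * (u \<bullet> D v)) *\<^sub>R u"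
          by (simp only: scaleR_scaleR)
        then show "inverse (norm (dual_pt x)) *\<^sub>R D v + (- (inverse s * (u \<bullet> D v) * inverse s)) *\<^sub>R dual_pt x = W0 v"
          unfolding s_def[symmetric] unfolding S eq W0_def by (simp add: scaleR_diff_right divide_inverse)
      qed
    qed
  qed
  have N0: "(outer_normal K has_derivative W0) (at x within frontier K)"
    using has_derivative_at_withinI[OF f'] x
    by (rule has_derivative_transform_within[of _ _ _ _ 1, simplified])
      (simp_all add: outer_normal_eq)
  have NW: "(outer_normal K has_derivative W) (at x within frontier K)"
    unfolding has_derivative_at_within
  proof (intro conjI)
    show "bounded_linear W" using lW by (simp add: linear_conv_bounded_linear)
    \<comment> \<open>\<open>W\<close> and \<open>W0\<close> differ by a multiple of u \<bullet> (z
      - x), which is o(norm (z - x)) along the boundary, so both are derivatives there.\<close>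
    let ?b = "\<lambda>z. ((u \<bullet> (z - x)) / norm (z - x)) *\<^sub>R (W0 u - u)"
    have t0: "((\<lambda>z. (u \<bullet> (z - x)) / norm (z - x)) \<longlongrightarrow> 0) (at x within frontier K)"
    proof (rule Lim_null_comparison)
      have "((\<lambda>z. norm (dual_pt z - dual_pt x) / s) \<longlongrightarrow> norm (dual_pt x - dual_pt x) / s) (at x within frontier K)"
        using dual_pt_continuous_frontier x s unfolding continuous_on_def by (intro tendsto_intros) auto
      then show "((\<lambda>z. norm (dual_pt z - dual_pt x) / s) \<longlongrightarrow> 0) (at x within frontier K)" by simp
      have "norm ((u \<bullet> (z - x)) / norm (z - x)) \<le> norm (dual_pt z - dual_pt x) / s" if z: "z \<in> frontier K" "z \<noteq> x" for z
      proof -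
        have "s * \<bar>u \<bullet> (z - x)\<bar> \<le> norm (dual_pt z - dual_pt x) * norm (z - x)"
          using supporting_normal_small[OF x z(1)] s by (simp add: S abs_mult)
        then show ?thesis using z(2) s by (simp add: field_simps)
      qed
      then show "\<forall>\<^sub>F z in at x within frontier K. norm ((u \<bullet> (z - x)) / norm (z - x)) \<le> norm (dual_pt z - dual_pt x) / s"
        by (auto simp: eventually_at_filter)
    qed
    have "((\<lambda>z. (outer_normal K z - outer_normal K x - W0 (z - x)) /\<^sub>R norm (z - x) + ?b z) \<longlongrightarrow> 0 + 0 *\<^sub>R (W0 u - u)) (at x within frontier K)"
      using N0 unfolding has_derivative_at_within by (intro tendsto_intros t0) auto
    moreover have "(outer_normal K z - outer_normal K x - W0 (z - x)) /\<^sub>R norm (z - x) + ?b z =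
        (outer_normal K z - outer_normal K x - W (z - x)) /\<^sub>R norm (z - x)" for z
    proof -
      have Wd: "W d = W0 d - (u \<bullet> d) *\<^sub>R (W0 u - u)" for d
        by (simp add: W_def linear_diff[OF lW0] linear_scale[OF lW0] scaleR_diff_right)
      show ?thesis unfolding Wd[of "z - x"]
        by (simp only: divide_inverse mult.commute[of _ "inverse (norm (z - x))"] scaleR_scaleR[symmetric] scaleR_add_right[symmetric]) simp
    qed
    ultimately show "((\<lambda>z. (outer_normal K z - outer_normal K x - W (z - x)) /\<^sub>R norm (z - x)) \<longlongrightarrow> 0) (at x within frontier K)"
      by simp
  qed
  have "(THE W. (outer_normal K has_derivative W) (at x within frontier K) \<and> W (outer_normal K x) = outer_normal K x) = W"
  proof (rule the_equality)
    show "(outer_normal K has_derivative W) (at x within frontier K) \<and> W (outer_normal K x) = outer_normal K x"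
      using NW Wu by (simp add: u_def)
    fix V assume "(outer_normal K has_derivative V) (at x within frontier K) \<and> V (outer_normal K x) = outer_normal K x"
    then show "V = W"
      using weingarten_unique[OF x u_def _ _ NW Wu] by (simp add: u_def)
  qed
  then have curv: "gauss_curvature K x = det (matrix W)" by (simp add: gauss_curvature_def)
  define \<tau> where "\<tau> = x - h *\<^sub>R u"
  \<comment> \<open>\<open>R\<close> fixes the tangent vectors and sends x to the normal u.
    \<open>Q\<close> puts back the component along u that \<open>W0\<close> removes; its size
    follows from x \<bullet> D w = 0 for tangent w. Up to the factor s this composes D from
    W.\<close>
  define R where "R v = v + ((- s) *\<^sub>R u \<bullet> v) *\<^sub>R (x - u)" for v
  define Q where "Q y = y + ((- s) *\<^sub>R \<tau> \<bullet> y) *\<^sub>R u" for y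
  have lR: "linear R" "linear Q" unfolding R_def Q_def
    by (rule linearI; simp add: inner_add_right algebra_simps)+
  have "D v = s *\<^sub>R Q (W (R v))" for v
  proof -
    define a where "a = s * (u \<bullet> v)"
    define w where "w = v - a *\<^sub>R x"
    have uw: "u \<bullet> w = 0" using hs s by (simp add: w_def a_def inner_diff_right h_def[symmetric] inner_commute[of u x])
    have Rv: "R v = w + a *\<^sub>R u" by (simp add: R_def w_def a_def algebra_simps)
    have Wv: "W (R v) = W0 w + a *\<^sub>R u"
      unfolding Rv by (simp add: W_def inner_add_right uw u1)
    have Dw: "D w = s *\<^sub>R W0 w + (u \<bullet> D w) *\<^sub>R u" using s by (simp add: W0_def)
    have "x \<bullet> D w = 0" using xD[of w] by (simp add: S inner_commute uw)
    then have "s * (x \<bullet> W0 w) + (u \<bullet> D w) * h = 0"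
      by (subst (asm) Dw) (simp add: inner_add_right h_def)
    moreover have "x \<bullet> W0 w = \<tau> \<bullet> W0 w" by (simp add: \<tau>_def inner_diff_left uW0)
    ultimately have uDw: "u \<bullet> D w = - s * (s * (\<tau> \<bullet> W0 w))"
    proof -
      assume "s * (x \<bullet> W0 w) + (u \<bullet> D w) * h = 0" and *: "x \<bullet> W0 w = \<tau> \<bullet> W0 w"
      then have "(u \<bullet> D w) * h = - (s * (\<tau> \<bullet> W0 w))" by simp
      then have "((u \<bullet> D w) * h) * s = - (s * (\<tau> \<bullet> W0 w)) * s" by (rule arg_cong)
      moreover have "((u \<bullet> D w) * h) * s = u \<bullet> D w" using hs s by simp
      ultimately show ?thesis by simp
    qed
    have \<tau>u: "\<tau> \<bullet> u = 0" by (simp add: \<tau>_def inner_diff_left u1 h_def)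
    have "D v = D w + a *\<^sub>R D x" by (simp add: w_def linear_diff[OF lD] linear_scale[OF lD])
    also have "\<dots> = s *\<^sub>R W0 w + (u \<bullet> D w) *\<^sub>R u + (a * s) *\<^sub>R u" by (subst Dw) (simp add: Dx)
    also have "\<dots> = s *\<^sub>R Q (W (R v))"
      unfolding Wv uDw by (simp add: Q_def inner_add_right \<tau>u algebra_simps)
    finally show ?thesis .
  qed
  then have "D = (\<lambda>v. s *\<^sub>R v) \<circ> (Q \<circ> (W \<circ> R))" by auto
  moreover have lsc: "linear (\<lambda>v::real^'n. s *\<^sub>R v)" by (simp add: linear_iff algebra_simps)
  ultimately have "det (matrix D) = det (matrix (\<lambda>v::real^'n. s *\<^sub>R v)) * (det (matrix Q) * (det (matrix W) * det (matrix R)))"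
    using lR lW by (simp add: det_matrix_compose linear_compose)
  moreover have "det (matrix (\<lambda>v::real^'n. s *\<^sub>R v)) = s ^ CARD('n)" by (rule det_matrix_scale)
  moreover have "det (matrix Q) = 1"
    unfolding Q_def det_rank_one_update by (simp add: \<tau>_def inner_diff_left u1 h_def)
  moreover have "det (matrix R) = s"
    unfolding R_def det_rank_one_update using hs s by (simp add: inner_diff_right u1 h_def[symmetric] inner_commute[of u x] algebra_simps)
  ultimately have "det (matrix D) = s ^ (CARD('n) + 1) * det (matrix W)" by simp
  then have "det (matrix D) * h ^ (CARD('n) + 1) = det (matrix W)"
    unfolding hs using s by (simp add: power_divide del: power_Suc)
  then show ?thesis unfolding curv h_def u_def by simp
qed

end

section \<open>Continuous differentiability of the duality map\<close>

text \<open>If \<open>y\<close> had a component v orthogonal to the gradient G, the boundary would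
  contain points close to z + t v, found by the intermediate value theorem on the segment from z + t
  (v - a G) to z + t (v + a G); on such a point \<open>y\<close> exceeds 1, although
  \<open>y\<close> lies in the polar body.\<close>

lemma (in conv_body) hypersurface_dual:
  assumes z: "z \<in> frontier K" "z \<in> U" and U: "open U"
    and \<phi>: "\<And>y. y \<in> U \<Longrightarrow> (\<phi> has_derivative (\<lambda>h. \<psi> y \<bullet> h)) (at y)"
    and nz: "\<psi> z \<noteq> 0" and eq: "frontier K \<inter> U = {y \<in> U. \<phi> y = 0}"
    and y: "y \<in> polar_body K" "z \<bullet> y = 1"
  shows "z \<bullet> \<psi> z \<noteq> 0 \<and> y = \<psi> z /\<^sub>R (z \<bullet> \<psi> z)"
proof -
  define G where "G = \<psi> z"
  have G: "G \<bullet> G > 0" using nz by (simp add: G_def)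
  define v where "v = y - ((y \<bullet> G) / (G \<bullet> G)) *\<^sub>R G"
  have Gv: "G \<bullet> v = 0" using G by (simp add: v_def inner_diff_right inner_commute)
  have yv: "y \<bullet> v = v \<bullet> v"
    using Gv by (simp add: v_def inner_diff_left inner_diff_right inner_commute)
  have "v = 0"
  proof (rule ccontr)
    assume "v \<noteq> 0"
    then have v: "v \<bullet> v > 0" by simp
    \<comment> \<open>Small enough that a correction by at most a G changes the value of
      \<open>y\<close> by no more than half of v \<bullet> v.\<close>
    define a where "a = (v \<bullet> v) / (2 * (\<bar>y \<bullet> G\<bar> + 1))"
    have a: "a > 0" using v by (simp add: a_def add_nonneg_pos)
    have "a * \<bar>y \<bullet> G\<bar> \<le> a * (\<bar>y \<bullet> G\<bar> + 1)" using a by simp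
    also have "\<dots> = (v \<bullet> v) / 2"
    proof -
      have "\<bar>y \<bullet> G\<bar> + 1 \<noteq> 0" using abs_ge_zero[of "y \<bullet> G"] by linarith
      then show ?thesis unfolding a_def by (simp add: divide_simps)
    qed
    finally have ay: "a * \<bar>y \<bullet> G\<bar> \<le> (v \<bullet> v) / 2" .
    have \<phi>z: "\<phi> z = 0" using z eq by blast
    have der: "((\<lambda>t. \<phi> (z + t *\<^sub>R w)) has_real_derivative (G \<bullet> w)) (at 0)" for w
    proof -
      have "((\<lambda>t. z + t *\<^sub>R w) has_derivative (\<lambda>t. t *\<^sub>R w)) (at 0)" by (auto intro!: derivative_eq_intros)
      moreover have "(\<phi> has_derivative (\<lambda>h. G \<bullet> h)) (at (z + 0 *\<^sub>R w))" using \<phi>[OF z(2)] by (simp add: G_def)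
      ultimately have "((\<lambda>t. \<phi> (z + t *\<^sub>R w)) has_derivative (\<lambda>t. G \<bullet> (t *\<^sub>R w))) (at 0)"
        by (rule has_derivative_compose)
      then show ?thesis by (rule has_derivative_imp_has_field_derivative) simp
    qed
    obtain d1 where d1: "d1 > 0" "\<And>t. 0 < t \<Longrightarrow> t < d1 \<Longrightarrow> 0 < \<phi> (z + t *\<^sub>R (v + a *\<^sub>R G))"
      using DERIV_pos_inc_right[OF der[of "v + a *\<^sub>R G"]] a G Gv by (auto simp: inner_add_right \<phi>z)
    obtain d2 where d2: "d2 > 0" "\<And>t. 0 < t \<Longrightarrow> t < d2 \<Longrightarrow> \<phi> (z + t *\<^sub>R (v + (-a) *\<^sub>R G)) < 0"
      using DERIV_neg_dec_right[OF der[of "v + (-a) *\<^sub>R G"]] a G Gv by (auto simp: inner_diff_right \<phi>z)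
    obtain r where r: "r > 0" "ball z r \<subseteq> U" using U z(2) by (auto simp: open_contains_ball)
    define M where "M = norm v + a * norm G"
    have M: "M \<ge> 0" using a by (simp add: M_def)
    define t where "t = min (min d1 d2) (r / (M + 1)) / 2"
    have t: "t > 0" "t < d1" "t < d2" "t * M < r"
    proof -
      have rM: "r / (M + 1) > 0" using r M by simp
      then show "t > 0" "t < d1" "t < d2" using d1 d2 by (auto simp: t_def min_def)
      have "t < e" if "t = min (min d1 d2) e / 2" "e > 0" for e
        using that min.cobounded2[of "min d1 d2" e] by linarith
      from this[OF t_def rM] have "t < r / (M + 1)" .
      then have "t * (M + 1) < r" using M by (simp add: pos_less_divide_eq)
      then show "t * M < r" using \<open>t > 0\<close> by (simp add: algebra_simps)
    qed
    have inU: "z + t *\<^sub>R (v + b *\<^sub>R G) \<in> U" if "- a \<le> b" "b \<le> a" for b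
    proof -
      have "norm (v + b *\<^sub>R G) \<le> norm v + \<bar>b\<bar> * norm G" by (rule order_trans[OF norm_triangle_ineq]) simp
      also have "\<dots> \<le> M" using that by (auto simp: M_def abs_le_iff intro!: mult_right_mono)
      finally have "t * norm (v + b *\<^sub>R G) \<le> t * M" using t by simp
      from order.strict_trans1[OF this t(4)] have "norm (t *\<^sub>R (v + b *\<^sub>R G)) < r" using t(1) by simp
      then show ?thesis using r(2) by (auto simp: dist_norm)
    qed
    have "continuous_on {-a..a} (\<lambda>b. \<phi> (z + t *\<^sub>R (v + b *\<^sub>R G)))"
    proof (rule continuous_on_compose2[of U \<phi>])
      show "continuous_on U \<phi>" using \<phi> has_derivative_continuous
        by (intro continuous_at_imp_continuous_on) blast
    qed (auto intro!: continuous_intros inU)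
    then obtain b where b: "- a \<le> b" "b \<le> a" "\<phi> (z + t *\<^sub>R (v + b *\<^sub>R G)) = 0"
      using IVT'[of "\<lambda>b. \<phi> (z + t *\<^sub>R (v + b *\<^sub>R G))" "-a" 0 a] d1(2)[OF t(1,2)] d2(2)[OF t(1,3)] a by force
    then have "z + t *\<^sub>R (v + b *\<^sub>R G) \<in> frontier K" using inU eq by blast
    then have "z + t *\<^sub>R (v + b *\<^sub>R G) \<in> K" using compact_K frontier_subset_compact by blast
    then have "(z + t *\<^sub>R (v + b *\<^sub>R G)) \<bullet> y \<le> 1" using y(1) by (simp add: polar_body_def)
    then have "t * (v \<bullet> v + b * (y \<bullet> G)) \<le> 0"
      using y(2) yv by (simp add: inner_add_right inner_commute[of _ y] distrib_left)
    then have "v \<bullet> v + b * (y \<bullet> G) \<le> 0" using t(1) by (simp add: mult_le_0_iff)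
    moreover have "\<bar>b * (y \<bullet> G)\<bar> \<le> a * \<bar>y \<bullet> G\<bar>"
      using b(1,2) by (auto simp: abs_mult abs_le_iff intro!: mult_right_mono)
    ultimately show False using ay v by linarith
  qed
  then have y': "y = ((y \<bullet> G) / (G \<bullet> G)) *\<^sub>R G" by (simp add: v_def)
  define l where "l = (y \<bullet> G) / (G \<bullet> G)"
  have yl: "y = l *\<^sub>R G" using y' by (simp only: l_def)
  have "l * (z \<bullet> G) = 1" using y(2) by (simp add: yl)
  then have "z \<bullet> G \<noteq> 0" "l = inverse (z \<bullet> G)" using inverse_unique[of "z \<bullet> G" l] by (auto simp: mult.commute)
  then show ?thesis using yl by (simp add: G_def)
qed

lemma smooth_body_C2:
  assumes "conv_body K" "C2_hypersurface (frontier K)"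
  shows "smooth_body K"
proof -
  interpret conv_body K by fact
  show ?thesis
  proof
    fix x y y' assume *: "x \<in> frontier K" "y \<in> polar_body K" "y' \<in> polar_body K" "x \<bullet> y = 1" "x \<bullet> y' = 1"
    obtain U \<phi> g H where U: "open U" "x \<in> U" "\<And>y. y \<in> U \<Longrightarrow> (\<phi> has_derivative (\<lambda>h. g y \<bullet> h)) (at y)"
      and "\<And>y. y \<in> U \<Longrightarrow> (g has_derivative blinfun_apply (H y)) (at y)" "continuous_on U H"
      and U': "\<And>y. y \<in> U \<Longrightarrow> g y \<noteq> 0" "frontier K \<inter> U = {y \<in> U. \<phi> y = (0::real)}"
      using assms(2)[unfolded C2_hypersurface_def, rule_format, OF *(1)] by blast
    show "y = y'"
      using hypersurface_dual[OF *(1) U(2,1,3) U'(1)[OF U(2)] U'(2) *(2,4)]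
        hypersurface_dual[OF *(1) U(2,1,3) U'(1)[OF U(2)] U'(2) *(3,5)] by simp
  qed
qed

context smooth_body_cart
begin

text \<open>On the boundary \<open>dual_pt\<close> equals the gradient \<psi> divided by q z = z
  \<bullet> \<psi> z. This formula makes sense on an open set; composing it with the radial
  projection and restoring the factor \<open>gauge_fn\<close> represents \<open>dual_pt\<close> near
  x by continuously differentiable maps.\<close>

lemma dual_pt_C1_at:
  assumes C2: "C2_hypersurface (frontier K)" and x: "x \<noteq> 0"
  obtains V A where "open V" "x \<in> V" "0 \<notin> V" "\<And>y. y \<in> V \<Longrightarrow> (dual_pt has_derivative A y) (at y)"
    "\<And>v. continuous_on V (\<lambda>y. A y v)"
proof -
  define P where "P y = y /\<^sub>R gauge_fn y" for y
  have xf: "P x \<in> frontier K" unfolding P_def by (rule normalized_in_frontier[OF x])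
  obtain U \<phi> \<psi> H where U: "open U" "P x \<in> U" "\<And>y. y \<in> U \<Longrightarrow> (\<phi> has_derivative (\<lambda>h. \<psi> y \<bullet> h)) (at y)"
      "\<And>y. y \<in> U \<Longrightarrow> (\<psi> has_derivative blinfun_apply (H y)) (at y)" "continuous_on U H"
      "\<And>y. y \<in> U \<Longrightarrow> \<psi> y \<noteq> 0" "frontier K \<inter> U = {y \<in> U. \<phi> y = (0::real)}"
    using C2[unfolded C2_hypersurface_def, rule_format, OF xf] by blast
  define q where "q z = z \<bullet> \<psi> z" for z
  have dual: "q z \<noteq> 0 \<and> dual_pt z = \<psi> z /\<^sub>R q z" if "z \<in> frontier K" "z \<in> U" for z
    unfolding q_def using that dual_pt_frontier(1,2)[OF that(1)]
    by (intro hypersurface_dual[OF that U(1,3) U(6)[OF that(2)] U(7)]) auto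
  have c\<psi>: "continuous_on U \<psi>"
    using U(4) has_derivative_continuous by (intro continuous_at_imp_continuous_on) blast
  have cq: "continuous_on U q" unfolding q_def by (intro continuous_intros c\<psi>)
  define U' where "U' = {z \<in> U. q z \<noteq> 0}"
  have "U' = U \<inter> q -` (- {0})" by (auto simp: U'_def)
  then have U': "open U'" using continuous_open_preimage[OF cq U(1), of "- {0}"] by (simp add: open_Compl)
  have xU': "P x \<in> U'" using U(2) dual[OF xf U(2)] by (simp add: U'_def)
  have cP: "continuous_on (- {0}) P" unfolding P_def
    by (intro continuous_intros) (use gauge_pos in \<open>auto simp: less_imp_neq[symmetric]\<close>)
  define V where "V = (- {0}) \<inter> P -` U'"
  have V: "open V" unfolding V_def using continuous_open_preimage[OF cP _ U'] by (simp add: open_Compl)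
  define G' where "G' y v = v \<bullet> (dual_pt y /\<^sub>R gauge_fn y)" for y v
  define P' where "P' y v = v /\<^sub>R gauge_fn y - (G' y v / (gauge_fn y)\<^sup>2) *\<^sub>R y" for y v
  define q' where "q' z v = v \<bullet> \<psi> z + z \<bullet> blinfun_apply (H z) v" for z v
  define \<sigma> where "\<sigma> z = \<psi> z /\<^sub>R q z" for z
  define \<sigma>' where "\<sigma>' z v = blinfun_apply (H z) v /\<^sub>R q z - (q' z v / (q z)\<^sup>2) *\<^sub>R \<psi> z" for z v
  define A where "A y v = G' y v *\<^sub>R \<sigma> (P y) + gauge_fn y *\<^sub>R \<sigma>' (P y) (P' y v)" for y v
  have Pd: "(P has_derivative P' y) (at y)" if "y \<noteq> 0" for y
  proof -
    have g: "(gauge_fn has_derivative G' y) (at y)" unfolding G'_def by (rule gauge_has_derivative[OF that])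
    have gp: "gauge_fn y > 0" by (rule gauge_pos[OF that])
    have "((\<lambda>y. inverse (gauge_fn y)) has_derivative (\<lambda>v. - (inverse (gauge_fn y) * G' y v * inverse (gauge_fn y)))) (at y)"
      using gp by (intro Deriv.has_derivative_inverse g) simp
    from has_derivative_scaleR[OF this has_derivative_ident]
    show ?thesis unfolding P_def
      by (rule has_derivative_eq_rhs) (auto simp: P'_def fun_eq_iff power2_eq_square divide_inverse mult_ac)
  qed
  have qd: "(q has_derivative q' z) (at z)" if "z \<in> U" for z
    using has_derivative_inner[OF has_derivative_ident U(4)[OF that]]
    unfolding q_def q'_def by (simp add: add.commute)
  have \<sigma>d: "(\<sigma> has_derivative \<sigma>' z) (at z)" if "z \<in> U'" for z
  proof -
    have z: "z \<in> U" "q z \<noteq> 0" using that by (auto simp: U'_def)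
    have "((\<lambda>z. inverse (q z)) has_derivative (\<lambda>v. - (inverse (q z) * q' z v * inverse (q z)))) (at z)"
      using z by (intro Deriv.has_derivative_inverse qd)
    from has_derivative_scaleR[OF this U(4)[OF z(1)]]
    show ?thesis unfolding \<sigma>_def
      by (rule has_derivative_eq_rhs) (auto simp: \<sigma>'_def fun_eq_iff power2_eq_square divide_inverse mult_ac)
  qed
  have rep: "dual_pt y = gauge_fn y *\<^sub>R \<sigma> (P y)" if "y \<in> V" for y
  proof -
    have y: "y \<noteq> 0" "P y \<in> U" using that by (auto simp: V_def U'_def)
    have gp: "gauge_fn y > 0" by (rule gauge_pos[OF y(1)])
    have "dual_pt (P y) = \<sigma> (P y)"
      using dual[OF _ y(2)] normalized_in_frontier[OF y(1)] by (simp add: P_def \<sigma>_def)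
    moreover have "dual_pt (P y) = dual_pt y /\<^sub>R gauge_fn y" unfolding P_def using gp by (intro dual_pt_scale) simp
    moreover have "gauge_fn y *\<^sub>R (dual_pt y /\<^sub>R gauge_fn y) = dual_pt y" using gp by simp
    ultimately show ?thesis by simp
  qed
  have Ad: "(dual_pt has_derivative A y) (at y)" if y: "y \<in> V" for y
  proof -
    have y0: "y \<noteq> 0" "P y \<in> U'" using y by (auto simp: V_def)
    have g: "(gauge_fn has_derivative G' y) (at y)" unfolding G'_def by (rule gauge_has_derivative[OF y0(1)])
    have "((\<lambda>y. \<sigma> (P y)) has_derivative (\<lambda>v. \<sigma>' (P y) (P' y v))) (at y)"
      by (rule has_derivative_compose[OF Pd[OF y0(1)] \<sigma>d[OF y0(2)]])
    from has_derivative_scaleR[OF g this]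
    have "((\<lambda>y. gauge_fn y *\<^sub>R \<sigma> (P y)) has_derivative A y) (at y)"
      by (rule has_derivative_eq_rhs) (auto simp: A_def fun_eq_iff)
    then show ?thesis
      by (rule has_derivative_transform_within_open[OF _ V y]) (simp add: rep)
  qed
  have Ac: "continuous_on V (\<lambda>y. A y v)" for v
  proof -
    have V0: "V \<subseteq> - {0}" and PV: "P ` V \<subseteq> U" and PV': "\<And>y. y \<in> V \<Longrightarrow> q (P y) \<noteq> 0" by (auto simp: V_def U'_def)
    have gp: "\<And>y. y \<in> V \<Longrightarrow> gauge_fn y \<noteq> 0"
    proof -
      fix y assume "y \<in> V"
      then have "y \<noteq> 0" using V0 by auto
      then show "gauge_fn y \<noteq> 0" using gauge_pos[of y] by simp
    qed
    note [continuous_intros] = continuous_on_subset[OF cP V0] continuous_on_subset[OF dual_pt_continuous V0]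
    have c1: "continuous_on V (\<lambda>y. G' y v)" unfolding G'_def using gp by (intro continuous_intros) auto
    have c2: "continuous_on V (\<lambda>y. P' y v)" unfolding P'_def using gp by (intro continuous_intros c1) auto
    have c3: "continuous_on V (\<lambda>y. H (P y))" "continuous_on V (\<lambda>y. \<psi> (P y))" "continuous_on V (\<lambda>y. q (P y))"
      using PV by (auto intro!: continuous_on_compose2[OF U(5)] continuous_on_compose2[OF c\<psi>] continuous_on_compose2[OF cq] continuous_intros)
    have c4: "continuous_on V (\<lambda>y. blinfun_apply (H (P y)) (P' y v))"
      by (intro continuous_intros c2 c3)
    show ?thesis unfolding A_def \<sigma>_def \<sigma>'_def q'_def using PV' by (intro continuous_intros c1 c2 c3 c4) auto
  qed
  show ?thesis
    by (rule that[OF V _ _ Ad Ac]) (use x xU' in \<open>auto simp: V_def\<close>)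
qed

end

section \<open>Second order expansion of the squared gauge\<close>

text \<open>\<open>D x\<close> is the Hessian of half the squared gauge at x. Continuity is stated
  for each fixed vector, which in finite dimension amounts to continuity of D; the determinant
  condition is the form that positive curvature takes.\<close>

locale C1_dual_body = smooth_body_cart K for K :: "(real^'n) set" +
  fixes D :: "real^'n \<Rightarrow> real^'n \<Rightarrow> real^'n"
  assumes der: "x \<noteq> 0 \<Longrightarrow> (dual_pt has_derivative D x) (at x)"
    and D_cont: "continuous_on (- {0}) (\<lambda>x. D x v)"
    and det_pos: "x \<noteq> 0 \<Longrightarrow> det (matrix (D x)) > 0"
begin

lemma D_linear: "x \<noteq> 0 \<Longrightarrow> linear (D x)"
  using der has_derivative_linear by blast

definition Q :: "real^'n \<Rightarrow> real" where "Q z = (gauge_fn z)\<^sup>2 / 2"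

lemma Q_has_derivative:
  assumes "z \<noteq> 0" shows "(Q has_derivative (\<lambda>v. v \<bullet> dual_pt z)) (at z)"
proof -
  have "((\<lambda>z. (gauge_fn z)\<^sup>2) has_derivative (\<lambda>v. 2 * (v \<bullet> (dual_pt z /\<^sub>R gauge_fn z)) * gauge_fn z)) (at z)"
    using has_derivative_power[OF gauge_has_derivative[OF assms], of 2] by simp
  from has_derivative_mult_left[OF this, of "1/2"]
  have "((\<lambda>z. (gauge_fn z)\<^sup>2 / 2) has_derivative (\<lambda>v. 2 * (v \<bullet> (dual_pt z /\<^sub>R gauge_fn z)) * gauge_fn z * (1/2))) (at z)"
    by simp
  moreover have "2 * (v \<bullet> (dual_pt z /\<^sub>R gauge_fn z)) * gauge_fn z * (1/2) = v \<bullet> dual_pt z" for v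
    using gauge_pos[OF assms] by simp
  ultimately show ?thesis unfolding Q_def by (simp only:)
qed

lemma Q_line_derivative:
  assumes "p + t *\<^sub>R w \<noteq> 0"
  shows "((\<lambda>t. Q (p + t *\<^sub>R w)) has_real_derivative (w \<bullet> dual_pt (p + t *\<^sub>R w))) (at t)"
proof -
  have "((\<lambda>t. p + t *\<^sub>R w) has_derivative (\<lambda>t. t *\<^sub>R w)) (at t)" by (auto intro!: derivative_eq_intros)
  from has_derivative_compose[OF this Q_has_derivative[OF assms]]
  show ?thesis by (rule has_derivative_imp_has_field_derivative) simp
qed

lemma Q_convex: "x \<noteq> 0 \<Longrightarrow> Q x + (z - x) \<bullet> dual_pt x \<le> Q z"
proof -
  assume x: "x \<noteq> 0"
  have "z \<bullet> dual_pt x \<le> gauge_fn z * gauge_fn x" by (rule dual_pt(3)[OF x])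
  also have "\<dots> \<le> ((gauge_fn z)\<^sup>2 + (gauge_fn x)\<^sup>2) / 2"
    using sum_squares_bound[of "gauge_fn z" "gauge_fn x"] by simp
  finally show ?thesis by (simp add: Q_def inner_diff_left dual_pt(2)[OF x])
qed

text \<open>The mean value theorem in direction v leaves a difference of \<open>dual_pt\<close> in
  direction w, which the first-order expansion at x controls. Only differentiability of the gradient
  at x enters, as in the proof of Schwarz's theorem under this assumption.\<close>

lemma second_difference:
  assumes x: "x \<noteq> 0"
    and \<delta>: "\<And>h. norm h < \<delta> \<Longrightarrow> norm (dual_pt (x + h) - dual_pt x - D x h) \<le> e * norm h"
    and e: "e \<ge> 0" and t: "t > 0" "t * (norm v + norm w) < \<delta>" "t * (norm v + norm w) < norm x"
  shows "\<bar>(Q (x + t *\<^sub>R v + t *\<^sub>R w) - Q (x + t *\<^sub>R v) - Q (x + t *\<^sub>R w) + Q x) / t\<^sup>2 - D x w \<bullet> v\<bar> \<le> e * (2 * norm v + norm w) * norm v"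
proof -
  have lD: "linear (D x)" by (rule D_linear[OF x])
  have bnd: "norm (s *\<^sub>R v + r *\<^sub>R w) \<le> t * (norm v + norm w)" if "0 \<le> s" "s \<le> t" "0 \<le> r" "r \<le> t" for s r
  proof -
    have "norm (s *\<^sub>R v + r *\<^sub>R w) \<le> s * norm v + r * norm w" using that by (intro order_trans[OF norm_triangle_ineq]) simp
    also have "\<dots> \<le> t * norm v + t * norm w" using that by (intro add_mono mult_right_mono) auto
    finally show ?thesis by (simp add: distrib_left)
  qed
  have nz: "x + (s *\<^sub>R v + r *\<^sub>R w) \<noteq> 0" if "0 \<le> s" "s \<le> t" "0 \<le> r" "r \<le> t" for s r
  proof
    assume "x + (s *\<^sub>R v + r *\<^sub>R w) = 0"
    then have "norm x = norm (s *\<^sub>R v + r *\<^sub>R w)" by (metis add_eq_0_iff norm_minus_cancel)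
    then show False using bnd[OF that] t(3) by simp
  qed
  define \<phi> where "\<phi> s = Q ((x + t *\<^sub>R w) + s *\<^sub>R v) - Q (x + s *\<^sub>R v)" for s
  have "\<exists>z>0. z < t \<and> \<phi> t - \<phi> 0 = (t - 0) * (v \<bullet> dual_pt ((x + t *\<^sub>R w) + z *\<^sub>R v) - v \<bullet> dual_pt (x + z *\<^sub>R v))"
  proof (rule MVT2[OF t(1)])
    fix s assume s: "0 \<le> s" "s \<le> t"
    have "(x + t *\<^sub>R w) + s *\<^sub>R v \<noteq> 0" using nz[OF s, of t] t(1) by (simp add: add_ac)
    moreover have "x + s *\<^sub>R v \<noteq> 0" using nz[OF s, of 0] t(1) by simp
    ultimately show "(\<phi> has_real_derivative v \<bullet> dual_pt ((x + t *\<^sub>R w) + s *\<^sub>R v) - v \<bullet> dual_pt (x + s *\<^sub>R v)) (at s)"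
      unfolding \<phi>_def by (intro DERIV_diff Q_line_derivative)
  qed
  then obtain z where z: "0 < z" "z < t"
    "\<phi> t - \<phi> 0 = t * (v \<bullet> (dual_pt ((x + t *\<^sub>R w) + z *\<^sub>R v) - dual_pt (x + z *\<^sub>R v)))"
    by (auto simp: inner_diff_right)
  let ?E = "dual_pt ((x + t *\<^sub>R w) + z *\<^sub>R v) - dual_pt (x + z *\<^sub>R v) - D x (t *\<^sub>R w)"
  let ?h1 = "z *\<^sub>R v + t *\<^sub>R w" and ?h2 = "z *\<^sub>R v"
  have n1: "norm ?h1 \<le> t * (norm v + norm w)" using bnd[of z t] z t(1) by simp
  have n2: "norm ?h2 \<le> t * norm v" using z by (simp add: mult_right_mono)
  have "t * norm w \<ge> 0" "t * (norm v + norm w) = t * norm v + t * norm w" using t(1) by (simp_all add: distrib_left)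
  then have "norm ?h2 < \<delta>" using n2 t(2) by linarith
  then have e2: "norm (dual_pt (x + ?h2) - dual_pt x - D x ?h2) \<le> e * norm ?h2" by (rule \<delta>)
  have e1: "norm (dual_pt (x + ?h1) - dual_pt x - D x ?h1) \<le> e * norm ?h1" using n1 t(2) by (intro \<delta>) simp
  have "?E = (dual_pt (x + ?h1) - dual_pt x - D x ?h1) - (dual_pt (x + ?h2) - dual_pt x - D x ?h2)"
    by (simp add: linear_add[OF lD] add_ac)
  also have "norm \<dots> \<le> e * norm ?h1 + e * norm ?h2"
    by (rule order_trans[OF norm_triangle_ineq4]) (rule add_mono[OF e1 e2])
  also have "\<dots> \<le> e * (t * (norm v + norm w)) + e * (t * norm v)"
    using n1 n2 e by (intro add_mono mult_left_mono) auto
  also have "\<dots> = t * (e * (2 * norm v + norm w))" by (simp add: algebra_simps)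
  finally have E: "norm ?E \<le> t * (e * (2 * norm v + norm w))" .
  have "Q (x + t *\<^sub>R v + t *\<^sub>R w) - Q (x + t *\<^sub>R v) - Q (x + t *\<^sub>R w) + Q x = \<phi> t - \<phi> 0"
    by (simp add: \<phi>_def add_ac)
  also have "\<dots> = t * (v \<bullet> ?E) + t\<^sup>2 * (D x w \<bullet> v)"
    unfolding z(3) by (simp add: linear_scale[OF lD] inner_diff_right inner_commute power2_eq_square algebra_simps)
  finally have "(Q (x + t *\<^sub>R v + t *\<^sub>R w) - Q (x + t *\<^sub>R v) - Q (x + t *\<^sub>R w) + Q x) / t\<^sup>2 - D x w \<bullet> v = (v \<bullet> ?E) / t"
    using t(1) by (simp add: field_simps power2_eq_square)
  also have "\<bar>\<dots>\<bar> \<le> (norm v * (t * (e * (2 * norm v + norm w)))) / t"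
  proof -
    have "\<bar>v \<bullet> ?E\<bar> \<le> norm v * norm ?E" by (rule Cauchy_Schwarz_ineq2)
    also have "\<dots> \<le> norm v * (t * (e * (2 * norm v + norm w)))" using E by (rule mult_left_mono) simp
    finally have "\<bar>v \<bullet> ?E\<bar> / t \<le> (norm v * (t * (e * (2 * norm v + norm w)))) / t"
      using t(1) by (intro divide_right_mono) auto
    then show ?thesis using t(1) by (simp only: abs_divide abs_of_pos)
  qed
  also have "\<dots> = e * (2 * norm v + norm w) * norm v" using t(1) by simp
  finally show ?thesis .
qed

text \<open>The mixed second difference is symmetric in v and w and approximates both sides.\<close>

lemma D_symmetric:
  assumes x: "x \<noteq> 0" shows "D x v \<bullet> w = D x w \<bullet> v"
proof -
  define C where "C = (2 * norm v + norm w) * norm v + (2 * norm w + norm v) * norm w"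
  have "\<bar>D x w \<bullet> v - D x v \<bullet> w\<bar> \<le> e * C" if e: "e > 0" for e
  proof -
    obtain \<delta> where \<delta>: "\<delta> > 0" "\<And>y. norm (y - x) < \<delta> \<Longrightarrow> norm (dual_pt y - dual_pt x - D x (y - x)) \<le> e * norm (y - x)"
      using der[OF x] e unfolding has_derivative_at_alt by blast
    have \<delta>': "norm (dual_pt (x + h) - dual_pt x - D x h) \<le> e * norm h" if "norm h < \<delta>" for h
      using \<delta>(2)[of "x + h"] that by simp
    define m where "m = min \<delta> (norm x)"
    have m: "m > 0" "m \<le> \<delta>" "m \<le> norm x" using \<delta>(1) x by (auto simp: m_def)
    define t where "t = m / (norm v + norm w + 1)"
    have N: "norm v + norm w + 1 > 0" using norm_ge_zero[of v] norm_ge_zero[of w] by linarith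
    have t: "t > 0" using m N by (simp add: t_def)
    have "t * (norm v + norm w) < t * (norm v + norm w + 1)" using t by simp
    also have "\<dots> = m" using N by (simp add: t_def)
    finally have tm: "t * (norm v + norm w) < m" .
    let ?R = "(Q (x + t *\<^sub>R v + t *\<^sub>R w) - Q (x + t *\<^sub>R v) - Q (x + t *\<^sub>R w) + Q x) / t\<^sup>2"
    have 1: "\<bar>?R - D x w \<bullet> v\<bar> \<le> e * (2 * norm v + norm w) * norm v"
      using tm m e t by (intro second_difference[OF x \<delta>']) auto
    have "\<bar>(Q (x + t *\<^sub>R w + t *\<^sub>R v) - Q (x + t *\<^sub>R w) - Q (x + t *\<^sub>R v) + Q x) / t\<^sup>2 - D x v \<bullet> w\<bar> \<le> e * (2 * norm w + norm v) * norm w"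
      using tm m e t by (intro second_difference[OF x \<delta>']) (auto simp: add.commute)
    moreover have "Q (x + t *\<^sub>R w + t *\<^sub>R v) - Q (x + t *\<^sub>R w) - Q (x + t *\<^sub>R v) + Q x =
        Q (x + t *\<^sub>R v + t *\<^sub>R w) - Q (x + t *\<^sub>R v) - Q (x + t *\<^sub>R w) + Q x"
      by (simp add: add_ac)
    ultimately have 2: "\<bar>?R - D x v \<bullet> w\<bar> \<le> e * (2 * norm w + norm v) * norm w" by simp
    have "e * C = e * (2 * norm v + norm w) * norm v + e * (2 * norm w + norm v) * norm w"
      by (simp add: C_def algebra_simps)
    then show ?thesis using 1 2 by linarith
  qed
  then have *: "\<bar>D x w \<bullet> v - D x v \<bullet> w\<bar> \<le> e * C" if "e > 0" for e using that by blast
  have C0: "C \<ge> 0" by (simp add: C_def)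
  have "\<bar>D x w \<bullet> v - D x v \<bullet> w\<bar> \<le> 0 + e" if e: "e > 0" for e
  proof -
    have "e / (C + 1) * C \<le> e" using e C0 by (simp add: divide_le_eq mult_left_mono)
    then show ?thesis using *[of "e / (C + 1)"] e C0 by (simp add: add_nonneg_pos) 
  qed
  then have "\<bar>D x w \<bullet> v - D x v \<bullet> w\<bar> \<le> 0" by (rule field_le_epsilon)
  then show ?thesis by simp
qed

text \<open>Convexity of \<open>Q\<close> makes its gradient \<open>dual_pt\<close> monotone,
  whereas a negative value would let it decrease along w.\<close>

lemma D_psd:
  assumes x: "x \<noteq> 0" shows "D x w \<bullet> w \<ge> 0"
proof (rule ccontr)
  assume "\<not> ?thesis"
  then have neg: "D x w \<bullet> w < 0" by simp
  have "((\<lambda>t. x + t *\<^sub>R w) has_derivative (\<lambda>t. t *\<^sub>R w)) (at 0)" by (auto intro!: derivative_eq_intros)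
  moreover have "(dual_pt has_derivative D x) (at (x + 0 *\<^sub>R w))" using der[OF x] by simp
  ultimately have "((\<lambda>t. dual_pt (x + t *\<^sub>R w)) has_derivative (\<lambda>t. D x (t *\<^sub>R w))) (at 0)"
    by (rule has_derivative_compose)
  from has_derivative_inner_left[OF this, of w]
  have "((\<lambda>t. dual_pt (x + t *\<^sub>R w) \<bullet> w) has_real_derivative (D x w \<bullet> w)) (at 0)"
    by (rule has_derivative_imp_has_field_derivative) (simp add: linear_scale[OF D_linear[OF x]])
  from DERIV_neg_dec_right[OF this neg] obtain d where d: "d > 0" "\<And>h. 0 < h \<Longrightarrow> h < d \<Longrightarrow> dual_pt (x + h *\<^sub>R w) \<bullet> w < dual_pt x \<bullet> w"
    by auto
  define h where "h = min (d / 2) (norm x / (2 * (norm w + 1)))"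
  have nw: "norm w + 1 > 0" using norm_ge_zero[of w] by linarith
  have h: "0 < h" "h < d" "h \<le> norm x / (2 * (norm w + 1))" using d(1) x nw by (auto simp: h_def)
  have "h * (2 * (norm w + 1)) \<le> norm x" using h(3) nw by (simp add: pos_le_divide_eq)
  then have "h * norm w < norm x" using h(1) x
    by (smt (verit) distrib_left mult_nonneg_nonneg norm_ge_zero zero_less_norm_iff mult_left_mono)
  then have nz: "x + h *\<^sub>R w \<noteq> 0"
    using h(1) by (metis abs_of_pos add_eq_0_iff less_irrefl norm_minus_cancel norm_scaleR)
  have "Q x + (h *\<^sub>R w) \<bullet> dual_pt x \<le> Q (x + h *\<^sub>R w)" using Q_convex[OF x, of "x + h *\<^sub>R w"] by simp
  moreover have "Q (x + h *\<^sub>R w) - (h *\<^sub>R w) \<bullet> dual_pt (x + h *\<^sub>R w) \<le> Q x" using Q_convex[OF nz, of x] by simp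
  ultimately have "h * (dual_pt x \<bullet> w) \<le> h * (dual_pt (x + h *\<^sub>R w) \<bullet> w)" by (simp add: inner_commute)
  then have "dual_pt x \<bullet> w \<le> dual_pt (x + h *\<^sub>R w) \<bullet> w" using h(1) by simp
  then show False using d(2)[OF h(1,2)] by simp
qed

lemma D_inj: "x \<noteq> 0 \<Longrightarrow> D x w = 0 \<Longrightarrow> w = 0"
  using det_nz_iff_inj[OF D_linear] det_pos[of x] linear_injective_0[OF D_linear] by (metis less_irrefl)

text \<open>A zero of a positive semidefinite symmetric form lies in the kernel, which is trivial
  since the determinant is positive. Moving from w in the direction -D x w changes the form by t (t
  a - 2 b), negative for t = b / (a + 1).\<close>

lemma D_pos:
  assumes x: "x \<noteq> 0" and w: "w \<noteq> 0" shows "D x w \<bullet> w > 0"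
proof (rule ccontr)
  assume "\<not> ?thesis"
  then have 0: "D x w \<bullet> w = 0" using D_psd[OF x, of w] by simp
  note lin = D_linear[OF x]
  define v where "v = - D x w"
  define a where "a = D x v \<bullet> v"
  define b where "b = D x w \<bullet> D x w"
  have nz: "D x w \<noteq> 0" using D_inj[OF x] w by blast
  have b: "b > 0" using nz by (simp add: b_def)
  have a: "a \<ge> 0" unfolding a_def by (rule D_psd[OF x])
  have q: "D x (w + t *\<^sub>R v) \<bullet> (w + t *\<^sub>R v) = t\<^sup>2 * a - 2 * t * b" for t
  proof -
    have "D x v \<bullet> w = - b" using D_symmetric[OF x, of v w] by (simp add: v_def b_def)
    moreover have "D x w \<bullet> v = - b" by (simp add: v_def b_def)
    ultimately show ?thesis using 0
      by (simp add: linear_add[OF lin] linear_scale[OF lin] inner_add_left inner_add_right a_def[symmetric] power2_eq_square algebra_simps)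
  qed
  define t where "t = b / (a + 1)"
  have t: "t > 0" "t * a < 2 * b" 
  proof -
    show "t > 0" using a b by (simp add: t_def)
    have "t * a \<le> b" using a b by (simp add: t_def divide_le_eq)
    then show "t * a < 2 * b" using b by linarith
  qed
  have "t\<^sup>2 * a - 2 * t * b = t * (t * a - 2 * b)" by (simp add: power2_eq_square algebra_simps)
  then have "D x (w + t *\<^sub>R v) \<bullet> (w + t *\<^sub>R v) < 0" unfolding q using t by (simp add: mult_pos_neg)
  then show False using D_psd[OF x, of "w + t *\<^sub>R v"] by simp
qed

lemma D_scale:
  assumes c: "c > 0" and x: "x \<noteq> 0" shows "D (c *\<^sub>R x) = D x"
proof -
  have "((\<lambda>z. c *\<^sub>R z) has_derivative (\<lambda>v. c *\<^sub>R v)) (at x)" by (auto intro!: derivative_eq_intros)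
  from has_derivative_compose[OF this der[of "c *\<^sub>R x"]]
  have 1: "((\<lambda>z. dual_pt (c *\<^sub>R z)) has_derivative (\<lambda>v. D (c *\<^sub>R x) (c *\<^sub>R v))) (at x)" using c x by simp
  have "(\<lambda>z. dual_pt (c *\<^sub>R z)) = (\<lambda>z. c *\<^sub>R dual_pt z)" using dual_pt_scale[OF c] by auto
  moreover have "((\<lambda>z. c *\<^sub>R dual_pt z) has_derivative (\<lambda>v. c *\<^sub>R D x v)) (at x)"
    by (rule has_derivative_scaleR_right[OF der[OF x]])
  ultimately have "(\<lambda>v. D (c *\<^sub>R x) (c *\<^sub>R v)) = (\<lambda>v. c *\<^sub>R D x v)" using has_derivative_unique[OF 1] by simp
  then have "c *\<^sub>R D (c *\<^sub>R x) v = c *\<^sub>R D x v" for v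
    using linear_scale[OF D_linear[of "c *\<^sub>R x"]] c x by (metis scaleR_eq_0_iff less_irrefl)
  then show ?thesis using c by (auto simp: fun_eq_iff)
qed

lemma D_self:
  assumes x: "x \<noteq> 0" shows "D x x = dual_pt x"
proof -
  have "((\<lambda>t. t *\<^sub>R x) has_derivative (\<lambda>t. t *\<^sub>R x)) (at 1)" by (auto intro!: derivative_eq_intros)
  moreover have "(dual_pt has_derivative D x) (at (1 *\<^sub>R x))" using der[OF x] by simp
  ultimately have 1: "((\<lambda>t. dual_pt (t *\<^sub>R x)) has_derivative (\<lambda>t. D x (t *\<^sub>R x))) (at 1)"
    by (rule has_derivative_compose)
  have "((\<lambda>t. t *\<^sub>R dual_pt x) has_derivative (\<lambda>t. t *\<^sub>R dual_pt x)) (at (1::real))"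
    by (auto intro!: derivative_eq_intros)
  then have "((\<lambda>t. dual_pt (t *\<^sub>R x)) has_derivative (\<lambda>t. t *\<^sub>R dual_pt x)) (at 1)"
    by (rule has_derivative_transform_within_open[where s = "{0<..}"]) (auto simp: dual_pt_scale)
  from has_derivative_unique[OF 1 this] have "(\<lambda>t. D x (t *\<^sub>R x)) = (\<lambda>t. t *\<^sub>R dual_pt x)" .
  from fun_cong[OF this, of 1] show ?thesis by simp
qed

lemma D_expansion: "x \<noteq> 0 \<Longrightarrow> D x w = (\<Sum>i\<in>UNIV. (w $ i) *\<^sub>R D x (axis i 1))"
proof -
  assume x: "x \<noteq> 0"
  have "w = (\<Sum>i\<in>UNIV. (w $ i) *\<^sub>R axis i 1)"
    by (simp add: basis_expansion scalar_mult_eq_scaleR[symmetric])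
  then have "D x w = D x (\<Sum>i\<in>UNIV. (w $ i) *\<^sub>R axis i 1)" by simp
  also have "\<dots> = (\<Sum>i\<in>UNIV. (w $ i) *\<^sub>R D x (axis i 1))"
    using D_linear[OF x] by (simp add: linear_sum linear_scale)
  finally show ?thesis .
qed

lemma continuous_on_D:
  fixes f g :: "'b::topological_space \<Rightarrow> real^'n"
  assumes "continuous_on S f" "continuous_on S g" "\<And>x. x \<in> S \<Longrightarrow> f x \<noteq> 0"
  shows "continuous_on S (\<lambda>x. D (f x) (g x))"
proof -
  have "continuous_on S (\<lambda>x. \<Sum>i\<in>UNIV. (g x $ i) *\<^sub>R D (f x) (axis i 1))"
    using assms by (intro continuous_intros continuous_on_compose2[OF D_cont]) auto
  moreover have "D (f x) (g x) = (\<Sum>i\<in>UNIV. (g x $ i) *\<^sub>R D (f x) (axis i 1))" if "x \<in> S" for x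
    by (rule D_expansion[OF assms(3)[OF that]])
  ultimately show ?thesis by (simp cong: continuous_on_cong)
qed

lemma D_coercive:
  obtains a where "a > 0" "\<And>x w. x \<in> frontier K \<Longrightarrow> D x w \<bullet> w \<ge> a * (norm w)\<^sup>2"
proof -
  let ?C = "frontier K \<times> sphere (0::real^'n) 1"
  have c: "compact ?C" by (intro compact_Times compact_frontier_K compact_sphere)
  have cont: "continuous_on ?C (\<lambda>z. D (fst z) (snd z) \<bullet> snd z)"
    by (intro continuous_on_inner continuous_on_D continuous_intros) (auto dest: frontier_nonzero)
  have e: "(axis undefined 1 :: real^'n) \<noteq> 0" by (simp add: axis_eq_0_iff)
  from normalized_in_frontier[OF e] have ne: "?C \<noteq> {}" by force
  obtain m where m: "m \<in> ?C" "\<And>z. z \<in> ?C \<Longrightarrow> D (fst m) (snd m) \<bullet> snd m \<le> D (fst z) (snd z) \<bullet> snd z"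
    using continuous_attains_inf[OF c ne cont] by blast
  define a where "a = D (fst m) (snd m) \<bullet> snd m"
  have "fst m \<noteq> 0" "snd m \<noteq> 0" using m(1) frontier_nonzero by (auto simp: mem_Times_iff)
  then have a: "a > 0" unfolding a_def by (rule D_pos)
  show ?thesis
  proof (rule that[OF a])
    fix x w :: "real^'n" assume x: "x \<in> frontier K"
    show "D x w \<bullet> w \<ge> a * (norm w)\<^sup>2"
    proof (cases "w = 0")
      case False
      define v where "v = w /\<^sub>R norm w"
      have w: "w = norm w *\<^sub>R v" using False by (simp add: v_def)
      have "(x, v) \<in> ?C" using x False by (simp add: v_def)
      from m(2)[OF this] have "a \<le> D x v \<bullet> v" by (simp add: a_def)
      then have "a * (norm w)\<^sup>2 \<le> (D x v \<bullet> v) * (norm w)\<^sup>2" by (rule mult_right_mono) simp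
      also have "\<dots> = D x (norm w *\<^sub>R v) \<bullet> (norm w *\<^sub>R v)"
        by (simp add: linear_scale[OF D_linear[OF frontier_nonzero[OF x]]] power2_eq_square)
      finally show ?thesis using w by metis
    qed (simp add: linear_0[OF D_linear[OF frontier_nonzero[OF x]]])
  qed
qed

lemma D_uniformly_continuous:
  assumes e: "e > 0"
  obtains r where "r > 0" "\<And>x z w. x \<in> frontier K \<Longrightarrow> norm (z - x) \<le> r \<Longrightarrow> z \<noteq> 0 \<and> norm (D z w - D x w) \<le> e * norm w"
proof -
  obtain R where R: "R > 0" "cball 0 R \<subseteq> K" by (rule inner_ball)
  have far: "norm x \<ge> R" if x: "x \<in> frontier K" for x
  proof (rule ccontr)
    assume "\<not> ?thesis"
    then have "x \<in> interior K" using R(2) by (intro interiorI[of "ball 0 R"]) (auto simp: subset_iff)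
    then show False using x by (simp add: frontier_def)
  qed
  \<comment> \<open>A compact neighbourhood of the boundary that avoids 0, since boundary points
    have norm at least R.\<close>
  define C where "C = {x + v | x v. x \<in> frontier K \<and> v \<in> cball 0 (R / 2)}"
  have cC: "compact C" unfolding C_def by (rule compact_sums[OF compact_frontier_K compact_cball])
  have C0: "z \<noteq> 0" if "z \<in> C" for z
  proof -
    obtain x v where xv: "x \<in> frontier K" "norm v \<le> R / 2" "z = x + v" using \<open>z \<in> C\<close> unfolding C_def by auto
    have "norm v < norm x" using xv far[OF xv(1)] R(1) by linarith
    then show "z \<noteq> 0" using xv(3) by (metis add_eq_0_iff less_irrefl norm_minus_cancel)
  qed
  define e' where "e' = e / real CARD('n)"
  have e': "e' > 0" using e by (simp add: e'_def)
  have "\<exists>d>0. \<forall>x\<in>C. \<forall>z\<in>C. dist z x < d \<longrightarrow> dist (D z (axis i 1)) (D x (axis i 1)) < e'" for i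
  proof -
    have "continuous_on C (\<lambda>x. D x (axis i 1))" by (rule continuous_on_subset[OF D_cont]) (use C0 in auto)
    from compact_uniformly_continuous[OF this cC] show ?thesis
      using e' unfolding uniformly_continuous_on_def by blast
  qed
  then obtain d where d: "\<And>i. d i > 0" "\<And>i x z. x \<in> C \<Longrightarrow> z \<in> C \<Longrightarrow> dist z x < d i \<Longrightarrow> dist (D z (axis i 1)) (D x (axis i 1)) < e'"
    by metis
  define r where "r = min (R / 2) (Min (range d) / 2)"
  have Mp: "Min (range d) > 0" using d(1) by simp
  have r: "r > 0" using R(1) Mp by (simp add: r_def)
  show ?thesis
  proof (rule that[OF r])
    fix x z w :: "real^'n" assume x: "x \<in> frontier K" and z: "norm (z - x) \<le> r"
    have rR: "r \<le> R / 2" by (simp add: r_def)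
    have zC: "z \<in> C" unfolding C_def using x z rR by (intro CollectI exI[of _ x] exI[of _ "z - x"]) auto
    have xC: "x \<in> C" unfolding C_def using x R(1) by (intro CollectI exI[of _ x] exI[of _ 0]) auto
    have z0: "z \<noteq> 0" by (rule C0[OF zC])
    have x0: "x \<noteq> 0" by (rule C0[OF xC])
    have di: "norm (D z (axis i 1) - D x (axis i 1)) \<le> e'" for i
    proof -
      have "Min (range d) \<le> d i" by simp
      moreover have "norm (z - x) \<le> Min (range d) / 2" using z by (simp only: r_def)
      ultimately have "dist z x < d i" using Mp unfolding dist_norm by linarith
      from d(2)[OF xC zC this] show ?thesis by (simp add: dist_norm)
    qed
    have "D z w - D x w = (\<Sum>i\<in>UNIV. (w $ i) *\<^sub>R (D z (axis i 1) - D x (axis i 1)))"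
      by (subst (1) D_expansion[OF z0], subst (1) D_expansion[OF x0]) (simp add: sum_subtractf scaleR_diff_right)
    also have "norm \<dots> \<le> (\<Sum>i\<in>(UNIV::'n set). norm w * e')"
    proof (rule sum_norm_le)
      fix i :: 'n
      have "norm ((w $ i) *\<^sub>R (D z (axis i 1) - D x (axis i 1))) = \<bar>w $ i\<bar> * norm (D z (axis i 1) - D x (axis i 1))" by simp
      also have "\<dots> \<le> norm w * e'" by (intro mult_mono component_le_norm_cart di) auto
      finally show "norm ((w $ i) *\<^sub>R (D z (axis i 1) - D x (axis i 1))) \<le> norm w * e'" .
    qed
    also have "\<dots> = e * norm w" by (simp add: e'_def)
    finally show "z \<noteq> 0 \<and> norm (D z w - D x w) \<le> e * norm w" using z0 by blast
  qed
qed

text \<open>Uniform continuity of D near the boundary makes the derivative of s \<mapsto>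
  \<open>dual_pt\<close> (x + s w) - s D x w uniformly small; two applications of the mean value
  theorem carry this over to the squared gauge, with one radius for all x.\<close>

lemma Q_taylor:
  assumes e: "e > 0"
  obtains r where "r > 0" "\<And>x w. x \<in> frontier K \<Longrightarrow> norm w \<le> r \<Longrightarrow>
    \<bar>(gauge_fn (x + w))\<^sup>2 - 1 - 2 * (dual_pt x \<bullet> w) - D x w \<bullet> w\<bar> \<le> e * (norm w)\<^sup>2"
proof -
  have e2: "e / 2 > 0" using e by simp
  obtain r where r: "r > 0" "\<And>x z w. x \<in> frontier K \<Longrightarrow> norm (z - x) \<le> r \<Longrightarrow> z \<noteq> 0 \<and> norm (D z w - D x w) \<le> e / 2 * norm w"
    using D_uniformly_continuous[OF e2] by metis
  show ?thesis
  proof (rule that[OF r(1)])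
    fix x w :: "real^'n" assume x: "x \<in> frontier K" and w: "norm w \<le> r"
    have x0: "x \<noteq> 0" by (rule frontier_nonzero[OF x])
    have near: "norm ((x + t *\<^sub>R w) - x) \<le> r" if "0 \<le> t" "t \<le> 1" for t
    proof -
      have "norm ((x + t *\<^sub>R w) - x) = t * norm w" using that by simp
      also have "\<dots> \<le> 1 * norm w" using that by (intro mult_right_mono) auto
      finally show ?thesis using w by simp
    qed
    have dual: "norm (dual_pt (x + t *\<^sub>R w) - dual_pt x - D x (t *\<^sub>R w)) \<le> e / 2 * norm w * t" if t: "0 \<le> t" "t \<le> 1" for t
    proof -
      define f where "f s = dual_pt (x + s *\<^sub>R w) - s *\<^sub>R D x w" for s
      have "norm (f t - f 0) \<le> (e / 2 * norm w) * norm (t - 0)"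
      proof (rule differentiable_bound[where S = "{0..1}" and f' = "\<lambda>s h. D (x + s *\<^sub>R w) (h *\<^sub>R w) - h *\<^sub>R D x w"])
        fix s :: real assume s: "s \<in> {0..1}"
        then have s0: "x + s *\<^sub>R w \<noteq> 0" using r(2)[OF x near] by auto
        have "((\<lambda>s. x + s *\<^sub>R w) has_derivative (\<lambda>h. h *\<^sub>R w)) (at s within {0..1})" by (auto intro!: derivative_eq_intros)
        from has_derivative_compose[OF this der[OF s0]]
        show "(f has_derivative (\<lambda>h. D (x + s *\<^sub>R w) (h *\<^sub>R w) - h *\<^sub>R D x w)) (at s within {0..1})"
          unfolding f_def by (intro has_derivative_diff) (auto intro!: derivative_eq_intros)
        show "onorm (\<lambda>h. D (x + s *\<^sub>R w) (h *\<^sub>R w) - h *\<^sub>R D x w) \<le> e / 2 * norm w"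
        proof (rule onorm_le)
          fix h :: real
          have "D (x + s *\<^sub>R w) (h *\<^sub>R w) - h *\<^sub>R D x w = h *\<^sub>R (D (x + s *\<^sub>R w) w - D x w)"
            by (simp add: linear_scale[OF D_linear[OF s0]] scaleR_diff_right)
          also have "norm \<dots> \<le> \<bar>h\<bar> * (e / 2 * norm w)"
            unfolding norm_scaleR using r(2)[OF x near, of s w] s by (intro mult_left_mono) auto
          finally show "norm (D (x + s *\<^sub>R w) (h *\<^sub>R w) - h *\<^sub>R D x w) \<le> e / 2 * norm w * norm h" by (simp add: mult.commute)
        qed
      qed (use t in auto)
      moreover have "f t - f 0 = dual_pt (x + t *\<^sub>R w) - dual_pt x - D x (t *\<^sub>R w)"
        by (simp add: f_def linear_scale[OF D_linear[OF x0]])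
      ultimately show ?thesis using t by simp
    qed
    define \<phi> where "\<phi> t = Q (x + t *\<^sub>R w) - t * (dual_pt x \<bullet> w) - t\<^sup>2 / 2 * (D x w \<bullet> w)" for t
    have "\<exists>z>0. z < 1 \<and> \<phi> 1 - \<phi> 0 = (1 - 0) * (w \<bullet> dual_pt (x + z *\<^sub>R w) - dual_pt x \<bullet> w - z * (D x w \<bullet> w))"
    proof (rule MVT2)
      fix s :: real assume s: "0 \<le> s" "s \<le> 1"
      then have s0: "x + s *\<^sub>R w \<noteq> 0" using r(2)[OF x near] by auto
      show "(\<phi> has_real_derivative w \<bullet> dual_pt (x + s *\<^sub>R w) - dual_pt x \<bullet> w - s * (D x w \<bullet> w)) (at s)"
        unfolding \<phi>_def
        by (intro DERIV_diff Q_line_derivative[OF s0]) (auto intro!: derivative_eq_intros)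
    qed simp
    then obtain z where z: "0 < z" "z < 1"
      "\<phi> 1 - \<phi> 0 = w \<bullet> dual_pt (x + z *\<^sub>R w) - dual_pt x \<bullet> w - z * (D x w \<bullet> w)" by auto
    have "\<phi> 1 - \<phi> 0 = w \<bullet> (dual_pt (x + z *\<^sub>R w) - dual_pt x - D x (z *\<^sub>R w))"
      unfolding z(3) by (simp add: linear_scale[OF D_linear[OF x0]] inner_diff_right inner_commute)
    also have "\<bar>\<dots>\<bar> \<le> norm w * (e / 2 * norm w * z)"
      by (rule order_trans[OF Cauchy_Schwarz_ineq2 mult_left_mono[OF dual]]) (use z in auto)
    also have "\<dots> = (e / 2 * (norm w)\<^sup>2) * z" by (simp add: power2_eq_square)
    also have "\<dots> \<le> e / 2 * (norm w)\<^sup>2" using z e by (intro mult_left_le) auto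
    finally have "\<bar>\<phi> 1 - \<phi> 0\<bar> \<le> e / 2 * (norm w)\<^sup>2" .
    moreover have "\<phi> 1 - \<phi> 0 = ((gauge_fn (x + w))\<^sup>2 - 1 - 2 * (dual_pt x \<bullet> w) - D x w \<bullet> w) / 2"
      using x by (simp add: \<phi>_def Q_def frontier_iff_gauge)
    ultimately show "\<bar>(gauge_fn (x + w))\<^sup>2 - 1 - 2 * (dual_pt x \<bullet> w) - D x w \<bullet> w\<bar> \<le> e * (norm w)\<^sup>2" by simp
  qed
qed

text \<open>Radius and error are measured in the form \<open>D x\<close> instead of the Euclidean
  norm, so that the estimate becomes rotation invariant in coordinates where this form is the
  standard inner product. Coercivity of D permits the exchange.\<close>

lemma relative_taylor:
  assumes e: "e > 0"
  obtains r where "r > 0" "\<And>x w. x \<in> frontier K \<Longrightarrow> D x w \<bullet> w \<le> r\<^sup>2 \<Longrightarrow>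
    \<bar>(gauge_fn (x + w))\<^sup>2 - 1 - 2 * (dual_pt x \<bullet> w) - D x w \<bullet> w\<bar> \<le> e * (D x w \<bullet> w)"
proof -
  obtain a where a: "a > 0" "\<And>x w. x \<in> frontier K \<Longrightarrow> D x w \<bullet> w \<ge> a * (norm w)\<^sup>2"
    using D_coercive by metis
  have ea: "e * a > 0" using e a by simp
  obtain r where r: "r > 0" "\<And>x w. x \<in> frontier K \<Longrightarrow> norm w \<le> r \<Longrightarrow>
    \<bar>(gauge_fn (x + w))\<^sup>2 - 1 - 2 * (dual_pt x \<bullet> w) - D x w \<bullet> w\<bar> \<le> e * a * (norm w)\<^sup>2"
    using Q_taylor[OF ea] by metis
  show ?thesis
  proof (rule that[of "sqrt a * r"])
    show "sqrt a * r > 0" using a r by simp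
    fix x w :: "real^'n" assume x: "x \<in> frontier K" and w: "D x w \<bullet> w \<le> (sqrt a * r)\<^sup>2"
    have "a * (norm w)\<^sup>2 \<le> a * r\<^sup>2" using a(2)[OF x, of w] w less_imp_le[OF a(1)] by (simp add: power_mult_distrib)
    then have "(norm w)\<^sup>2 \<le> r\<^sup>2" using mult_le_cancel_left_pos[OF a(1), of "(norm w)\<^sup>2" "r\<^sup>2"] by blast
    then have "norm w \<le> r" by (rule power2_le_imp_le) (use r(1) in simp)
    from r(2)[OF x this] have "\<bar>(gauge_fn (x + w))\<^sup>2 - 1 - 2 * (dual_pt x \<bullet> w) - D x w \<bullet> w\<bar> \<le> e * (a * (norm w)\<^sup>2)" by simp
    also have "\<dots> \<le> e * (D x w \<bullet> w)" using a(2)[OF x] e by (simp add: mult_left_mono)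
    finally show "\<bar>(gauge_fn (x + w))\<^sup>2 - 1 - 2 * (dual_pt x \<bullet> w) - D x w \<bullet> w\<bar> \<le> e * (D x w \<bullet> w)" .
  qed
qed

definition \<Phi> :: "real^'n \<Rightarrow> real" where "\<Phi> x = det (matrix (D x))"

lemma \<Phi>_pos: "x \<noteq> 0 \<Longrightarrow> \<Phi> x > 0"
  unfolding \<Phi>_def by (rule det_pos)

lemma \<Phi>_scale: "c > 0 \<Longrightarrow> x \<noteq> 0 \<Longrightarrow> \<Phi> (c *\<^sub>R x) = \<Phi> x"
  by (simp add: \<Phi>_def D_scale)

lemma \<Phi>_continuous: "continuous_on (- {0}) \<Phi>"
  unfolding \<Phi>_def det_def matrix_def
  by (simp, intro continuous_intros D_cont)

lemma gauss_curvature_\<Phi>: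
  assumes x: "x \<in> frontier K"
  shows "gauss_curvature K x = \<Phi> x / norm (dual_pt x) ^ (CARD('n) + 1)"
  unfolding gauss_curvature_eq[OF x der[OF frontier_nonzero[OF x]]] \<Phi>_def inner_outer_normal[OF x]
  by (simp add: power_divide)

lemma dual_pt_surj:
  assumes y: "y \<noteq> 0"
  obtains a where "a \<in> frontier K" "y = supp K y *\<^sub>R dual_pt a"
proof -
  have p: "supp K y > 0" by (rule supp_pos[OF y])
  obtain a where a: "a \<in> K" "y \<bullet> a = supp K y" by (rule supp_attained)
  have yp: "y /\<^sub>R supp K y \<in> polar_body K" using p by (simp add: polar_iff_supp supp_scale)
  have "a \<bullet> (y /\<^sub>R supp K y) = 1" proof -
    have "a \<bullet> y = supp K y" using a(2) by (simp only: inner_commute)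
    then show ?thesis using p by simp
  qed
  moreover from inner_le_gauge[OF yp, of a] have "a \<bullet> (y /\<^sub>R supp K y) \<le> gauge_fn a" .
  ultimately have g: "gauge_fn a = 1" using a(1) mem_iff_gauge by force
  then have fa: "a \<in> frontier K" by (simp add: frontier_iff_gauge)
  have "dual_pt a = gauge_fn a *\<^sub>R (y /\<^sub>R supp K y)"
    by (rule dual_pt_eqI[OF frontier_nonzero[OF fa] yp]) (simp only: g \<open>a \<bullet> (y /\<^sub>R supp K y) = 1\<close>)
  then have "y = supp K y *\<^sub>R dual_pt a" using p by (simp add: g)
  from that[OF fa this] show thesis .
qed

text \<open>Two points of \<open>K\<close> with the same supporting functional y would be joined by
  a segment on which \<open>dual_pt\<close> is constantly y, so the derivative would vanish in the
  direction of the segment, against injectivity of D.\<close>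

lemma smooth_body_polar: "smooth_body_cart (polar_body K)"
proof -
  interpret P: conv_body "polar_body K" by (rule conv_body_polar)
  show ?thesis
  proof
    show "CARD('n) \<ge> 2" by (rule dim2)
    fix y x x' assume y: "y \<in> frontier (polar_body K)" and x: "x \<in> polar_body (polar_body K)" "x' \<in> polar_body (polar_body K)"
      and yx: "y \<bullet> x = 1" "y \<bullet> x' = 1"
    have yL: "y \<in> polar_body K" using y P.compact_K by (meson compact_imp_closed frontier_subset_closed subsetD)
    have K: "x \<in> K" "x' \<in> K" using x bipolar by auto
    have seg: "dual_pt (x + t *\<^sub>R (x' - x)) = y" if t: "0 \<le> t" "t \<le> 1" for t
    proof -
      let ?z = "x + t *\<^sub>R (x' - x)"
      have "?z = (1 - t) *\<^sub>R x + t *\<^sub>R x'" by (simp add: algebra_simps)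
      then have "?z \<in> K" using convexD[OF convex_K K, of "1 - t" t] t by simp
      then have "gauge_fn ?z \<le> 1" by (simp add: mem_iff_gauge)
      moreover have yz: "?z \<bullet> y = 1" using yx by (simp add: inner_add_right inner_diff_right inner_commute[of _ y])
      ultimately have g: "gauge_fn ?z = 1" using inner_le_gauge[OF yL, of ?z] by simp
      have z0: "?z \<noteq> 0" using g by (metis gauge_zero zero_neq_one)
      show ?thesis using dual_pt_eqI[OF z0 yL] yz g by simp
    qed
    have x0: "x \<noteq> 0" using yx by auto
    have "((\<lambda>t. x + t *\<^sub>R (x' - x)) has_derivative (\<lambda>t. t *\<^sub>R (x' - x))) (at 0 within {0..1})" by (auto intro!: derivative_eq_intros)
    moreover have "(dual_pt has_derivative D x) (at (x + 0 *\<^sub>R (x' - x)))" using der[OF x0] by simp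
    ultimately have "((\<lambda>t. dual_pt (x + t *\<^sub>R (x' - x))) has_derivative (\<lambda>t. D x (t *\<^sub>R (x' - x)))) (at 0 within {0..1})"
      by (rule has_derivative_compose)
    then have "((\<lambda>t. y) has_derivative (\<lambda>t. D x (t *\<^sub>R (x' - x)))) (at 0 within {0..1})"
      by (rule has_derivative_transform[rotated 2]) (auto simp: seg)
    then have "((\<lambda>t. y) has_derivative (\<lambda>t. t *\<^sub>R D x (x' - x))) (at 0 within {0..1})"
      by (simp add: linear_scale[OF D_linear[OF x0]])
    then have v1: "((\<lambda>t. y) has_vector_derivative (D x (x' - x))) (at 0 within {0..1})"
      by (simp add: has_vector_derivative_def)
    have v2: "((\<lambda>t. y) has_vector_derivative 0) (at (0::real) within {0..1})" by (rule has_vector_derivative_const)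
    have "at (0::real) within {0..1} \<noteq> bot" by (simp add: at_within_Icc_at_right)
    from vector_derivative_unique_within[OF this v1 v2] have "D x (x' - x) = 0" .
    from D_inj[OF x0 this] show "x = x'" by simp
  qed
qed

end

section \<open>Change of variables\<close>

definition relabel :: "('m \<Rightarrow> 'n) \<Rightarrow> real^'n \<Rightarrow> real^'m" where
  "relabel b x = (\<chi> i. x $ b i)"

lemma relabel_inverse:
  assumes "bij b" shows "relabel b (relabel (inv b) u) = u" "relabel (inv b) (relabel b x) = x"
  using assms by (simp_all add: relabel_def bij_is_inj bij_is_surj surj_f_inv_f vec_eq_iff)

lemma bounded_linear_relabel: "bounded_linear (relabel b)"
  by (auto simp: linear_conv_bounded_linear[symmetric] relabel_def vec_eq_iff intro!: linearI)

lemma measurable_relabel [measurable]: "relabel b \<in> borel \<rightarrow>\<^sub>M borel"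
  by (intro borel_measurable_continuous_onI linear_continuous_on bounded_linear_relabel)

lemma lborel_distr_permute_coordinates:
  assumes b: "bij (b :: 'm \<Rightarrow> 'n)"
  shows "(lborel :: (real^'m) measure) = distr lborel borel (relabel b :: real^'n \<Rightarrow> real^'m)"
proof (rule lborel_eqI)
  let ?R = "relabel b :: real^'n \<Rightarrow> real^'m"
  let ?R' = "relabel (inv b) :: real^'m \<Rightarrow> real^'n"
  fix l u :: "real^'m" assume le: "\<And>b. b \<in> Basis \<Longrightarrow> l \<bullet> b \<le> u \<bullet> b"
  have le': "l $ i \<le> u $ i" for i using le[of "axis i 1"] by (auto simp: Basis_vec_def inner_axis)
  have ib: "inv b (b i) = i" "b (inv b j) = j" for i j
    using b by (simp_all add: bij_is_inj bij_is_surj surj_f_inv_f)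
  have "?R -` box l u = box (?R' l) (?R' u)"
    by (auto simp: mem_box_cart relabel_def) (metis ib)+
  then have "emeasure (distr lborel borel ?R) (box l u) = emeasure lborel (box (?R' l) (?R' u))"
    by (simp add: emeasure_distr)
  also have "\<dots> = ennreal (\<Prod>b\<in>Basis. (?R' u - ?R' l) \<bullet> b)"
    using le' by (intro emeasure_lborel_box) (auto simp: Basis_vec_def inner_axis relabel_def)
  also have "(\<Prod>b\<in>Basis. (?R' u - ?R' l) \<bullet> b) = (\<Prod>i\<in>UNIV. u $ inv b i - l $ inv b i)"
    by (simp add: Basis_vec_def UNION_singleton_eq_range prod.reindex inj_on_def axis_eq_axis inner_axis relabel_def)
  also have "\<dots> = (\<Prod>i\<in>UNIV. u $ i - l $ i)"
    using prod.reindex_bij_betw[of "inv b" UNIV UNIV "\<lambda>i. u $ i - l $ i"] bij_imp_bij_inv[OF b] by simp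
  also have "\<dots> = (\<Prod>b\<in>Basis. (u - l) \<bullet> b)"
    by (simp add: Basis_vec_def UNION_singleton_eq_range prod.reindex inj_on_def axis_eq_axis inner_axis)
  finally show "emeasure (distr lborel borel ?R) (box l u) = ennreal (\<Prod>b\<in>Basis. (u - l) \<bullet> b)" .
qed simp

text \<open>Both determinants tell how the same map changes volume, and the renaming of coordinates
  preserves volume. Comparing the preimages of a ball therefore replaces a reindexing of the
  determinant sum across two index types.\<close>

lemma abs_det_permute_coordinates:
  fixes b :: "'m::finite \<Rightarrow> 'n::finite" and h :: "real^'n \<Rightarrow> real^'n"
  assumes b: "bij b" and h: "linear h" and det: "det (matrix h) \<noteq> 0"
  shows "\<bar>det (matrix (\<lambda>u :: real^'m. relabel b (h (relabel (inv b) u))))\<bar> = \<bar>det (matrix h)\<bar>"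
proof -
  let ?R = "relabel b :: real^'n \<Rightarrow> real^'m"
  let ?R' = "relabel (inv b) :: real^'m \<Rightarrow> real^'n"
  let ?h = "\<lambda>u. ?R (h (?R' u))"
  note RR = relabel_inverse[OF b]
  have linR: "linear ?R" "linear ?R'" by (simp_all add: linear_conv_bounded_linear bounded_linear_relabel)
  have lh: "linear ?h" using linear_compose[OF linear_compose[OF linR(2) h] linR(1)] by (simp add: comp_def)
  have inj: "inj h" using det_nz_iff_inj[OF h] det by blast
  have "inj ?h" proof (rule injI)
    fix u v assume "?h u = ?h v"
    then have "?R' (?h u) = ?R' (?h v)" by (rule arg_cong)
    then have "?R' u = ?R' v" unfolding RR by (rule injD[OF inj])
    then have "?R (?R' u) = ?R (?R' v)" by (rule arg_cong)
    then show "u = v" unfolding RR .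
  qed
  then have det': "det (matrix ?h) \<noteq> 0" using det_nz_iff_inj[OF lh] by blast
  have [measurable]: "?h \<in> borel \<rightarrow>\<^sub>M borel" by (rule measurable_linear_cart[OF lh])
  have mR: "emeasure lborel X = emeasure lborel (?R -` X)" if "X \<in> sets borel" for X
    using that by (subst lborel_distr_permute_coordinates[OF b]) (simp add: emeasure_distr)
  let ?B = "ball (0::real^'m) 1"
  have hB: "?h -` ?B \<in> sets borel" using measurable_sets[of ?h borel borel ?B] by simp
  have RB: "?R -` ?B \<in> sets borel" using measurable_sets[of ?R borel borel ?B] by simp
  have "?R -` (?h -` ?B) = h -` (?R -` ?B)" by (auto simp: RR)
  then have e: "emeasure lborel (?h -` ?B) = emeasure lborel (h -` (?R -` ?B))" using mR[OF hB] by simp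
  have 1: "emeasure lborel ?B = ennreal \<bar>det (matrix ?h)\<bar> * emeasure lborel (h -` (?R -` ?B))"
    unfolding e[symmetric] by (rule emeasure_lborel_linear_vimage[OF lh det']) simp
  have 2: "emeasure lborel ?B = ennreal \<bar>det (matrix h)\<bar> * emeasure lborel (h -` (?R -` ?B))"
    unfolding mR[of ?B, simplified] by (rule emeasure_lborel_linear_vimage[OF h det RB])
  have fin1: "emeasure lborel ?B < \<infinity>" using emeasure_lborel_ball_finite[of 0 1] by simp
  have "emeasure lborel ?B = ennreal (measure lborel ?B)"
    by (rule emeasure_eq_ennreal_measure) (use fin1 in simp)
  moreover have "measure lborel ?B > 0" using content_ball_pos[of 1 "0::real^'m"] by simp
  ultimately have fin: "emeasure lborel ?B < \<infinity>" "emeasure lborel ?B > 0" using fin1 by simp_all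
  obtain r where r: "r \<ge> 0" "emeasure lborel (h -` (?R -` ?B)) = ennreal r"
  proof (cases "emeasure lborel (h -` (?R -` ?B))")
    case top
    then show ?thesis using 2 det fin(1) by (simp add: ennreal_mult_top)
  qed (use that in blast)
  have "r \<noteq> 0" using 2 fin(2) r(2) by auto
  then have "r > 0" using r(1) by simp
  moreover have "ennreal (\<bar>det (matrix ?h)\<bar> * r) = ennreal (\<bar>det (matrix h)\<bar> * r)"
    using 1 2 r by (simp add: ennreal_mult)
  ultimately show ?thesis by simp
qed

text \<open>The change of variables theorem of the library needs a well-ordered index type; the result for arbitrary index types
  is obtained by renaming the coordinates.\<close>

typedef (overloaded) ('n::finite) nat_index = "{..<CARD('n)}" by (rule exI[of _ 0]) (simp add: card_gt_0_iff)

instance nat_index :: (finite) finite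
proof
  have "range (Rep_nat_index :: 'a nat_index \<Rightarrow> nat) \<subseteq> {..<CARD('a)}" using Rep_nat_index by blast
  then have "finite (range (Rep_nat_index :: 'a nat_index \<Rightarrow> nat))" by (rule finite_subset) simp
  then show "finite (UNIV :: 'a nat_index set)"
    by (rule finite_imageD) (simp add: inj_def Rep_nat_index_inject)
qed

instantiation nat_index :: (finite) wellorder
begin
definition "x \<le> y \<longleftrightarrow> Rep_nat_index x \<le> Rep_nat_index y"
definition "x < y \<longleftrightarrow> Rep_nat_index x < Rep_nat_index y"
instance
proof
  fix x y z :: "'a nat_index"
  show "x < y \<longleftrightarrow> x \<le> y \<and> \<not> y \<le> x" "x \<le> x" "x \<le> y \<or> y \<le> x"
    unfolding less_eq_nat_index_def less_nat_index_def by linarith+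
  show "x \<le> z" if "x \<le> y" "y \<le> z" using that unfolding less_eq_nat_index_def by linarith
  show "x = y" if "x \<le> y" "y \<le> x"
    using that unfolding less_eq_nat_index_def Rep_nat_index_inject[symmetric] by linarith
next
  fix P :: "'a nat_index \<Rightarrow> bool" and a :: "'a nat_index"
  assume step: "\<And>x. (\<And>y. y < x \<Longrightarrow> P y) \<Longrightarrow> P x"
  show "P a"
    by (rule measure_induct_rule[of Rep_nat_index]) (rule step, simp add: less_nat_index_def)
qed
end

lemma integral_change_of_variables:
  fixes g :: "real^'n \<Rightarrow> real^'n" and f :: "real^'n \<Rightarrow> real"
  assumes S: "S \<in> sets borel" and gS: "g ` S \<in> sets borel" and f [measurable]: "f \<in> borel_measurable borel"
    and der: "\<And>x. x \<in> S \<Longrightarrow> (g has_derivative g' x) (at x)"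
    and det: "\<And>x. x \<in> S \<Longrightarrow> det (matrix (g' x)) > 0" and inj: "inj_on g S"
    and int: "integrable lborel (\<lambda>x. indicator S x * (det (matrix (g' x)) * f (g x)))"
  shows "(LINT y|lborel. indicator (g ` S) y * f y) = (LINT x|lborel. indicator S x * (det (matrix (g' x)) * f (g x)))"
proof -
  have "card (UNIV :: 'n nat_index set) = CARD('n)"
    using type_definition.card[OF type_definition_nat_index] by simp
  then obtain b :: "'n nat_index \<Rightarrow> 'n" where b: "bij b"
    using finite_same_card_bij[of "UNIV :: 'n nat_index set" "UNIV :: 'n set"] by auto
  let ?R = "relabel b :: real^'n \<Rightarrow> real^'n nat_index"
  let ?R' = "relabel (inv b) :: real^'n nat_index \<Rightarrow> real^'n"
  note RR = relabel_inverse[OF b]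
  note [simp] = RR
  note blR = bounded_linear_relabel[of b] bounded_linear_relabel[of "inv b"]
  note [measurable] = S gS
  have tr: "(LINT u|lborel. F (?R' u)) = (LINT x|lborel. F x)" "integrable lborel (\<lambda>u. F (?R' u)) \<longleftrightarrow> integrable lborel F"
    if [measurable]: "F \<in> borel_measurable borel" for F :: "real^'n \<Rightarrow> real"
  proof -
    have m: "(\<lambda>u. F (?R' u)) \<in> borel_measurable borel" by measurable
    have R: "?R \<in> lborel \<rightarrow>\<^sub>M borel" by simp
    show "(LINT u|lborel. F (?R' u)) = (LINT x|lborel. F x)"
      unfolding lborel_distr_permute_coordinates[OF b] integral_distr[OF R m] by simp
    show "integrable lborel (\<lambda>u. F (?R' u)) \<longleftrightarrow> integrable lborel F"
      unfolding lborel_distr_permute_coordinates[OF b] integrable_distr_eq[OF R m] by simp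
  qed
  define S' where "S' = ?R' -` S"
  define G where "G u = ?R (g (?R' u))" for u
  define G' where "G' u = (\<lambda>v. ?R (g' (?R' u) (?R' v)))" for u
  \<comment> \<open>The substitution theorem is stated for functions with values in a Cartesian
    space, hence the detour through \<open>real^1\<close>; it also works with the completed measure,
    from which the result is brought back to \<open>lborel\<close>.\<close>
  define f' where "f' u = (vec (f (?R' u)) :: real^1)" for u
  have S': "S' \<in> sets borel" unfolding S'_def using measurable_sets[of ?R' borel borel S] by simp
  have GS: "G ` S' = ?R' -` (g ` S)"
  proof -
    have "y \<in> G ` S'" if "?R' y = g x" "x \<in> S" for x y
    proof (rule image_eqI)
      have "y = ?R (?R' y)" by simp
      then show "y = G (?R x)" by (simp only: that(1) G_def RR)
      show "?R x \<in> S'" using that(2) by (simp add: S'_def)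
    qed
    moreover have "?R' (G u) \<in> g ` S" if "u \<in> S'" for u
      using that by (simp add: G_def S'_def)
    ultimately show ?thesis by blast
  qed
  have GS': "G ` S' \<in> sets borel" unfolding GS using measurable_sets[of ?R' borel borel "g ` S"] by simp
  have derG: "(G has_derivative G' u) (at u within S')" if "u \<in> S'" for u
  proof -
    have "(?R' has_derivative ?R') (at u within S')" by (rule bounded_linear_imp_has_derivative[OF blR(2)])
    moreover have "(g has_derivative g' (?R' u)) (at (?R' u))" by (rule der) (use that in \<open>simp add: S'_def\<close>)
    ultimately have "((\<lambda>u. g (?R' u)) has_derivative (\<lambda>v. g' (?R' u) (?R' v))) (at u within S')"
      by (rule has_derivative_compose)
    from bounded_linear.has_derivative[OF blR(1) this] show ?thesis by (simp add: G_def[abs_def] G'_def)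
  qed
  have injG: "inj_on G S'"
  proof (rule inj_onI)
    fix u v assume uv: "u \<in> S'" "v \<in> S'" "G u = G v"
    have "g (?R' u) = g (?R' v)" using arg_cong[OF uv(3)[unfolded G_def], of ?R'] by simp
    then have "?R' u = ?R' v" by (rule inj_onD[OF inj]) (use uv(1,2) in \<open>simp_all add: S'_def\<close>)
    then have "?R (?R' u) = ?R (?R' v)" by (rule arg_cong)
    then show "u = v" by simp
  qed
  have detG: "\<bar>det (matrix (G' u))\<bar> = det (matrix (g' (?R' u)))" if "u \<in> S'" for u
  proof -
    have x: "?R' u \<in> S" using that by (simp add: S'_def)
    have "\<bar>det (matrix (G' u))\<bar> = \<bar>det (matrix (g' (?R' u)))\<bar>"
      unfolding G'_def
      by (rule abs_det_permute_coordinates[OF b has_derivative_linear[OF der[OF x]]]) (use det[OF x] in simp)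
    then show ?thesis using det[OF x] by simp
  qed
  let ?h = "\<lambda>x. indicator S x * (det (matrix (g' x)) * f (g x))"
  have hm [measurable]: "?h \<in> borel_measurable borel" using borel_measurable_integrable[OF int] by simp
  have intu: "integrable lborel (\<lambda>u. ?h (?R' u))" using int tr(2)[OF hm] by simp
  have eqv: "indicator S' u *\<^sub>R (\<bar>det (matrix (G' u))\<bar> *\<^sub>R f' (G u)) = (vec (?h (?R' u)) :: real^1)" for u
    using detG[of u] by (cases "u \<in> S'") (simp_all add: S'_def f'_def G_def vec_eq_iff)
  have vecbl: "bounded_linear (vec :: real \<Rightarrow> real^1)"
    by (auto simp: linear_conv_bounded_linear[symmetric] vec_eq_iff intro!: linearI)
  have "integrable lborel (\<lambda>u. vec (?h (?R' u)) :: real^1)"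
    by (rule integrable_bounded_linear[OF vecbl intu])
  note intv = this
  then have ai: "(\<lambda>u. \<bar>det (matrix (G' u))\<bar> *\<^sub>R f' (G u)) absolutely_integrable_on S'"
    unfolding set_integrable_def eqv by (rule integrable_completion[THEN iffD2, rotated]) (rule borel_measurable_integrable[OF intv])
  define I where "I = integral S' (\<lambda>u. \<bar>det (matrix (G' u))\<bar> *\<^sub>R f' (G u))"
  have S'l: "S' \<in> sets lebesgue" using S' by (simp add: sets_completionI_sets)
  have "(\<lambda>u. \<bar>det (matrix (G' u))\<bar> *\<^sub>R f' (G u)) absolutely_integrable_on S' \<and>
      integral S' (\<lambda>u. \<bar>det (matrix (G' u))\<bar> *\<^sub>R f' (G u)) = I \<longleftrightarrow>
      f' absolutely_integrable_on (G ` S') \<and> integral (G ` S') f' = I"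
    by (rule has_absolute_integral_change_of_variables[OF S'l derG injG])
  then have cv: "f' absolutely_integrable_on G ` S'" "integral (G ` S') f' = I"
    using ai I_def by blast+
  have "integral S' (\<lambda>u. \<bar>det (matrix (G' u))\<bar> *\<^sub>R f' (G u)) = (LINT u|lebesgue. (vec (?h (?R' u)) :: real^1))"
    using set_lebesgue_integral_eq_integral(2)[OF ai] unfolding set_lebesgue_integral_def eqv by simp
  also have "\<dots> = (LINT u|lborel. (vec (?h (?R' u)) :: real^1))"
    by (rule integral_completion) (use borel_measurable_integrable[OF \<open>integrable lborel (\<lambda>u. vec (?h (?R' u)) :: real^1)\<close>] in simp)
  also have "\<dots> = vec (LINT u|lborel. ?h (?R' u))"
    by (rule integral_bounded_linear[OF vecbl intu])
  also have "\<dots> = vec (LINT x|lborel. ?h x)" using tr(1)[OF hm] by simp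
  finally have R: "I = vec (LINT x|lborel. ?h x)" unfolding I_def .
  let ?k = "\<lambda>y. indicator (g ` S) y * f y"
  have km: "?k \<in> borel_measurable borel" by measurable
  have eqk: "indicator (G ` S') u *\<^sub>R f' u = vec (?k (?R' u))" for u
    unfolding GS by (simp add: f'_def vec_eq_iff indicator_def)
  have "integral (G ` S') f' = (LINT u|lebesgue. (vec (?k (?R' u)) :: real^1))"
    using set_lebesgue_integral_eq_integral(2)[OF cv(1)] unfolding set_lebesgue_integral_def eqk by simp
  moreover have km': "(\<lambda>u. vec (?k (?R' u)) :: real^1) \<in> borel_measurable borel"
  proof -
    have "(vec :: real \<Rightarrow> real^1) \<in> borel_measurable borel"
      by (rule borel_measurable_continuous_onI[OF linear_continuous_on[OF vecbl]])
    from measurable_compose[OF measurable_compose[OF measurable_relabel km] this] show ?thesis .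
  qed
  moreover have "(LINT u|lebesgue. (vec (?k (?R' u)) :: real^1)) = (LINT u|lborel. (vec (?k (?R' u)) :: real^1))"
    by (rule integral_completion) (simp only: measurable_lborel2 km')
  moreover have "integrable lborel (\<lambda>u. ?k (?R' u))"
  proof -
    have "integrable lebesgue (\<lambda>u. vec (?k (?R' u)) :: real^1)"
      by (rule cv(1)[unfolded set_integrable_def eqk])
    then have "integrable lborel (\<lambda>u. vec (?k (?R' u)) :: real^1)"
      by (rule integrable_completion[THEN iffD1, rotated]) (simp only: measurable_lborel2 km')
    from integrable_bounded_linear[OF bounded_linear_vec_nth this, of 1] show ?thesis by simp
  qed
  then have "(LINT u|lborel. (vec (?k (?R' u)) :: real^1)) = vec (LINT u|lborel. ?k (?R' u))"
    by (rule integral_bounded_linear[OF vecbl])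
  ultimately have "(vec (LINT x|lborel. ?k x) :: real^1) = vec (LINT x|lborel. ?h x)"
    using cv(2) R tr(1)[OF km] by simp
  then show ?thesis by (simp add: vec_eq_iff)
qed

section \<open>Affine surface areas as volume integrals\<close>

context smooth_body_cart
begin

text \<open>The common source for affine surface areas and cap masses. With N the norm of
  \<open>dual_pt\<close>, the curvature contributes N^(-(n+1) a), the support distance N^(-c) and
  the surface density N; \<open>ac\<close> makes these cancel. The density \<phi> is kept abstract
  because the formula is applied to both the body and its polar.\<close>

lemma surface_integral_powr:
  assumes curv: "\<And>x. x \<in> frontier K \<Longrightarrow> gauss_curvature K x = \<phi> x / norm (dual_pt x) ^ (CARD('n) + 1)"
    and pos: "\<And>x. x \<noteq> 0 \<Longrightarrow> \<phi> x > 0" and hom: "\<And>c x. c > 0 \<Longrightarrow> x \<noteq> 0 \<Longrightarrow> \<phi> (c *\<^sub>R x) = \<phi> x"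
    and [measurable]: "\<phi> \<in> borel_measurable borel" "A \<in> sets borel"
    and ac: "(real CARD('n) + 1) * a + c = 1"
  shows "(LINT x|surface_measure K. indicator A x * (gauss_curvature K x powr a * (x \<bullet> outer_normal K x) powr c)) =
    real CARD('n) * (LINT x|lborel. indicator (K - {0}) x * (indicator A (proj x) * \<phi> x powr a))"
proof -
  let ?F = "\<lambda>x. indicator A x * (gauss_curvature K x powr a * (x \<bullet> outer_normal K x) powr c)"
  let ?G = "\<lambda>x. indicator A x * ((\<phi> x / norm (dual_pt x) ^ (CARD('n) + 1)) powr a * (1 / norm (dual_pt x)) powr c) :: real"
  have FG: "?F x = ?G x" if "x \<in> frontier K" for x
    using curv[OF that] inner_outer_normal[OF that] by simp
  have "?G \<in> borel_measurable borel" by measurable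
  then have "?G \<in> borel_measurable (restrict_space borel (frontier K))" by (rule measurable_restrict_space1)
  then have F: "?F \<in> borel_measurable (restrict_space borel (frontier K))"
    by (rule measurable_cong[THEN iffD1, rotated]) (simp add: space_restrict_space FG)
  have val: "?F z * norm (dual_pt z) = indicator A z * \<phi> z powr a" if z: "z \<in> frontier K" for z
  proof -
    define N where "N = norm (dual_pt z)"
    have N: "N > 0" using dual_pt_nonzero[OF frontier_nonzero[OF z]] by (simp add: N_def)
    have f: "\<phi> z > 0" by (rule pos[OF frontier_nonzero[OF z]])
    have "(\<phi> z / N ^ (CARD('n) + 1)) powr a = \<phi> z powr a * N powr (- (real CARD('n) + 1) * a)"
    proof -
      have "N ^ (CARD('n) + 1) = N powr (real CARD('n) + 1)" using powr_realpow[OF N, of "CARD('n) + 1"] by (simp add: add.commute)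
      then have "(\<phi> z / N ^ (CARD('n) + 1)) powr a = \<phi> z powr a / (N powr (real CARD('n) + 1)) powr a"
        using f N by (simp add: powr_divide)
      then show ?thesis by (simp only: powr_powr powr_minus_divide minus_mult_left[symmetric]) simp
    qed
    moreover have "(1 / N) powr c = N powr (- c)" using N by (simp add: powr_divide powr_minus_divide)
    moreover have "N powr (- (real CARD('n) + 1) * a) * N powr (- c) * N powr 1 = 1"
    proof -
      have "- (real CARD('n) + 1) * a + - c + 1 = 0" using ac by (simp add: algebra_simps)
      then show ?thesis using N by (simp only: powr_add[symmetric] powr_zero_eq_one) simp
    qed
    ultimately have "(\<phi> z / N ^ (CARD('n) + 1)) powr a * (1 / N) powr c * N = \<phi> z powr a"
      using N by (simp add: mult.assoc)
    then show ?thesis unfolding FG[OF z] N_def by (simp add: mult.assoc)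
  qed
  have "(LINT x|lborel. indicator (K - {0}) x * (?F (proj x) * norm (dual_pt (proj x)))) =
      (LINT x|lborel. indicator (K - {0}) x * (indicator A (proj x) * \<phi> x powr a))"
  proof (rule Bochner_Integration.integral_cong[OF refl])
    fix x
    show "indicator (K - {0}) x * (?F (proj x) * norm (dual_pt (proj x))) = indicator (K - {0}) x * (indicator A (proj x) * \<phi> x powr a)"
    proof (cases "x = 0")
      case False
      have "proj x \<in> frontier K" unfolding proj_def by (rule normalized_in_frontier[OF False])
      moreover have "\<phi> (proj x) = \<phi> x" unfolding proj_def using gauge_pos[OF False] False by (intro hom) auto
      ultimately show ?thesis using val[of "proj x"] by simp
    qed simp
  qed
  then show ?thesis unfolding integral_surface_measure[OF F] by simp
qed

text \<open>The exponents p / (n+p) and -n (p-1) / (n+p) satisfy the cancellation condition for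
  every p, and so do 1 and -n, which belong to the infinite index.\<close>

lemma affine_surface_area_eq:
  assumes curv: "\<And>x. x \<in> frontier K \<Longrightarrow> gauss_curvature K x = \<phi> x / norm (dual_pt x) ^ (CARD('n) + 1)"
    and pos: "\<And>x. x \<noteq> 0 \<Longrightarrow> \<phi> x > 0" and hom: "\<And>c x. c > 0 \<Longrightarrow> x \<noteq> 0 \<Longrightarrow> \<phi> (c *\<^sub>R x) = \<phi> x"
    and meas: "\<phi> \<in> borel_measurable borel"
  shows "p \<noteq> - real CARD('n) \<Longrightarrow> affine_surface_area (ereal p) K =
      real CARD('n) * (LINT x|lborel. indicator (K - {0}) x * \<phi> x powr (p / (real CARD('n) + p)))"
    and "affine_surface_area \<infinity> K = real CARD('n) * (LINT x|lborel. indicator (K - {0}) x * \<phi> x)"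
proof -
  let ?n = "real CARD('n)"
  show "affine_surface_area (ereal p) K = ?n * (LINT x|lborel. indicator (K - {0}) x * \<phi> x powr (p / (?n + p)))"
    if p: "p \<noteq> - ?n"
  proof -
    have np: "?n + p \<noteq> 0" using p by linarith
    have ac: "(?n + 1) * (p / (?n + p)) + - (?n * (p - 1) / (?n + p)) = 1"
      using np by (simp add: divide_simps) (simp add: algebra_simps)
    show ?thesis
      using surface_integral_powr[OF curv pos hom meas _ ac, of UNIV]
      by (simp add: affine_surface_area_def Let_def powr_minus_divide)
  qed
  have ac: "(?n + 1) * 1 + - ?n = 1" by simp
  have N: "x \<bullet> outer_normal K x > 0" if "x \<in> frontier K" for x
    unfolding inner_outer_normal[OF that] using dual_pt_nonzero[OF frontier_nonzero[OF that]] by simp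
  have sp: "space (surface_measure K) = frontier K"
    by (simp add: surface_measure_def space_restrict_space hausdorff_measure_def)
  have "(LINT x|surface_measure K. gauss_curvature K x / (x \<bullet> outer_normal K x) ^ CARD('n)) =
    (LINT x|surface_measure K. indicator UNIV x * (gauss_curvature K x powr 1 * (x \<bullet> outer_normal K x) powr (- ?n)))"
  proof (rule Bochner_Integration.integral_cong[OF refl])
    fix x assume "x \<in> space (surface_measure K)"
    then have x: "x \<in> frontier K" by (simp add: sp)
    have "gauss_curvature K x \<ge> 0" unfolding curv[OF x] using less_imp_le[OF pos[OF frontier_nonzero[OF x]]] by simp
    then show "gauss_curvature K x / (x \<bullet> outer_normal K x) ^ CARD('n) =
        indicator UNIV x * (gauss_curvature K x powr 1 * (x \<bullet> outer_normal K x) powr (- ?n))"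
      using N[OF x] by (simp add: powr_minus_divide powr_realpow)
  qed
  also have "\<dots> = ?n * (LINT x|lborel. indicator (K - {0}) x * (indicator UNIV (proj x) * \<phi> x powr 1))"
    by (rule surface_integral_powr[OF curv pos hom meas _ ac]) auto
  also have "(LINT x|lborel. indicator (K - {0}) x * (indicator UNIV (proj x) * \<phi> x powr 1)) = (LINT x|lborel. indicator (K - {0}) x * \<phi> x)"
  proof (rule Bochner_Integration.integral_cong[OF refl])
    fix x show "indicator (K - {0}) x * (indicator UNIV (proj x) * \<phi> x powr 1) = indicator (K - {0}) x * \<phi> x"
      using less_imp_le[OF pos[of x]] by (cases "x = 0") auto
  qed
  finally show "affine_surface_area \<infinity> K = ?n * (LINT x|lborel. indicator (K - {0}) x * \<phi> x)"
    by (simp add: affine_surface_area_def)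
qed

end

context C1_dual_body
begin

interpretation P: smooth_body_cart "polar_body K" by (rule smooth_body_polar)

lemma P_gauge: "P.gauge_fn = supp K" by (simp add: bipolar)

text \<open>The normalised point x is the one at which \<open>dual_pt x\<close> attains its maximum
  over \<open>K\<close>, so the duality map of the polar body is the inverse map.\<close>

lemma P_dual_pt_dual_pt [simp]: "P.dual_pt (dual_pt x) = x"
proof (cases "x = 0")
  case False
  have gp: "gauge_fn x > 0" by (rule gauge_pos[OF False])
  have "x /\<^sub>R gauge_fn x \<in> frontier K" by (rule normalized_in_frontier[OF False])
  then have "x /\<^sub>R gauge_fn x \<in> K" using compact_K by (meson compact_imp_closed frontier_subset_closed subsetD)
  then have "P.dual_pt (dual_pt x) = supp K (dual_pt x) *\<^sub>R (x /\<^sub>R gauge_fn x)"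
    using dual_pt(2)[OF False] gp
    by (intro P.dual_pt_eqI[unfolded P_gauge bipolar] dual_pt_nonzero[OF False])
      (simp_all add: supp_dual_pt inner_commute[of "dual_pt x"] power2_eq_square)
  then show ?thesis using gp by (simp add: supp_dual_pt)
qed simp

lemma dual_pt_P_dual_pt [simp]: "dual_pt (P.dual_pt y) = y"
proof (cases "y = 0")
  case False
  obtain a where a: "a \<in> frontier K" "y = supp K y *\<^sub>R dual_pt a" by (rule dual_pt_surj[OF False])
  have "y = dual_pt (supp K y *\<^sub>R a)" using a(2) dual_pt_scale[OF supp_pos[OF False], of a] by simp
  then show ?thesis using P_dual_pt_dual_pt by metis
qed simp

text \<open>An inverse map that is continuous has the inverse derivative. This supplies the
  curvature of the polar body without a defining function for its boundary.\<close>

lemma P_dual_pt_has_derivative: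
  assumes y: "y \<noteq> 0"
  obtains E where "(P.dual_pt has_derivative E) (at y)" "det (matrix E) = 1 / \<Phi> (P.dual_pt y)"
proof -
  define x where "x = P.dual_pt y"
  have x: "x \<noteq> 0" unfolding x_def by (rule P.dual_pt_nonzero[OF y])
  have yx: "dual_pt x = y" by (simp add: x_def)
  note lD = D_linear[OF x]
  have "inj (D x)" using det_nz_iff_inj[OF lD] det_pos[OF x] by simp
  then obtain E where E: "linear E" "E \<circ> D x = id" using linear_injective_left_inverse[OF lD] by blast
  have "isCont P.dual_pt y"
    using P.dual_pt_continuous y by (simp add: continuous_on_eq_continuous_at open_Compl)
  then have "(P.dual_pt has_derivative E) (at (dual_pt x))"
    using E yx y
    by (intro has_derivative_inverse_basic_x[OF der[OF x], where T = UNIV]) (simp_all add: linear_conv_bounded_linear x_def)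
  moreover have "det (matrix E) * \<Phi> x = 1"
    unfolding \<Phi>_def det_matrix_compose[OF E(1) lD, symmetric] E(2) by (rule det_matrix_id)
  then have "det (matrix E) = 1 / \<Phi> x" using \<Phi>_pos[OF x] by (simp add: field_simps)
  ultimately show thesis using that[of E] by (simp add: yx x_def)
qed

lemma \<Phi>_measurable [measurable]: "\<Phi> \<in> borel_measurable borel"
proof -
  have "(\<lambda>x. if x \<in> {0} then \<Phi> 0 else \<Phi> x) \<in> borel \<rightarrow>\<^sub>M borel"
    using \<Phi>_continuous by (intro borel_measurable_continuous_on_if) auto
  moreover have "(\<lambda>x. if x \<in> {0} then \<Phi> 0 else \<Phi> x) = \<Phi>" by auto
  ultimately show ?thesis by simp
qed

lemma \<Phi>_bounds:
  obtains a b where "0 < a" "\<And>x. x \<noteq> 0 \<Longrightarrow> a \<le> \<Phi> x" "\<And>x. x \<noteq> 0 \<Longrightarrow> \<Phi> x \<le> b"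
proof -
  have c: "continuous_on (frontier K) \<Phi>"
    by (rule continuous_on_subset[OF \<Phi>_continuous]) (auto dest: frontier_nonzero)
  have e: "(axis undefined 1 :: real^'n) \<noteq> 0" by (simp add: axis_eq_0_iff)
  from normalized_in_frontier[OF e] have ne: "frontier K \<noteq> {}" by blast
  obtain l where l: "l \<in> frontier K" "\<And>z. z \<in> frontier K \<Longrightarrow> \<Phi> l \<le> \<Phi> z"
    using continuous_attains_inf[OF compact_frontier_K ne c] by blast
  obtain u where u: "u \<in> frontier K" "\<And>z. z \<in> frontier K \<Longrightarrow> \<Phi> z \<le> \<Phi> u"
    using continuous_attains_sup[OF compact_frontier_K ne c] by blast
  have eq: "\<Phi> (x /\<^sub>R gauge_fn x) = \<Phi> x" if "x \<noteq> 0" for x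
    using gauge_pos[OF that] that by (intro \<Phi>_scale) auto
  show ?thesis
  proof (rule that)
    show "0 < \<Phi> l" by (rule \<Phi>_pos[OF frontier_nonzero[OF l(1)]])
    show "\<Phi> l \<le> \<Phi> x" if "x \<noteq> 0" for x using l(2)[OF normalized_in_frontier[OF that]] eq[OF that] by simp
    show "\<Phi> x \<le> \<Phi> u" if "x \<noteq> 0" for x using u(2)[OF normalized_in_frontier[OF that]] eq[OF that] by simp
  qed
qed

lemma \<Phi>_powr_bounds:
  obtains a b where "0 < a" "\<And>x. x \<noteq> 0 \<Longrightarrow> a \<le> \<Phi> x powr e" "\<And>x. x \<noteq> 0 \<Longrightarrow> \<Phi> x powr e \<le> b"
proof -
  obtain a b where ab: "0 < a" "\<And>x. x \<noteq> 0 \<Longrightarrow> a \<le> \<Phi> x" "\<And>x. x \<noteq> 0 \<Longrightarrow> \<Phi> x \<le> b"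
    by (rule \<Phi>_bounds) blast
  show ?thesis
  proof (cases "e \<ge> 0")
    case True
    show ?thesis
    proof (rule that[of "a powr e" "b powr e"])
      show "a powr e > 0" using ab(1) by simp
      fix x :: "real^'n" assume x: "x \<noteq> 0"
      show "a powr e \<le> \<Phi> x powr e" using ab(1) ab(2)[OF x] True by (intro powr_mono2) auto
      show "\<Phi> x powr e \<le> b powr e" using ab(3)[OF x] \<Phi>_pos[OF x] True by (intro powr_mono2) auto
    qed
  next
    case False
    have e: "(axis undefined 1 :: real^'n) \<noteq> 0" by (simp add: axis_eq_0_iff)
    have b: "b > 0" using ab(1) ab(2,3)[OF e] by linarith
    show ?thesis
    proof (rule that[of "b powr e" "a powr e"])
      show "b powr e > 0" using b by simp
      fix x :: "real^'n" assume x: "x \<noteq> 0"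
      show "b powr e \<le> \<Phi> x powr e" using b ab(3)[OF x] \<Phi>_pos[OF x] False by (intro powr_mono2') auto
      show "\<Phi> x powr e \<le> a powr e" using ab(1) ab(2)[OF x] False by (intro powr_mono2') auto
    qed
  qed
qed

lemma integrable_\<Phi>_powr:
  assumes [measurable]: "A \<in> sets borel" "T \<in> borel \<rightarrow>\<^sub>M borel" and A: "bounded A" and T: "\<And>x. x \<in> A \<Longrightarrow> T x \<noteq> 0"
  shows "integrable lborel (\<lambda>x. indicator A x * \<Phi> (T x) powr e)"
proof -
  obtain a b where ab: "0 < a" "\<And>x. x \<noteq> 0 \<Longrightarrow> a \<le> \<Phi> x powr e" "\<And>x. x \<noteq> 0 \<Longrightarrow> \<Phi> x powr e \<le> b"
    by (rule \<Phi>_powr_bounds) blast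
  have fin: "emeasure lborel A < \<infinity>" by (rule emeasure_bounded_finite[OF A])
  have "integrable lborel (\<lambda>x. b * indicator A x)" using fin by (intro integrable_mult_right integrable_real_indicator) auto
  then show ?thesis
  proof (rule Bochner_Integration.integrable_bound)
    show "AE x in lborel. norm (indicator A x * \<Phi> (T x) powr e) \<le> norm (b * indicator A x)"
    proof (intro AE_I2)
      fix x show "norm (indicator A x * \<Phi> (T x) powr e) \<le> norm (b * indicator A x)"
        using ab(3)[OF T[of x]] by (cases "x \<in> A") auto
    qed
  qed measurable
qed

lemma affine_surface_area_K:
  assumes p: "p \<noteq> - real CARD('n)"
  shows "affine_surface_area (ereal p) K =
    real CARD('n) * (LINT x|lborel. indicator (K - {0}) x * \<Phi> x powr (p / (real CARD('n) + p)))"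
  by (rule affine_surface_area_eq(1)[OF gauss_curvature_\<Phi> \<Phi>_pos \<Phi>_scale \<Phi>_measurable p])

text \<open>For q = n^2 / p the exponent q / (n+q) is n / (n+p), and the determinant belonging to
  the polar is 1 / \<Phi>, hence the negative sign. The case p = 0 has infinite index and exponent
  1, the value of the same expression.\<close>

lemma affine_surface_area_polar:
  assumes p: "p \<noteq> - real CARD('n)"
  shows "affine_surface_area (ereal ((real CARD('n))\<^sup>2) / ereal p) (polar_body K) =
    real CARD('n) * (LINT y|lborel. indicator (polar_body K - {0}) y * \<Phi> (P.dual_pt y) powr (- (real CARD('n) / (real CARD('n) + p))))"
proof -
  let ?n = "real CARD('n)"
  let ?\<phi> = "\<lambda>y. 1 / \<Phi> (P.dual_pt y)"
  have curv: "gauss_curvature (polar_body K) y = ?\<phi> y / norm (P.dual_pt y) ^ (CARD('n) + 1)" if y: "y \<in> frontier (polar_body K)" for y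
  proof -
    obtain E where E: "(P.dual_pt has_derivative E) (at y)" "det (matrix E) = ?\<phi> y"
      by (rule P_dual_pt_has_derivative[OF P.frontier_nonzero[OF y]])
    show ?thesis unfolding P.gauss_curvature_eq[OF y E(1)] E(2) P.inner_outer_normal[OF y] by (simp add: power_divide)
  qed
  have pos: "?\<phi> y > 0" if "y \<noteq> 0" for y using \<Phi>_pos[OF P.dual_pt_nonzero[OF that]] by simp
  have hom: "?\<phi> (c *\<^sub>R y) = ?\<phi> y" if "c > 0" "y \<noteq> 0" for c y
    using P.dual_pt_scale[OF that(1), of y] \<Phi>_scale[OF that(1) P.dual_pt_nonzero[OF that(2)]] by simp
  have meas: "?\<phi> \<in> borel_measurable borel" by measurable
  have n: "?n > 0" using dim2 by simp
  have np: "?n + p \<noteq> 0" using p by linarith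
  have pw: "?\<phi> y powr e = \<Phi> (P.dual_pt y) powr (- e)" if "y \<noteq> 0" for y e
    using \<Phi>_pos[OF P.dual_pt_nonzero[OF that]] by (simp add: powr_divide powr_minus_divide)
  have pw': "indicator (polar_body K - {0}) y * ?\<phi> y powr e = indicator (polar_body K - {0}) y * \<Phi> (P.dual_pt y) powr (- e)" for y e
    using pw[of y e] by (cases "y = 0") auto
  show ?thesis
  proof (cases "p = 0")
    case True
    have "ereal (?n\<^sup>2) / ereal p = \<infinity>" using True n by simp
    moreover have "indicator (polar_body K - {0}) y * ?\<phi> y = indicator (polar_body K - {0}) y * \<Phi> (P.dual_pt y) powr (- (?n / (?n + p)))" for y
      using pw'[of y 1] less_imp_le[OF pos[of y]] True n by (cases "y = 0") auto
    ultimately show ?thesis using P.affine_surface_area_eq(2)[OF curv pos hom meas] by simp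
  next
    case False
    have q: "ereal (?n\<^sup>2) / ereal p = ereal (?n\<^sup>2 / p)" using False by simp
    have q1: "?n\<^sup>2 / p \<noteq> - ?n"
    proof
      assume "?n\<^sup>2 / p = - ?n"
      then have "?n * (?n + p) = 0" using False by (simp add: field_simps power2_eq_square)
      then show False using n np by simp
    qed
    have "?n\<^sup>2 / p / (?n + ?n\<^sup>2 / p) = ?n / (?n + p)"
    proof -
      have "?n + ?n\<^sup>2 / p = ?n * (?n + p) / p" using False by (simp add: field_simps power2_eq_square)
      then show ?thesis using False n np by (simp add: power2_eq_square)
    qed
    then show ?thesis using P.affine_surface_area_eq(1)[OF curv pos hom meas q1] unfolding q pw' by simp
  qed
qed

lemma dual_pt_image: "dual_pt ` (K - {0}) = polar_body K - {0}"
proof (intro set_eqI iffI)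
  fix y assume "y \<in> dual_pt ` (K - {0})"
  then obtain x where x: "x \<in> K" "x \<noteq> 0" "y = dual_pt x" by auto
  have "supp K y \<le> 1" using x by (simp add: supp_dual_pt mem_iff_gauge)
  then show "y \<in> polar_body K - {0}" using dual_pt_nonzero[OF x(2)] x(3) by (simp add: polar_iff_supp)
next
  fix y assume y: "y \<in> polar_body K - {0}"
  have "gauge_fn (P.dual_pt y) = supp K y" using supp_dual_pt[of "P.dual_pt y"] by simp
  then have "P.dual_pt y \<in> K - {0}" using y P.dual_pt_nonzero[of y] by (simp add: mem_iff_gauge polar_iff_supp)
  then show "y \<in> dual_pt ` (K - {0})" by (intro image_eqI[of _ _ "P.dual_pt y"]) simp_all
qed

text \<open>The Jacobian of \<open>dual_pt\<close> is \<Phi>, which raises the exponent from -n /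
  (n+p) to 1 - n / (n+p) = p / (n+p).\<close>

lemma integral_polar:
  assumes p: "p \<noteq> - real CARD('n)"
  shows "(LINT y|lborel. indicator (polar_body K - {0}) y * \<Phi> (P.dual_pt y) powr (- (real CARD('n) / (real CARD('n) + p)))) =
    (LINT x|lborel. indicator (K - {0}) x * \<Phi> x powr (p / (real CARD('n) + p)))"
proof -
  let ?n = "real CARD('n)"
  let ?f = "\<lambda>y. \<Phi> (P.dual_pt y) powr (- (?n / (?n + p)))"
  have np: "?n + p \<noteq> 0" using p by linarith
  have eq: "indicator (K - {0}) x * (det (matrix (D x)) * ?f (dual_pt x)) = indicator (K - {0}) x * \<Phi> x powr (p / (?n + p))" for x
  proof (cases "x = 0")
    case False
    have "1 + - (?n / (?n + p)) = p / (?n + p)" using np by (simp add: field_simps)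
    then have "\<Phi> x powr 1 * \<Phi> x powr (- (?n / (?n + p))) = \<Phi> x powr (p / (?n + p))"
      by (simp only: powr_add[symmetric])
    then show ?thesis using \<Phi>_pos[OF False] by (simp add: \<Phi>_def[symmetric])
  qed simp
  have "(LINT y|lborel. indicator (dual_pt ` (K - {0})) y * ?f y) =
      (LINT x|lborel. indicator (K - {0}) x * (det (matrix (D x)) * ?f (dual_pt x)))"
  proof (rule integral_change_of_variables)
    show "K - {0} \<in> sets borel" "dual_pt ` (K - {0}) \<in> sets borel" unfolding dual_pt_image by measurable
    show "?f \<in> borel_measurable borel" by measurable
    show "(dual_pt has_derivative D x) (at x)" "det (matrix (D x)) > 0" if "x \<in> K - {0}" for x
      using der det_pos that by auto
    show "inj_on dual_pt (K - {0})" by (rule inj_on_inverseI) (rule P_dual_pt_dual_pt)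
    show "integrable lborel (\<lambda>x. indicator (K - {0}) x * (det (matrix (D x)) * ?f (dual_pt x)))"
      unfolding eq
    proof (rule integrable_\<Phi>_powr)
      show "bounded (K - {0})" by (rule bounded_subset[OF compact_imp_bounded[OF compact_K]]) blast
    qed auto
  qed
  then show ?thesis unfolding dual_pt_image eq .
qed

theorem affine_surface_area_duality:
  assumes p: "p \<noteq> - real CARD('n)"
  shows "affine_surface_area (ereal p) K = affine_surface_area (ereal ((real CARD('n))\<^sup>2) / ereal p) (polar_body K)"
  unfolding affine_surface_area_K[OF p] affine_surface_area_polar[OF p] integral_polar[OF p] ..

end

section \<open>Measure of caps\<close>

lemma emeasure_lborel_cone:
  fixes k :: "'n::finite"
  assumes r: "r > 0" and \<rho>: "\<rho> > 0"
  shows "ennreal (real CARD('n)) * emeasure lborel {z::real^'n. 0 < z $ k \<and> z $ k \<le> r \<and> norm (flat k (z /\<^sub>R z $ k)) \<le> \<rho>} =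
    ennreal (r ^ CARD('n) * (unit_ball_vol (real (CARD('n) - 1)) * \<rho> ^ (CARD('n) - 1)))"
proof -
  let ?C = "\<lambda>r. {z::real^'n. 0 < z $ k \<and> z $ k \<le> r \<and> norm (flat k (z /\<^sub>R z $ k)) \<le> \<rho>}"
  have C [measurable]: "?C r \<in> sets borel" for r by measurable
  have sc: "(\<lambda>z. (1 / r) *\<^sub>R z) -` ?C 1 = ?C r"
  proof -
    have "((1 / r) *\<^sub>R z) /\<^sub>R ((1 / r) *\<^sub>R z) $ k = z /\<^sub>R z $ k" for z :: "real^'n"
      using r by (simp add: inverse_eq_divide)
    moreover have "0 < ((1 / r) *\<^sub>R z) $ k \<longleftrightarrow> 0 < z $ k" "((1 / r) *\<^sub>R z) $ k \<le> 1 \<longleftrightarrow> z $ k \<le> r" for z :: "real^'n"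
      using r by (simp_all add: zero_less_divide_iff)
    ultimately show ?thesis by (intro set_eqI) (simp only: vimage_eq mem_Collect_eq)
  qed
  have "emeasure lborel (?C r) = ennreal ((1 / (1 / r)) ^ CARD('n)) * emeasure lborel (?C 1)"
    unfolding sc[symmetric] using r by (intro emeasure_lborel_scaling C) simp
  also have "1 / (1 / r) = r" by simp
  also have "emeasure lborel (?C 1) = emeasure (cone_measure k) {x. norm (flat k x) \<le> \<rho>}"
    by (subst emeasure_cone_measure) (auto intro!: flat_ball_measurable)
  finally have "ennreal (real CARD('n)) * emeasure lborel (?C r) =
      ennreal (r ^ CARD('n)) * (ennreal (real CARD('n)) * emeasure (cone_measure k) {x. norm (flat k x) \<le> \<rho>})"
    by (simp add: mult_ac)
  also have "ennreal (real CARD('n)) * emeasure (cone_measure k) {x. norm (flat k x) \<le> \<rho>} = emeasure (plane_measure k) {x. norm (flat k x) \<le> \<rho>}"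
    by (rule cone_measure_eq[OF flat_ball_measurable])
  also have "\<dots> = ennreal (unit_ball_vol (real (CARD('n) - 1)) * \<rho> ^ (CARD('n) - 1))"
    by (rule emeasure_plane_ball[OF \<rho>])
  finally show ?thesis using r by (simp add: ennreal_mult[symmetric] \<rho> less_imp_le)
qed

context C1_dual_body
begin

text \<open>Gram-Schmidt orthogonalization for the inner product v \<bullet> D x w. It can start
  with x itself, which has unit length because x \<bullet> D x x = x \<bullet>
  \<open>dual_pt x\<close> = 1. In matrix form the transpose of B times D x times B is the identity,
  whence the determinant.\<close>

lemma adapted_frame:
  assumes x: "x \<in> frontier K"
  obtains B :: "real^'n \<Rightarrow> real^'n" where "linear B" "B (axis k 1) = x" "\<And>z z'. B z \<bullet> D x (B z') = z \<bullet> z'"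
    "(det (matrix B))\<^sup>2 * \<Phi> x = 1"
proof -
  have x0: "x \<noteq> 0" by (rule frontier_nonzero[OF x])
  note lD = D_linear[OF x0]
  have xx: "x \<bullet> D x x = 1" using dual_pt_frontier(2)[OF x] by (simp add: D_self[OF x0])
  have "\<exists>f. f k = x \<and> (\<forall>i\<in>insert k S. \<forall>j\<in>insert k S. f i \<bullet> D x (f j) = (if i = j then 1 else 0))" if "finite S" for S :: "'n set"
    using that
  proof (induction S rule: finite_induct)
    case empty
    show ?case using xx by (intro exI[of _ "\<lambda>_. x"]) simp
  next
    case (insert a S)
    then obtain f where f: "f k = x" "\<And>i j. i \<in> insert k S \<Longrightarrow> j \<in> insert k S \<Longrightarrow> f i \<bullet> D x (f j) = (if i = j then 1 else 0)" by blast
    show ?case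
    proof (cases "a = k")
      case True
      then show ?thesis using f by (intro exI[of _ f]) auto
    next
      case False
      let ?S = "insert k S"
      \<comment> \<open>The vectors D x (f i) constructed so far span a proper subspace; a Euclidean
        normal to it is orthogonal to every f i in the new inner product.\<close>
      have aS: "a \<notin> ?S" using False insert.hyps(2) by simp
      have "card ?S < CARD('n)" by (rule psubset_card_mono) (use aS in auto)
      moreover have "dim ((\<lambda>i. D x (f i)) ` ?S) \<le> card ?S"
        using dim_le_card'[of "(\<lambda>i. D x (f i)) ` ?S"] card_image_le[of ?S "\<lambda>i. D x (f i)"] by simp
      ultimately have "dim ((\<lambda>i. D x (f i)) ` ?S) < DIM(real^'n)" by simp
      from orthogonal_to_subspace_exists[OF this] obtain u where u: "u \<noteq> 0" "\<And>y. y \<in> span ((\<lambda>i. D x (f i)) ` ?S) \<Longrightarrow> orthogonal u y" by blast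
      have orth: "u \<bullet> D x (f i) = 0" if "i \<in> ?S" for i
        using u(2)[OF span_base, of "D x (f i)"] that by (auto simp: orthogonal_def)
      have orth': "f i \<bullet> D x u = 0" if "i \<in> ?S" for i
        using orth[OF that] D_symmetric[OF x0, of u "f i"] by (simp add: inner_commute)
      define c where "c = D x u \<bullet> u"
      have c: "c > 0" unfolding c_def by (rule D_pos[OF x0 u(1)])
      define v where "v = u /\<^sub>R sqrt c"
      have vv: "v \<bullet> D x v = 1" using c by (simp add: v_def linear_scale[OF lD] inner_commute[of u] c_def[symmetric] field_simps)
      have v1: "v \<bullet> D x (f i) = 0" "f i \<bullet> D x v = 0" if "i \<in> ?S" for i
        using orth[OF that] orth'[OF that] by (simp_all add: v_def linear_scale[OF lD])
      have "(f(a := v)) i \<bullet> D x ((f(a := v)) j) = (if i = j then 1 else 0)" if ij: "i \<in> insert a ?S" "j \<in> insert a ?S" for i j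
      proof -
        consider "i = a" "j = a" | "i = a" "j \<in> ?S" "j \<noteq> a" | "i \<in> ?S" "i \<noteq> a" "j = a" | "i \<in> ?S" "i \<noteq> a" "j \<in> ?S" "j \<noteq> a"
          using ij by blast
        then show ?thesis using vv v1 f(2) by cases simp_all
      qed
      then show ?thesis using f(1) False by (intro exI[of _ "f(a := v)"]) (simp add: insert_commute)
    qed
  qed
  from this[of UNIV] obtain f where f: "f k = x" "\<And>i j. f i \<bullet> D x (f j) = (if i = j then 1 else 0)" by auto
  define B where "B z = (\<Sum>i\<in>UNIV. (z $ i) *\<^sub>R f i)" for z
  have lB: "linear B"
    unfolding B_def by (rule linearI) (simp_all add: scaleR_add_left sum.distrib scaleR_sum_right)
  have orth: "B z \<bullet> D x (B z') = z \<bullet> z'" for z z'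
  proof -
    have "D x (B z') = (\<Sum>j\<in>UNIV. (z' $ j) *\<^sub>R D x (f j))"
      unfolding B_def by (simp add: linear_sum[OF lD] linear_scale[OF lD])
    then have "B z \<bullet> D x (B z') = (\<Sum>i\<in>UNIV. (z $ i) *\<^sub>R f i \<bullet> (\<Sum>j\<in>UNIV. (z' $ j) *\<^sub>R D x (f j)))"
      by (simp only: B_def inner_sum_left)
    also have "\<dots> = (\<Sum>i\<in>UNIV. z $ i * z' $ i)"
      by (rule sum.cong[OF refl]) (simp add: inner_sum_right f(2) if_distrib cong: if_cong)
    also have "\<dots> = z \<bullet> z'" by (simp add: inner_vec_def)
    finally show ?thesis .
  qed
  have Bk: "B (axis k 1) = x"
    unfolding B_def by (simp add: axis_def f(1) if_distrib[of "\<lambda>c. c *\<^sub>R _"] cong: if_cong)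
  have lDB: "linear (D x \<circ> B)" by (rule linear_compose[OF lB lD])
  have "adjoint B \<circ> (D x \<circ> B) = id"
  proof
    fix z'
    have "z \<bullet> (adjoint B \<circ> (D x \<circ> B)) z' = z \<bullet> id z'" for z
      using adjoint_works[OF lB, of z "D x (B z')"] orth[of z z'] by simp
    then show "(adjoint B \<circ> (D x \<circ> B)) z' = id z'" using vector_eq_ldot by blast
  qed
  then have "det (matrix (adjoint B)) * (det (matrix (D x)) * det (matrix B)) = 1"
    using det_matrix_compose[OF adjoint_linear[OF lB] lDB] det_matrix_compose[OF lD lB] det_matrix_id by simp
  moreover have "det (matrix (adjoint B)) = det (matrix B)" using matrix_adjoint[OF lB] by (simp add: det_transpose)
  ultimately have "(det (matrix B))\<^sup>2 * \<Phi> x = 1" by (simp add: \<Phi>_def power2_eq_square mult_ac)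
  then show thesis using that lB Bk orth by blast
qed

text \<open>A uniform continuity of \<Phi> in which nearness is measured by the height of a cap. The
  pairs that violate the bound lie in a compact set on which \<open>dual_pt x0\<close> \<bullet> x
  stays below 1, since the value 1 forces x = x0 by injectivity of \<open>dual_pt\<close>.\<close>

lemma powr_ratio_near:
  assumes c: "c > 1"
  obtains e0 where "e0 > 0" "\<And>x0 x. x0 \<in> frontier K \<Longrightarrow> x \<in> frontier K \<Longrightarrow> dual_pt x0 \<bullet> x \<ge> 1 - e0 \<Longrightarrow>
    \<Phi> x powr e \<le> c * \<Phi> x0 powr e"
proof -
  let ?C = "{z \<in> frontier K \<times> frontier K. c * \<Phi> (fst z) powr e \<le> \<Phi> (snd z) powr e}"
  have cF: "compact (frontier K \<times> frontier K)" by (intro compact_Times compact_frontier_K)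
  have nz: "fst z \<noteq> 0" "snd z \<noteq> 0" if "z \<in> frontier K \<times> frontier K" for z
    using that frontier_nonzero by (auto simp: mem_Times_iff)
  have "continuous_on (frontier K \<times> frontier K) (\<lambda>z. \<Phi> (fst z))" "continuous_on (frontier K \<times> frontier K) (\<lambda>z. \<Phi> (snd z))"
    using nz by (auto intro!: continuous_on_compose2[OF \<Phi>_continuous] continuous_intros)
  then have "continuous_on (frontier K \<times> frontier K) (\<lambda>z. c * \<Phi> (fst z) powr e)" "continuous_on (frontier K \<times> frontier K) (\<lambda>z. \<Phi> (snd z) powr e)"
    using nz \<Phi>_pos by (auto intro!: continuous_intros simp: less_imp_neq[symmetric])
  then have "closed ?C"
    by (intro continuous_on_closed_Collect_le compact_imp_closed cF)
  moreover have "bounded ?C" by (rule bounded_subset[OF compact_imp_bounded[OF cF]]) blast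
  ultimately have cC: "compact ?C" by (simp only: compact_eq_bounded_closed)
  have less: "dual_pt (fst z) \<bullet> snd z < 1" if z: "z \<in> ?C" for z
  proof (rule ccontr)
    assume "\<not> ?thesis"
    moreover have fz: "fst z \<in> frontier K" "snd z \<in> frontier K" using z by (auto simp: mem_Times_iff)
    moreover have "snd z \<bullet> dual_pt (fst z) \<le> 1" using dual_pt_frontier(3)[OF fz(1), of "snd z"] fz(2) by (simp add: frontier_iff_gauge)
    ultimately have eq: "snd z \<bullet> dual_pt (fst z) = 1" by (simp add: inner_commute)
    have "dual_pt (snd z) = gauge_fn (snd z) *\<^sub>R dual_pt (fst z)"
      using eq fz by (intro dual_pt_eqI frontier_nonzero dual_pt_frontier(1)) (auto simp: frontier_iff_gauge)
    then have "dual_pt (snd z) = dual_pt (fst z)" using fz by (simp add: frontier_iff_gauge)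
    from arg_cong[OF this, of "smooth_body.dual_pt (polar_body K)"] have "snd z = fst z"
      by (simp only: P_dual_pt_dual_pt)
    then have "c * \<Phi> (fst z) powr e \<le> 1 * \<Phi> (fst z) powr e" using z by simp
    moreover have "\<Phi> (fst z) powr e > 0" using \<Phi>_pos[OF frontier_nonzero[OF fz(1)]] by simp
    ultimately have "c \<le> 1" using mult_le_cancel_right_pos by blast
    then show False using c by simp
  qed
  obtain M where M: "M < 1" "\<And>z. z \<in> ?C \<Longrightarrow> dual_pt (fst z) \<bullet> snd z \<le> M"
  proof (cases "?C = {}")
    case True
    show ?thesis by (rule that[of 0]) (use True in auto)
  next
    case False
    have "continuous_on ?C (\<lambda>z. dual_pt (fst z) \<bullet> snd z)"
      using nz by (intro continuous_on_inner continuous_on_compose2[OF dual_pt_continuous] continuous_intros) auto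
    from continuous_attains_sup[OF cC False this] obtain m where m: "m \<in> ?C" "\<And>z. z \<in> ?C \<Longrightarrow> dual_pt (fst z) \<bullet> snd z \<le> dual_pt (fst m) \<bullet> snd m"
      by blast
    show ?thesis by (rule that[OF less[OF m(1)] m(2)])
  qed
  show ?thesis
  proof (rule that[of "(1 - M) / 2"])
    show "(1 - M) / 2 > 0" using M(1) by simp
    fix x0 x assume *: "x0 \<in> frontier K" "x \<in> frontier K" "dual_pt x0 \<bullet> x \<ge> 1 - (1 - M) / 2"
    show "\<Phi> x powr e \<le> c * \<Phi> x0 powr e"
    proof (rule ccontr)
      assume "\<not> ?thesis"
      then have "dual_pt x0 \<bullet> x \<le> M" using M(2)[of "(x0, x)"] * by simp
      then show False using *(3) M(1) by (simp add: field_simps)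
    qed
  qed
qed

text \<open>The cone with apex 0 over the cap that the hyperplane \<open>dual_pt x0 \<bullet> x = 1 - e\<close> cuts off from the boundary.\<close>

definition cap :: "real^'n \<Rightarrow> real \<Rightarrow> (real^'n) set" where
  "cap x0 e = {x \<in> K - {0}. 1 - e \<le> dual_pt x0 \<bullet> proj x}"

lemma cap_measurable [measurable]: "cap x0 e \<in> sets borel"
  unfolding cap_def by measurable

text \<open>In the adapted frame a point of height 1 with horizontal part w has gauge G w, and its
  radial projection has height 1 / G w; the cap is thus the cone over the set where G w \<le> 1 /
  (1-e). By the expansion G^2 is about 1 + norm(w)^2, so this set lies between the balls of radius
  \<rho>1 and \<rho>2. The inner cone is cut at height 1 - e to stay inside
  \<open>K\<close>.\<close>

lemma cap_emeasure_bounds: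
  assumes x0: "x0 \<in> frontier K" and t: "0 < t" "t < 1" and e: "0 < e" "e \<le> t" "e \<le> (1 - t) ^ 3 * r\<^sup>2 / 4" and r: "r > 0"
    and taylor: "\<And>w. D x0 w \<bullet> w \<le> r\<^sup>2 \<Longrightarrow>
      \<bar>(gauge_fn (x0 + w))\<^sup>2 - 1 - 2 * (dual_pt x0 \<bullet> w) - D x0 w \<bullet> w\<bar> \<le> t * (D x0 w \<bullet> w)"
  shows "ennreal (\<Phi> x0 powr (- 1 / 2) * ((1 - e) ^ CARD('n) * (unit_ball_vol (real (CARD('n) - 1)) * sqrt (2 * e / (1 + t)) ^ (CARD('n) - 1))))
        \<le> ennreal (real CARD('n)) * emeasure lborel (cap x0 e)" (is "?L \<le> _")
    and "ennreal (real CARD('n)) * emeasure lborel (cap x0 e)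
        \<le> ennreal (\<Phi> x0 powr (- 1 / 2) * (unit_ball_vol (real (CARD('n) - 1)) * sqrt (2 * e / (1 - t) ^ 3) ^ (CARD('n) - 1)))" (is "_ \<le> ?U")
proof -
  define k :: 'n where "k = undefined"
  have nz: "x0 \<noteq> 0" by (rule frontier_nonzero[OF x0])
  obtain B :: "real^'n \<Rightarrow> real^'n" where B: "linear B" "B (axis k 1) = x0" "\<And>z z'. B z \<bullet> D x0 (B z') = z \<bullet> z'" "(det (matrix B))\<^sup>2 * \<Phi> x0 = 1"
    by (rule adapted_frame[OF x0]) blast
  \<comment> \<open>The radii solve (1+t) \<rho>1^2 = 2 e and (1-t) \<rho>2^2 = 2 e / (1-t)^2, the
    two sides being the bounds \<open>q1\<close> and \<open>q2\<close> for the square of 1 / (1-e),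
    minus 1.\<close>
  define \<rho>1 where "\<rho>1 = sqrt (2 * e / (1 + t))"
  define \<rho>2 where "\<rho>2 = sqrt (2 * e / (1 - t) ^ 3)"
  have \<rho>1: "\<rho>1 > 0" "\<rho>1\<^sup>2 = 2 * e / (1 + t)" using e t by (auto simp: \<rho>1_def)
  have \<rho>2: "\<rho>2 > 0" "\<rho>2\<^sup>2 = 2 * e / (1 - t) ^ 3" using e t by (auto simp: \<rho>2_def)
  have e1: "e < 1" "1 - e > 0" using e t by auto
  have q1: "1 + 2 * e \<le> (1 / (1 - e))\<^sup>2"
  proof -
    have "(1 + 2 * e) * (1 - e)\<^sup>2 = 1 - e\<^sup>2 * (3 - 2 * e)" by (simp add: power2_eq_square algebra_simps)
    also have "\<dots> \<le> 1" using e1 by simp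
    finally show ?thesis using e1 by (simp add: power_divide pos_le_divide_eq)
  qed
  have q2: "(1 / (1 - e))\<^sup>2 \<le> 1 + 2 * e / (1 - t)\<^sup>2"
  proof -
    have "e * (2 - e) = 1 - (1 - e)\<^sup>2" by (simp add: power2_eq_square algebra_simps)
    then have "(1 / (1 - e))\<^sup>2 - 1 = e * (2 - e) / (1 - e)\<^sup>2" using e1 by (simp add: power_divide diff_divide_distrib)
    also have "\<dots> \<le> 2 * e / (1 - t)\<^sup>2"
      using e t by (intro frac_le power_mono) auto
    finally show ?thesis by simp
  qed
  have dB: "dual_pt x0 \<bullet> B z = z $ k" for z
  proof -
    have "dual_pt x0 \<bullet> B z = B z \<bullet> D x0 (B (axis k 1))" by (simp add: B(2) D_self[OF nz] inner_commute)
    then show ?thesis by (simp add: B(3) inner_axis)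
  qed
  have nB: "D x0 (B w) \<bullet> B w = (norm w)\<^sup>2" for w
    using B(3)[of w w] by (simp add: inner_commute[of "D x0 (B w)"] power2_norm_eq_inner)
  define G where "G w = gauge_fn (x0 + B w)" for w
  have T: "\<bar>(G w)\<^sup>2 - 1 - (norm w)\<^sup>2\<bar> \<le> t * (norm w)\<^sup>2" if "w $ k = 0" "norm w \<le> r" for w
    using taylor[of "B w"] that power_mono[OF that(2), of 2] by (simp add: nB dB G_def)
  have G1: "G w \<ge> 1" if "w $ k = 0" for w
    using dual_pt_frontier(3)[OF x0, of "x0 + B w"] dual_pt_frontier(2)[OF x0] dB[of w] that
    by (simp add: G_def inner_add_left inner_commute[of "B w"])
  have low: "G w \<le> 1 / (1 - e)" if w: "w $ k = 0" "norm w \<le> \<rho>1" for w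
  proof (rule power2_le_imp_le)
    have w2: "(norm w)\<^sup>2 \<le> 2 * e / (1 + t)" using power_mono[OF w(2), of 2] \<rho>1(2) by simp
    have "2 * e / (1 + t) \<le> 2 * e" using e t by (simp add: divide_le_eq)
    also have "2 * e \<le> r\<^sup>2"
    proof -
      have "(1 - t) ^ 3 * r\<^sup>2 \<le> 1 * r\<^sup>2" using t by (intro mult_right_mono power_le_one) auto
      then show ?thesis using e(3) zero_le_power2[of r] by linarith
    qed
    finally have "(norm w)\<^sup>2 \<le> r\<^sup>2" using w2 by linarith
    then have "norm w \<le> r" by (rule power2_le_imp_le) (use r in simp)
    from T[OF w(1) this] have "(G w)\<^sup>2 \<le> 1 + (1 + t) * (norm w)\<^sup>2" by (simp add: algebra_simps)
    also have "\<dots> \<le> 1 + (1 + t) * (2 * e / (1 + t))" using w2 t by (intro add_left_mono mult_left_mono) auto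
    also have "\<dots> = 1 + 2 * e" using t by simp
    finally show "(G w)\<^sup>2 \<le> (1 / (1 - e))\<^sup>2" using q1 by linarith
  qed (use e1 in simp)
  have up: "norm w \<le> \<rho>2" if w: "w $ k = 0" "G w \<le> 1 / (1 - e)" for w
  proof -
    have Gle: "(G w)\<^sup>2 \<le> 1 + 2 * e / (1 - t)\<^sup>2"
      using power_mono[OF w(2), of 2] G1[OF w(1)] q2 by simp
    \<comment> \<open>The expansion is available only for norm w \<le> r. A point further out is
      pulled back to distance r; by convexity its gauge does not increase, yet at distance r it is
      already too large by the third bound on e.\<close>
    have wr: "norm w \<le> r"
    proof (rule ccontr)
      assume "\<not> ?thesis"
      then have nw: "norm w > r" "norm w > 0" using r by auto
      define s where "s = r / norm w"
      have s: "0 < s" "s < 1" using r nw by (simp_all add: s_def)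
      have nsw: "norm (s *\<^sub>R w) = r" using r nw by (simp add: s_def)
      have "x0 + B (s *\<^sub>R w) = (1 - s) *\<^sub>R x0 + s *\<^sub>R (x0 + B w)"
        by (simp add: linear_scale[OF B(1)] algebra_simps)
      then have "G (s *\<^sub>R w) \<le> gauge_fn ((1 - s) *\<^sub>R x0) + gauge_fn (s *\<^sub>R (x0 + B w))"
        using gauge_triangle unfolding G_def by simp
      also have "\<dots> = (1 - s) * gauge_fn x0 + s * G w" using s by (simp add: gauge_scale G_def)
      also have "\<dots> = (1 - s) * 1 + s * G w" using x0 by (simp add: frontier_iff_gauge)
      also have "\<dots> \<le> (1 - s) * G w + s * G w" using s G1[OF w(1)] by (intro add_right_mono mult_left_mono) auto
      also have "\<dots> = G w" by (simp add: algebra_simps)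
      finally have "(G (s *\<^sub>R w))\<^sup>2 \<le> (G w)\<^sup>2" using G1[of "s *\<^sub>R w"] w(1) by (intro power_mono) auto
      moreover have "\<bar>(G (s *\<^sub>R w))\<^sup>2 - 1 - r\<^sup>2\<bar> \<le> t * r\<^sup>2" using T[of "s *\<^sub>R w"] w(1) nsw by simp
      ultimately have "(1 - t) * r\<^sup>2 \<le> 2 * e / (1 - t)\<^sup>2" using Gle by (simp add: algebra_simps)
      then have "(1 - t) * r\<^sup>2 * (1 - t)\<^sup>2 \<le> 2 * e" using t by (simp add: pos_le_divide_eq)
      then have "(1 - t) ^ 3 * r\<^sup>2 \<le> 2 * e" by (simp add: power2_eq_square power3_eq_cube mult_ac)
      moreover have "(1 - t) ^ 3 * r\<^sup>2 > 0" using t r by simp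
      ultimately show False using e(3) by linarith
    qed
    have "(1 - t) * (norm w)\<^sup>2 \<le> 2 * e / (1 - t)\<^sup>2" using T[OF w(1) wr] Gle by (simp add: algebra_simps)
    then have "(norm w)\<^sup>2 \<le> 2 * e / (1 - t)\<^sup>2 / (1 - t)"
      by (subst pos_le_divide_eq) (use t in \<open>simp_all only: mult.commute diff_gt_0_iff_gt\<close>)
    also have "\<dots> = \<rho>2\<^sup>2" unfolding \<rho>2(2) by (simp add: power2_eq_square power3_eq_cube)
    finally show ?thesis by (rule power2_le_imp_le) (use \<rho>2 in simp)
  qed
  have dec: "B z = z $ k *\<^sub>R (x0 + B (flat k (z /\<^sub>R z $ k)))" if "z $ k > 0" for z
  proof -
    have "z = z $ k *\<^sub>R (axis k 1 + flat k (z /\<^sub>R z $ k))" using that by (simp add: vec_eq_iff axis_def)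
    then have "B z = B (z $ k *\<^sub>R (axis k 1 + flat k (z /\<^sub>R z $ k)))" by simp
    then show ?thesis by (simp only: linear_scale[OF B(1)] linear_add[OF B(1)] B(2))
  qed
  have gB: "gauge_fn (B z) = z $ k * G (flat k (z /\<^sub>R z $ k))" if "z $ k > 0" for z
    using that by (subst dec[OF that]) (simp add: gauge_scale G_def)
  have fk: "flat k v $ k = 0" for v by simp
  let ?C = "\<lambda>r \<rho>. {z::real^'n. 0 < z $ k \<and> z $ k \<le> r \<and> norm (flat k (z /\<^sub>R z $ k)) \<le> \<rho>}"
  have vB: "B -` cap x0 e \<in> sets borel" using measurable_sets[OF measurable_linear_cart[OF B(1)] cap_measurable] by simp
  have inc1: "?C (1 - e) \<rho>1 \<subseteq> B -` cap x0 e"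
  proof
    fix z assume z: "z \<in> ?C (1 - e) \<rho>1"
    then have zk: "z $ k > 0" by simp
    define g where "g = G (flat k (z /\<^sub>R z $ k))"
    have g: "1 \<le> g" "g \<le> 1 / (1 - e)" using G1[OF fk] low[OF fk] z by (auto simp: g_def)
    have "z $ k * g \<le> (1 - e) * (1 / (1 - e))" using z g e1 by (intro mult_mono) auto
    then have "gauge_fn (B z) \<le> 1" using gB[OF zk] e1 by (simp add: g_def)
    moreover have "B z \<noteq> 0" using dB[of z] zk by auto
    moreover have "dual_pt x0 \<bullet> proj (B z) = 1 / g"
    proof -
      have "gauge_fn (B z) = z $ k * g" using gB[OF zk] by (simp add: g_def)
      then show ?thesis using zk g by (simp add: proj_def dB field_simps)
    qed
    moreover have "1 - e \<le> 1 / g" using g e1 by (simp add: pos_le_divide_eq) (simp add: field_simps)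
    ultimately show "z \<in> B -` cap x0 e" by (simp add: cap_def mem_iff_gauge)
  qed
  have inc2: "B -` cap x0 e \<subseteq> ?C 1 \<rho>2"
  proof
    fix z assume "z \<in> B -` cap x0 e"
    then have z: "gauge_fn (B z) \<le> 1" "B z \<noteq> 0" "1 - e \<le> z $ k / gauge_fn (B z)"
      by (auto simp: cap_def mem_iff_gauge proj_def dB divide_inverse mult.commute)
    have gp: "gauge_fn (B z) > 0" by (rule gauge_pos[OF z(2)])
    have "0 < z $ k / gauge_fn (B z)" using z(3) e1 by linarith
    then have zk: "z $ k > 0" using gp by (simp add: zero_less_divide_iff)
    define g where "g = G (flat k (z /\<^sub>R z $ k))"
    have g1: "1 \<le> g" unfolding g_def by (rule G1[OF fk])
    have gz: "gauge_fn (B z) = z $ k * g" using gB[OF zk] by (simp add: g_def)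
    have "1 - e \<le> 1 / g" using z(3) zk by (simp add: gz)
    then have "g \<le> 1 / (1 - e)" using g1 e1 by (simp add: field_simps)
    then have "norm (flat k (z /\<^sub>R z $ k)) \<le> \<rho>2" unfolding g_def by (rule up[OF fk])
    moreover have "z $ k \<le> 1"
    proof -
      have "z $ k * 1 \<le> z $ k * g" using g1 zk by (intro mult_left_mono) auto
      then show ?thesis using z(1) gz by linarith
    qed
    ultimately show "z \<in> ?C 1 \<rho>2" using zk by simp
  qed
  have det0: "det (matrix B) \<noteq> 0" using B(4) by auto
  have detB: "\<bar>det (matrix B)\<bar> = \<Phi> x0 powr (- 1 / 2)"
  proof -
    have p: "\<Phi> x0 > 0" by (rule \<Phi>_pos[OF nz])
    have "(det (matrix B))\<^sup>2 = 1 / \<Phi> x0" using B(4) p by (simp add: field_simps)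
    then have "\<bar>det (matrix B)\<bar> = sqrt (1 / \<Phi> x0)" by (metis real_sqrt_abs)
    then show ?thesis using p by (simp add: powr_minus_divide powr_half_sqrt real_sqrt_divide)
  qed
  have V: "ennreal (real CARD('n)) * emeasure lborel (cap x0 e) =
      ennreal (\<Phi> x0 powr (- 1 / 2)) * (ennreal (real CARD('n)) * emeasure lborel (B -` cap x0 e))"
    unfolding emeasure_lborel_linear_vimage[OF B(1) det0 cap_measurable] detB by (simp only: mult_ac)
  have Cm: "?C r \<rho> \<in> sets lborel" for r \<rho> by simp
  have "?L = ennreal (\<Phi> x0 powr (- 1 / 2)) * (ennreal (real CARD('n)) * emeasure lborel (?C (1 - e) \<rho>1))"
    unfolding emeasure_lborel_cone[OF e1(2) \<rho>1(1)] \<rho>1_def[symmetric]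
    using e1 \<rho>1(1) by (intro ennreal_mult) auto
  also have "\<dots> \<le> ennreal (\<Phi> x0 powr (- 1 / 2)) * (ennreal (real CARD('n)) * emeasure lborel (B -` cap x0 e))"
    by (rule mult_left_mono[OF mult_left_mono[OF emeasure_mono[OF inc1]]]) (simp_all add: vB)
  finally show "?L \<le> ennreal (real CARD('n)) * emeasure lborel (cap x0 e)" unfolding V .
  have "ennreal (\<Phi> x0 powr (- 1 / 2)) * (ennreal (real CARD('n)) * emeasure lborel (B -` cap x0 e))
      \<le> ennreal (\<Phi> x0 powr (- 1 / 2)) * (ennreal (real CARD('n)) * emeasure lborel (?C 1 \<rho>2))"
    by (rule mult_left_mono[OF mult_left_mono[OF emeasure_mono[OF inc2 Cm]]]) simp_all
  also have "\<dots> = ?U"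
    unfolding emeasure_lborel_cone[OF zero_less_one \<rho>2(1)] \<rho>2_def[symmetric]
    using \<rho>2(1) by (subst ennreal_mult) auto
  finally show "ennreal (real CARD('n)) * emeasure lborel (cap x0 e) \<le> ?U" unfolding V .
qed

end

section \<open>Weighted mass of caps\<close>

lemma sqrt_power_powr: "a > 0 \<Longrightarrow> sqrt a ^ m = a powr (real m / 2)"
  by (simp add: powr_half_sqrt[symmetric] powr_realpow[symmetric] powr_powr)

context smooth_body_cart
begin

text \<open>The two exponents in \<open>weight\<close> satisfy the cancellation condition of
  \<open>surface_integral_powr\<close>, so the support distance drops out and a pure power of \<phi>
  remains.\<close>

lemma weight_mass:
  assumes curv: "\<And>x. x \<in> frontier K \<Longrightarrow> gauss_curvature K x = \<phi> x / norm (dual_pt x) ^ (CARD('n) + 1)"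
    and pos: "\<And>x. x \<noteq> 0 \<Longrightarrow> \<phi> x > 0" and hom: "\<And>c x. c > 0 \<Longrightarrow> x \<noteq> 0 \<Longrightarrow> \<phi> (c *\<^sub>R x) = \<phi> x"
    and meas: "\<phi> \<in> borel_measurable borel" and p: "p \<noteq> - real CARD('n)"
  shows "(LINT x:frontier K \<inter> {x. u \<bullet> x \<ge> t}|surface_measure K. weight p K x) =
    real CARD('n) * (LINT x|lborel. indicator {x \<in> K - {0}. t \<le> u \<bullet> proj x} x * \<phi> x powr (((real CARD('n))\<^sup>2 + p) / (2 * (real CARD('n) + p))))"
proof -
  let ?n = "real CARD('n)"
  let ?A = "{x. u \<bullet> x \<ge> t}"
  let ?a = "(?n\<^sup>2 + p) / (2 * (?n + p))" and ?c = "- ((?n - 1) * (?n\<^sup>2 + 2 * ?n + p) / (2 * (?n + p)))"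
  have np: "?n + p \<noteq> 0" using p by linarith
  have "(?n + 1) * (?n\<^sup>2 + p) - (?n - 1) * (?n\<^sup>2 + 2 * ?n + p) = 2 * (?n + p)"
    by (simp add: algebra_simps power2_eq_square)
  moreover have "(?n + 1) * ?a + ?c = ((?n + 1) * (?n\<^sup>2 + p) - (?n - 1) * (?n\<^sup>2 + 2 * ?n + p)) / (2 * (?n + p))"
    by (simp add: diff_divide_distrib)
  ultimately have ac: "(?n + 1) * ?a + ?c = 1" using np by simp
  have Ab: "?A \<in> sets borel" by measurable
  have sp: "space (surface_measure K) = frontier K"
    by (simp add: surface_measure_def space_restrict_space hausdorff_measure_def)
  have "(LINT x:frontier K \<inter> ?A|surface_measure K. weight p K x) =
      (LINT x|surface_measure K. indicator ?A x * (gauss_curvature K x powr ?a * (x \<bullet> outer_normal K x) powr ?c))"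
    unfolding set_lebesgue_integral_def
    by (rule Bochner_Integration.integral_cong[OF refl]) (simp add: sp weight_def Let_def indicator_def)
  also have "\<dots> = ?n * (LINT x|lborel. indicator (K - {0}) x * (indicator ?A (proj x) * \<phi> x powr ?a))"
    by (rule surface_integral_powr[OF curv pos hom meas Ab ac])
  also have "(\<lambda>x. indicator (K - {0}) x * (indicator ?A (proj x) * \<phi> x powr ?a)) = (\<lambda>x. indicator {x \<in> K - {0}. t \<le> u \<bullet> proj x} x * \<phi> x powr ?a)"
    by (auto simp: fun_eq_iff indicator_def)
  finally show ?thesis .
qed

end

context C1_dual_body
begin

lemma powr_constants:
  assumes c: "c > 1"
  obtains t :: real where "0 < t" "t < 1" "(1 / (1 - t) ^ 3) powr a \<le> c" "1 / c \<le> (1 - t) ^ N * (1 / (1 + t)) powr a"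
proof -
  have "((\<lambda>t::real. (1 / (1 - t) ^ 3) powr a) \<longlongrightarrow> (1 / (1 - 0) ^ 3) powr a) (at_right 0)"
    by (intro tendsto_intros) auto
  from order_tendstoD(2)[OF this, of c] have 1: "\<forall>\<^sub>F t in at_right 0. (1 / (1 - t) ^ 3) powr a < c" using c by simp
  have "((\<lambda>t::real. (1 - t) ^ N * (1 / (1 + t)) powr a) \<longlongrightarrow> (1 - 0) ^ N * (1 / (1 + 0)) powr a) (at_right 0)"
    by (intro tendsto_intros) auto
  from order_tendstoD(1)[OF this, of "1 / c"] have 2: "\<forall>\<^sub>F t in at_right 0. 1 / c < (1 - t) ^ N * (1 / (1 + t)) powr a" using c by simp
  have 3: "\<forall>\<^sub>F t in at_right (0::real). 0 < t \<and> t < 1"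
    by (rule eventually_at_rightI[of 0 1]) auto
  have "\<forall>\<^sub>F t in at_right 0. (0 < t \<and> t < 1) \<and> (1 / (1 - t) ^ 3) powr a < c \<and> 1 / c < (1 - t) ^ N * (1 / (1 + t)) powr a"
    using 3 1 2 by eventually_elim simp
  then obtain t where "(0 < t \<and> t < 1) \<and> (1 / (1 - t) ^ 3) powr a < c \<and> 1 / c < (1 - t) ^ N * (1 / (1 + t)) powr a"
    using eventually_happens[of _ "at_right (0::real)"] by auto
  then show thesis using that[of t] by simp
qed

lemma cap_volume:
  assumes c: "c > 1"
  obtains e0 where "e0 > 0" "e0 < 1" "\<And>x0 e. x0 \<in> frontier K \<Longrightarrow> 0 < e \<Longrightarrow> e \<le> e0 \<Longrightarrow>
    unit_ball_vol (real (CARD('n) - 1)) * (2 * e) powr (real (CARD('n) - 1) / 2) * \<Phi> x0 powr (- 1 / 2) / c \<le> real CARD('n) * measure lborel (cap x0 e) \<and>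
    real CARD('n) * measure lborel (cap x0 e) \<le> c * (unit_ball_vol (real (CARD('n) - 1)) * (2 * e) powr (real (CARD('n) - 1) / 2) * \<Phi> x0 powr (- 1 / 2))"
proof -
  let ?m = "CARD('n) - 1"
  let ?a = "real ?m / 2"
  let ?o = "unit_ball_vol (real ?m)"
  obtain t where t: "0 < t" "t < 1" "(1 / (1 - t) ^ 3) powr ?a \<le> c" "1 / c \<le> (1 - t) ^ CARD('n) * (1 / (1 + t)) powr ?a"
    by (rule powr_constants[OF c]) blast
  obtain r where r: "r > 0" "\<And>x w. x \<in> frontier K \<Longrightarrow> D x w \<bullet> w \<le> r\<^sup>2 \<Longrightarrow>
    \<bar>(gauge_fn (x + w))\<^sup>2 - 1 - 2 * (dual_pt x \<bullet> w) - D x w \<bullet> w\<bar> \<le> t * (D x w \<bullet> w)"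
    using relative_taylor[OF t(1)] by metis
  define e0 where "e0 = min t ((1 - t) ^ 3 * r\<^sup>2 / 4)"
  show ?thesis
  proof (rule that[of e0])
    show "e0 > 0" "e0 < 1" using t r by (auto simp: e0_def)
    fix x0 :: "real^'n" and e :: real assume x0: "x0 \<in> frontier K" and e: "0 < e" "e \<le> e0"
    have e': "e \<le> t" "e \<le> (1 - t) ^ 3 * r\<^sup>2 / 4" using e by (auto simp: e0_def)
    have fin: "emeasure lborel (cap x0 e) \<noteq> \<infinity>"
    proof -
      have "bounded (cap x0 e)" by (rule bounded_subset[OF compact_imp_bounded[OF compact_K]]) (auto simp: cap_def)
      from emeasure_bounded_finite[OF this] show ?thesis by simp
    qed
    then have V: "ennreal (real CARD('n)) * emeasure lborel (cap x0 e) = ennreal (real CARD('n) * measure lborel (cap x0 e))"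
      by (simp add: emeasure_eq_ennreal_measure ennreal_mult)
    note bnd = cap_emeasure_bounds[OF x0 t(1,2) e(1) e' r(1) r(2)[OF x0], unfolded V]
    define P where "P = \<Phi> x0 powr (- 1 / 2)"
    have P: "P \<ge> 0" by (simp add: P_def)
    have s1: "sqrt (2 * e / (1 + t)) ^ ?m = (2 * e) powr ?a * (1 / (1 + t)) powr ?a"
      using e t by (subst sqrt_power_powr) (auto simp: powr_mult[symmetric])
    have s2: "sqrt (2 * e / (1 - t) ^ 3) ^ ?m = (2 * e) powr ?a * (1 / (1 - t) ^ 3) powr ?a"
      using e t by (subst sqrt_power_powr) (auto simp: powr_mult[symmetric])
    have "P * ((1 - e) ^ CARD('n) * (?o * sqrt (2 * e / (1 + t)) ^ ?m)) \<le> real CARD('n) * measure lborel (cap x0 e)"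
      using bnd(1) unfolding P_def
      by (rule ennreal_le_iff[THEN iffD1, rotated]) (assumption, intro mult_nonneg_nonneg measure_nonneg, simp)
    moreover have "?o * (2 * e) powr ?a * P / c \<le> P * ((1 - e) ^ CARD('n) * (?o * sqrt (2 * e / (1 + t)) ^ ?m))"
    proof -
      have "?o * (2 * e) powr ?a * P * (1 / c) \<le> ?o * (2 * e) powr ?a * P * ((1 - t) ^ CARD('n) * (1 / (1 + t)) powr ?a)"
        using P by (intro mult_left_mono t(4)) auto
      also have "\<dots> \<le> ?o * (2 * e) powr ?a * P * ((1 - e) ^ CARD('n) * (1 / (1 + t)) powr ?a)"
        using P e' t by (intro mult_left_mono mult_right_mono power_mono) auto
      also have "\<dots> = P * ((1 - e) ^ CARD('n) * (?o * sqrt (2 * e / (1 + t)) ^ ?m))" unfolding s1 by (simp add: mult_ac)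
      finally show ?thesis by simp
    qed
    ultimately have lower: "?o * (2 * e) powr ?a * P / c \<le> real CARD('n) * measure lborel (cap x0 e)" by linarith
    have nn: "0 \<le> P * (?o * sqrt (2 * e / (1 - t) ^ 3) ^ ?m)"
      using e t P by (intro mult_nonneg_nonneg zero_le_power) auto
    have "real CARD('n) * measure lborel (cap x0 e) \<le> P * (?o * sqrt (2 * e / (1 - t) ^ 3) ^ ?m)"
      by (rule ennreal_le_iff[OF nn, THEN iffD1]) (rule bnd(2)[folded P_def])
    also have "\<dots> = ?o * (2 * e) powr ?a * P * (1 / (1 - t) ^ 3) powr ?a" unfolding s2 by (simp add: mult_ac)
    also have "\<dots> \<le> ?o * (2 * e) powr ?a * P * c" using P by (intro mult_left_mono t(3)) auto
    finally show "?o * (2 * e) powr ?a * \<Phi> x0 powr (- 1 / 2) / c \<le> real CARD('n) * measure lborel (cap x0 e) \<and>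
        real CARD('n) * measure lborel (cap x0 e) \<le> c * (?o * (2 * e) powr ?a * \<Phi> x0 powr (- 1 / 2))"
      using lower unfolding P_def by (simp add: mult_ac)
  qed
qed

definition cap_mass :: "real \<Rightarrow> real^'n \<Rightarrow> real \<Rightarrow> real" where
  "cap_mass p x0 e = (LINT x:frontier K \<inter> {x. dual_pt x0 \<bullet> x \<ge> 1 - e}|surface_measure K. weight p K x)"

lemma cap_mass_eq:
  assumes p: "p \<noteq> - real CARD('n)"
  shows "cap_mass p x0 e = real CARD('n) * (LINT x|lborel. indicator (cap x0 e) x * \<Phi> x powr (((real CARD('n))\<^sup>2 + p) / (2 * (real CARD('n) + p))))"
  unfolding cap_mass_def cap_def by (rule weight_mass[OF gauss_curvature_\<Phi> \<Phi>_pos \<Phi>_scale \<Phi>_measurable p])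

lemma integrable_cap: "integrable lborel (\<lambda>x. indicator (cap x0 e) x * \<Phi> x powr a)"
  by (rule integrable_\<Phi>_powr) (auto simp: cap_def intro: bounded_subset[OF compact_imp_bounded[OF compact_K]])

lemma cap_mass_mono:
  assumes p: "p \<noteq> - real CARD('n)" and "e \<le> e'"
  shows "cap_mass p x0 e \<le> cap_mass p x0 e'"
  unfolding cap_mass_eq[OF p]
proof (intro mult_left_mono integral_mono integrable_cap)
  have "cap x0 e \<subseteq> cap x0 e'" using assms(2) by (auto simp: cap_def)
  then show "indicator (cap x0 e) x * \<Phi> x powr a \<le> indicator (cap x0 e') x * \<Phi> x powr a" for x a
    by (auto simp: indicator_def)
qed simp

text \<open>\<Phi>^\<gamma> is nearly constant on a low cap, so the mass is about
  \<Phi>(x0)^\<gamma> times the volume term with its \<Phi>(x0)^(-1/2). The exponents combine to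
  \<gamma> - 1/2 = n / (n+p) times (n-1) / 2, which lets \<Phi> join the height inside one
  power.\<close>

lemma cap_mass_asymp:
  assumes p: "p \<noteq> - real CARD('n)" and c: "c > 1"
  obtains e0 where "e0 > 0" "e0 < 1" "\<And>x0 e. x0 \<in> frontier K \<Longrightarrow> 0 < e \<Longrightarrow> e \<le> e0 \<Longrightarrow>
    unit_ball_vol (real (CARD('n) - 1)) * (2 * e * \<Phi> x0 powr (real CARD('n) / (real CARD('n) + p))) powr (real (CARD('n) - 1) / 2) / c \<le> cap_mass p x0 e \<and>
    cap_mass p x0 e \<le> c * (unit_ball_vol (real (CARD('n) - 1)) * (2 * e * \<Phi> x0 powr (real CARD('n) / (real CARD('n) + p))) powr (real (CARD('n) - 1) / 2))"
proof -
  let ?n = "real CARD('n)"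
  let ?m = "CARD('n) - 1"
  let ?a = "real ?m / 2"
  let ?o = "unit_ball_vol (real ?m)"
  define \<gamma> where "\<gamma> = (?n\<^sup>2 + p) / (2 * (?n + p))"
  \<comment> \<open>The error factor c is shared equally between the volume of the cap and the
    oscillation of the density on it.\<close>
  define d where "d = sqrt c"
  have d: "d > 1" "d * d = c" using c by (auto simp: d_def)
  have np: "?n + p \<noteq> 0" using p by linarith
  have ex: "\<gamma> + (- 1 / 2) = ?n / (?n + p) * ?a"
  proof -
    have "\<gamma> + (- 1 / 2) = ((?n\<^sup>2 + p) - (?n + p)) / (2 * (?n + p))" using np by (simp add: \<gamma>_def field_simps)
    also have "(?n\<^sup>2 + p) - (?n + p) = ?n * real ?m" by (simp add: power2_eq_square algebra_simps)
    finally show ?thesis by simp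
  qed
  obtain e1 where e1: "e1 > 0" "e1 < 1" "\<And>x0 e. x0 \<in> frontier K \<Longrightarrow> 0 < e \<Longrightarrow> e \<le> e1 \<Longrightarrow>
    ?o * (2 * e) powr ?a * \<Phi> x0 powr (- 1 / 2) / d \<le> ?n * measure lborel (cap x0 e) \<and>
    ?n * measure lborel (cap x0 e) \<le> d * (?o * (2 * e) powr ?a * \<Phi> x0 powr (- 1 / 2))"
    by (rule cap_volume[OF d(1)]) blast
  obtain e2 where e2: "e2 > 0" "\<And>x0 x. x0 \<in> frontier K \<Longrightarrow> x \<in> frontier K \<Longrightarrow> dual_pt x0 \<bullet> x \<ge> 1 - e2 \<Longrightarrow>
    \<Phi> x powr \<gamma> \<le> d * \<Phi> x0 powr \<gamma>" by (rule powr_ratio_near[OF d(1)]) blast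
  \<comment> \<open>The comparison is one-sided in x and x0, so the lower bound on the density comes
    from the exponent -\<gamma>.\<close>
  obtain e3 where e3: "e3 > 0" "\<And>x0 x. x0 \<in> frontier K \<Longrightarrow> x \<in> frontier K \<Longrightarrow> dual_pt x0 \<bullet> x \<ge> 1 - e3 \<Longrightarrow>
    \<Phi> x powr (- \<gamma>) \<le> d * \<Phi> x0 powr (- \<gamma>)" by (rule powr_ratio_near[OF d(1)]) blast
  define e0 where "e0 = min e1 (min e2 e3)"
  show ?thesis
  proof (rule that[of e0])
    show "e0 > 0" "e0 < 1" using e1 e2 e3 by (auto simp: e0_def)
    fix x0 :: "real^'n" and e :: real assume x0: "x0 \<in> frontier K" and e: "0 < e" "e \<le> e0"
    have e': "e \<le> e1" "e \<le> e2" "e \<le> e3" using e by (auto simp: e0_def)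
    have p0: "\<Phi> x0 > 0" by (rule \<Phi>_pos[OF frontier_nonzero[OF x0]])
    let ?C = "cap x0 e"
    have near: "\<Phi> x powr \<gamma> \<le> d * \<Phi> x0 powr \<gamma>" "\<Phi> x0 powr \<gamma> / d \<le> \<Phi> x powr \<gamma>" if x: "x \<in> ?C" for x
    proof -
      have xn: "x \<noteq> 0" using x by (simp add: cap_def)
      have px: "proj x \<in> frontier K" unfolding proj_def by (rule normalized_in_frontier[OF xn])
      have \<Phi>p: "\<Phi> (proj x) = \<Phi> x" unfolding proj_def using gauge_pos[OF xn] xn by (intro \<Phi>_scale) auto
      have in_cap: "dual_pt x0 \<bullet> proj x \<ge> 1 - e" using x by (simp add: cap_def)
      show "\<Phi> x powr \<gamma> \<le> d * \<Phi> x0 powr \<gamma>" using e2(2)[OF x0 px] in_cap e' \<Phi>p by simp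
      have "\<Phi> x powr (- \<gamma>) \<le> d * \<Phi> x0 powr (- \<gamma>)" using e3(2)[OF x0 px] in_cap e' \<Phi>p by simp
      then show "\<Phi> x0 powr \<gamma> / d \<le> \<Phi> x powr \<gamma>" using p0 \<Phi>_pos[OF xn] d by (simp add: powr_minus_divide field_simps)
    qed
    have fin: "emeasure lborel ?C < \<infinity>"
      by (rule emeasure_bounded_finite) (auto simp: cap_def intro: bounded_subset[OF compact_imp_bounded[OF compact_K]])
    have int: "integrable lborel (\<lambda>x. b * indicator ?C x :: real)" for b
      using fin by (intro integrable_mult_right integrable_real_indicator) auto
    have intv: "(LINT x|lborel. b * indicator ?C x :: real) = b * measure lborel ?C" for b by simp
    have X: "\<Phi> x0 powr \<gamma> * (?o * (2 * e) powr ?a * \<Phi> x0 powr (- 1 / 2)) = ?o * (2 * e * \<Phi> x0 powr (?n / (?n + p))) powr ?a"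
    proof -
      have "\<Phi> x0 powr \<gamma> * \<Phi> x0 powr (- 1 / 2) = (\<Phi> x0 powr (?n / (?n + p))) powr ?a"
        unfolding powr_add[symmetric] ex powr_powr ..
      then show ?thesis using e by (simp add: powr_mult mult_ac)
    qed
    let ?I = "LINT x|lborel. indicator ?C x * \<Phi> x powr \<gamma>"
    have Cm: "cap_mass p x0 e = ?n * ?I" unfolding cap_mass_eq[OF p] \<gamma>_def ..
    have "?I \<le> (LINT x|lborel. d * \<Phi> x0 powr \<gamma> * indicator ?C x)"
      by (intro integral_mono integrable_cap int) (use near(1) in \<open>simp add: indicator_def\<close>)
    then have u: "?I \<le> d * \<Phi> x0 powr \<gamma> * measure lborel ?C" by (simp only: intv)
    have "?n * ?I \<le> d * \<Phi> x0 powr \<gamma> * (?n * measure lborel ?C)"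
      using mult_left_mono[OF u, of ?n] by (simp add: mult_ac)
    also have "\<dots> \<le> d * \<Phi> x0 powr \<gamma> * (d * (?o * (2 * e) powr ?a * \<Phi> x0 powr (- 1 / 2)))"
      using e1(3)[OF x0 e(1) e'(1)] d by (intro mult_left_mono) auto
    also have "\<dots> = d * d * (\<Phi> x0 powr \<gamma> * (?o * (2 * e) powr ?a * \<Phi> x0 powr (- 1 / 2)))" by (simp only: mult_ac)
    finally have upper: "cap_mass p x0 e \<le> c * (?o * (2 * e * \<Phi> x0 powr (?n / (?n + p))) powr ?a)" unfolding X Cm d(2) .
    have "(LINT x|lborel. \<Phi> x0 powr \<gamma> / d * indicator ?C x) \<le> ?I"
      by (intro integral_mono integrable_cap int) (use near(2) in \<open>simp add: indicator_def\<close>)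
    then have l: "\<Phi> x0 powr \<gamma> / d * measure lborel ?C \<le> ?I" by (simp only: intv)
    have "?o * (2 * e * \<Phi> x0 powr (?n / (?n + p))) powr ?a / c = \<Phi> x0 powr \<gamma> / d * (?o * (2 * e) powr ?a * \<Phi> x0 powr (- 1 / 2) / d)"
      unfolding X[symmetric] d(2)[symmetric] by simp
    also have "\<dots> \<le> \<Phi> x0 powr \<gamma> / d * (?n * measure lborel ?C)"
      using e1(3)[OF x0 e(1) e'(1)] d by (intro mult_left_mono) auto
    also have "\<dots> \<le> ?n * ?I" using mult_left_mono[OF l, of ?n] by (simp add: mult_ac)
    finally have lower: "?o * (2 * e * \<Phi> x0 powr (?n / (?n + p))) powr ?a / c \<le> cap_mass p x0 e" unfolding Cm .
    show "?o * (2 * e * \<Phi> x0 powr (?n / (?n + p))) powr ?a / c \<le> cap_mass p x0 e \<and>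
      cap_mass p x0 e \<le> c * (?o * (2 * e * \<Phi> x0 powr (?n / (?n + p))) powr ?a)"
      using lower upper by blast
  qed
qed

section \<open>Surface bodies and their polars\<close>

text \<open>Setting the leading term \<omega> (2 e \<Phi>^(n/(n+p)))^((n-1)/2) equal to s and
  solving for e gives this number times s^(2/(n-1)); the factor 2 \<omega>^(2/(n-1)) that appears is
  \<open>ball_const\<close>.\<close>

definition cap_height :: "real \<Rightarrow> real^'n \<Rightarrow> real" where
  "cap_height p x = \<Phi> x powr (- (real CARD('n) / (real CARD('n) + p))) / ball_const (real CARD('n))"

lemma cap_dim_pos: "real (CARD('n) - 1) > 0"
  using dim2 by simp

lemma ball_const_eq: "ball_const (real CARD('n)) = 2 * unit_ball_vol (real (CARD('n) - 1)) powr (2 / real (CARD('n) - 1))"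
  using dim2 by (simp add: ball_const_def of_nat_diff)

lemma ball_const_pos: "ball_const (real CARD('n)) > 0"
proof -
  have "unit_ball_vol (real (CARD('n) - 1)) > 0" by (rule unit_ball_vol_pos) (rule of_nat_0_le_iff)
  then show ?thesis unfolding ball_const_eq by (intro mult_pos_pos) (simp, simp only: powr_gt_zero)
qed

lemma cap_height_bounds:
  obtains b where "b > 0" "\<And>x. x \<noteq> 0 \<Longrightarrow> 0 < cap_height p x \<and> cap_height p x \<le> b"
proof -
  obtain a b where ab: "0 < a" "\<And>x. x \<noteq> 0 \<Longrightarrow> a \<le> \<Phi> x powr (- (real CARD('n) / (real CARD('n) + p)))"
    "\<And>x. x \<noteq> 0 \<Longrightarrow> \<Phi> x powr (- (real CARD('n) / (real CARD('n) + p))) \<le> b"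
    by (rule \<Phi>_powr_bounds) blast
  define b' where "b' = \<bar>b\<bar> + 1"
  have "0 < cap_height p x \<and> cap_height p x \<le> b' / ball_const (real CARD('n))" if "x \<noteq> 0" for x
    unfolding cap_height_def using \<Phi>_pos[OF that] ab(3)[OF that] ball_const_pos
    by (auto intro!: divide_right_mono simp: b'_def)
  moreover have "b' / ball_const (real CARD('n)) > 0" using ball_const_pos by (simp add: b'_def)
  ultimately show thesis using that by blast
qed

lemma eventually_small_powr:
  assumes b: "b > 0" shows "\<forall>\<^sub>F s in at_right 0. a * s powr (2 / real (CARD('n) - 1)) < b"
proof -
  have "((\<lambda>s. s powr (2 / real (CARD('n) - 1))) \<longlongrightarrow> 0) (at_right 0)"
    using cap_dim_pos by (intro tendsto_zero_powrI) (auto intro: tendsto_intros eventually_at_right_less[THEN eventually_mono])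
  from tendsto_mult_left[OF this, of a] have "((\<lambda>s. a * s powr (2 / real (CARD('n) - 1))) \<longlongrightarrow> 0) (at_right 0)" by simp
  from order_tendstoD(2)[OF this b] show ?thesis .
qed

text \<open>Stretching the height of the cap of mass about s by l multiplies its mass by
  l^((n-1)/2). The bound on \<open>cap_height\<close> makes the admissible range of s independent of
  x.\<close>

lemma cap_mass_level:
  assumes p: "p \<noteq> - real CARD('n)" and l: "l > 0" and c: "c > 1"
  shows "\<forall>\<^sub>F s in at_right 0. \<forall>x\<in>frontier K.
    l powr (real (CARD('n) - 1) / 2) * s / c \<le> cap_mass p x (l * cap_height p x * s powr (2 / real (CARD('n) - 1))) \<and>
    cap_mass p x (l * cap_height p x * s powr (2 / real (CARD('n) - 1))) \<le> c * (l powr (real (CARD('n) - 1) / 2) * s)"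
proof -
  obtain e0 where e0: "e0 > 0" "e0 < 1" "\<And>x0 e. x0 \<in> frontier K \<Longrightarrow> 0 < e \<Longrightarrow> e \<le> e0 \<Longrightarrow>
    unit_ball_vol (real (CARD('n) - 1)) * (2 * e * \<Phi> x0 powr (real CARD('n) / (real CARD('n) + p))) powr (real (CARD('n) - 1) / 2) / c \<le> cap_mass p x0 e \<and>
    cap_mass p x0 e \<le> c * (unit_ball_vol (real (CARD('n) - 1)) * (2 * e * \<Phi> x0 powr (real CARD('n) / (real CARD('n) + p))) powr (real (CARD('n) - 1) / 2))"
    by (rule cap_mass_asymp[OF p c]) blast
  obtain b where b: "b > 0" "\<And>x. x \<noteq> 0 \<Longrightarrow> 0 < cap_height p x \<and> cap_height p x \<le> b"
    by (rule cap_height_bounds) blast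
  have pos: "\<forall>\<^sub>F s in at_right (0::real). 0 < s" by (rule eventually_at_right_less)
  show ?thesis
    using eventually_small_powr[OF e0(1), of "l * b"] pos
  proof eventually_elim
    case (elim s)
    show ?case
    proof
      fix x assume x: "x \<in> frontier K"
      have x0: "x \<noteq> 0" by (rule frontier_nonzero[OF x])
      define e where "e = l * cap_height p x * s powr (2 / real (CARD('n) - 1))"
      have h: "0 < cap_height p x" "cap_height p x \<le> b" using b(2)[OF x0] by auto
      have e: "0 < e" using l h elim by (simp add: e_def)
      have "e \<le> l * b * s powr (2 / real (CARD('n) - 1))" using l h unfolding e_def by (intro mult_right_mono mult_left_mono) auto
      then have ee: "e \<le> e0" using elim by linarith
      define m where "m = real (CARD('n) - 1)"
      define \<omega> where "\<omega> = unit_ball_vol m"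
      have m: "m > 0" unfolding m_def by (rule cap_dim_pos)
      have \<omega>: "\<omega> > 0" unfolding \<omega>_def using m by simp
      have "2 * e * \<Phi> x powr (real CARD('n) / (real CARD('n) + p)) = l * s powr (2 / m) / \<omega> powr (2 / m)"
        using \<Phi>_pos[OF x0] unfolding e_def cap_height_def ball_const_eq m_def[symmetric] \<omega>_def[symmetric]
        by (simp add: powr_minus_divide)
      also have "(\<dots>) powr (m / 2) = l powr (m / 2) * s / \<omega>"
        using l elim \<omega> m by (simp add: powr_mult powr_divide powr_powr)
      finally have "\<omega> * (2 * e * \<Phi> x powr (real CARD('n) / (real CARD('n) + p))) powr (m / 2) = l powr (m / 2) * s"
        using \<omega> by simp
      note eq = this[unfolded \<omega>_def, unfolded m_def]
      show "l powr (real (CARD('n) - 1) / 2) * s / c \<le> cap_mass p x (l * cap_height p x * s powr (2 / real (CARD('n) - 1))) \<and>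
          cap_mass p x (l * cap_height p x * s powr (2 / real (CARD('n) - 1))) \<le> c * (l powr (real (CARD('n) - 1) / 2) * s)"
        using e0(3)[OF x e ee] unfolding eq e_def[symmetric] .
    qed
  qed
qed

text \<open>A cap with height slightly below the predicted one has mass at most s, so its
  complementary half-space is among those that are intersected.\<close>

lemma surface_body_outer:
  assumes p: "p \<noteq> - real CARD('n)" and l: "0 < l" "l < 1"
  shows "\<forall>\<^sub>F s in at_right 0. \<forall>x\<in>frontier K. \<forall>z\<in>surface_body K (weight p K) s.
    dual_pt x \<bullet> z \<le> 1 - l * cap_height p x * s powr (2 / real (CARD('n) - 1))"
proof -
  \<comment> \<open>The error factor is chosen to use up exactly the mass gained by shrinking the
    height by l.\<close>
  define c where "c = 1 / l powr (real (CARD('n) - 1) / 2)"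
  have "l powr (real (CARD('n) - 1) / 2) < 1 powr (real (CARD('n) - 1) / 2)" using l cap_dim_pos by (intro powr_less_mono2) auto
  then have c: "c > 1" using l by (simp add: c_def)
  show ?thesis using cap_mass_level[OF p l(1) c]
  proof eventually_elim
    case (elim s)
    show ?case
    proof (intro ballI)
      fix x z assume x: "x \<in> frontier K" and z: "z \<in> surface_body K (weight p K) s"
      define e where "e = l * cap_height p x * s powr (2 / real (CARD('n) - 1))"
      have "c * (l powr (real (CARD('n) - 1) / 2) * s) = s" using l by (simp add: c_def)
      moreover have "cap_mass p x e \<le> c * (l powr (real (CARD('n) - 1) / 2) * s)" using elim x unfolding e_def by blast
      ultimately have "cap_mass p x e \<le> s" by (simp only:)
      then have "(LINT x:frontier K \<inter> {z. dual_pt x \<bullet> z \<ge> 1 - e}|surface_measure K. weight p K x) \<le> s"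
        by (simp only: cap_mass_def)
      moreover have "dual_pt x \<noteq> 0" by (rule dual_pt_nonzero[OF frontier_nonzero[OF x]])
      ultimately show "dual_pt x \<bullet> z \<le> 1 - l * cap_height p x * s powr (2 / real (CARD('n) - 1))"
        using z unfolding surface_body_def e_def by blast
    qed
  qed
qed

text \<open>A half-space in the intersection has its normal along some \<open>dual_pt x1\<close>,
  and its cap has mass at most s, hence height below l times the predicted one. If x0 lies close to
  x1, \<open>cap_height\<close> at the two points differs at most by the factor l, and the point on
  the ray of x0 lies deep enough; otherwise the low cap at x1 does not reach that ray.\<close>

lemma surface_body_inner:
  assumes p: "p \<noteq> - real CARD('n)" and L: "L > 1"
  shows "\<forall>\<^sub>F s in at_right 0. \<forall>x\<in>frontier K.
    (1 - L * cap_height p x * s powr (2 / real (CARD('n) - 1))) *\<^sub>R x \<in> surface_body K (weight p K) s"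
proof -
  \<comment> \<open>One factor l makes the mass exceed s strictly, the other absorbs the change of
    \<open>cap_height\<close> from x1 to x0.\<close>
  define l where "l = sqrt L"
  have l: "l > 1" "l * l = L" using L by (auto simp: l_def)
  \<comment> \<open>Half of the exponent (n-1)/2, so that dividing l^((n-1)/2) s by c still leaves c
    s, which exceeds s.\<close>
  define c where "c = l powr (real (CARD('n) - 1) / 4)"
  have "1 powr (real (CARD('n) - 1) / 4) < c" unfolding c_def using l cap_dim_pos by (intro powr_less_mono2) auto
  then have c: "c > 1" by simp
  have cl: "l powr (real (CARD('n) - 1) / 2) = c * c" unfolding c_def using l by (simp add: powr_add[symmetric])
  obtain e2 where e2: "e2 > 0" "\<And>x0 x. x0 \<in> frontier K \<Longrightarrow> x \<in> frontier K \<Longrightarrow> dual_pt x0 \<bullet> x \<ge> 1 - e2 \<Longrightarrow>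
    \<Phi> x powr (real CARD('n) / (real CARD('n) + p)) \<le> l * \<Phi> x0 powr (real CARD('n) / (real CARD('n) + p))"
    by (rule powr_ratio_near[OF l(1)]) blast
  obtain b where b: "b > 0" "\<And>x. x \<noteq> 0 \<Longrightarrow> 0 < cap_height p x \<and> cap_height p x \<le> b"
    by (rule cap_height_bounds) blast
  have e3: "min e2 1 > 0" using e2 by simp
  have pos: "\<forall>\<^sub>F s in at_right (0::real). 0 < s" by (rule eventually_at_right_less)
  have l0: "l > 0" using l by simp
  show ?thesis
    using cap_mass_level[OF p l0 c] eventually_small_powr[OF e3, of "L * b"] pos
  proof eventually_elim
    case (elim s)
    let ?\<delta> = "s powr (2 / real (CARD('n) - 1))"
    have \<delta>: "?\<delta> > 0" using elim by simp
    have small: "0 < k * cap_height p x * ?\<delta> \<and> k * cap_height p x * ?\<delta> < min e2 1" if "x \<in> frontier K" "0 < k" "k \<le> L" for x k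
    proof -
      have h: "0 < cap_height p x" "cap_height p x \<le> b" using b(2)[OF frontier_nonzero[OF that(1)]] by auto
      have "k * cap_height p x * ?\<delta> \<le> L * b * ?\<delta>" using that h L b(1) \<delta> by (intro mult_right_mono mult_mono) auto
      then have "k * cap_height p x * ?\<delta> < min e2 1" using elim(2) by (rule le_less_trans)
      moreover have "0 < k * cap_height p x * ?\<delta>" using that(2) h(1) \<delta> by (intro mult_pos_pos)
      ultimately show ?thesis by blast
    qed
    have lL: "l \<le> L" using l mult_left_mono[of 1 l l] by simp
    show ?case
    proof
      fix x0 assume x0: "x0 \<in> frontier K"
      have "u \<bullet> ((1 - L * cap_height p x0 * ?\<delta>) *\<^sub>R x0) \<le> t"
        if u: "u \<noteq> 0" and m: "(LINT x:frontier K \<inter> {x. u \<bullet> x \<ge> t}|surface_measure K. weight p K x) \<le> s" for u t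
      proof -
        define h where "h = supp K u"
        have h: "h > 0" unfolding h_def by (rule supp_pos[OF u])
        obtain x1 where x1: "x1 \<in> frontier K" "u = h *\<^sub>R dual_pt x1"
          using dual_pt_surj[OF u] unfolding h_def by metis
        have "{x. u \<bullet> x \<ge> t} = {x. dual_pt x1 \<bullet> x \<ge> 1 - (1 - t / h)}"
          using h by (simp add: x1(2) pos_divide_le_eq mult.commute)
        then have cm: "cap_mass p x1 (1 - t / h) \<le> s" using m by (simp only: cap_mass_def)
        let ?e1 = "l * cap_height p x1 * ?\<delta>"
        have "l powr (real (CARD('n) - 1) / 2) * s / c \<le> cap_mass p x1 ?e1" using elim(1) x1(1) by blast
        moreover have "l powr (real (CARD('n) - 1) / 2) * s / c = c * s" using c unfolding cl by simp
        moreover have "c * s > s" using c elim by simp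
        ultimately have "cap_mass p x1 ?e1 > s" by linarith
        then have lt: "1 - t / h < ?e1" using cap_mass_mono[OF p, of ?e1 "1 - t / h" x1] cm by linarith
        define a where "a = dual_pt x1 \<bullet> x0"
        have a1: "a \<le> 1" using dual_pt_frontier(3)[OF x1(1), of x0] x0 by (simp add: a_def inner_commute frontier_iff_gauge)
        let ?e0 = "L * cap_height p x0 * ?\<delta>"
        have s0: "0 < ?e0" "?e0 < 1" using small[OF x0, of L] L by auto
        have s1: "0 < ?e1" "?e1 < 1" "?e1 < e2" using small[OF x1(1) l0 lL] by auto
        have "(1 - ?e0) * a \<le> 1 - ?e1"
        proof (cases "a \<ge> 1 - e2")
          case True
          have "\<Phi> x0 powr (real CARD('n) / (real CARD('n) + p)) \<le> l * \<Phi> x1 powr (real CARD('n) / (real CARD('n) + p))"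
            using e2(2)[OF x1(1) x0] True by (simp add: a_def)
          then have "1 / \<Phi> x1 powr (real CARD('n) / (real CARD('n) + p)) \<le> l * (1 / \<Phi> x0 powr (real CARD('n) / (real CARD('n) + p)))"
            using \<Phi>_pos[OF frontier_nonzero[OF x0]] \<Phi>_pos[OF frontier_nonzero[OF x1(1)]] by (simp add: field_simps)
          then have "1 / \<Phi> x1 powr (real CARD('n) / (real CARD('n) + p)) / ball_const (real CARD('n)) \<le>
              l * (1 / \<Phi> x0 powr (real CARD('n) / (real CARD('n) + p))) / ball_const (real CARD('n))"
            using ball_const_pos by (intro divide_right_mono) auto
          then have "cap_height p x1 \<le> l * cap_height p x0" unfolding cap_height_def powr_minus_divide by simp
          then have "l * cap_height p x1 * ?\<delta> \<le> l * (l * cap_height p x0) * ?\<delta>"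
            using l \<delta> by (intro mult_right_mono mult_left_mono) auto
          then have "?e1 \<le> ?e0" by (simp only: l(2)[symmetric] mult.assoc)
          moreover have "(1 - ?e0) * a \<le> 1 - ?e0" by (rule mult_left_le[OF a1]) (use s0 in linarith)
          ultimately show ?thesis by linarith
        next
          case False
          show ?thesis
          proof (cases "a \<ge> 0")
            case True
            have "(1 - ?e0) * a \<le> 1 * a" using True s0 by (intro mult_right_mono) auto
            then show ?thesis using False s1 by linarith
          next
            case False
            then have "(1 - ?e0) * a \<le> 0" using s0 by (intro mult_nonneg_nonpos) auto
            then show ?thesis using s1 by linarith
          qed
        qed
        then have "(1 - ?e0) * a < t / h" using lt by linarith
        then have "h * ((1 - ?e0) * a) \<le> t" using h by (simp add: pos_less_divide_eq mult.commute)
        then show ?thesis by (simp add: x1(2) a_def mult_ac)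
      qed
      then show "(1 - L * cap_height p x0 * ?\<delta>) *\<^sub>R x0 \<in> surface_body K (weight p K) s"
        unfolding surface_body_def by blast
    qed
  qed
qed

end

section \<open>Volumes of star-shaped sets and the limit\<close>

context smooth_body_cart
begin

text \<open>A substitute for integration in polar coordinates. Space is divided into the cones
  \<open>S j\<close> on which \<rho> lies between consecutive powers of a; inside each of them the
  star-shaped set lies between two dilates of \<open>K\<close> whose volumes differ by the factor
  a^n = c, and c tends to 1.\<close>

lemma emeasure_star_set:
  assumes [measurable]: "\<rho> \<in> borel_measurable borel" and hom: "\<And>c x. c > 0 \<Longrightarrow> \<rho> (c *\<^sub>R x) = \<rho> x"
    and ge1: "\<And>x. \<rho> x \<ge> 1"
  shows "emeasure lborel {x. gauge_fn x \<le> \<rho> x} = (\<integral>\<^sup>+x. indicator K x * ennreal (\<rho> x ^ CARD('n)) \<partial>lborel)"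
proof -
  let ?n = "CARD('n)"
  let ?F = "{x. gauge_fn x \<le> \<rho> x}"
  let ?I = "\<lambda>A. (\<integral>\<^sup>+x. indicator K x * ennreal (\<rho> x ^ ?n) * indicator A x \<partial>lborel)"
  have main: "emeasure lborel ?F \<le> ennreal c * ?I UNIV \<and> ?I UNIV \<le> ennreal c * emeasure lborel ?F" if c: "c > 1" for c
  proof -
    define a where "a = root ?n c"
    have n: "?n > 0" by simp
    have a: "a > 1" "a ^ ?n = c" using c by (simp_all add: a_def)
    define S where "S j = {x. a ^ j \<le> \<rho> x \<and> \<rho> x < a ^ Suc j}" for j
    have S [measurable]: "S j \<in> sets borel" for j unfolding S_def by measurable
    have cover: "\<exists>j. x \<in> S j" for x
    proof -
      obtain k where k: "\<rho> x < a ^ k" using real_arch_pow[OF a(1)] by blast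
      define k0 where "k0 = (LEAST k. \<rho> x < a ^ k)"
      have k0: "\<rho> x < a ^ k0" unfolding k0_def by (rule LeastI[of "\<lambda>k. \<rho> x < a ^ k", OF k])
      have "k0 \<noteq> 0"
      proof
        assume "k0 = 0"
        then show False using k0 ge1[of x] by simp
      qed
      then obtain j where j: "k0 = Suc j" by (cases k0) auto
      have "\<not> \<rho> x < a ^ j"
        unfolding k0_def[symmetric] using not_less_Least[of j "\<lambda>k. \<rho> x < a ^ k"] j unfolding k0_def by simp
      then show ?thesis using k0 j by (auto simp: S_def intro!: exI[of _ j])
    qed
    have disj: "disjoint_family S"
      unfolding disjoint_family_on_def
    proof (intro ballI impI)
      fix i j :: nat assume ij: "i \<noteq> j"
      have *: "False" if "x \<in> S i" "x \<in> S j" "i < j" for x i j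
      proof -
        have "a ^ Suc i \<le> a ^ j" using that(3) a(1) by (intro power_increasing) auto
        then show False using that(1,2) unfolding S_def by (simp del: power_Suc)
      qed
      then show "S i \<inter> S j = {}" using ij by (metis disjoint_iff nat_neq_iff)
    qed
    have ball: "emeasure lborel {x \<in> S j. gauge_fn x \<le> b} = ennreal (b ^ ?n) * emeasure lborel (K \<inter> S j)" if b: "b > 0" for b j
    proof -
      have "(\<lambda>x. (1 / b) *\<^sub>R x) -` (K \<inter> S j) = {x \<in> S j. gauge_fn x \<le> b}"
        using b hom[of "1 / b"] by (auto simp: S_def mem_iff_gauge gauge_scale divide_le_eq)
      then show ?thesis using emeasure_lborel_scaling[of "1 / b" "K \<inter> S j"] b by simp
    qed
    define V where "V j = emeasure lborel (K \<inter> S j)" for j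
    have low: "ennreal ((a ^ j) ^ ?n) * V j \<le> emeasure lborel (?F \<inter> S j)" for j
      unfolding V_def using a(1) by (subst ball[symmetric]) (auto intro!: emeasure_mono simp: S_def)
    have up: "emeasure lborel (?F \<inter> S j) \<le> ennreal ((a ^ Suc j) ^ ?n) * V j" for j
      unfolding V_def using a(1) by (subst ball[symmetric]) (auto intro!: emeasure_mono simp: S_def simp del: power_Suc)
    have Iup: "?I (S j) \<le> ennreal ((a ^ Suc j) ^ ?n) * V j" for j
    proof -
      have "?I (S j) \<le> (\<integral>\<^sup>+x. ennreal ((a ^ Suc j) ^ ?n) * indicator (K \<inter> S j) x \<partial>lborel)"
      proof (rule nn_integral_mono)
        fix x
        have "\<rho> x ^ ?n \<le> (a ^ Suc j) ^ ?n" if "x \<in> S j"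
          using that ge1[of x] unfolding S_def by (intro power_mono) auto
        then show "indicator K x * ennreal (\<rho> x ^ ?n) * indicator (S j) x \<le> ennreal ((a ^ Suc j) ^ ?n) * indicator (K \<inter> S j) x"
          by (auto simp: indicator_def intro!: ennreal_leI simp del: power_Suc)
      qed
      then show ?thesis by (simp add: nn_integral_cmult_indicator V_def del: power_Suc)
    qed
    have Ilow: "ennreal ((a ^ j) ^ ?n) * V j \<le> ?I (S j)" for j
    proof -
      have "(\<integral>\<^sup>+x. ennreal ((a ^ j) ^ ?n) * indicator (K \<inter> S j) x \<partial>lborel) \<le> ?I (S j)"
      proof (rule nn_integral_mono)
        fix x
        have "(a ^ j) ^ ?n \<le> \<rho> x ^ ?n" if "x \<in> S j"
          using that a(1) unfolding S_def by (intro power_mono) auto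
        then show "ennreal ((a ^ j) ^ ?n) * indicator (K \<inter> S j) x \<le> indicator K x * ennreal (\<rho> x ^ ?n) * indicator (S j) x"
          by (auto simp: indicator_def intro!: ennreal_leI)
      qed
      then show ?thesis by (simp add: nn_integral_cmult_indicator V_def)
    qed
    have step: "ennreal ((a ^ Suc j) ^ ?n) * V j = ennreal c * (ennreal ((a ^ j) ^ ?n) * V j)" for j
    proof -
      have "(a ^ Suc j) ^ ?n = c * (a ^ j) ^ ?n" by (simp add: power_mult_distrib a(2))
      then show ?thesis using a(1) c by (simp only: ennreal_mult_mult_left[symmetric]) (simp add: ennreal_mult mult.assoc)
    qed
    have sumF: "(\<Sum>j. emeasure lborel (?F \<inter> S j)) = emeasure lborel ?F"
    proof -
      have "(\<Sum>j. emeasure lborel (?F \<inter> S j)) = emeasure lborel (\<Union>j. ?F \<inter> S j)"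
        using disj by (intro suminf_emeasure) (auto simp: disjoint_family_on_def)
      moreover have "(\<Union>j. ?F \<inter> S j) = ?F" using cover by blast
      ultimately show ?thesis by simp
    qed
    have sumI: "(\<Sum>j. ?I (S j)) = ?I UNIV"
    proof -
      have "(\<Sum>j. ?I (S j)) = (\<integral>\<^sup>+x. (\<Sum>j. indicator K x * ennreal (\<rho> x ^ ?n) * indicator (S j) x) \<partial>lborel)"
        by (rule nn_integral_suminf[symmetric]) measurable
      also have "\<dots> = ?I UNIV"
      proof (rule nn_integral_cong)
        fix x
        have "(\<Sum>j. indicator (S j) x :: ennreal) = indicator (\<Union>j. S j) x" by (rule suminf_indicator[OF disj])
        also have "(\<Union>j. S j) = UNIV" using cover by blast
        finally show "(\<Sum>j. indicator K x * ennreal (\<rho> x ^ ?n) * indicator (S j) x) = indicator K x * ennreal (\<rho> x ^ ?n) * indicator UNIV x"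
          by simp
      qed
      finally show ?thesis .
    qed
    have "emeasure lborel (?F \<inter> S j) \<le> ennreal c * ?I (S j)" for j
      by (rule order_trans[OF up]) (simp only: step, intro mult_left_mono Ilow, simp)
    then have "(\<Sum>j. emeasure lborel (?F \<inter> S j)) \<le> (\<Sum>j. ennreal c * ?I (S j))" by (intro suminf_le) auto
    then have 1: "emeasure lborel ?F \<le> ennreal c * ?I UNIV" by (simp only: sumF sumI ennreal_suminf_cmult)
    have "?I (S j) \<le> ennreal c * emeasure lborel (?F \<inter> S j)" for j
      by (rule order_trans[OF Iup]) (simp only: step, intro mult_left_mono low, simp)
    then have "(\<Sum>j. ?I (S j)) \<le> (\<Sum>j. ennreal c * emeasure lborel (?F \<inter> S j))" by (intro suminf_le) auto
    then have 2: "?I UNIV \<le> ennreal c * emeasure lborel ?F" by (simp only: sumF sumI ennreal_suminf_cmult)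
    show ?thesis using 1 2 by blast
  qed
  have "emeasure lborel ?F = ?I UNIV"
    by (rule antisym) (rule ennreal_le_of_le_mult, use main in blast)+
  then show ?thesis by simp
qed

end

context C1_dual_body
begin

interpretation P: smooth_body_cart "polar_body K" by (rule smooth_body_polar)

definition polar_height :: "real \<Rightarrow> real^'n \<Rightarrow> real" where
  "polar_height p y = cap_height p (P.dual_pt y)"

lemma polar_point:
  assumes "y \<noteq> 0"
  obtains x where "x \<in> frontier K" "y = supp K y *\<^sub>R dual_pt x" "polar_height p y = cap_height p x"
proof -
  obtain x where x: "x \<in> frontier K" "y = supp K y *\<^sub>R dual_pt x" by (rule dual_pt_surj[OF assms])
  have sp: "supp K y > 0" by (rule supp_pos[OF assms])
  have "P.dual_pt y = supp K y *\<^sub>R x"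
    using P.dual_pt_scale[OF sp, of "dual_pt x"] x(2) by simp
  then have "polar_height p y = cap_height p x"
    using \<Phi>_scale[OF sp frontier_nonzero[OF x(1)]] by (simp add: polar_height_def cap_height_def)
  then show thesis using that x by blast
qed

text \<open>Each direction y is a multiple of \<open>dual_pt x\<close> for a boundary point x. The
  bound on \<open>dual_pt x\<close> over the surface body gives the first inclusion; for the second,
  the single test point on the ray of x is enough.\<close>

lemma polar_surface_body_sandwich:
  assumes p: "p \<noteq> - real CARD('n)" and l: "0 < l" "l < 1" and L: "L > 1"
  shows "\<forall>\<^sub>F s in at_right 0.
    {y. supp K y * (1 - l * s powr (2 / real (CARD('n) - 1)) * polar_height p y) \<le> 1} \<subseteq> polar_body (surface_body K (weight p K) s) \<and>
    polar_body (surface_body K (weight p K) s) \<subseteq> {y. supp K y * (1 - L * s powr (2 / real (CARD('n) - 1)) * polar_height p y) \<le> 1}"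
  using surface_body_outer[OF p l] surface_body_inner[OF p L]
proof eventually_elim
  case (elim s)
  let ?\<delta> = "s powr (2 / real (CARD('n) - 1))"
  let ?S = "surface_body K (weight p K) s"
  show ?case
  proof (intro conjI subsetI)
    fix y assume y: "y \<in> {y. supp K y * (1 - l * ?\<delta> * polar_height p y) \<le> 1}"
    show "y \<in> polar_body ?S"
    proof (cases "y = 0")
      case False
      obtain x where x: "x \<in> frontier K" "y = supp K y *\<^sub>R dual_pt x" "polar_height p y = cap_height p x"
        by (rule polar_point[OF False])
      have "z \<bullet> y \<le> 1" if "z \<in> ?S" for z
      proof -
        have "dual_pt x \<bullet> z \<le> 1 - l * cap_height p x * ?\<delta>" using elim(1) x(1) that by blast
        then have "supp K y * (dual_pt x \<bullet> z) \<le> supp K y * (1 - l * cap_height p x * ?\<delta>)"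
          by (rule mult_left_mono) (rule supp_nonneg)
        also have "\<dots> \<le> 1" using y by (simp add: x(3) mult_ac)
        finally have "supp K y * (dual_pt x \<bullet> z) \<le> 1" .
        moreover have "z \<bullet> y = supp K y * (dual_pt x \<bullet> z)" by (subst x(2)) (simp add: inner_commute)
        ultimately show ?thesis by simp
      qed
      then show ?thesis by (simp add: polar_body_def)
    qed (simp add: polar_body_def)
  next
    fix y assume y: "y \<in> polar_body ?S"
    show "y \<in> {y. supp K y * (1 - L * ?\<delta> * polar_height p y) \<le> 1}"
    proof (cases "y = 0")
      case False
      obtain x where x: "x \<in> frontier K" "y = supp K y *\<^sub>R dual_pt x" "polar_height p y = cap_height p x"
        by (rule polar_point[OF False])
      have "(1 - L * cap_height p x * ?\<delta>) *\<^sub>R x \<in> ?S" using elim(2) x(1) by blast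
      then have "((1 - L * cap_height p x * ?\<delta>) *\<^sub>R x) \<bullet> y \<le> 1" using y by (simp only: polar_body_def mem_Collect_eq)
      moreover have "x \<bullet> y = supp K y" by (subst x(2)) (simp add: dual_pt_frontier(2)[OF x(1)])
      ultimately show ?thesis by (simp add: x(3) mult_ac)
    qed simp
  qed
qed

lemma polar_height_measurable [measurable]: "polar_height p \<in> borel_measurable borel"
  unfolding polar_height_def cap_height_def by measurable

lemma polar_height_scale: "c > 0 \<Longrightarrow> polar_height p (c *\<^sub>R y) = polar_height p y"
  using \<Phi>_scale[of c "P.dual_pt y"] P.dual_pt_nonzero[of y]
  by (cases "y = 0") (simp_all add: polar_height_def cap_height_def P.dual_pt_scale)

lemma polar_height_bounds:
  obtains b where "b > 0" "\<And>y. 0 \<le> polar_height p y \<and> polar_height p y \<le> b"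
proof -
  obtain b where b: "b > 0" "\<And>x. x \<noteq> 0 \<Longrightarrow> 0 < cap_height p x \<and> cap_height p x \<le> b"
    by (rule cap_height_bounds) blast
  have "0 \<le> cap_height p x \<and> cap_height p x \<le> max b (cap_height p 0)" for x
    using b(2)[of x] ball_const_pos by (cases "x = 0") (auto simp: cap_height_def)
  then show thesis using b(1) by (intro that[of "max b (cap_height p 0)"]) (auto simp: polar_height_def)
qed

text \<open>The reciprocal of 1 - \<delta> q is the factor by which the polar body is stretched in
  direction y; the bound 1/2 keeps it between 1 and 2.\<close>

lemma measure_star_set:
  assumes \<delta>: "\<delta> \<ge> 0" and small: "\<And>y. \<delta> * polar_height p y \<le> 1 / 2"
  shows "{y. supp K y * (1 - \<delta> * polar_height p y) \<le> 1} \<in> sets borel" (is "?F \<in> _")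
    and "emeasure lborel {y. supp K y * (1 - \<delta> * polar_height p y) \<le> 1} < \<infinity>"
    and "integrable lborel (\<lambda>y. indicator (polar_body K) y * (1 / (1 - \<delta> * polar_height p y)) ^ CARD('n))" (is "integrable lborel ?g")
    and "measure lborel {y. supp K y * (1 - \<delta> * polar_height p y) \<le> 1} =
      (LINT y|lborel. indicator (polar_body K) y * (1 / (1 - \<delta> * polar_height p y)) ^ CARD('n))"
proof -
  have sm [measurable]: "supp K \<in> borel_measurable borel" using P.measurable_gauge by (simp add: P_gauge)
  show F [measurable]: "?F \<in> sets borel" by measurable
  obtain b where b: "b > 0" "\<And>y. 0 \<le> polar_height p y \<and> polar_height p y \<le> b" by (rule polar_height_bounds) blast
  let ?\<rho> = "\<lambda>y. 1 / (1 - \<delta> * polar_height p y)"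
  have \<rho>1: "?\<rho> y \<ge> 1" for y proof -
    have "0 \<le> \<delta> * polar_height p y" using b(2)[of y] \<delta> by simp
    then show ?thesis using small[of y] by simp
  qed
  have \<rho>2: "?\<rho> y \<le> 2" for y using small[of y] by (simp add: divide_le_eq)
  have pos: "1 - \<delta> * polar_height p y > 0" for y using small[of y] by linarith
  have eq: "?F = {y. P.gauge_fn y \<le> ?\<rho> y}"
    unfolding P_gauge using pos by (simp add: pos_le_divide_eq)
  have em: "emeasure lborel ?F = (\<integral>\<^sup>+y. indicator (polar_body K) y * ennreal (?\<rho> y ^ CARD('n)) \<partial>lborel)"
    unfolding eq by (rule P.emeasure_star_set[OF _ _ \<rho>1]) (measurable, simp add: polar_height_scale)
  have nn: "(\<integral>\<^sup>+y. indicator (polar_body K) y * ennreal (?\<rho> y ^ CARD('n)) \<partial>lborel) = (\<integral>\<^sup>+y. ennreal (?g y) \<partial>lborel)"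
    by (rule nn_integral_cong) (simp add: indicator_def)
  have g0: "?g y \<ge> 0" for y
    using less_imp_le[OF pos[of y]] by (simp add: indicator_def)
  have gm: "?g \<in> borel_measurable lborel" by measurable
  show fin: "emeasure lborel ?F < \<infinity>"
  proof -
    have "emeasure lborel ?F \<le> (\<integral>\<^sup>+y. ennreal (2 ^ CARD('n)) * indicator (polar_body K) y \<partial>lborel)"
      unfolding em
    proof (rule nn_integral_mono)
      fix y
      have "?\<rho> y ^ CARD('n) \<le> 2 ^ CARD('n)" using \<rho>2[of y] \<rho>1[of y] by (intro power_mono) linarith+
      then show "indicator (polar_body K) y * ennreal (?\<rho> y ^ CARD('n)) \<le> ennreal (2 ^ CARD('n)) * indicator (polar_body K) y"
        by (auto simp: indicator_def intro!: ennreal_leI)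
    qed
    also have "\<dots> = ennreal (2 ^ CARD('n)) * emeasure lborel (polar_body K)" by (simp add: nn_integral_cmult_indicator)
    also have "\<dots> < \<infinity>"
      using emeasure_bounded_finite[OF compact_imp_bounded[OF P.compact_K]] by (simp add: ennreal_mult_less_top)
    finally show ?thesis .
  qed
  show "integrable lborel ?g"
    by (rule integrableI_nonneg[OF gm]) (use g0 fin in \<open>simp_all add: em nn[symmetric]\<close>)
  show "measure lborel ?F = (LINT y|lborel. ?g y)"
    unfolding measure_def em nn using integral_eq_nn_integral[OF gm] g0 by simp
qed

end

text \<open>Bernoulli's inequality for 1 + t and for 1 - t gives the first-order behaviour of
  (1-t)^(-n) uniformly in t, which takes the place of a limit under the integral.\<close>

lemma inverse_power_bounds:
  fixes t :: real
  assumes t: "0 \<le> t" "t < 1"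
  shows "1 + real n * t \<le> (1 / (1 - t)) ^ n"
    and "\<lbrakk>\<kappa> > 1; real n * t \<le> 1 - 1 / \<kappa>\<rbrakk> \<Longrightarrow> (1 / (1 - t)) ^ n \<le> 1 + \<kappa> * (real n * t)"
proof -
  have "(1 + t) * (1 - t) \<le> 1" by (simp add: algebra_simps)
  then have 1: "1 + t \<le> 1 / (1 - t)" using t by (simp add: pos_le_divide_eq)
  have "1 + real n * t \<le> (1 + t) ^ n" using t by (intro Bernoulli_inequality) simp
  also have "\<dots> \<le> (1 / (1 - t)) ^ n" using 1 t by (intro power_mono) auto
  finally show "1 + real n * t \<le> (1 / (1 - t)) ^ n" .
  assume \<kappa>: "\<kappa> > 1" and s: "real n * t \<le> 1 - 1 / \<kappa>"
  define x where "x = real n * t"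
  have x: "0 \<le> x" "x \<le> 1 - 1 / \<kappa>" using t s by (auto simp: x_def)
  then have x1: "x < 1" using \<kappa> by (smt (verit) divide_pos_pos)
  have "\<kappa> * x \<le> \<kappa> * (1 - 1 / \<kappa>)" using x \<kappa> by (intro mult_left_mono) auto
  then have "\<kappa> * x \<le> \<kappa> - 1" using \<kappa> by (simp add: right_diff_distrib)
  then have "0 \<le> x * (\<kappa> - 1 - \<kappa> * x)" using x by (intro mult_nonneg_nonneg) auto
  then have k: "1 \<le> (1 + \<kappa> * x) * (1 - x)" by (simp add: algebra_simps)
  have b: "1 - x \<le> (1 - t) ^ n" using Bernoulli_inequality[of "- t" n] t by (simp add: x_def)
  have "1 / (1 - t) ^ n \<le> 1 / (1 - x)" using b x1 by (intro frac_le) auto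
  also have "\<dots> \<le> 1 + \<kappa> * x" using k x1 by (simp add: pos_divide_le_eq)
  finally show "(1 / (1 - t)) ^ n \<le> 1 + \<kappa> * (real n * t)" by (simp add: power_one_over x_def)
qed

context C1_dual_body
begin

interpretation P: smooth_body_cart "polar_body K" by (rule smooth_body_polar)

lemma integrable_polar_height: "integrable lborel (\<lambda>y. indicator (polar_body K) y * polar_height p y)"
proof -
  obtain b where b: "b > 0" "\<And>y. 0 \<le> polar_height p y \<and> polar_height p y \<le> b" by (rule polar_height_bounds) blast
  have "integrable lborel (\<lambda>y. b * indicator (polar_body K) y)"
    using emeasure_bounded_finite[OF compact_imp_bounded[OF P.compact_K]]
    by (intro integrable_mult_right integrable_real_indicator) auto
  then show ?thesis
  proof (rule Bochner_Integration.integrable_bound)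
    show "AE y in lborel. norm (indicator (polar_body K) y * polar_height p y) \<le> norm (b * indicator (polar_body K) y)"
      using b by (intro AE_I2) (simp add: indicator_def abs_mult)
  qed measurable
qed

lemma measure_star_set_bounds:
  fixes p
  defines "J \<equiv> LINT y|lborel. indicator (polar_body K) y * polar_height p y"
  assumes \<delta>: "\<delta> \<ge> 0" and small: "\<And>y. \<delta> * polar_height p y \<le> 1 / 2"
  shows "measure lborel {y. supp K y * (1 - \<delta> * polar_height p y) \<le> 1} \<ge> measure lborel (polar_body K) + real CARD('n) * \<delta> * J"
    and "\<lbrakk>\<kappa> > 1; \<And>y. real CARD('n) * (\<delta> * polar_height p y) \<le> 1 - 1 / \<kappa>\<rbrakk> \<Longrightarrow>
      measure lborel {y. supp K y * (1 - \<delta> * polar_height p y) \<le> 1} \<le> measure lborel (polar_body K) + \<kappa> * (real CARD('n) * \<delta> * J)"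
proof -
  obtain b where b: "b > 0" "\<And>y. 0 \<le> polar_height p y \<and> polar_height p y \<le> b" by (rule polar_height_bounds) blast
  let ?L = "polar_body K"
  let ?n = "real CARD('n)"
  have t: "0 \<le> \<delta> * polar_height p y" "\<delta> * polar_height p y < 1" for y
    using b(2)[of y] \<delta> small[of y] by simp_all
  have iL: "integrable lborel (\<lambda>y. indicator ?L y :: real)"
    using emeasure_bounded_finite[OF compact_imp_bounded[OF P.compact_K]] by (intro integrable_real_indicator) auto
  have int: "integrable lborel (\<lambda>y. indicator ?L y + c * (indicator ?L y * polar_height p y))"
    and intv: "(LINT y|lborel. indicator ?L y + c * (indicator ?L y * polar_height p y)) = measure lborel ?L + c * J" for c
    using iL integrable_polar_height[of p] by (simp_all add: J_def)
  have "(LINT y|lborel. indicator ?L y + (?n * \<delta>) * (indicator ?L y * polar_height p y)) \<le>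
      (LINT y|lborel. indicator ?L y * (1 / (1 - \<delta> * polar_height p y)) ^ CARD('n))"
    by (rule integral_mono[OF int measure_star_set(3)[OF \<delta> small]])
      (use inverse_power_bounds(1)[OF t, of "CARD('n)"] in \<open>simp add: indicator_def mult.assoc\<close>)
  then show "measure lborel {y. supp K y * (1 - \<delta> * polar_height p y) \<le> 1} \<ge> measure lborel ?L + ?n * \<delta> * J"
    unfolding intv measure_star_set(4)[OF \<delta> small] .
  assume \<kappa>: "\<kappa> > 1" and s: "\<And>y. ?n * (\<delta> * polar_height p y) \<le> 1 - 1 / \<kappa>"
  have "(LINT y|lborel. indicator ?L y * (1 / (1 - \<delta> * polar_height p y)) ^ CARD('n)) \<le>
      (LINT y|lborel. indicator ?L y + (\<kappa> * (?n * \<delta>)) * (indicator ?L y * polar_height p y))"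
    by (rule integral_mono[OF measure_star_set(3)[OF \<delta> small] int])
      (use inverse_power_bounds(2)[OF t \<kappa> s] in \<open>simp add: indicator_def mult.assoc\<close>)
  then show "measure lborel {y. supp K y * (1 - \<delta> * polar_height p y) \<le> 1} \<le> measure lborel ?L + \<kappa> * (?n * \<delta> * J)"
    unfolding intv measure_star_set(4)[OF \<delta> small] by (simp add: mult.assoc)
qed

lemma polar_height_integral:
  assumes p: "p \<noteq> - real CARD('n)"
  shows "ball_const (real CARD('n)) * (real CARD('n) * (LINT y|lborel. indicator (polar_body K) y * polar_height p y)) =
    affine_surface_area (ereal ((real CARD('n))\<^sup>2) / ereal p) (polar_body K)"
proof -
  let ?f = "\<lambda>y. \<Phi> (P.dual_pt y) powr (- (real CARD('n) / (real CARD('n) + p)))"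
  have "(LINT y|lborel. indicator (polar_body K) y * polar_height p y) =
      (LINT y|lborel. indicator (polar_body K - {0}) y * ?f y / ball_const (real CARD('n)))"
  proof (rule integral_cong_AE)
    have "AE y in lborel. y \<noteq> (0::real^'n)" by (rule AE_lborel_singleton)
    then show "AE y in lborel. indicator (polar_body K) y * polar_height p y = indicator (polar_body K - {0}) y * ?f y / ball_const (real CARD('n))"
      by eventually_elim (simp add: indicator_def polar_height_def cap_height_def)
  qed measurable
  then show ?thesis unfolding affine_surface_area_polar[OF p] using ball_const_pos by simp
qed

theorem polar_surface_body_limit:
  assumes p: "p \<noteq> - real CARD('n)"
  shows "((\<lambda>s. ball_const (real CARD('n)) *
      ((measure lebesgue (polar_body (surface_body K (weight p K) s)) - measure lebesgue (polar_body K)) / s powr (2 / (real CARD('n) - 1))))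
    \<longlongrightarrow> affine_surface_area (ereal ((real CARD('n))\<^sup>2) / ereal p) (polar_body K)) (at_right 0)"
proof -
  define J where "J = (LINT y|lborel. indicator (polar_body K) y * polar_height p y)"
  define A where "A = real CARD('n) * J"
  define m where "m = real (CARD('n) - 1)"
  have meq: "real CARD('n) - 1 = m" using dim2 by (simp add: m_def of_nat_diff)
  let ?X = "\<lambda>s. polar_body (surface_body K (weight p K) s)"
  let ?L = "polar_body K"
  obtain b where b: "b > 0" "\<And>y. 0 \<le> polar_height p y \<and> polar_height p y \<le> b" by (rule polar_height_bounds) blast
  have J0: "J \<ge> 0" unfolding J_def by (rule integral_nonneg_AE) (use b in \<open>auto simp: indicator_def\<close>)
  then have A0: "A \<ge> 0" by (simp add: A_def)
  have bounds: "\<forall>\<^sub>F s in at_right 0. (1 - \<eta>) * A \<le> (measure lborel (?X s) - measure lborel ?L) / s powr (2 / m) \<and>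
      (measure lborel (?X s) - measure lborel ?L) / s powr (2 / m) \<le> (1 + \<eta>)\<^sup>2 * A" if \<eta>: "0 < \<eta>" "\<eta> < 1" for \<eta>
  proof -
    have l: "0 < 1 - \<eta>" "1 - \<eta> < 1" "1 + \<eta> > 1" using \<eta> by auto
    \<comment> \<open>The first bound is what the star-shaped sets ask for, the second is the
      condition of the upper Bernoulli estimate with \<kappa> = 1 + \<eta>.\<close>
    define \<epsilon> where "\<epsilon> = min (1 / 2) ((1 - 1 / (1 + \<eta>)) / real CARD('n))"
    have \<epsilon>: "\<epsilon> > 0" using l by (simp add: \<epsilon>_def)
    have pos: "\<forall>\<^sub>F s in at_right (0::real). 0 < s" by (rule eventually_at_right_less)
    show ?thesis
      using polar_surface_body_sandwich[OF p l] eventually_small_powr[OF \<epsilon>, of "(1 + \<eta>) * b"] pos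
      unfolding m_def[symmetric]
    proof eventually_elim
      case (elim s)
      let ?\<delta> = "s powr (2 / m)"
      have \<delta>: "?\<delta> > 0" using elim by simp
      have sm: "k * ?\<delta> * polar_height p y \<le> \<epsilon>" if k: "0 \<le> k" "k \<le> 1 + \<eta>" for k y
      proof -
        have "k * polar_height p y * ?\<delta> \<le> (1 + \<eta>) * b * ?\<delta>"
          using b(2)[of y] k \<eta> b(1) \<delta> by (intro mult_right_mono mult_mono) auto
        then show ?thesis using elim(2) by (simp add: mult_ac)
      qed
      have h1: "k * ?\<delta> * polar_height p y \<le> 1 / 2" if k: "0 \<le> k" "k \<le> 1 + \<eta>" for k y
        using sm[OF k, of y] by (simp add: \<epsilon>_def)
      have h2: "real CARD('n) * ((1 + \<eta>) * ?\<delta> * polar_height p y) \<le> 1 - 1 / (1 + \<eta>)" for y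
      proof -
        have "(1 + \<eta>) * ?\<delta> * polar_height p y \<le> (1 - 1 / (1 + \<eta>)) / real CARD('n)"
          using sm[of "1 + \<eta>" y] \<eta> by (simp add: \<epsilon>_def)
        then show ?thesis by (simp add: pos_le_divide_eq mult.commute)
      qed
      let ?F = "\<lambda>k. {y. supp K y * (1 - k * ?\<delta> * polar_height p y) \<le> 1}"
      have k1: "0 \<le> (1 - \<eta>) * ?\<delta>" "0 \<le> (1 + \<eta>) * ?\<delta>" using \<eta> \<delta> by auto
      have e1: "0 \<le> 1 - \<eta>" "1 - \<eta> \<le> 1 + \<eta>" "0 \<le> 1 + \<eta>" "1 + \<eta> \<le> 1 + \<eta>" using \<eta> by auto
      have Xb: "?X s \<in> sets borel" by (rule borel_closed[OF polar_body_closed])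
      note F1 = measure_star_set[OF k1(1) h1[OF e1(1,2)]] and F2 = measure_star_set[OF k1(2) h1[OF e1(3,4)]]
      have inc: "?F (1 - \<eta>) \<subseteq> ?X s" "?X s \<subseteq> ?F (1 + \<eta>)" by (rule conjunct1[OF elim(1)], rule conjunct2[OF elim(1)])
      have F2f: "?F (1 + \<eta>) \<in> fmeasurable lborel" by (rule fmeasurableI[OF F2(1)[unfolded sets_lborel[symmetric]] F2(2)])
      have Xf: "?X s \<in> fmeasurable lborel" by (rule fmeasurableI2[OF F2f inc(2)]) (rule Xb[unfolded sets_lborel[symmetric]])
      have mono1: "measure lborel (?F (1 - \<eta>)) \<le> measure lborel (?X s)"
        by (rule measure_mono_fmeasurable[OF inc(1) _ Xf]) (rule F1(1)[unfolded sets_lborel[symmetric]])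
      have mono2: "measure lborel (?X s) \<le> measure lborel (?F (1 + \<eta>))"
        by (rule measure_mono_fmeasurable[OF inc(2) _ F2f]) (rule Xb[unfolded sets_lborel[symmetric]])
      note b1 = measure_star_set_bounds(1)[OF k1(1) h1[OF e1(1,2)], folded J_def]
      note b2 = measure_star_set_bounds(2)[OF k1(2) h1[OF e1(3,4)] l(3) h2, folded J_def]
      have "real CARD('n) * ((1 - \<eta>) * ?\<delta>) * J = ((1 - \<eta>) * A) * ?\<delta>"
        unfolding A_def by (simp only: mult_ac)
      with order_trans[OF b1 mono1] have lower: "((1 - \<eta>) * A) * ?\<delta> \<le> measure lborel (?X s) - measure lborel ?L"
        by (simp only: le_diff_eq add.commute)
      have "(1 + \<eta>) * (real CARD('n) * ((1 + \<eta>) * ?\<delta>) * J) = ((1 + \<eta>)\<^sup>2 * A) * ?\<delta>"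
        unfolding A_def power2_eq_square by (simp only: mult_ac)
      with order_trans[OF mono2 b2] have upper: "measure lborel (?X s) - measure lborel ?L \<le> ((1 + \<eta>)\<^sup>2 * A) * ?\<delta>"
        by (simp only: diff_le_eq add.commute)
      show ?case
        by (rule conjI[OF pos_le_divide_eq[OF \<delta>, THEN iffD2, OF lower] pos_divide_le_eq[OF \<delta>, THEN iffD2, OF upper]])
    qed
  qed
  have lim: "((\<lambda>s. (measure lborel (?X s) - measure lborel ?L) / s powr (2 / m)) \<longlongrightarrow> A) (at_right 0)"
  proof (rule tendstoI)
    fix e :: real assume e: "e > 0"
    \<comment> \<open>The deviations from A are at most \<eta> A below and 3 \<eta> A above, the
      latter because (1+\<eta>)^2 \<le> 1 + 3 \<eta>; A + 1 in the denominator covers A = 0.\<close>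
    define \<eta> where "\<eta> = min (1 / 2) (e / (4 * (A + 1)))"
    have \<eta>: "0 < \<eta>" "\<eta> < 1" using e A0 by (auto simp: \<eta>_def)
    have "\<eta> \<le> e / (4 * (A + 1))" by (simp add: \<eta>_def)
    then have "\<eta> * (4 * (A + 1)) \<le> e" using A0 by (simp add: pos_le_divide_eq)
    moreover have "\<eta> * (4 * (A + 1)) = 4 * (\<eta> * A) + 4 * \<eta>" by (simp add: algebra_simps)
    ultimately have \<eta>A: "4 * (\<eta> * A) + 4 * \<eta> \<le> e" by simp
    have \<eta>A0: "0 \<le> \<eta> * A" using \<eta> A0 by simp
    have "\<eta> * (\<eta> * A) \<le> 1 * (\<eta> * A)" using \<eta> \<eta>A0 by (intro mult_right_mono) auto
    then have sq: "(1 + \<eta>)\<^sup>2 * A \<le> A + 3 * (\<eta> * A)" by (simp add: power2_eq_square algebra_simps)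
    have lo: "(1 - \<eta>) * A = A - \<eta> * A" by (simp add: algebra_simps)
    have lo': "A - e < (1 - \<eta>) * A" and hi: "(1 + \<eta>)\<^sup>2 * A < A + e"
      using sq lo \<eta>A \<eta>A0 \<eta> e by linarith+
    show "\<forall>\<^sub>F s in at_right 0. dist ((measure lborel (?X s) - measure lborel ?L) / s powr (2 / m)) A < e"
      using bounds[OF \<eta>]
    proof eventually_elim
      case (elim s)
      show ?case unfolding dist_real_def abs_diff_less_iff
        by (rule conjI[OF less_le_trans[OF lo' conjunct1[OF elim]] le_less_trans[OF conjunct2[OF elim] hi]])
    qed
  qed
  have "((\<lambda>s. ball_const (real CARD('n)) * ((measure lborel (?X s) - measure lborel ?L) / s powr (2 / m))) \<longlongrightarrow> ball_const (real CARD('n)) * A) (at_right 0)"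
    by (rule tendsto_mult_left[OF lim])
  moreover have "ball_const (real CARD('n)) * A = affine_surface_area (ereal ((real CARD('n))\<^sup>2) / ereal p) (polar_body K)"
    unfolding A_def J_def by (rule polar_height_integral[OF p])
  moreover have "measure lebesgue (polar_body Y) = measure lborel (polar_body Y)" for Y :: "(real^'n) set"
    by (rule measure_completion) (simp add: borel_closed polar_body_closed)
  ultimately show ?thesis unfolding meq by simp
qed

end

section \<open>Conclusion\<close>

lemma (in smooth_body) dual_pt_derivative_scale:
  assumes A: "(dual_pt has_derivative A) (at x)" and c: "c > 0"
  shows "(dual_pt has_derivative A) (at (c *\<^sub>R x))"
proof -
  have lA: "linear A" using A by (rule has_derivative_linear)
  have "((\<lambda>z. (1 / c) *\<^sub>R z) has_derivative (\<lambda>v. (1 / c) *\<^sub>R v)) (at (c *\<^sub>R x))" by (auto intro!: derivative_eq_intros)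
  moreover have "(dual_pt has_derivative A) (at ((1 / c) *\<^sub>R (c *\<^sub>R x)))" using A c by simp
  ultimately have "((\<lambda>z. dual_pt ((1 / c) *\<^sub>R z)) has_derivative (\<lambda>v. A ((1 / c) *\<^sub>R v))) (at (c *\<^sub>R x))"
    by (rule has_derivative_compose)
  from has_derivative_scaleR_right[OF this, of c]
  have "((\<lambda>z. c *\<^sub>R dual_pt ((1 / c) *\<^sub>R z)) has_derivative (\<lambda>v. c *\<^sub>R A ((1 / c) *\<^sub>R v))) (at (c *\<^sub>R x))" .
  moreover have "(\<lambda>z. c *\<^sub>R dual_pt ((1 / c) *\<^sub>R z)) = dual_pt"
    using c by (simp add: fun_eq_iff dual_pt_scale[symmetric])
  moreover have "(\<lambda>v. c *\<^sub>R A ((1 / c) *\<^sub>R v)) = A"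
    using c by (simp add: fun_eq_iff linear_scale[OF lA])
  ultimately show ?thesis by simp
qed

text \<open>\<open>frechet_derivative\<close> merges the local derivatives into one function, and
  uniqueness of derivatives transfers their continuity to it. By homogeneity the derivative at x is
  also the one at the radial projection of x, where positive curvature gives a positive
  determinant.\<close>

lemma (in smooth_body_cart) C1_dual_bodyI:
  assumes C2: "C2_hypersurface (frontier K)" and curv: "\<And>x. x \<in> frontier K \<Longrightarrow> gauss_curvature K x > 0"
  shows "C1_dual_body K (\<lambda>x. frechet_derivative dual_pt (at x))"
proof
  show der: "(dual_pt has_derivative frechet_derivative dual_pt (at x)) (at x)" if x: "x \<noteq> 0" for x
  proof -
    obtain V A where "x \<in> V" "\<And>y. y \<in> V \<Longrightarrow> (dual_pt has_derivative A y) (at y)"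
      by (rule dual_pt_C1_at[OF C2 x]) blast
    then show ?thesis unfolding frechet_derivative_works[symmetric] differentiable_def by blast
  qed
  show "continuous_on (- {0}) (\<lambda>x. frechet_derivative dual_pt (at x) v)" for v
    unfolding continuous_on_eq_continuous_at[OF open_Compl[OF closed_singleton]]
  proof
    fix x :: "real^'n" assume "x \<in> - {0}"
    then have x: "x \<noteq> 0" by simp
    obtain V A where V: "open V" "x \<in> V" "\<And>y. y \<in> V \<Longrightarrow> (dual_pt has_derivative A y) (at y)" "\<And>v. continuous_on V (\<lambda>y. A y v)"
      by (rule dual_pt_C1_at[OF C2 x]) blast
    have "frechet_derivative dual_pt (at y) v = A y v" if "y \<in> V" for y
      using frechet_derivative_at[OF V(3)[OF that]] by simp
    then have "continuous_on V (\<lambda>y. frechet_derivative dual_pt (at y) v)"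
      using V(4)[of v] by (simp cong: continuous_on_cong)
    then show "isCont (\<lambda>x. frechet_derivative dual_pt (at x) v) x"
      using V(1,2) by (simp add: continuous_on_eq_continuous_at)
  qed
  show "det (matrix (frechet_derivative dual_pt (at x))) > 0" if x: "x \<noteq> 0" for x
  proof -
    have px: "proj x \<in> frontier K" unfolding proj_def by (rule normalized_in_frontier[OF x])
    have c: "inverse (gauge_fn x) > 0" using gauge_pos[OF x] by simp
    have "(dual_pt has_derivative frechet_derivative dual_pt (at x)) (at (proj x))"
      unfolding proj_def by (rule dual_pt_derivative_scale[OF der[OF x] c])
    from gauss_curvature_eq[OF px this] curv[OF px]
    have "0 < det (matrix (frechet_derivative dual_pt (at x))) * (proj x \<bullet> outer_normal K (proj x)) ^ (CARD('n) + 1)" by simp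
    moreover have "proj x \<bullet> outer_normal K (proj x) > 0"
      unfolding inner_outer_normal[OF px] using dual_pt_nonzero[OF frontier_nonzero[OF px]] by simp
    then have "(proj x \<bullet> outer_normal K (proj x)) ^ (CARD('n) + 1) > 0" by (rule zero_less_power)
    ultimately show ?thesis by (rule zero_less_mult_pos2)
  qed
qed

text \<open>If 0 were outside the interior, a linear functional would be nonnegative on
  \<open>K\<close> with integral 0, hence zero almost everywhere on \<open>K\<close>; the interior
  would then lie in a hyperplane up to a null set.\<close>

lemma zero_in_interior_if_centroid_zero:
  fixes K :: "'a::euclidean_space set"
  assumes K: "compact K" "convex K" "interior K \<noteq> {}" and cent: "centroid K = 0"
  shows "0 \<in> interior K"
proof (rule ccontr)
  assume "0 \<notin> interior K"
  then have "{0} \<inter> interior K = {}" by simp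
  from separating_hyperplane_sets[OF convex_singleton convex_interior[OF K(2)] _ K(3) this]
  obtain a b where ab: "a \<noteq> 0" "a \<bullet> 0 \<le> b" "\<And>x. x \<in> interior K \<Longrightarrow> b \<le> a \<bullet> x" by auto
  have "closure (interior K) \<subseteq> {x. a \<bullet> x \<ge> 0}"
    by (rule closure_minimal) (use ab in \<open>auto simp: closed_halfspace_ge intro: order_trans\<close>)
  then have nonneg: "a \<bullet> x \<ge> 0" if "x \<in> K" for x
    using convex_closure_interior[OF K(2,3)] closure_subset[of K] that by blast
  have notnull: "\<not> negligible (interior K)" by (rule open_not_negligible[OF open_interior K(3)])
  have "measure lebesgue K \<noteq> 0"
  proof
    assume "measure lebesgue K = 0"
    then have "negligible K" using lmeasurable_compact[OF K(1)] negligible_iff_measure by blast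
    then show False using notnull negligible_subset interior_subset by blast
  qed
  then have I0: "(LINT x:K|lebesgue. x) = 0" using cent by (simp add: centroid_def)
  have "integrable lborel (\<lambda>x. indicator K x *\<^sub>R x)" by (rule borel_integrable_compact[OF K(1) continuous_on_id])
  then have int: "integrable lebesgue (\<lambda>x. indicator K x *\<^sub>R x)"
    by (rule integrable_completion[THEN iffD2, rotated]) (rule borel_measurable_integrable[OF \<open>integrable lborel (\<lambda>x. indicator K x *\<^sub>R x)\<close>])
  let ?f = "\<lambda>x. a \<bullet> (indicator K x *\<^sub>R x)"
  have "(LINT x|lebesgue. ?f x) = a \<bullet> (LINT x|lebesgue. indicator K x *\<^sub>R x)"
    by (rule integral_inner_right) (rule int)
  then have "(LINT x|lebesgue. ?f x) = 0" using I0 by (simp add: set_lebesgue_integral_def)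
  moreover have "integrable lebesgue ?f" by (rule integrable_inner_right) (rule int)
  moreover have "AE x in lebesgue. 0 \<le> ?f x" using nonneg by (intro AE_I2) (simp add: indicator_def)
  ultimately have 1: "AE x in lebesgue. ?f x = 0" using integral_nonneg_eq_0_iff_AE by blast
  have "negligible {x. a \<bullet> x = 0}" by (rule negligible_hyperplane) (simp add: ab(1))
  then have 2: "AE x in lebesgue. x \<notin> {x. a \<bullet> x = 0}" by (intro AE_not_in) (simp add: negligible_iff_null_sets)
  have "AE x in lebesgue. x \<notin> interior K"
    using 1 2
  proof eventually_elim
    case (elim x)
    then show ?case using interior_subset[of K] by (auto simp: indicator_def split: if_splits)
  qed
  then have "interior K \<in> null_sets lebesgue" by (subst AE_iff_null_sets) auto
  then show False using notnull by (simp add: negligible_iff_null_sets)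
qed

theorem corollary3p1:
  fixes K :: "(real ^ 'n) set" and p :: real
  assumes "CARD('n) \<ge> 2"
    and "convex_body K" and "C2_plus K" and "centroid K = 0"
    and "p \<noteq> - real CARD('n)"
  shows
    "((\<lambda>s. ball_const (real CARD('n)) *
           ((measure lebesgue (polar_body (surface_body K (weight p K) s))
             - measure lebesgue (polar_body K)) / s powr (2 / (real CARD('n) - 1))))
        \<longlongrightarrow> affine_surface_area (ereal ((real CARD('n))\<^sup>2) / ereal p) (polar_body K)) (at_right 0)
     \<and>
     ((\<lambda>s. ball_const (real CARD('n)) *
           ((measure lebesgue (polar_body (surface_body K (weight p K) s))
             - measure lebesgue (polar_body K)) / s powr (2 / (real CARD('n) - 1))))
        \<longlongrightarrow> affine_surface_area (ereal p) K) (at_right 0)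
     \<and>
     affine_surface_area (ereal p) K
       = affine_surface_area (ereal ((real CARD('n))\<^sup>2) / ereal p) (polar_body K)"
proof -
  have K: "compact K" "convex K" "interior K \<noteq> {}" using assms(2) by (auto simp: convex_body_def)
  have cb: "conv_body K" using K(1,2) zero_in_interior_if_centroid_zero[OF K assms(4)] by unfold_locales
  have C2: "C2_hypersurface (frontier K)" "\<And>x. x \<in> frontier K \<Longrightarrow> gauss_curvature K x > 0"
    using assms(3) by (auto simp: C2_plus_def)
  interpret smooth_body K by (rule smooth_body_C2[OF cb C2(1)])
  interpret smooth_body_cart K by unfold_locales (rule assms(1))
  interpret C1_dual_body K "\<lambda>x. frechet_derivative dual_pt (at x)" by (rule C1_dual_bodyI[OF C2])
  show ?thesis
    using polar_surface_body_limit[OF assms(5)] affine_surface_area_duality[OF assms(5)] by simp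
qed

end
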